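(* Let $k$ be an algebraically closed field of characteristic $p>0$. Consider the following three classes of isomorphism classes of finite $p$-groups: $C_1$: the finite $p$-groups $G$ having a normal subgroup $N\subset G$ cyclic of order $p$ such that $G/N$ is an elementary abelian $p$-group. $C_2$: the groups $G$ for which there exist an extraspecial $p$-group $E$ and an $\mathbb F_p$-subspace $V\subset E/Z(E)$ such that $G\simeq\pi^{-1}(V)$, where $\pi:E\to E/Z(E)$ is the canonical map. $C_3$: the groups $G$ for which there exists $f\in Xk[X]$ of degree $\deg f>1$ prime to $p$ such that $G\simeq G_{\infty,1}(f)$. Then $C_1=C_2=C_3$.
   Context: A finite $p$-group $E$ is extraspecial if it is non-abelian, its center $Z(E)$ is cyclic of order $p$, and $E/Z(E)$ is an elementary abelian $p$-group (hence an $\mathbb F_p$-vector space). The trivial group counts as elementary abelian, and $V=0$ is allowed. For $f\in k[X]$ of degree prime to $p$, $C_f$ is the smooth projective curve over $k$ with function field $k(X,W)$, $W^p-W=f(X)$; $\infty\in C_f$ is the unique point above $X=\infty$; $G_\infty(f)$ is the stabilizer of $\infty$ in $\mathrm{Aut}_k C_f$ (inertia group at $\infty$), and $G_{\infty,1}(f)$ is the wild inertia group at $\infty$, i.e. the unique Sylow $p$-subgroup of $G_\infty(f)$. *)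

theory Defs
  imports
    "HOL-Algebra.Algebra"
    "HOL-Algebra.Algebraic_Closure_Type"
    "HOL-Computational_Algebra.Computational_Algebra"
begin

definition finite_p_group :: "nat \<Rightarrow> 'g monoid \<Rightarrow> bool" where
  "finite_p_group p G \<longleftrightarrow> group G \<and> finite (carrier G) \<and> (\<exists>n. card (carrier G) = p ^ n)"

definition elementary_abelian :: "nat \<Rightarrow> 'g monoid \<Rightarrow> bool" where
  "elementary_abelian p A \<longleftrightarrow>
     comm_group A \<and> (\<forall>a\<in>carrier A. a [^]\<^bsub>A\<^esub> p = \<one>\<^bsub>A\<^esub>)"

definition cyclic_of_order :: "nat \<Rightarrow> 'g monoid \<Rightarrow> bool" where
  "cyclic_of_order n G \<longleftrightarrow> group G \<and> cyclic_group G \<and> card (carrier G) = n"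

definition group_center :: "'g monoid \<Rightarrow> 'g set" where
  "group_center G = {z \<in> carrier G. \<forall>x\<in>carrier G. z \<otimes>\<^bsub>G\<^esub> x = x \<otimes>\<^bsub>G\<^esub> z}"

definition extraspecial :: "nat \<Rightarrow> 'g monoid \<Rightarrow> bool" where
  "extraspecial p E \<longleftrightarrow>
     finite_p_group p E \<and> \<not> comm_group E \<and>
     cyclic_of_order p (E\<lparr>carrier := group_center E\<rparr>) \<and>
     elementary_abelian p (E Mod group_center E)"

text \<open>The residue class of \<open>c\<close> in \<open>F_p\<close> acts on an elementary abelian group, written
  multiplicatively, by \<open>v \<mapsto> v ^ c\<close>.\<close>

definition Fp_subspace :: "nat \<Rightarrow> 'g set \<Rightarrow> 'g monoid \<Rightarrow> bool" where
  "Fp_subspace p V A \<longleftrightarrow>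
     subgroup V A \<and> (\<forall>c\<in>{0..<p}. \<forall>v\<in>V. v [^]\<^bsub>A\<^esub> c \<in> V)"

definition center_preimage :: "'g monoid \<Rightarrow> 'g set set \<Rightarrow> 'g set" where
  "center_preimage E V = {x \<in> carrier E. group_center E #>\<^bsub>E\<^esub> x \<in> V}"

definition sylow_subgroup :: "nat \<Rightarrow> 'g set \<Rightarrow> 'g monoid \<Rightarrow> bool" where
  "sylow_subgroup p H G \<longleftrightarrow>
     group G \<and> finite (carrier G) \<and> subgroup H G \<and> card H = p ^ multiplicity p (card (carrier G))"


text \<open>The function field \<open>k(X,W)\<close> of \<open>C_f\<close> is \<open>k(X)[W] / (W^p - W - f(X))\<close>. Here
  \<open>k(X)\<close> is \<^typ>\<open>'k poly fract\<close>, the polynomial indeterminate over it is \<open>W\<close>, and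
  elements of the function field are cosets.\<close>

definition artin_schreier_poly :: "'k::alg_closed_field poly \<Rightarrow> 'k poly fract poly" where
  "artin_schreier_poly f = monom 1 CHAR('k) - monom 1 1 - [:to_fract f:]"

definition artin_schreier_ideal :: "'k::alg_closed_field poly \<Rightarrow> 'k poly fract poly set" where
  "artin_schreier_ideal f = PIdl\<^bsub>ring_of_type_algebra\<^esub> (artin_schreier_poly f)"

definition function_field :: "'k::alg_closed_field poly \<Rightarrow> 'k poly fract poly set ring" where
  "function_field f = ring_of_type_algebra Quot (artin_schreier_ideal f)"

definition rational_fun :: "'k::alg_closed_field poly \<Rightarrow> 'k poly \<Rightarrow> 'k poly fract poly set" where
  "rational_fun f h = artin_schreier_ideal f +>\<^bsub>ring_of_type_algebra\<^esub> [:to_fract h:]"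

definition fun_const :: "'k::alg_closed_field poly \<Rightarrow> 'k \<Rightarrow> 'k poly fract poly set" where
  "fun_const f c = rational_fun f [:c:]"

definition fun_X :: "'k::alg_closed_field poly \<Rightarrow> 'k poly fract poly set" where
  "fun_X f = rational_fun f [:0, 1:]"


text \<open>The smooth projective curve \<open>C_f\<close> is realised as the abstract nonsingular curve of
  its function field \<open>K\<close> (Hartshorne, Algebraic Geometry, I.6): its points are the valuation
  rings \<open>P\<close> of \<open>K/k\<close>, that is the local rings of \<open>C_f\<close>; its topology is the cofinite one;
  and the ring of regular functions on an open set \<open>U\<close> is the intersection of all \<open>P\<close>
  in \<open>U\<close>, an element of \<open>P\<close> taking at \<open>P\<close> its residue modulo the maximal ideal as value.
  Since \<open>K\<close> is a function field in one variable, the valuation rings in the following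
  definition are automatically discrete.\<close>

type_synonym 'k curve_point = "'k poly fract poly set set"

definition curve_points :: "'k::alg_closed_field poly \<Rightarrow> 'k curve_point set" where
  "curve_points f =
     {P. subring P (function_field f) \<and> range (fun_const f) \<subseteq> P \<and>
         P \<noteq> carrier (function_field f) \<and>
         (\<forall>z \<in> carrier (function_field f) - {\<zero>\<^bsub>function_field f\<^esub>}.
            z \<in> P \<or> inv\<^bsub>function_field f\<^esub> z \<in> P)}"

definition point_ideal ::
    "'k::alg_closed_field poly \<Rightarrow> 'k curve_point \<Rightarrow> 'k poly fract poly set set" where
  "point_ideal f P =
     {z \<in> P. \<not> (\<exists>w\<in>P. z \<otimes>\<^bsub>function_field f\<^esub> w = \<one>\<^bsub>function_field f\<^esub>)}"

definition value_at ::
    "'k::alg_closed_field poly \<Rightarrow> 'k curve_point \<Rightarrow> 'k poly fract poly set \<Rightarrow> 'k" where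
  "value_at f P z =
     (THE c. z \<ominus>\<^bsub>function_field f\<^esub> fun_const f c \<in> point_ideal f P)"

definition zariski_open :: "'k::alg_closed_field poly \<Rightarrow> 'k curve_point set \<Rightarrow> bool" where
  "zariski_open f U \<longleftrightarrow>
     U \<subseteq> curve_points f \<and> (U = {} \<or> finite (curve_points f - U))"

definition regular_on ::
    "'k::alg_closed_field poly \<Rightarrow> 'k curve_point set \<Rightarrow> ('k curve_point \<Rightarrow> 'k) \<Rightarrow> bool" where
  "regular_on f U g \<longleftrightarrow>
     (\<exists>z \<in> carrier (function_field f). \<forall>P\<in>U. z \<in> P \<and> g P = value_at f P z)"

definition curve_morphism ::
    "'k::alg_closed_field poly \<Rightarrow> ('k curve_point \<Rightarrow> 'k curve_point) \<Rightarrow> bool" where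
  "curve_morphism f \<phi> \<longleftrightarrow>
     \<phi> \<in> curve_points f \<rightarrow> curve_points f \<and>
     (\<forall>U. zariski_open f U \<longrightarrow>
        zariski_open f (\<phi> -` U \<inter> curve_points f) \<and>
        (\<forall>g. regular_on f U g \<longrightarrow> regular_on f (\<phi> -` U \<inter> curve_points f) (g \<circ> \<phi>)))"

text \<open>As in \<^const>\<open>BijGroup\<close>, automorphisms are taken to be extensional on the set of points.\<close>

definition curve_Aut ::
    "'k::alg_closed_field poly \<Rightarrow> ('k curve_point \<Rightarrow> 'k curve_point) monoid" where
  "curve_Aut f = BijGroup (curve_points f)
     \<lparr>carrier := {\<phi> \<in> Bij (curve_points f).
        curve_morphism f \<phi> \<and> curve_morphism f (inv_into (curve_points f) \<phi>)}\<rparr>"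

text \<open>The point above \<open>X = \<infinity>\<close> is the one at which \<open>X\<close> has a pole.\<close>

definition point_infinity :: "'k::alg_closed_field poly \<Rightarrow> 'k curve_point" where
  "point_infinity f = (THE P. P \<in> curve_points f \<and> fun_X f \<notin> P)"

definition inertia_infinity ::
    "'k::alg_closed_field poly \<Rightarrow> ('k curve_point \<Rightarrow> 'k curve_point) monoid" where
  "inertia_infinity f = (curve_Aut f)
     \<lparr>carrier := {\<phi> \<in> carrier (curve_Aut f). \<phi> (point_infinity f) = point_infinity f}\<rparr>"

definition wild_inertia_infinity ::
    "'k::alg_closed_field poly \<Rightarrow> ('k curve_point \<Rightarrow> 'k curve_point) monoid" where
  "wild_inertia_infinity f = (inertia_infinity f)
     \<lparr>carrier := (THE H. sylow_subgroup CHAR('k) H (inertia_infinity f))\<rparr>"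


text \<open>The three classes are isomorphism-invariant; each is given by the groups with carrier
  in an arbitrary type \<open>'g\<close> that it contains. In \<open>class_C2\<close> the group \<open>E\<close> may be larger than
  \<open>'g\<close>, so it is taken with carrier in \<^typ>\<open>nat\<close>, which represents every finite group up to
  isomorphism. The assumption \<^term>\<open>group G\<close> is needed because \<^const>\<open>is_iso\<close> does not
  require its arguments to be groups.\<close>

definition class_C1 :: "nat \<Rightarrow> 'g monoid set" where
  "class_C1 p =
     {G. finite_p_group p G \<and>
         (\<exists>N. N \<lhd> G \<and> cyclic_of_order p (G\<lparr>carrier := N\<rparr>) \<and> elementary_abelian p (G Mod N))}"

definition class_C2 :: "nat \<Rightarrow> 'g monoid set" where
  "class_C2 p =
     {G. group G \<and>
         (\<exists>(E :: nat monoid) V. extraspecial p E \<and> Fp_subspace p V (E Mod group_center E) \<and>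
            G \<cong> E\<lparr>carrier := center_preimage E V\<rparr>)}"

definition class_C3 :: "'k::alg_closed_field itself \<Rightarrow> 'g monoid set" where
  "class_C3 _ =
     {G. group G \<and>
         (\<exists>f :: 'k poly. [:0, 1:] dvd f \<and> degree f > 1 \<and> coprime (degree f) CHAR('k) \<and>
            G \<cong> wild_inertia_infinity f)}"

end

theory Submission imports Defs "HOL-Number_Theory.Residues" begin

text \<open>
  Write \<open>N\<close> for the normal subgroup of order \<open>p\<close>. A group \<open>G\<close> of the first class with \<open>G \<noteq> N\<close> sits
  in the extraspecial group \<open>G \<rtimes> Hom (G/N, N)\<close> as the preimage of a subspace, and the inclusions into
  the first class come from homomorphisms to elementary abelian groups with kernel of order \<open>p\<close>.

  For the curve \<open>w^p - w = f x\<close>, let \<open>w = t^(-m)\<close> with \<open>m = degree f\<close>. By Hensel's lemma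
  \<open>x = t^(-p) z\<close> for a unit \<open>z\<close>, so the function field embeds into \<open>k((t))\<close>, where the order in \<open>t\<close> is
  the valuation at infinity. An automorphism fixing infinity preserves the spaces of functions with
  bounded pole order there, hence is of the form \<open>x \<mapsto> a x + b, w \<mapsto> c w + P x\<close>. There are finitely many
  of these, and the wild inertia group consists of those with \<open>a = c = 1\<close>, that is of the pairs
  \<open>(b, P)\<close> with \<open>P^p - P = f (x + b) - f x\<close>.

  To realize \<open>G\<close>, choose a homomorphism \<open>\<beta>\<close> from \<open>G\<close> to \<open>k\<close> with kernel \<open>N\<close>. Averaging over its image with
  a polynomial of trace one yields a cocycle \<open>P g\<close> extending \<open>N \<cong> F_p\<close> and an \<open>f\<close> with
  \<open>f (x + \<beta> g) - f x = P g^p - P g\<close>. Adding a suitable polynomial invariant under the image removes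
  all other translations, and subtracting \<open>Q^p - Q\<close> makes the degree prime to \<open>p\<close>.
\<close>

text \<open>Neither irreducibility of the Artin-Schreier polynomial nor general valuation theory
  enters. Everything on the curve rests on one count in \<open>k((t))\<close>: \<open>x\<close> has
  order \<open>-p\<close> and \<open>w\<close> has order \<open>-m\<close> with \<open>m\<close>
  prime to \<open>p\<close>, so nonzero terms \<open>h(x) * w ^ j\<close> with \<open>j < p\<close>
  have orders distinct modulo \<open>p\<close> and never cancel. This gives the kernel of
  evaluation, the pole orders of all functions and the spaces of functions with bounded pole at
  infinity. The delicate case is \<open>m < p\<close>, where powers of \<open>w\<close> could enter
  the image of \<open>x\<close>; comparing both sides of the transformed equation excludes them. In
  the realization, the polynomial of trace one does the work of additive Hilbert 90 twice, for
  \<open>P\<close> and for \<open>f\<close>. The \<open>f\<close> so obtained may admit further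
  translations. The correction is a power of the invariant coordinate with a large exponent that is
  1 modulo \<open>p\<close>, so that it survives differentiation. For \<open>G = N\<close> the group
  \<open>Hom (G/N, N)\<close> is trivial and the semidirect product would stay abelian; the direct
  square of \<open>G\<close> is used instead.\<close>

hide_const (open) Divisibility.prime Polynomial.order

section \<open>Groups with an elementary abelian quotient by a subgroup of prime order\<close>

text \<open>If another prime \<open>r\<close> divided the order, Cauchy's theorem (here Sylow's
  theorem with exponent 1) would give a nontrivial element whose order divides both \<open>r\<close>
  and \<open>p ^ k\<close>.\<close>

lemma finite_group_prime_exponent_card:
  assumes "group G" "finite (carrier G)" "prime p"
    and exp: "\<And>x. x \<in> carrier G \<Longrightarrow> x [^]\<^bsub>G\<^esub> ((p::nat) ^ k) = \<one>\<^bsub>G\<^esub>"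
  shows "\<exists>n. card (carrier G) = p ^ n"
proof -
  interpret G: group G by fact
  have "card (carrier G) \<noteq> 0"
    using assms(2) G.one_closed by (auto simp: card_eq_0_iff)
  then obtain m where m: "card (carrier G) = p ^ multiplicity p (card (carrier G)) * m" "\<not> p dvd m"
    using multiplicity_decompose' [of "card (carrier G)" p] assms(3)
    by (metis not_prime_unit)
  have "m = 1"
  proof (rule ccontr)
    assume "m \<noteq> 1"
    then obtain r where r: "prime r" "r dvd m" using prime_factor_nat by blast
    then obtain l where "m = r * l" by (auto simp: dvd_def)
    then have "order G = r ^ 1 * (p ^ multiplicity p (card (carrier G)) * l)"
      using m(1) by (simp add: Coset.order_def mult.left_commute)
    from sylow_thm[OF r(1) assms(1) this assms(2)]
    obtain H where H: "subgroup H G" "card H = r" by auto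
    interpret H: group "G\<lparr>carrier := H\<rparr>"
      using H(1) by (rule G.subgroup_imp_group)
    have "\<exists>x\<in>H. x \<noteq> \<one>\<^bsub>G\<^esub>"
    proof (rule ccontr)
      assume "\<not> ?thesis"
      then have "H \<subseteq> {\<one>\<^bsub>G\<^esub>}" by auto
      then have "card H \<le> 1" using card_mono[of "{\<one>\<^bsub>G\<^esub>}" H] by simp
      then show False using H(2) prime_gt_1_nat[OF r(1)] by simp
    qed
    then obtain x where x: "x \<in> H" "x \<noteq> \<one>\<^bsub>G\<^esub>" by auto
    have xG: "x \<in> carrier G" using x(1) H(1) by (meson subgroup.mem_carrier)
    have "x [^]\<^bsub>G\<^esub> r = \<one>\<^bsub>G\<^esub>"
      using H.pow_order_eq_1[of x] x(1) H(2) G.nat_pow_consistent[of x r H]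
      by (simp add: Coset.order_def)
    then have "G.ord x dvd r" using G.pow_eq_id[OF xG] by simp
    moreover have "G.ord x dvd p ^ k" using G.pow_eq_id[OF xG] exp[OF xG] by simp
    moreover have "coprime r (p ^ k)"
      using r m(2) assms(3) by (metis coprime_power_right_iff primes_coprime)
    ultimately have "G.ord x = 1" by (meson coprime_common_divisor nat_dvd_1_iff_1)
    then show False using x(2) G.ord_eq_1[OF xG] by simp
  qed
  with m(1) show ?thesis by auto
qed

lemma prime_card_imp_cyclic:
  assumes "group G" "card (carrier G) = p" "prime p"
  shows "cyclic_group G"
proof -
  interpret G: group G by fact
  have fin: "finite (carrier G)" using assms(2,3) card_ge_0_finite prime_gt_0_nat by auto
  have "\<exists>x\<in>carrier G. x \<noteq> \<one>\<^bsub>G\<^esub>"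
  proof (rule ccontr)
    assume "\<not> ?thesis"
    then have "carrier G \<subseteq> {\<one>\<^bsub>G\<^esub>}" by auto
    then have "card (carrier G) \<le> 1" using card_mono[of "{\<one>\<^bsub>G\<^esub>}" "carrier G"] by simp
    then show False using assms(2,3) prime_gt_1_nat[of p] by simp
  qed
  then obtain x where x: "x \<in> carrier G" "x \<noteq> \<one>\<^bsub>G\<^esub>" by auto
  have "G.ord x dvd p" using G.ord_dvd_group_order[OF x(1)] assms(2) by (simp add: Coset.order_def)
  moreover have "G.ord x \<noteq> 1" using x G.ord_eq_1[OF x(1)] by simp
  ultimately have "G.ord x = p" using assms(3) by (metis prime_nat_iff)
  then have "card (generate G {x}) = card (carrier G)"
    using G.generate_pow_card[OF x(1)] assms(2) by simp
  moreover have "generate G {x} \<subseteq> carrier G" using x(1) by (simp add: G.generate_incl)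
  ultimately have "generate G {x} = carrier G" using fin by (simp add: card_subset_eq)
  then have "carrier G = range (\<lambda>n::int. x [^]\<^bsub>G\<^esub> n)"
    using G.generate_pow[OF x(1)] by (simp add: full_SetCompr_eq)
  then show ?thesis using G.cyclic_group x(1) by blast
qed

section \<open>Elementary abelian quotients and membership in the first class\<close>

lemma elementary_abelian_inj_hom:
  assumes "elementary_abelian p T" "group A" "h \<in> hom A T" "inj_on h (carrier A)"
  shows "elementary_abelian p A"
proof -
  interpret T: comm_group T using assms(1) by (simp add: elementary_abelian_def)
  interpret A: group A by fact
  interpret h: group_hom A T h
    using assms(3) by (simp add: group_hom_def group_hom_axioms_def A.is_group T.is_group)
  have "comm_group A"
  proof (rule A.group_comm_groupI)
    fix x y assume xy: "x \<in> carrier A" "y \<in> carrier A"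
    then have "h (x \<otimes>\<^bsub>A\<^esub> y) = h (y \<otimes>\<^bsub>A\<^esub> x)" by (simp add: T.m_comm)
    then show "x \<otimes>\<^bsub>A\<^esub> y = y \<otimes>\<^bsub>A\<^esub> x"
      using assms(4) xy by (meson A.m_closed inj_onD)
  qed
  moreover have "a [^]\<^bsub>A\<^esub> p = \<one>\<^bsub>A\<^esub>" if "a \<in> carrier A" for a
  proof -
    have "h (a [^]\<^bsub>A\<^esub> p) = h \<one>\<^bsub>A\<^esub>"
      using that assms(1) by (simp add: h.hom_nat_pow elementary_abelian_def)
    then show ?thesis using assms(4) that by (meson A.nat_pow_closed A.one_closed inj_onD)
  qed
  ultimately show ?thesis by (simp add: elementary_abelian_def)
qed

lemma elementary_abelian_Mod_kernel:
  assumes "elementary_abelian p T" "group G" "\<beta> \<in> hom G T"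
  shows "elementary_abelian p (G Mod kernel G T \<beta>)"
proof -
  interpret T: comm_group T using assms(1) by (simp add: elementary_abelian_def)
  interpret h: group_hom G T \<beta>
    using assms(2,3) by (simp add: group_hom_def group_hom_axioms_def T.is_group)
  show ?thesis
    using elementary_abelian_inj_hom[OF assms(1) _ h.FactGroup_hom h.FactGroup_inj_on]
    by (simp add: h.normal_kernel normal.factorgroup_is_group)
qed

text \<open>A p-th power dies in \<open>T\<close>, so it lies in the kernel, a group of order
  \<open>p\<close>; hence \<open>p ^ 2\<close> is an exponent of \<open>G\<close>.\<close>

lemma elementary_abelian_kernel_finite_p_group:
  assumes "prime p" "group G" "finite (carrier G)" "elementary_abelian p T" "\<beta> \<in> hom G T"
    and card: "card (kernel G T \<beta>) = p"
  shows "finite_p_group p G"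
proof -
  interpret T: comm_group T using assms(4) by (simp add: elementary_abelian_def)
  interpret h: group_hom G T \<beta>
    using assms(2,5) by (simp add: group_hom_def group_hom_axioms_def T.is_group)
  have sub: "subgroup (kernel G T \<beta>) G" by (rule h.subgroup_kernel)
  interpret N: group "G\<lparr>carrier := kernel G T \<beta>\<rparr>" using sub by (rule h.subgroup_imp_group)
  have "x [^]\<^bsub>G\<^esub> (p ^ 2) = \<one>\<^bsub>G\<^esub>" if x: "x \<in> carrier G" for x
  proof -
    have "\<beta> (x [^]\<^bsub>G\<^esub> p) = \<one>\<^bsub>T\<^esub>"
      using x assms(4) by (simp add: h.hom_nat_pow elementary_abelian_def)
    then have "x [^]\<^bsub>G\<^esub> p \<in> kernel G T \<beta>" using x by (simp add: kernel_def)
    then have "(x [^]\<^bsub>G\<^esub> p) [^]\<^bsub>G\<^esub> p = \<one>\<^bsub>G\<^esub>"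
      using N.pow_order_eq_1[of "x [^]\<^bsub>G\<^esub> p"] card h.nat_pow_consistent[of _ p "kernel G T \<beta>"]
      by (simp add: Coset.order_def)
    then show ?thesis using x by (simp add: h.nat_pow_pow power2_eq_square)
  qed
  from finite_group_prime_exponent_card[OF assms(2,3,1) this] show ?thesis
    using assms(2,3) by (simp add: finite_p_group_def)
qed

text \<open>The common entry to the first class: for the second class \<open>T\<close> is
  \<open>E Mod group_center E\<close>, for the third it is the additive group of
  \<open>k\<close>.\<close>

lemma class_C1I:
  assumes "prime p" "group G" "finite (carrier G)" "elementary_abelian p T" "\<beta> \<in> hom G T"
    and card: "card (kernel G T \<beta>) = p"
  shows "G \<in> class_C1 p"
proof -
  interpret T: comm_group T using assms(4) by (simp add: elementary_abelian_def)
  interpret h: group_hom G T \<beta>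
    using assms(2,5) by (simp add: group_hom_def group_hom_axioms_def T.is_group)
  have grp: "group (G\<lparr>carrier := kernel G T \<beta>\<rparr>)" using h.subgroup_kernel by (rule h.subgroup_imp_group)
  have "cyclic_of_order p (G\<lparr>carrier := kernel G T \<beta>\<rparr>)"
    using prime_card_imp_cyclic[OF grp _ assms(1)] card grp by (simp add: cyclic_of_order_def)
  then show ?thesis
    using elementary_abelian_Mod_kernel[OF assms(4,2,5)]
      elementary_abelian_kernel_finite_p_group[OF assms] h.normal_kernel
    by (auto simp: class_C1_def)
qed

text \<open>Conjugation by \<open>g\<close> raises a generator \<open>x\<close> of \<open>N\<close>
  to some power \<open>r\<close>. Since \<open>g ^ p\<close> lies in the commutative group
  \<open>N\<close>, \<open>r ^ p\<close> is 1 modulo \<open>p\<close>; by Fermat it is also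
  \<open>r\<close> modulo \<open>p\<close>, so \<open>r\<close> is 1.\<close>

lemma normal_prime_order_central:
  assumes "prime p" "N \<lhd> G" "cyclic_of_order p (G\<lparr>carrier := N\<rparr>)" "elementary_abelian p (G Mod N)"
    and "g \<in> carrier G" "n \<in> N"
  shows "g \<otimes>\<^bsub>G\<^esub> n = n \<otimes>\<^bsub>G\<^esub> g"
proof -
  interpret N: normal N G by fact
  interpret NG: group "G\<lparr>carrier := N\<rparr>" using assms(3) by (simp add: cyclic_of_order_def)
  have cardN: "card N = p" using assms(3) by (simp add: cyclic_of_order_def)
  obtain x where x: "x \<in> N" "N = range (\<lambda>i::int. x [^]\<^bsub>G\<^esub> i)"
    using assms(3) NG.cyclic_group N.int_pow_consistent[OF N.subgroup_axioms]
    unfolding cyclic_of_order_def by (metis (no_types, lifting) image_cong partial_object.select_convs(1)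
        partial_object.surjective partial_object.update_convs(1))
  have xG: "x \<in> carrier G" using x N.mem_carrier by blast
  \<comment> \<open>Natural exponents, so that conjugation iterates to \<open>r ^ i\<close> and
    Fermat's theorem for \<open>nat\<close> applies.\<close>
  have nx: "\<exists>i::nat. m = x [^]\<^bsub>G\<^esub> i" if "m \<in> N" for m
  proof -
    from that x(2) have "m \<in> range (\<lambda>i::int. x [^]\<^bsub>G\<^esub> i)" by blast
    then obtain i :: int where i: "m = x [^]\<^bsub>G\<^esub> i" by blast
    have xp: "x [^]\<^bsub>G\<^esub> int p = \<one>\<^bsub>G\<^esub>"
      using NG.pow_order_eq_1[of x] x(1) cardN N.nat_pow_consistent[of x p N]
      by (simp add: Coset.order_def int_pow_int)
    have "x [^]\<^bsub>G\<^esub> i = x [^]\<^bsub>G\<^esub> (int p * (i div int p) + i mod int p)" by simp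
    also have "\<dots> = x [^]\<^bsub>G\<^esub> (i mod int p)"
      using xG xp by (simp only: N.int_pow_mult N.int_pow_pow[symmetric]) (simp add: N.int_pow_one)
    also have "\<dots> = x [^]\<^bsub>G\<^esub> (nat (i mod int p))"
      using assms(1) prime_gt_0_nat[of p] by (metis int_pow_int nat_0_le of_nat_0_less_iff pos_mod_sign)
    finally show ?thesis using i by blast
  qed
  define c where "c = (\<lambda>y. g \<otimes>\<^bsub>G\<^esub> y \<otimes>\<^bsub>G\<^esub> inv\<^bsub>G\<^esub> g)"
  have gG: "g \<in> carrier G" by fact
  have cN: "c y \<in> N" if "y \<in> N" for y using that N.inv_op_closed2[OF gG] by (simp add: c_def)
  obtain r where r: "c x = x [^]\<^bsub>G\<^esub> (r::nat)" using nx[OF cN[OF x(1)]] by blast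
  have ch: "c (y \<otimes>\<^bsub>G\<^esub> z) = c y \<otimes>\<^bsub>G\<^esub> c z" if "y \<in> carrier G" "z \<in> carrier G" for y z
    using that gG by (simp add: c_def N.m_assoc) (simp add: N.m_assoc[symmetric])
  have cpow: "c (x [^]\<^bsub>G\<^esub> i) = x [^]\<^bsub>G\<^esub> (r * i)" for i :: nat
  proof (induction i)
    case 0 then show ?case using gG by (simp add: c_def)
  next
    case (Suc i)
    then show ?case using ch[of "x [^]\<^bsub>G\<^esub> i" x] xG r
      by (simp add: N.nat_pow_mult add.commute)
  qed
  have conj: "g [^]\<^bsub>G\<^esub> i \<otimes>\<^bsub>G\<^esub> x \<otimes>\<^bsub>G\<^esub> inv\<^bsub>G\<^esub> (g [^]\<^bsub>G\<^esub> i) = x [^]\<^bsub>G\<^esub> (r ^ i)" for i :: nat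
  proof (induction i)
    case 0 then show ?case using xG by simp
  next
    case (Suc i)
    have "g [^]\<^bsub>G\<^esub> Suc i = g \<otimes>\<^bsub>G\<^esub> g [^]\<^bsub>G\<^esub> i" using gG by (rule N.nat_pow_Suc2)
    then have "g [^]\<^bsub>G\<^esub> Suc i \<otimes>\<^bsub>G\<^esub> x \<otimes>\<^bsub>G\<^esub> inv\<^bsub>G\<^esub> (g [^]\<^bsub>G\<^esub> Suc i)
        = c (g [^]\<^bsub>G\<^esub> i \<otimes>\<^bsub>G\<^esub> x \<otimes>\<^bsub>G\<^esub> inv\<^bsub>G\<^esub> (g [^]\<^bsub>G\<^esub> i))"
      using gG xG by (simp add: c_def N.inv_mult_group N.m_assoc del: nat_pow_Suc)
    then show ?case using Suc cpow by (simp add: mult.commute)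
  qed
  have "g [^]\<^bsub>G\<^esub> p \<in> N"
  proof -
    have "N #>\<^bsub>G\<^esub> g \<in> carrier (G Mod N)" using gG by (auto simp: carrier_FactGroup)
    then have "(N #>\<^bsub>G\<^esub> g) [^]\<^bsub>G Mod N\<^esub> p = N"
      using assms(4) by (simp add: elementary_abelian_def)
    then have "N #>\<^bsub>G\<^esub> (g [^]\<^bsub>G\<^esub> p) = N" using N.FactGroup_pow[OF gG] by simp
    then show ?thesis using gG by (metis N.nat_pow_closed N.rcos_self N.subgroup_axioms)
  qed
  then obtain s :: nat where "g [^]\<^bsub>G\<^esub> p = x [^]\<^bsub>G\<^esub> s" using nx by blast
  then have "g [^]\<^bsub>G\<^esub> p \<otimes>\<^bsub>G\<^esub> x \<otimes>\<^bsub>G\<^esub> inv\<^bsub>G\<^esub> (g [^]\<^bsub>G\<^esub> p) = x"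
    using xG by (metis N.inv_closed N.m_assoc N.nat_pow_Suc N.nat_pow_Suc2 N.nat_pow_closed N.r_inv N.r_one)
  then have "x [^]\<^bsub>G\<^esub> (r ^ p) = x" using conj by simp
  have ordx: "N.ord x = p"
  proof -
    have "generate G {x} = N" using x N.generate_pow[OF xG] by auto
    then show ?thesis using N.generate_pow_card[OF xG] cardN by simp
  qed
  have xcong: "[i = j] (mod p)" if "x [^]\<^bsub>G\<^esub> i = x [^]\<^bsub>G\<^esub> j" for i j :: nat
    using that N.int_pow_eq[OF xG, of "int i" "int j"] ordx
    by (metis cong_iff_dvd_diff cong_int_iff cong_sym int_pow_int)
  have rp: "[r ^ p = 1] (mod p)"
    using xcong[of "r ^ p" 1] \<open>x [^]\<^bsub>G\<^esub> (r ^ p) = x\<close> xG by simp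
  have "\<not> p dvd r"
  proof
    assume "p dvd r"
    then have "p dvd r ^ p" using assms(1) by (simp add: dvd_power prime_gt_0_nat dvd_trans)
    then have "p dvd 1" using rp by (meson cong_dvd_iff)
    then show False using assms(1) by (simp add: not_prime_1)
  qed
  then have "[r ^ (p - 1) = 1] (mod p)" using fermat_theorem assms(1) by blast
  then have "[r ^ (p - 1) * r = 1 * r] (mod p)" by (rule cong_scalar_right)
  then have "[r ^ p = r] (mod p)" using assms(1) by (simp add: power_eq_if prime_gt_0_nat mult.commute)
  with rp have r1: "[r = 1] (mod p)" by (meson cong_sym cong_trans)
  have "c x = x"
  proof -
    have "x [^]\<^bsub>G\<^esub> r = x [^]\<^bsub>G\<^esub> (1::nat)"
      using r1 N.int_pow_eq[OF xG, of "int 1" "int r"] ordx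
      by (metis cong_iff_dvd_diff cong_int_iff int_pow_int)
    then show ?thesis using r xG by simp
  qed
  obtain i :: nat where i: "n = x [^]\<^bsub>G\<^esub> i" using nx assms(6) by blast
  have "c n = n"
    using cpow[of i] \<open>c x = x\<close> r i xG by (metis N.nat_pow_pow)
  then show ?thesis
    using gG assms(6) N.mem_carrier[OF assms(6)]
    by (simp add: c_def N.inv_solve_right')
qed

text \<open>Adjoining one vector to a subspace and prescribing its image: a power
  \<open>a ^ i\<close> lies in \<open>S\<close> only when \<open>p\<close> divides \<open>i\<close>,
  so \<open>s * a ^ i\<close> determines \<open>s\<close>, and \<open>i\<close> modulo
  \<open>p\<close>. The explicit \<open>S'\<close> is part of the conclusion because a later
  injectivity argument decomposes its elements.\<close>

lemma elementary_abelian_extend_hom: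
  assumes "prime p" "elementary_abelian p A" "elementary_abelian p T"
    and "subgroup S A" "\<beta> \<in> hom (A\<lparr>carrier := S\<rparr>) T" "a \<in> carrier A" "a \<notin> S" "t \<in> carrier T"
  shows "\<exists>S' \<beta>'. subgroup S' A \<and> S \<subseteq> S' \<and> a \<in> S' \<and> \<beta>' \<in> hom (A\<lparr>carrier := S'\<rparr>) T \<and>
    (\<forall>s\<in>S. \<forall>i::nat. \<beta>' (s \<otimes>\<^bsub>A\<^esub> a [^]\<^bsub>A\<^esub> i) = \<beta> s \<otimes>\<^bsub>T\<^esub> t [^]\<^bsub>T\<^esub> i) \<and>
    S' = (\<lambda>(s, i). s \<otimes>\<^bsub>A\<^esub> a [^]\<^bsub>A\<^esub> (i::nat)) ` (S \<times> UNIV)"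
proof -
  interpret A: comm_group A using assms(2) by (simp add: elementary_abelian_def)
  interpret T: comm_group T using assms(3) by (simp add: elementary_abelian_def)
  interpret S: subgroup S A by fact
  interpret SG: group "A\<lparr>carrier := S\<rparr>" using assms(4) by (rule A.subgroup_imp_group)
  have SA: "s \<in> carrier A" if "s \<in> S" for s using that by (rule S.mem_carrier)
  have bT: "\<beta> s \<in> carrier T" if "s \<in> S" for s using that assms(5) by (auto simp: hom_def)
  have bh: "\<beta> (s \<otimes>\<^bsub>A\<^esub> s') = \<beta> s \<otimes>\<^bsub>T\<^esub> \<beta> s'" if "s \<in> S" "s' \<in> S" for s s'
    using that assms(5) by (auto simp: hom_def)
  have pA: "x [^]\<^bsub>A\<^esub> p = \<one>\<^bsub>A\<^esub>" if "x \<in> carrier A" for x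
    using that assms(2) by (simp add: elementary_abelian_def)
  have pT: "x [^]\<^bsub>T\<^esub> p = \<one>\<^bsub>T\<^esub>" if "x \<in> carrier T" for x
    using that assms(3) by (simp add: elementary_abelian_def)
  have aA: "a \<in> carrier A" and tT: "t \<in> carrier T" by fact+
  \<comment> \<open>\<open>p - 1\<close> turns inverses into natural powers, so that
    \<open>S'\<close> can be described with nonnegative exponents.\<close>
  have invpow: "inv\<^bsub>A\<^esub> (a [^]\<^bsub>A\<^esub> i) = a [^]\<^bsub>A\<^esub> ((p - 1) * i)" for i :: nat
  proof (rule A.inv_equality)
    have "(p - 1) * i + i = p * i" using prime_gt_0_nat[OF assms(1)] by (simp add: algebra_simps)
    then have "a [^]\<^bsub>A\<^esub> ((p - 1) * i) \<otimes>\<^bsub>A\<^esub> a [^]\<^bsub>A\<^esub> i = a [^]\<^bsub>A\<^esub> (p * i)"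
      using aA by (simp add: A.nat_pow_mult)
    also have "\<dots> = (a [^]\<^bsub>A\<^esub> p) [^]\<^bsub>A\<^esub> i" using aA by (simp add: A.nat_pow_pow)
    also have "\<dots> = \<one>\<^bsub>A\<^esub>" using pA[OF aA] by simp
    finally show "a [^]\<^bsub>A\<^esub> ((p - 1) * i) \<otimes>\<^bsub>A\<^esub> a [^]\<^bsub>A\<^esub> i = \<one>\<^bsub>A\<^esub>" .
  qed (use aA in auto)
  \<comment> \<open>With \<open>i\<close> invertible modulo \<open>p\<close>, some power of
    \<open>a ^ i\<close> is \<open>a\<close> itself, which is not in \<open>S\<close>.\<close>
  have dvd: "p dvd i" if "a [^]\<^bsub>A\<^esub> i \<in> S" for i :: nat
  proof (rule ccontr)
    assume "\<not> p dvd i"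
    then have "coprime i p" using assms(1) by (metis coprime_commute prime_imp_coprime_nat)
    then obtain j where j: "[i * j = 1] (mod p)" using cong_solve_coprime_nat[of i p] by auto
    then have "i * j mod p = 1" using prime_gt_1_nat[OF assms(1)] by (simp add: cong_def)
    then obtain q where q: "i * j = p * q + 1" by (metis mult_div_mod_eq)
    have "a = a [^]\<^bsub>A\<^esub> (p * q + 1)"
      using aA pA[OF aA] by (simp add: A.nat_pow_mult[symmetric] A.nat_pow_pow[symmetric])
    also have "\<dots> = (a [^]\<^bsub>A\<^esub> i) [^]\<^bsub>A\<^esub> j" using aA q by (simp add: A.nat_pow_pow)
    also have "\<dots> \<in> S" using that SG.nat_pow_closed[of "a [^]\<^bsub>A\<^esub> i" j] A.nat_pow_consistent[of "a [^]\<^bsub>A\<^esub> i" j S] by simp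
    finally show False using assms(7) by simp
  qed
  have wd: "\<beta> s \<otimes>\<^bsub>T\<^esub> t [^]\<^bsub>T\<^esub> i = \<beta> s' \<otimes>\<^bsub>T\<^esub> t [^]\<^bsub>T\<^esub> j"
    if s: "s \<in> S" "s' \<in> S" and eq: "s \<otimes>\<^bsub>A\<^esub> a [^]\<^bsub>A\<^esub> i = s' \<otimes>\<^bsub>A\<^esub> a [^]\<^bsub>A\<^esub> j" for s s' and i j :: nat
  proof -
    have e: "a [^]\<^bsub>A\<^esub> (i + (p - 1) * j) = inv\<^bsub>A\<^esub> s \<otimes>\<^bsub>A\<^esub> s'"
    proof -
      have "a [^]\<^bsub>A\<^esub> (i + (p - 1) * j) = a [^]\<^bsub>A\<^esub> i \<otimes>\<^bsub>A\<^esub> inv\<^bsub>A\<^esub> (a [^]\<^bsub>A\<^esub> j)"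
        using aA invpow by (simp add: A.nat_pow_mult)
      also have "a [^]\<^bsub>A\<^esub> i = inv\<^bsub>A\<^esub> s \<otimes>\<^bsub>A\<^esub> (s' \<otimes>\<^bsub>A\<^esub> a [^]\<^bsub>A\<^esub> j)"
        using eq s SA aA by (metis A.inv_solve_left A.m_closed A.nat_pow_closed)
      finally show ?thesis using s SA aA by (simp add: A.m_assoc)
    qed
    have "inv\<^bsub>A\<^esub> s \<otimes>\<^bsub>A\<^esub> s' \<in> S" using s by auto
    then have "p dvd i + (p - 1) * j" using dvd e by simp
    then obtain q where q: "i + (p - 1) * j = p * q" by (auto simp: dvd_def)
    have "inv\<^bsub>A\<^esub> s \<otimes>\<^bsub>A\<^esub> s' = \<one>\<^bsub>A\<^esub>"
      using e q aA pA[OF aA] by (simp add: A.nat_pow_pow[symmetric])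
    then have "s' = s" using s SA by (metis A.inv_equality A.inv_inv A.inv_closed)
    moreover have "t [^]\<^bsub>T\<^esub> i = t [^]\<^bsub>T\<^esub> j"
    proof -
      have red: "t [^]\<^bsub>T\<^esub> (p * k + l) = t [^]\<^bsub>T\<^esub> l" for k l :: nat
        using tT pT[OF tT] by (simp add: T.nat_pow_mult[symmetric] T.nat_pow_pow[symmetric])
      have "p * q + j = p * j + i"
        unfolding q[symmetric] using prime_gt_0_nat[OF assms(1)] by (cases p) auto
      then show ?thesis using red[of q j] red[of j i] by simp
    qed
    ultimately show ?thesis by simp
  qed
  define S' where "S' = (\<lambda>(s, i). s \<otimes>\<^bsub>A\<^esub> a [^]\<^bsub>A\<^esub> (i::nat)) ` (S \<times> UNIV)"
  define \<beta>' where "\<beta>' = (\<lambda>x. SOME y. \<exists>s\<in>S. \<exists>i::nat. x = s \<otimes>\<^bsub>A\<^esub> a [^]\<^bsub>A\<^esub> i \<and> y = \<beta> s \<otimes>\<^bsub>T\<^esub> t [^]\<^bsub>T\<^esub> i)"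
  have b': "\<beta>' (s \<otimes>\<^bsub>A\<^esub> a [^]\<^bsub>A\<^esub> i) = \<beta> s \<otimes>\<^bsub>T\<^esub> t [^]\<^bsub>T\<^esub> i" if "s \<in> S" for s and i :: nat
  proof -
    have "\<exists>y. \<exists>s'\<in>S. \<exists>j::nat. s \<otimes>\<^bsub>A\<^esub> a [^]\<^bsub>A\<^esub> i = s' \<otimes>\<^bsub>A\<^esub> a [^]\<^bsub>A\<^esub> j \<and> y = \<beta> s' \<otimes>\<^bsub>T\<^esub> t [^]\<^bsub>T\<^esub> j"
      using that by blast
    from someI_ex[OF this] obtain s' and j :: nat
      where "s' \<in> S" "s \<otimes>\<^bsub>A\<^esub> a [^]\<^bsub>A\<^esub> i = s' \<otimes>\<^bsub>A\<^esub> a [^]\<^bsub>A\<^esub> j"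
        "\<beta>' (s \<otimes>\<^bsub>A\<^esub> a [^]\<^bsub>A\<^esub> i) = \<beta> s' \<otimes>\<^bsub>T\<^esub> t [^]\<^bsub>T\<^esub> j"
      unfolding \<beta>'_def by blast
    then show ?thesis using wd[OF that, of s' i j] by simp
  qed
  have mul: "(s \<otimes>\<^bsub>A\<^esub> a [^]\<^bsub>A\<^esub> i) \<otimes>\<^bsub>A\<^esub> (s' \<otimes>\<^bsub>A\<^esub> a [^]\<^bsub>A\<^esub> j) = (s \<otimes>\<^bsub>A\<^esub> s') \<otimes>\<^bsub>A\<^esub> a [^]\<^bsub>A\<^esub> (i + j)"
    if "s \<in> S" "s' \<in> S" for s s' and i j :: nat
    using that SA aA by (simp add: A.nat_pow_mult[symmetric] A.m_ac)
  have sub: "subgroup S' A"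
  proof (rule A.subgroupI)
    show "S' \<subseteq> carrier A" using SA aA by (auto simp: S'_def)
    show "S' \<noteq> {}" using S.one_closed by (auto simp: S'_def simp del: S.one_closed)
    show "x \<otimes>\<^bsub>A\<^esub> y \<in> S'" if "x \<in> S'" "y \<in> S'" for x y
      using that mul S.m_closed by (force simp: S'_def)
    show "inv\<^bsub>A\<^esub> x \<in> S'" if "x \<in> S'" for x
    proof -
      from that obtain s and i :: nat where x: "s \<in> S" "x = s \<otimes>\<^bsub>A\<^esub> a [^]\<^bsub>A\<^esub> i" by (auto simp: S'_def)
      then have "inv\<^bsub>A\<^esub> x = inv\<^bsub>A\<^esub> s \<otimes>\<^bsub>A\<^esub> a [^]\<^bsub>A\<^esub> ((p - 1) * i)"
        using SA aA invpow by (simp add: A.inv_mult)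
      then show ?thesis using x(1) by (auto simp: S'_def)
    qed
  qed
  have hom: "\<beta>' \<in> hom (A\<lparr>carrier := S'\<rparr>) T"
  proof (rule homI)
    fix x assume "x \<in> carrier (A\<lparr>carrier := S'\<rparr>)"
    then show "\<beta>' x \<in> carrier T" using b' bT tT by (auto simp: S'_def)
  next
    fix x y assume "x \<in> carrier (A\<lparr>carrier := S'\<rparr>)" "y \<in> carrier (A\<lparr>carrier := S'\<rparr>)"
    then obtain s s' and i j :: nat
      where "s \<in> S" "s' \<in> S" "x = s \<otimes>\<^bsub>A\<^esub> a [^]\<^bsub>A\<^esub> i" "y = s' \<otimes>\<^bsub>A\<^esub> a [^]\<^bsub>A\<^esub> j" by (auto simp: S'_def)
    then show "\<beta>' (x \<otimes>\<^bsub>A\<lparr>carrier := S'\<rparr>\<^esub> y) = \<beta>' x \<otimes>\<^bsub>T\<^esub> \<beta>' y"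
      using mul b' bh bT tT S.m_closed by (simp add: T.nat_pow_mult[symmetric] T.m_ac)
  qed
  have "S \<subseteq> S'"
  proof
    fix s assume "s \<in> S"
    then show "s \<in> S'" using SA by (auto simp: S'_def intro!: image_eqI[of _ _ "(s, 0)"])
  qed
  moreover have "a \<in> S'" using aA by (auto simp: S'_def intro!: image_eqI[of _ _ "(\<one>\<^bsub>A\<^esub>, 1)"])
  ultimately show ?thesis using sub hom b' S'_def by blast
qed

text \<open>A subgroup of maximal order that embeds must be everything: for \<open>a\<close> outside
  it, the infinite \<open>T\<close> has an element \<open>t\<close> outside the finite image, and
  sending \<open>a\<close> to \<open>t\<close> keeps the map injective.\<close>

lemma elementary_abelian_embedding:
  assumes "prime p" "elementary_abelian p A" "finite (carrier A)"
    and "elementary_abelian p T" "infinite (carrier T)"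
  shows "\<exists>\<beta> \<in> hom A T. inj_on \<beta> (carrier A)"
proof -
  interpret A: comm_group A using assms(2) by (simp add: elementary_abelian_def)
  interpret T: comm_group T using assms(4) by (simp add: elementary_abelian_def)
  define Q where "Q = (\<lambda>S. subgroup S A \<and> (\<exists>\<beta> \<in> hom (A\<lparr>carrier := S\<rparr>) T. inj_on \<beta> S))"
  have "Q {\<one>\<^bsub>A\<^esub>}"
    unfolding Q_def using A.triv_subgroup by (auto intro!: bexI[of _ "\<lambda>_. \<one>\<^bsub>T\<^esub>"] simp: hom_def)
  moreover have "\<forall>S. Q S \<longrightarrow> card S < Suc (card (carrier A))"
    using assms(3) by (auto simp: Q_def less_Suc_eq_le intro!: card_mono subgroup.subset)
  ultimately have "\<exists>S. Q S \<and> (\<forall>S'. Q S' \<longrightarrow> card S' \<le> card S)"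
    by (rule ex_has_greatest_nat)
  then obtain S where S: "Q S" "\<And>S'. Q S' \<Longrightarrow> card S' \<le> card S" by blast
  then obtain \<beta> where \<beta>: "\<beta> \<in> hom (A\<lparr>carrier := S\<rparr>) T" "inj_on \<beta> S" and sub: "subgroup S A"
    by (auto simp: Q_def)
  have "S = carrier A"
  proof (rule ccontr)
    assume "S \<noteq> carrier A"
    then obtain a where a: "a \<in> carrier A" "a \<notin> S" using subgroup.subset[OF sub] by blast
    have finS: "finite S" using subgroup.subset[OF sub] assms(3) finite_subset by blast
    then obtain t where t: "t \<in> carrier T" "t \<notin> \<beta> ` S"
      using assms(5) by (meson finite_imageI finite_subset subsetI)
    obtain S' \<beta>' where S': "subgroup S' A" "S \<subseteq> S'" "a \<in> S'" "\<beta>' \<in> hom (A\<lparr>carrier := S'\<rparr>) T"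
      and b': "\<And>s i. s \<in> S \<Longrightarrow> \<beta>' (s \<otimes>\<^bsub>A\<^esub> a [^]\<^bsub>A\<^esub> (i::nat)) = \<beta> s \<otimes>\<^bsub>T\<^esub> t [^]\<^bsub>T\<^esub> i"
      and S'eq: "S' = (\<lambda>(s, i). s \<otimes>\<^bsub>A\<^esub> a [^]\<^bsub>A\<^esub> (i::nat)) ` (S \<times> UNIV)"
      using elementary_abelian_extend_hom[OF assms(1,2,4) sub \<beta>(1) a t(1)] by blast
    interpret S: subgroup S A by fact
    interpret SG: group "A\<lparr>carrier := S\<rparr>" using sub by (rule A.subgroup_imp_group)
    interpret SG': group "A\<lparr>carrier := S'\<rparr>" using S'(1) by (rule A.subgroup_imp_group)
    interpret bh: group_hom "A\<lparr>carrier := S\<rparr>" T \<beta>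
      using \<beta>(1) by (simp add: group_hom_def group_hom_axioms_def SG.is_group T.is_group)
    interpret bh': group_hom "A\<lparr>carrier := S'\<rparr>" T \<beta>'
      using S'(4) by (simp add: group_hom_def group_hom_axioms_def SG'.is_group T.is_group)
    have "inj_on \<beta>' (carrier (A\<lparr>carrier := S'\<rparr>))"
    proof (subst bh'.inj_on_one_iff, intro allI impI)
      fix x assume x: "x \<in> carrier (A\<lparr>carrier := S'\<rparr>)" "\<beta>' x = \<one>\<^bsub>T\<^esub>"
      then obtain s and i :: nat where s: "s \<in> S" "x = s \<otimes>\<^bsub>A\<^esub> a [^]\<^bsub>A\<^esub> i" by (auto simp: S'eq)
      have bs: "\<beta> s \<in> carrier T" using bh.hom_closed s(1) by simp
      have e: "\<beta> s \<otimes>\<^bsub>T\<^esub> t [^]\<^bsub>T\<^esub> i = \<one>\<^bsub>T\<^esub>" using x(2) s b' by simp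
      have inv: "t [^]\<^bsub>T\<^esub> i = \<beta> (inv\<^bsub>A\<^esub> s)"
        using e bs t(1) s(1) bh.hom_inv[of s] A.m_inv_consistent[OF sub s(1)]
        by (metis T.inv_equality T.m_comm T.nat_pow_closed partial_object.select_convs(1)
            partial_object.simps(3) partial_object.surjective partial_object.update_convs(1))
      \<comment> \<open>Otherwise \<open>t\<close> would be a power of \<open>t ^ i\<close>, which
        is a value of \<open>\<beta>\<close> on \<open>S\<close>, and so lie in the image of
        \<open>S\<close>.\<close>
      have "p dvd i"
      proof (rule ccontr)
        assume "\<not> p dvd i"
        then have "coprime i p" using assms(1) by (metis coprime_commute prime_imp_coprime_nat)
        then obtain j where j: "[i * j = 1] (mod p)" using cong_solve_coprime_nat[of i p] by auto
        then have "i * j mod p = 1" using prime_gt_1_nat[OF assms(1)] by (simp add: cong_def)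
        then obtain q where q: "i * j = p * q + 1" by (metis mult_div_mod_eq)
        have pT: "t [^]\<^bsub>T\<^esub> p = \<one>\<^bsub>T\<^esub>" using t(1) assms(4) by (simp add: elementary_abelian_def)
        have "t = t [^]\<^bsub>T\<^esub> (p * q + 1)"
          using t(1) pT by (simp add: T.nat_pow_mult[symmetric] T.nat_pow_pow[symmetric])
        also have "\<dots> = (t [^]\<^bsub>T\<^esub> i) [^]\<^bsub>T\<^esub> j" using t(1) q by (simp add: T.nat_pow_pow)
        also have "\<dots> = \<beta> ((inv\<^bsub>A\<^esub> s) [^]\<^bsub>A\<lparr>carrier := S\<rparr>\<^esub> j)"
          using inv s(1) by (simp add: bh.hom_nat_pow)
        also have "\<dots> \<in> \<beta> ` S" using s(1) SG.nat_pow_closed[of "inv\<^bsub>A\<^esub> s" j] by simp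
        finally show False using t(2) by simp
      qed
      then obtain q where q: "i = p * q" by (auto simp: dvd_def)
      have "a [^]\<^bsub>A\<^esub> i = \<one>\<^bsub>A\<^esub>" "t [^]\<^bsub>T\<^esub> i = \<one>\<^bsub>T\<^esub>"
        using q a(1) t(1) assms(2,4) by (simp_all add: elementary_abelian_def A.nat_pow_pow[symmetric] T.nat_pow_pow[symmetric])
      then have "\<beta> s = \<one>\<^bsub>T\<^esub>" "x = s" using e bs s S.mem_carrier by auto
      moreover have "\<beta> \<one>\<^bsub>A\<^esub> = \<one>\<^bsub>T\<^esub>" using bh.hom_one by simp
      ultimately have "s = \<one>\<^bsub>A\<^esub>" using inj_onD[OF \<beta>(2), of s "\<one>\<^bsub>A\<^esub>"] s(1) by simp
      then show "x = \<one>\<^bsub>A\<lparr>carrier := S'\<rparr>\<^esub>" using \<open>x = s\<close> by simp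
    qed
    then have "Q S'" using S'(1,4) by (auto simp: Q_def)
    then have "card S' \<le> card S" by (rule S(2))
    moreover have "finite S'" using subgroup.subset[OF S'(1)] assms(3) finite_subset by blast
    ultimately have "S = S'" using S'(2) by (meson card_seteq)
    then show False using a(2) S'(3) by simp
  qed
  then show ?thesis using \<beta> by auto
qed

text \<open>Characters of a finite elementary abelian group separate its points: the value at
  \<open>a\<close> is prescribed on the subgroup generated by \<open>a\<close>, and a maximal
  extension is enlarged by sending a further element to the identity.\<close>

lemma elementary_abelian_separating_hom:
  assumes "prime p" "elementary_abelian p A" "finite (carrier A)" "elementary_abelian p T"
    and "a \<in> carrier A" "a \<noteq> \<one>\<^bsub>A\<^esub>" "t \<in> carrier T"
  shows "\<exists>\<beta> \<in> hom A T. \<beta> a = t"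
proof -
  interpret A: comm_group A using assms(2) by (simp add: elementary_abelian_def)
  interpret T: comm_group T using assms(4) by (simp add: elementary_abelian_def)
  define Q where "Q = (\<lambda>S. subgroup S A \<and> a \<in> S \<and> (\<exists>\<beta> \<in> hom (A\<lparr>carrier := S\<rparr>) T. \<beta> a = t))"
  have triv: "(\<lambda>_. \<one>\<^bsub>T\<^esub>) \<in> hom (A\<lparr>carrier := {\<one>\<^bsub>A\<^esub>}\<rparr>) T" by (auto simp: hom_def)
  have "a \<notin> {\<one>\<^bsub>A\<^esub>}" using assms(6) by simp
  then obtain S0 \<beta>0 where "subgroup S0 A" "a \<in> S0" "\<beta>0 \<in> hom (A\<lparr>carrier := S0\<rparr>) T"
    and b0: "\<And>s i. s \<in> {\<one>\<^bsub>A\<^esub>} \<Longrightarrow> \<beta>0 (s \<otimes>\<^bsub>A\<^esub> a [^]\<^bsub>A\<^esub> (i::nat)) = \<one>\<^bsub>T\<^esub> \<otimes>\<^bsub>T\<^esub> t [^]\<^bsub>T\<^esub> i"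
    using elementary_abelian_extend_hom[OF assms(1,2,4) A.triv_subgroup triv assms(5) _ assms(7)] by blast
  moreover have "\<beta>0 a = t" using b0[of "\<one>\<^bsub>A\<^esub>" 1] assms(5,7) by simp
  ultimately have "Q S0" by (auto simp: Q_def)
  moreover have "\<forall>S. Q S \<longrightarrow> card S < Suc (card (carrier A))"
    using assms(3) by (auto simp: Q_def less_Suc_eq_le intro!: card_mono subgroup.subset)
  ultimately have "\<exists>S. Q S \<and> (\<forall>S'. Q S' \<longrightarrow> card S' \<le> card S)"
    by (rule ex_has_greatest_nat)
  then obtain S where S: "Q S" "\<And>S'. Q S' \<Longrightarrow> card S' \<le> card S" by blast
  then obtain \<beta> where \<beta>: "\<beta> \<in> hom (A\<lparr>carrier := S\<rparr>) T" "\<beta> a = t" and sub: "subgroup S A" "a \<in> S"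
    by (auto simp: Q_def)
  have "S = carrier A"
  proof (rule ccontr)
    assume "S \<noteq> carrier A"
    then obtain c where c: "c \<in> carrier A" "c \<notin> S" using subgroup.subset[OF sub(1)] by blast
    obtain S' \<beta>' where S': "subgroup S' A" "S \<subseteq> S'" "c \<in> S'" "\<beta>' \<in> hom (A\<lparr>carrier := S'\<rparr>) T"
      and b': "\<And>s i. s \<in> S \<Longrightarrow> \<beta>' (s \<otimes>\<^bsub>A\<^esub> c [^]\<^bsub>A\<^esub> (i::nat)) = \<beta> s \<otimes>\<^bsub>T\<^esub> \<one>\<^bsub>T\<^esub> [^]\<^bsub>T\<^esub> i"
      and "S' = (\<lambda>(s, i). s \<otimes>\<^bsub>A\<^esub> c [^]\<^bsub>A\<^esub> (i::nat)) ` (S \<times> UNIV)"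
      using elementary_abelian_extend_hom[OF assms(1,2,4) sub(1) \<beta>(1) c T.one_closed] by blast
    have "\<beta>' a = t" using b'[of a 0] sub(2) assms(5,7) \<beta>(2) by simp
    then have "Q S'" using S' sub(2) by (auto simp: Q_def)
    then have "card S' \<le> card S" by (rule S(2))
    moreover have "finite S'" using subgroup.subset[OF S'(1)] assms(3) finite_subset by blast
    ultimately have "S = S'" using S'(2) by (meson card_seteq)
    then show False using c(2) S'(3) by simp
  qed
  then show ?thesis using \<beta> by auto
qed

section \<open>Centers and extraspecial groups\<close>

lemma group_center_subgroup:
  assumes "group G" shows "group_center G \<lhd> G"
proof -
  interpret G: group G by fact
  have "subgroup (group_center G) G"
  proof (rule G.subgroupI)
    show "group_center G \<noteq> {}" by (auto simp: group_center_def intro!: exI[of _ "\<one>\<^bsub>G\<^esub>"])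
    show "inv\<^bsub>G\<^esub> a \<in> group_center G" if "a \<in> group_center G" for a
    proof -
      have a: "a \<in> carrier G" "\<And>x. x \<in> carrier G \<Longrightarrow> a \<otimes>\<^bsub>G\<^esub> x = x \<otimes>\<^bsub>G\<^esub> a"
        using that by (auto simp: group_center_def)
      have "inv\<^bsub>G\<^esub> a \<otimes>\<^bsub>G\<^esub> x = x \<otimes>\<^bsub>G\<^esub> inv\<^bsub>G\<^esub> a" if x: "x \<in> carrier G" for x
        using a(1) a(2)[of "inv\<^bsub>G\<^esub> x"] x G.inv_mult_group[of a "inv\<^bsub>G\<^esub> x"] G.inv_mult_group[of "inv\<^bsub>G\<^esub> x" a] by simp
      then show ?thesis using a(1) by (simp add: group_center_def)
    qed
    show "a \<otimes>\<^bsub>G\<^esub> b \<in> group_center G" if "a \<in> group_center G" "b \<in> group_center G" for a b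
    proof -
      have a: "a \<in> carrier G" "\<And>x. x \<in> carrier G \<Longrightarrow> a \<otimes>\<^bsub>G\<^esub> x = x \<otimes>\<^bsub>G\<^esub> a"
        and b: "b \<in> carrier G" "\<And>x. x \<in> carrier G \<Longrightarrow> b \<otimes>\<^bsub>G\<^esub> x = x \<otimes>\<^bsub>G\<^esub> b"
        using that by (auto simp: group_center_def)
      have "a \<otimes>\<^bsub>G\<^esub> b \<otimes>\<^bsub>G\<^esub> x = x \<otimes>\<^bsub>G\<^esub> (a \<otimes>\<^bsub>G\<^esub> b)" if x: "x \<in> carrier G" for x
        using a(1) b(1) x a(2)[OF x] b(2)[OF x] by (metis G.m_assoc)
      then show ?thesis using a(1) b(1) by (simp add: group_center_def)
    qed
  qed (auto simp: group_center_def)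
  moreover have "x \<otimes>\<^bsub>G\<^esub> h \<otimes>\<^bsub>G\<^esub> inv\<^bsub>G\<^esub> x = h" if "x \<in> carrier G" "h \<in> group_center G" for x h
  proof -
    have h: "h \<in> carrier G" "x \<otimes>\<^bsub>G\<^esub> h = h \<otimes>\<^bsub>G\<^esub> x" using that by (auto simp: group_center_def)
    then show ?thesis using that(1) by (simp add: G.m_assoc)
  qed
  ultimately show ?thesis by (simp add: G.normal_inv_iff)
qed

lemma elementary_abelian_ModI:
  assumes "H \<lhd> G"
    and comm: "\<And>x y. x \<in> carrier G \<Longrightarrow> y \<in> carrier G \<Longrightarrow> \<exists>z\<in>H. x \<otimes>\<^bsub>G\<^esub> y = z \<otimes>\<^bsub>G\<^esub> (y \<otimes>\<^bsub>G\<^esub> x)"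
    and pow: "\<And>x. x \<in> carrier G \<Longrightarrow> x [^]\<^bsub>G\<^esub> (p::nat) \<in> H"
  shows "elementary_abelian p (G Mod H)"
proof -
  interpret H: normal H G by fact
  interpret M: group "G Mod H" by (rule H.factorgroup_is_group)
  have "comm_group (G Mod H)"
  proof (rule M.group_comm_groupI)
    fix U W assume "U \<in> carrier (G Mod H)" "W \<in> carrier (G Mod H)"
    then obtain x y where xy: "x \<in> carrier G" "y \<in> carrier G" "U = H #>\<^bsub>G\<^esub> x" "W = H #>\<^bsub>G\<^esub> y"
      by (auto simp: carrier_FactGroup)
    obtain z where z: "z \<in> H" "x \<otimes>\<^bsub>G\<^esub> y = z \<otimes>\<^bsub>G\<^esub> (y \<otimes>\<^bsub>G\<^esub> x)" using comm xy by blast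
    then have "H #>\<^bsub>G\<^esub> (x \<otimes>\<^bsub>G\<^esub> y) = H #>\<^bsub>G\<^esub> (y \<otimes>\<^bsub>G\<^esub> x)"
      using xy H.repr_independence[of "x \<otimes>\<^bsub>G\<^esub> y" H "y \<otimes>\<^bsub>G\<^esub> x"] H.subgroup_axioms
      by (metis H.m_closed H.rcosI H.subset)
    then show "U \<otimes>\<^bsub>G Mod H\<^esub> W = W \<otimes>\<^bsub>G Mod H\<^esub> U" using xy by (simp add: H.rcos_sum)
  qed
  moreover have "U [^]\<^bsub>G Mod H\<^esub> p = \<one>\<^bsub>G Mod H\<^esub>" if "U \<in> carrier (G Mod H)" for U
  proof -
    from that obtain x where x: "x \<in> carrier G" "U = H #>\<^bsub>G\<^esub> x" by (auto simp: carrier_FactGroup)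
    then show ?thesis using H.FactGroup_pow[OF x(1), of p] pow[OF x(1)] H.rcos_const by simp
  qed
  ultimately show ?thesis by (simp add: elementary_abelian_def)
qed

lemma elementary_abelian_ModD:
  assumes "H \<lhd> G" "elementary_abelian p (G Mod H)"
  shows "\<And>x y. x \<in> carrier G \<Longrightarrow> y \<in> carrier G \<Longrightarrow> \<exists>z\<in>H. x \<otimes>\<^bsub>G\<^esub> y = z \<otimes>\<^bsub>G\<^esub> (y \<otimes>\<^bsub>G\<^esub> x)"
    and "\<And>x. x \<in> carrier G \<Longrightarrow> x [^]\<^bsub>G\<^esub> (p::nat) \<in> H"
proof -
  interpret H: normal H G by fact
  interpret M: comm_group "G Mod H" using assms(2) by (simp add: elementary_abelian_def)
  show "\<exists>z\<in>H. x \<otimes>\<^bsub>G\<^esub> y = z \<otimes>\<^bsub>G\<^esub> (y \<otimes>\<^bsub>G\<^esub> x)" if "x \<in> carrier G" "y \<in> carrier G" for x y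
  proof -
    have "(H #>\<^bsub>G\<^esub> x) \<otimes>\<^bsub>G Mod H\<^esub> (H #>\<^bsub>G\<^esub> y) = (H #>\<^bsub>G\<^esub> y) \<otimes>\<^bsub>G Mod H\<^esub> (H #>\<^bsub>G\<^esub> x)"
      by (rule M.m_comm) (use that in \<open>auto simp: carrier_FactGroup\<close>)
    then have "H #>\<^bsub>G\<^esub> (x \<otimes>\<^bsub>G\<^esub> y) = H #>\<^bsub>G\<^esub> (y \<otimes>\<^bsub>G\<^esub> x)" using that by (simp add: H.rcos_sum)
    moreover have "x \<otimes>\<^bsub>G\<^esub> y \<in> H #>\<^bsub>G\<^esub> (x \<otimes>\<^bsub>G\<^esub> y)"
      using that H.rcos_self H.subgroup_axioms by blast
    ultimately have "x \<otimes>\<^bsub>G\<^esub> y \<in> H #>\<^bsub>G\<^esub> (y \<otimes>\<^bsub>G\<^esub> x)" by simp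
    then show ?thesis by (auto simp: r_coset_def)
  qed
  show "x [^]\<^bsub>G\<^esub> (p::nat) \<in> H" if x: "x \<in> carrier G" for x
  proof -
    have "(H #>\<^bsub>G\<^esub> x) [^]\<^bsub>G Mod H\<^esub> p = H"
      using assms(2) x by (simp add: elementary_abelian_def carrier_FactGroup)
    then have "H #>\<^bsub>G\<^esub> (x [^]\<^bsub>G\<^esub> p) = H" using H.FactGroup_pow[OF x] by simp
    then show ?thesis using x by (metis H.nat_pow_closed H.rcos_self H.subgroup_axioms)
  qed
qed

lemma kernel_r_coset_Mod:
  assumes "H \<lhd> G"
  shows "kernel G (G Mod H) (\<lambda>a. H #>\<^bsub>G\<^esub> a) = H"
proof -
  interpret H: normal H G by fact
  show ?thesis
    using H.subset H.rcos_const H.rcos_self[OF _ H.subgroup_axioms] by (auto simp: kernel_def)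
qed

text \<open>The extraspecial group is constructed on pairs, while \<open>class_C2\<close> asks for a
  carrier in \<open>nat\<close>; the criterion is therefore stated along an isomorphism and also
  records where the center goes.\<close>

lemma extraspecialI_iso:
  assumes "prime p" "group E" "finite (carrier E)" "card (group_center E) = p"
    and ncom: "\<exists>x\<in>carrier E. x \<notin> group_center E"
    and comm: "\<And>x y. x \<in> carrier E \<Longrightarrow> y \<in> carrier E \<Longrightarrow> \<exists>z\<in>group_center E. x \<otimes>\<^bsub>E\<^esub> y = z \<otimes>\<^bsub>E\<^esub> (y \<otimes>\<^bsub>E\<^esub> x)"
    and pow: "\<And>x. x \<in> carrier E \<Longrightarrow> x [^]\<^bsub>E\<^esub> p \<in> group_center E"
    and h: "h \<in> iso E E'" "group E'"
  shows "extraspecial p E'" "h ` group_center E = group_center E'"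
proof -
  interpret E: group E by fact
  interpret E': group E' by fact
  interpret h: group_hom E E' h
    using h(1) by (simp add: group_hom_def group_hom_axioms_def E.is_group E'.is_group iso_def)
  have surj: "h ` carrier E = carrier E'" and inj: "inj_on h (carrier E)"
    using h(1) by (auto simp: iso_iff)
  show Z: "h ` group_center E = group_center E'"
  proof
    show "h ` group_center E \<subseteq> group_center E'"
      by (auto simp: group_center_def surj[symmetric] simp flip: h.hom_mult)
    show "group_center E' \<subseteq> h ` group_center E"
    proof
      fix z assume z: "z \<in> group_center E'"
      then obtain y where y: "y \<in> carrier E" "z = h y" by (auto simp: group_center_def surj[symmetric])
      have "y \<otimes>\<^bsub>E\<^esub> x = x \<otimes>\<^bsub>E\<^esub> y" if x: "x \<in> carrier E" for x
      proof -
        have "h (y \<otimes>\<^bsub>E\<^esub> x) = h (x \<otimes>\<^bsub>E\<^esub> y)" using z y x by (simp add: group_center_def)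
        then show ?thesis using inj x y by (meson E.m_closed inj_onD)
      qed
      then show "z \<in> h ` group_center E" using y by (auto simp: group_center_def)
    qed
  qed
  have fin: "finite (carrier E')" using assms(3) surj by (metis finite_imageI)
  have card: "card (group_center E') = p"
    using assms(4) inj Z by (metis (no_types, lifting) card_image group_center_def inj_on_subset mem_Collect_eq subsetI)
  have ncm: "\<not> comm_group E'"
  proof
    assume "comm_group E'"
    then interpret c: comm_group E' .
    from ncom obtain x where x: "x \<in> carrier E" "x \<notin> group_center E" by blast
    have "h x \<in> group_center E'" using x by (auto simp: group_center_def c.m_comm)
    then obtain y where "y \<in> group_center E" "h x = h y" using Z by auto
    then show False using inj x by (metis (no_types, lifting) group_center_def inj_onD mem_Collect_eq)
  qed
  have el: "elementary_abelian p (E' Mod group_center E')"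
  proof (rule elementary_abelian_ModI[OF group_center_subgroup[OF h(2)]])
    fix x y assume "x \<in> carrier E'" "y \<in> carrier E'"
    then obtain u v where uv: "u \<in> carrier E" "v \<in> carrier E" "x = h u" "y = h v" by (auto simp: surj[symmetric])
    then obtain z where z: "z \<in> group_center E" "u \<otimes>\<^bsub>E\<^esub> v = z \<otimes>\<^bsub>E\<^esub> (v \<otimes>\<^bsub>E\<^esub> u)" using comm by blast
    then have "h (u \<otimes>\<^bsub>E\<^esub> v) = h (z \<otimes>\<^bsub>E\<^esub> (v \<otimes>\<^bsub>E\<^esub> u))" by simp
    moreover have "z \<in> carrier E" using z by (simp add: group_center_def)
    ultimately have "x \<otimes>\<^bsub>E'\<^esub> y = h z \<otimes>\<^bsub>E'\<^esub> (y \<otimes>\<^bsub>E'\<^esub> x)" using uv by simp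
    then show "\<exists>z\<in>group_center E'. x \<otimes>\<^bsub>E'\<^esub> y = z \<otimes>\<^bsub>E'\<^esub> (y \<otimes>\<^bsub>E'\<^esub> x)" using z(1) Z by blast
  next
    fix x assume "x \<in> carrier E'"
    then obtain u where "u \<in> carrier E" "x = h u" by (auto simp: surj[symmetric])
    then show "x [^]\<^bsub>E'\<^esub> p \<in> group_center E'" using pow Z by (auto simp: h.hom_nat_pow[symmetric])
  qed
  have nZ: "group_center E' \<lhd> E'" by (rule group_center_subgroup[OF h(2)])
  have grpZ: "group (E'\<lparr>carrier := group_center E'\<rparr>)"
    using nZ by (simp add: E'.subgroup_imp_group normal_imp_subgroup)
  have "finite_p_group p E'"
    using elementary_abelian_kernel_finite_p_group[OF assms(1) h(2) fin el normal.r_coset_hom_Mod[OF nZ]]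
      kernel_r_coset_Mod[OF nZ] card by simp
  then show "extraspecial p E'"
    using ncm el prime_card_imp_cyclic[OF grpZ _ assms(1)] grpZ card
    by (simp add: extraspecial_def cyclic_of_order_def)
qed

lemma finite_group_iso_nat:
  assumes "group G" "finite (carrier G)"
  shows "\<exists>(E :: nat monoid) h. group E \<and> h \<in> iso G E"
proof -
  interpret G: group G by fact
  obtain e :: "_ \<Rightarrow> nat" where "inj_on e (carrier G)"
    using assms(2) finite_imp_inj_to_nat_seg by blast
  from inj_imp_image_group_iso[OF this] have e: "e \<in> iso G (image_group e G)" .
  have "group ((image_group e G)\<lparr>one := e \<one>\<^bsub>G\<^esub>\<rparr>)" using G.iso_imp_img_group[OF e] .
  then show ?thesis using e by (auto simp: image_group_def)
qed

text \<open>A character \<open>\<phi>\<close> in \<open>D\<close> acts on \<open>G\<close> by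
  \<open>h \<mapsto> h * \<phi> h\<close>, an automorphism because \<open>N\<close> is central. In
  the semidirect product these characters destroy every central element outside \<open>N\<close>,
  because they separate the points of \<open>G Mod N\<close>; commutators and p-th powers still fall
  into \<open>N\<close>.\<close>

lemma central_extension_in_extraspecial:
  assumes "prime p" "group G" "finite (carrier G)" "N \<lhd> G" "cyclic_of_order p (G\<lparr>carrier := N\<rparr>)"
    "elementary_abelian p (G Mod N)" "N \<noteq> carrier G"
  shows "\<exists>(E :: nat monoid) i. extraspecial p E \<and> i \<in> hom G E \<and> inj_on i (carrier G) \<and> i ` N = group_center E"
proof -
  interpret N: normal N G by fact
  let ?N = "G\<lparr>carrier := N\<rparr>"
  have cen: "n \<otimes>\<^bsub>G\<^esub> g = g \<otimes>\<^bsub>G\<^esub> n" if "n \<in> N" "g \<in> carrier G" for n g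
    using normal_prime_order_central[OF assms(1,4,5,6) that(2,1)] by simp
  have NG: "n \<in> carrier G" if "n \<in> N" for n using that by (rule N.mem_carrier)
  have cardN: "card N = p" using assms(5) by (simp add: cyclic_of_order_def)
  interpret NG: comm_group ?N
    using assms(5) N.subgroup_imp_group[OF N.subgroup_axioms] cen NG
    by (auto intro!: group.group_comm_groupI)
  have elN: "elementary_abelian p ?N"
    using NG.pow_order_eq_1 cardN by (simp add: elementary_abelian_def NG.comm_group_axioms Coset.order_def)
  note AbD = elementary_abelian_ModD[OF assms(4,6)]
  \<comment> \<open>Extensionality makes equality in \<open>D\<close> equality of values on
    \<open>G\<close>, and makes \<open>D\<close> finite.\<close>
  define D where "D = {\<psi> \<in> hom G ?N \<inter> extensional (carrier G). \<forall>n\<in>N. \<psi> n = \<one>\<^bsub>G\<^esub>}"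
  have DN: "\<psi> g \<in> N" if "\<psi> \<in> D" "g \<in> carrier G" for \<psi> g using that by (auto simp: D_def hom_def)
  have DG: "\<psi> g \<in> carrier G" if "\<psi> \<in> D" "g \<in> carrier G" for \<psi> g using NG DN that by blast
  have Dm: "\<psi> (g \<otimes>\<^bsub>G\<^esub> h) = \<psi> g \<otimes>\<^bsub>G\<^esub> \<psi> h" if "\<psi> \<in> D" "g \<in> carrier G" "h \<in> carrier G" for \<psi> g h
    using that by (auto simp: D_def hom_def)
  have D1: "\<psi> n = \<one>\<^bsub>G\<^esub>" if "\<psi> \<in> D" "n \<in> N" for \<psi> n using that by (auto simp: D_def)
  have DI: "restrict \<psi> (carrier G) \<in> D"
    if "\<And>g. g \<in> carrier G \<Longrightarrow> \<psi> g \<in> N" "\<And>n. n \<in> N \<Longrightarrow> \<psi> n = \<one>\<^bsub>G\<^esub>"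
      "\<And>g h. g \<in> carrier G \<Longrightarrow> h \<in> carrier G \<Longrightarrow> \<psi> (g \<otimes>\<^bsub>G\<^esub> h) = \<psi> g \<otimes>\<^bsub>G\<^esub> \<psi> h" for \<psi>
    using that by (auto simp: D_def hom_def NG)
  have Dext: "\<phi> = \<psi>" if "\<phi> \<in> D" "\<psi> \<in> D" "\<And>g. g \<in> carrier G \<Longrightarrow> \<phi> g = \<psi> g" for \<phi> \<psi>
    using that by (auto simp: D_def intro: extensionalityI)
  define e where "e = (\<lambda>g\<in>carrier G. \<one>\<^bsub>G\<^esub>)"
  define mu where "mu = (\<lambda>\<phi> \<psi>. \<lambda>g\<in>carrier G. \<phi> g \<otimes>\<^bsub>G\<^esub> \<psi> g)"
  have eD: "e \<in> D" by (auto simp: D_def e_def hom_def NG)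
  have muD: "mu \<phi> \<psi> \<in> D" if "\<phi> \<in> D" "\<psi> \<in> D" for \<phi> \<psi>
  proof -
    have "\<phi> g \<otimes>\<^bsub>G\<^esub> \<phi> h \<otimes>\<^bsub>G\<^esub> (\<psi> g \<otimes>\<^bsub>G\<^esub> \<psi> h) = \<phi> g \<otimes>\<^bsub>G\<^esub> \<psi> g \<otimes>\<^bsub>G\<^esub> (\<phi> h \<otimes>\<^bsub>G\<^esub> \<psi> h)"
      if "g \<in> carrier G" "h \<in> carrier G" for g h
      using NG.m_ac DN that \<open>\<phi> \<in> D\<close> \<open>\<psi> \<in> D\<close> by simp
    then show ?thesis unfolding mu_def using that by (intro DI) (auto simp: Dm DN D1)
  qed
  define iv where "iv = (\<lambda>\<phi>. \<lambda>g\<in>carrier G. inv\<^bsub>G\<^esub> (\<phi> g))"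
  have ivD: "iv \<phi> \<in> D" if "\<phi> \<in> D" for \<phi>
  proof -
    have "inv\<^bsub>G\<^esub> (\<phi> g \<otimes>\<^bsub>G\<^esub> \<phi> h) = inv\<^bsub>G\<^esub> \<phi> g \<otimes>\<^bsub>G\<^esub> inv\<^bsub>G\<^esub> \<phi> h"
      if "g \<in> carrier G" "h \<in> carrier G" for g h
      using cen[of "inv\<^bsub>G\<^esub> \<phi> h" "inv\<^bsub>G\<^esub> \<phi> g"] DN[OF \<open>\<phi> \<in> D\<close>] DG[OF \<open>\<phi> \<in> D\<close>] that by (simp add: N.inv_mult_group)
    then show ?thesis unfolding iv_def using that by (intro DI) (auto simp: Dm DN D1)
  qed
  define E where "E = \<lparr>carrier = carrier G \<times> D,
    monoid.mult = (\<lambda>(g, \<phi>) (h, \<psi>). (g \<otimes>\<^bsub>G\<^esub> h \<otimes>\<^bsub>G\<^esub> \<phi> h, mu \<phi> \<psi>)), one = (\<one>\<^bsub>G\<^esub>, e)\<rparr>"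
  have cE: "carrier E = carrier G \<times> D" and oE: "\<one>\<^bsub>E\<^esub> = (\<one>\<^bsub>G\<^esub>, e)"
    and mE: "(g, \<phi>) \<otimes>\<^bsub>E\<^esub> (h, \<psi>) = (g \<otimes>\<^bsub>G\<^esub> h \<otimes>\<^bsub>G\<^esub> \<phi> h, mu \<phi> \<psi>)" for g h \<phi> \<psi>
    by (simp_all add: E_def)
  have muap: "mu \<phi> \<psi> g = \<phi> g \<otimes>\<^bsub>G\<^esub> \<psi> g" if "g \<in> carrier G" for \<phi> \<psi> g using that by (simp add: mu_def)
  have mucomm: "mu \<phi> \<psi> = mu \<psi> \<phi>" if "\<phi> \<in> D" "\<psi> \<in> D" for \<phi> \<psi>
    using that by (intro Dext muD) (auto simp: muap DG DN cen)
  have mue: "mu e \<phi> = \<phi>" if "\<phi> \<in> D" for \<phi>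
    using that by (intro Dext muD eD) (auto simp: muap DG e_def)
  have muassoc: "mu (mu \<phi> \<psi>) \<chi> = mu \<phi> (mu \<psi> \<chi>)" if "\<phi> \<in> D" "\<psi> \<in> D" "\<chi> \<in> D" for \<phi> \<psi> \<chi>
    using that by (intro Dext muD) (auto simp: muap DG N.m_assoc)
  have grpE: "group E"
  proof (rule groupI)
    fix x y z assume "x \<in> carrier E" "y \<in> carrier E" "z \<in> carrier E"
    then obtain g h k \<phi> \<psi> \<chi> where
      x: "x = (g, \<phi>)" "y = (h, \<psi>)" "z = (k, \<chi>)" and G: "g \<in> carrier G" "h \<in> carrier G" "k \<in> carrier G"
      and D: "\<phi> \<in> D" "\<psi> \<in> D" "\<chi> \<in> D" by (auto simp: cE)
    have "\<phi> (h \<otimes>\<^bsub>G\<^esub> k \<otimes>\<^bsub>G\<^esub> \<psi> k) = \<phi> h \<otimes>\<^bsub>G\<^esub> \<phi> k"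
      using G D by (simp add: Dm DG DN D1)
    moreover have "g \<otimes>\<^bsub>G\<^esub> h \<otimes>\<^bsub>G\<^esub> \<phi> h \<otimes>\<^bsub>G\<^esub> k \<otimes>\<^bsub>G\<^esub> (\<phi> k \<otimes>\<^bsub>G\<^esub> \<psi> k)
       = g \<otimes>\<^bsub>G\<^esub> (h \<otimes>\<^bsub>G\<^esub> k \<otimes>\<^bsub>G\<^esub> \<psi> k) \<otimes>\<^bsub>G\<^esub> (\<phi> h \<otimes>\<^bsub>G\<^esub> \<phi> k)"
    proof -
      have c1: "\<phi> h \<otimes>\<^bsub>G\<^esub> k = k \<otimes>\<^bsub>G\<^esub> \<phi> h" using G D by (simp add: cen DN)
      have c2: "\<phi> h \<otimes>\<^bsub>G\<^esub> (\<phi> k \<otimes>\<^bsub>G\<^esub> \<psi> k) = \<psi> k \<otimes>\<^bsub>G\<^esub> (\<phi> h \<otimes>\<^bsub>G\<^esub> \<phi> k)"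
        using cen[of "\<psi> k" "\<phi> h \<otimes>\<^bsub>G\<^esub> \<phi> k"] G D by (simp add: DN DG N.m_assoc)
      have "g \<otimes>\<^bsub>G\<^esub> h \<otimes>\<^bsub>G\<^esub> \<phi> h \<otimes>\<^bsub>G\<^esub> k \<otimes>\<^bsub>G\<^esub> (\<phi> k \<otimes>\<^bsub>G\<^esub> \<psi> k)
        = g \<otimes>\<^bsub>G\<^esub> h \<otimes>\<^bsub>G\<^esub> (\<phi> h \<otimes>\<^bsub>G\<^esub> k) \<otimes>\<^bsub>G\<^esub> (\<phi> k \<otimes>\<^bsub>G\<^esub> \<psi> k)"
        using G D by (simp add: N.m_assoc DG)
      also have "\<dots> = g \<otimes>\<^bsub>G\<^esub> h \<otimes>\<^bsub>G\<^esub> k \<otimes>\<^bsub>G\<^esub> (\<phi> h \<otimes>\<^bsub>G\<^esub> (\<phi> k \<otimes>\<^bsub>G\<^esub> \<psi> k))"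
        unfolding c1 using G D by (simp add: N.m_assoc DG)
      finally show ?thesis unfolding c2 using G D by (simp add: N.m_assoc DG)
    qed
    ultimately show "x \<otimes>\<^bsub>E\<^esub> y \<otimes>\<^bsub>E\<^esub> z = x \<otimes>\<^bsub>E\<^esub> (y \<otimes>\<^bsub>E\<^esub> z)"
      using G D by (simp add: x mE muap muassoc)
  next
    fix x assume "x \<in> carrier E"
    then obtain g \<phi> where x: "x = (g, \<phi>)" "g \<in> carrier G" "\<phi> \<in> D" by (auto simp: cE)
    have "mu (iv \<phi>) \<phi> = e"
      using x by (intro Dext muD ivD eD) (auto simp: muap iv_def e_def DG)
    moreover have "inv\<^bsub>G\<^esub> g \<otimes>\<^bsub>G\<^esub> \<phi> g \<otimes>\<^bsub>G\<^esub> g \<otimes>\<^bsub>G\<^esub> iv \<phi> g = \<one>\<^bsub>G\<^esub>"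
    proof -
      have "\<phi> g \<otimes>\<^bsub>G\<^esub> g = g \<otimes>\<^bsub>G\<^esub> \<phi> g" using x by (simp add: cen DN)
      then have "inv\<^bsub>G\<^esub> g \<otimes>\<^bsub>G\<^esub> \<phi> g \<otimes>\<^bsub>G\<^esub> g = \<phi> g" using x by (simp add: N.m_assoc DG) (simp add: N.m_assoc[symmetric] DG)
      then show ?thesis using x by (simp add: iv_def DG)
    qed
    ultimately show "\<exists>y\<in>carrier E. y \<otimes>\<^bsub>E\<^esub> x = \<one>\<^bsub>E\<^esub>"
      using x by (intro bexI[of _ "(inv\<^bsub>G\<^esub> g \<otimes>\<^bsub>G\<^esub> \<phi> g, iv \<phi>)"]) (auto simp: mE oE cE ivD DG)
    show "\<one>\<^bsub>E\<^esub> \<otimes>\<^bsub>E\<^esub> x = x" using x by (simp add: oE mE mue) (simp add: e_def)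
  qed (auto simp: cE oE mE muD eD DG)
  interpret E: group E by (rule grpE)
  have sep: "\<exists>\<psi>\<in>D. \<psi> g \<noteq> \<one>\<^bsub>G\<^esub>" if g: "g \<in> carrier G" "g \<notin> N" for g
  proof -
    obtain t where t: "t \<in> N" "t \<noteq> \<one>\<^bsub>G\<^esub>"
    proof -
      have "\<not> N \<subseteq> {\<one>\<^bsub>G\<^esub>}"
      proof
        assume "N \<subseteq> {\<one>\<^bsub>G\<^esub>}"
        then have "card N \<le> 1" using card_mono[of "{\<one>\<^bsub>G\<^esub>}" N] by simp
        then show False using cardN prime_gt_1_nat[OF assms(1)] by simp
      qed
      then show ?thesis using that by blast
    qed
    have finA: "finite (carrier (G Mod N))" using assms(3) by (simp add: carrier_FactGroup)
    have "N #>\<^bsub>G\<^esub> g \<noteq> \<one>\<^bsub>G Mod N\<^esub>"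
      using g N.rcos_self[OF g(1) N.subgroup_axioms] by auto
    moreover have gA: "N #>\<^bsub>G\<^esub> g \<in> carrier (G Mod N)" using g by (auto simp: carrier_FactGroup)
    ultimately obtain \<beta> where \<beta>: "\<beta> \<in> hom (G Mod N) ?N" "\<beta> (N #>\<^bsub>G\<^esub> g) = t"
      using elementary_abelian_separating_hom[OF assms(1,6) finA elN _ _, of "N #>\<^bsub>G\<^esub> g" t] t by auto
    have bh: "\<beta> \<circ> (\<lambda>a. N #>\<^bsub>G\<^esub> a) \<in> hom G ?N" using hom_compose[OF N.r_coset_hom_Mod \<beta>(1)] .
    interpret bg: group_hom "G Mod N" ?N \<beta>
      using \<beta>(1) by (simp add: group_hom_def group_hom_axioms_def N.factorgroup_is_group NG.is_group)
    have "restrict (\<beta> \<circ> (\<lambda>a. N #>\<^bsub>G\<^esub> a)) (carrier G) \<in> D"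
      using bh bg.hom_one by (auto simp: D_def hom_def NG N.rcos_const)
    then show ?thesis using \<beta>(2) t g by (intro bexI) auto
  qed
  have Z: "group_center E = N \<times> {e}"
  proof
    show "N \<times> {e} \<subseteq> group_center E"
      by (auto simp: group_center_def cE mE eD NG mue mucomm[OF _ eD] D1 DG) (auto simp: e_def intro: cen)
    show "group_center E \<subseteq> N \<times> {e}"
    proof
      fix x assume x: "x \<in> group_center E"
      then obtain g \<phi> where gx: "x = (g, \<phi>)" "g \<in> carrier G" "\<phi> \<in> D" by (auto simp: group_center_def cE)
      have c: "(g, \<phi>) \<otimes>\<^bsub>E\<^esub> (h, \<psi>) = (h, \<psi>) \<otimes>\<^bsub>E\<^esub> (g, \<phi>)" if "h \<in> carrier G" "\<psi> \<in> D" for h \<psi>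
        using x gx that by (auto simp: group_center_def cE)
      \<comment> \<open>Commuting with the pair of the identity and \<open>\<psi>\<close> forces
        \<open>\<psi> g\<close> to be trivial, which fails for some \<open>\<psi>\<close> when
        \<open>g\<close> is outside \<open>N\<close>.\<close>
      have "g \<in> N"
      proof (rule ccontr)
        assume "g \<notin> N"
        then obtain \<psi> where \<psi>: "\<psi> \<in> D" "\<psi> g \<noteq> \<one>\<^bsub>G\<^esub>" using sep gx by blast
        have o: "\<phi> \<one>\<^bsub>G\<^esub> = \<one>\<^bsub>G\<^esub>" by (rule D1[OF gx(3) N.subgroup_axioms[THEN subgroup.one_closed]])
        have "g \<otimes>\<^bsub>G\<^esub> \<one>\<^bsub>G\<^esub> \<otimes>\<^bsub>G\<^esub> \<phi> \<one>\<^bsub>G\<^esub> = \<one>\<^bsub>G\<^esub> \<otimes>\<^bsub>G\<^esub> g \<otimes>\<^bsub>G\<^esub> \<psi> g"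
          using c[OF N.group_axioms[THEN group.is_monoid, THEN monoid.one_closed] \<psi>(1)] by (simp only: mE prod.inject)
        then have "g = g \<otimes>\<^bsub>G\<^esub> \<psi> g" using gx(2) by (simp add: o)
        then show False using \<psi>(2) N.l_cancel_one'[OF gx(2) DG[OF \<psi>(1) gx(2)]] by blast
      qed
      \<comment> \<open>Commuting with \<open>(h, e)\<close> leaves only the condition on
        \<open>\<phi> h\<close>, as \<open>g\<close> is already central in \<open>G\<close>.\<close>
      moreover have "\<phi> = e"
      proof (rule Dext[OF gx(3) eD])
        fix h assume h: "h \<in> carrier G"
        have "g \<otimes>\<^bsub>G\<^esub> h \<otimes>\<^bsub>G\<^esub> \<phi> h = h \<otimes>\<^bsub>G\<^esub> g \<otimes>\<^bsub>G\<^esub> e g" using c[OF h eD] by (simp add: mE)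
        also have "\<dots> = g \<otimes>\<^bsub>G\<^esub> h" using gx h cen[OF \<open>g \<in> N\<close> h] by (simp add: e_def)
        finally show "\<phi> h = e h" using gx h by (simp add: DG e_def)
      qed
      ultimately show "x \<in> N \<times> {e}" using gx by simp
    qed
  qed
  have comm: "\<exists>z\<in>group_center E. x \<otimes>\<^bsub>E\<^esub> y = z \<otimes>\<^bsub>E\<^esub> (y \<otimes>\<^bsub>E\<^esub> x)" if "x \<in> carrier E" "y \<in> carrier E" for x y
  proof -
    from that obtain g h \<phi> \<psi> where x: "x = (g, \<phi>)" "y = (h, \<psi>)" and G: "g \<in> carrier G" "h \<in> carrier G"
      and D: "\<phi> \<in> D" "\<psi> \<in> D" by (auto simp: cE)
    obtain n where n: "n \<in> N" "g \<otimes>\<^bsub>G\<^esub> h = n \<otimes>\<^bsub>G\<^esub> (h \<otimes>\<^bsub>G\<^esub> g)" using AbD(1)[OF G] by blast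
    \<comment> \<open>The commutator of \<open>x\<close> and \<open>y\<close> in \<open>E\<close>:
      the one of \<open>g\<close> and \<open>h\<close>, twisted by both characters.\<close>
    define m where "m = n \<otimes>\<^bsub>G\<^esub> \<phi> h \<otimes>\<^bsub>G\<^esub> inv\<^bsub>G\<^esub> (\<psi> g)"
    have mN: "m \<in> N" using n G D by (simp add: m_def DN)
    have "m \<otimes>\<^bsub>G\<^esub> (h \<otimes>\<^bsub>G\<^esub> g \<otimes>\<^bsub>G\<^esub> \<psi> g) = n \<otimes>\<^bsub>G\<^esub> (h \<otimes>\<^bsub>G\<^esub> g) \<otimes>\<^bsub>G\<^esub> \<phi> h"
    proof -
      have "m \<otimes>\<^bsub>G\<^esub> (h \<otimes>\<^bsub>G\<^esub> g \<otimes>\<^bsub>G\<^esub> \<psi> g) = (h \<otimes>\<^bsub>G\<^esub> g) \<otimes>\<^bsub>G\<^esub> (\<psi> g \<otimes>\<^bsub>G\<^esub> m)"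
        using cen[OF mN, of "h \<otimes>\<^bsub>G\<^esub> g \<otimes>\<^bsub>G\<^esub> \<psi> g"] G D NG[OF mN] by (simp add: DG N.m_assoc)
      also have "\<psi> g \<otimes>\<^bsub>G\<^esub> m = m \<otimes>\<^bsub>G\<^esub> \<psi> g" using cen[OF mN] G D by (simp add: DG)
      also have "m \<otimes>\<^bsub>G\<^esub> \<psi> g = n \<otimes>\<^bsub>G\<^esub> \<phi> h" using n NG G D by (simp add: m_def DG N.m_assoc)
      also have "(h \<otimes>\<^bsub>G\<^esub> g) \<otimes>\<^bsub>G\<^esub> (n \<otimes>\<^bsub>G\<^esub> \<phi> h) = n \<otimes>\<^bsub>G\<^esub> (h \<otimes>\<^bsub>G\<^esub> g) \<otimes>\<^bsub>G\<^esub> \<phi> h"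
        using cen[OF n(1), of "h \<otimes>\<^bsub>G\<^esub> g"] n NG G D by (simp add: DG N.m_assoc[symmetric])
      finally show ?thesis .
    qed
    then have "x \<otimes>\<^bsub>E\<^esub> y = (m, e) \<otimes>\<^bsub>E\<^esub> (y \<otimes>\<^bsub>E\<^esub> x)"
      using G D n mucomm mue NG[OF mN] muD by (simp add: x mE DG) (simp add: e_def DG NG)
    then show ?thesis using mN by (auto simp: Z)
  qed
  \<comment> \<open>Each further multiplication changes the first component by \<open>g\<close> and
    a central factor \<open>\<phi> g ^ i\<close>; these factors are collected in
    \<open>n\<close>.\<close>
  have powE: "\<exists>n\<in>N. (g, \<phi>) [^]\<^bsub>E\<^esub> (i::nat) = (n \<otimes>\<^bsub>G\<^esub> g [^]\<^bsub>G\<^esub> i, \<lambda>h\<in>carrier G. \<phi> h [^]\<^bsub>G\<^esub> i)"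
    if G: "g \<in> carrier G" "\<phi> \<in> D" for g \<phi> i
  proof (induction i)
    case 0 then show ?case using G by (auto simp: oE e_def)
  next
    case (Suc i)
    then obtain n where n: "n \<in> N" "(g, \<phi>) [^]\<^bsub>E\<^esub> i = (n \<otimes>\<^bsub>G\<^esub> g [^]\<^bsub>G\<^esub> i, \<lambda>h\<in>carrier G. \<phi> h [^]\<^bsub>G\<^esub> i)" by blast
    have gi: "\<phi> g [^]\<^bsub>G\<^esub> i \<in> N" using G NG.nat_pow_closed[of "\<phi> g" i] DN
        N.nat_pow_consistent[of "\<phi> g" i N] by simp
    have "n \<otimes>\<^bsub>G\<^esub> g [^]\<^bsub>G\<^esub> i \<otimes>\<^bsub>G\<^esub> g \<otimes>\<^bsub>G\<^esub> \<phi> g [^]\<^bsub>G\<^esub> i = (\<phi> g [^]\<^bsub>G\<^esub> i \<otimes>\<^bsub>G\<^esub> n) \<otimes>\<^bsub>G\<^esub> g [^]\<^bsub>G\<^esub> Suc i"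
      using cen[OF gi, of "n \<otimes>\<^bsub>G\<^esub> g [^]\<^bsub>G\<^esub> i \<otimes>\<^bsub>G\<^esub> g"] G n(1) NG NG[OF gi] by (simp add: N.m_assoc)
    then have "(g, \<phi>) [^]\<^bsub>E\<^esub> Suc i = ((\<phi> g [^]\<^bsub>G\<^esub> i \<otimes>\<^bsub>G\<^esub> n) \<otimes>\<^bsub>G\<^esub> g [^]\<^bsub>G\<^esub> Suc i, \<lambda>h\<in>carrier G. \<phi> h [^]\<^bsub>G\<^esub> Suc i)"
      using n(2) G by (simp add: mE mu_def cong: restrict_cong)
    then show ?case using gi n(1) by blast
  qed
  have pow: "x [^]\<^bsub>E\<^esub> p \<in> group_center E" if "x \<in> carrier E" for x
  proof -
    from that obtain g \<phi> where x: "x = (g, \<phi>)" "g \<in> carrier G" "\<phi> \<in> D" by (auto simp: cE)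
    obtain n where n: "n \<in> N" "x [^]\<^bsub>E\<^esub> p = (n \<otimes>\<^bsub>G\<^esub> g [^]\<^bsub>G\<^esub> p, \<lambda>h\<in>carrier G. \<phi> h [^]\<^bsub>G\<^esub> p)"
      using powE[OF x(2,3), of p] x(1) by blast
    have "\<phi> h [^]\<^bsub>G\<^esub> p = \<one>\<^bsub>G\<^esub>" if "h \<in> carrier G" for h
      using elN DN[OF x(3) that] N.nat_pow_consistent[of "\<phi> h" p N] by (simp add: elementary_abelian_def)
    then have "(\<lambda>h\<in>carrier G. \<phi> h [^]\<^bsub>G\<^esub> p) = e" by (auto simp: e_def)
    then show ?thesis using n AbD(2)[OF x(2)] by (simp add: Z)
  qed
  have "D \<subseteq> PiE (carrier G) (\<lambda>_. N)" by (auto simp: D_def hom_def PiE_def)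
  moreover have "finite N" using assms(3) N.subset finite_subset by blast
  ultimately have finD: "finite D" using assms(3) by (meson finite_PiE finite_subset)
  then have finE: "finite (carrier E)" using assms(3) by (simp add: cE)
  obtain E' :: "nat monoid" and h where h: "group E'" "h \<in> iso E E'"
    using finite_group_iso_nat[OF grpE finE] by blast
  have ncom: "\<exists>x\<in>carrier E. x \<notin> group_center E"
  proof -
    obtain g where "g \<in> carrier G" "g \<notin> N" using assms(7) N.subset by blast
    then show ?thesis by (intro bexI[of _ "(g, e)"]) (auto simp: Z cE eD)
  qed
  have cardZ: "card (group_center E) = p" using cardN by (simp add: Z card_cartesian_product)
  note ex = extraspecialI_iso[OF assms(1) grpE finE cardZ ncom comm pow h(2,1)]
  have i: "(\<lambda>g. (g, e)) \<in> hom G E"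
    by (auto simp: hom_def cE mE eD mue) (simp add: e_def)
  have "h \<circ> (\<lambda>g. (g, e)) \<in> hom G E'"
    using h(2) hom_compose[OF i] by (auto simp: iso_def)
  moreover have "inj_on (h \<circ> (\<lambda>g. (g, e))) (carrier G)"
    using h(2) eD by (intro comp_inj_on) (auto simp: inj_on_def iso_iff cE)
  moreover have "(h \<circ> (\<lambda>g. (g, e))) ` N = group_center E'"
    using ex(2) by (auto simp: Z image_image)
  ultimately show ?thesis using ex(1) by blast
qed

text \<open>With \<open>V\<close> the image of \<open>G\<close> in the quotient, the preimage of
  \<open>V\<close> is the image of \<open>G\<close> times the center, and the last assumption
  absorbs the center.\<close>

lemma class_C2I:
  assumes "group G" "extraspecial p (E :: nat monoid)" "i \<in> hom G E" "inj_on i (carrier G)"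
    and ZG: "group_center E \<subseteq> i ` carrier G"
  shows "G \<in> class_C2 p"
proof -
  interpret G: group G by fact
  interpret E: group E using assms(2) by (simp add: extraspecial_def finite_p_group_def)
  interpret Z: normal "group_center E" E by (rule group_center_subgroup[OF E.is_group])
  interpret M: group "E Mod group_center E" by (rule Z.factorgroup_is_group)
  interpret i: group_hom G E i
    using assms(3) by (simp add: group_hom_def group_hom_axioms_def G.is_group E.is_group)
  interpret q: group_hom G "E Mod group_center E" "(\<lambda>a. group_center E #>\<^bsub>E\<^esub> a) \<circ> i"
    using hom_compose[OF assms(3) Z.r_coset_hom_Mod]
    by (simp add: group_hom_def group_hom_axioms_def G.is_group M.is_group)
  define V where "V = ((\<lambda>a. group_center E #>\<^bsub>E\<^esub> a) \<circ> i) ` carrier G"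
  have sV: "subgroup V (E Mod group_center E)" unfolding V_def by (rule q.img_is_subgroup)
  interpret VG: group "(E Mod group_center E)\<lparr>carrier := V\<rparr>" using sV by (rule M.subgroup_imp_group)
  have "Fp_subspace p V (E Mod group_center E)"
    using sV VG.nat_pow_closed M.nat_pow_consistent[of _ _ V] by (simp add: Fp_subspace_def)
  moreover have "center_preimage E V = i ` carrier G"
  proof
    show "center_preimage E V \<subseteq> i ` carrier G"
    proof
      fix x assume "x \<in> center_preimage E V"
      then obtain g where g: "x \<in> carrier E" "g \<in> carrier G" "group_center E #>\<^bsub>E\<^esub> x = group_center E #>\<^bsub>E\<^esub> i g"
        by (auto simp: center_preimage_def V_def)
      then have "x \<in> group_center E #>\<^bsub>E\<^esub> i g" using E.rcos_self[OF g(1) Z.subgroup_axioms] by simp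
      then obtain z where "z \<in> group_center E" "x = z \<otimes>\<^bsub>E\<^esub> i g" by (auto simp: r_coset_def)
      then obtain h where "h \<in> carrier G" "x = i h \<otimes>\<^bsub>E\<^esub> i g" using ZG by auto
      then show "x \<in> i ` carrier G" using g(2) by (metis G.m_closed i.hom_mult image_eqI)
    qed
    show "i ` carrier G \<subseteq> center_preimage E V" by (auto simp: center_preimage_def V_def)
  qed
  moreover have "i \<in> iso G (E\<lparr>carrier := i ` carrier G\<rparr>)"
    using assms(4) by (auto simp: iso_def hom_def bij_betw_def)
  ultimately have "Fp_subspace p V (E Mod group_center E)" "G \<cong> E\<lparr>carrier := center_preimage E V\<rparr>"
    by (auto simp: is_iso_def)
  then show ?thesis using assms(1,2) by (auto simp: class_C2_def)
qed

lemma class_C1_subset_C2: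
  assumes "prime p" shows "(class_C1 p :: 'g monoid set) \<subseteq> class_C2 p"
proof
  fix G :: "'g monoid" assume "G \<in> class_C1 p"
  then obtain N where G: "group G" "finite (carrier G)" and N: "N \<lhd> G" "cyclic_of_order p (G\<lparr>carrier := N\<rparr>)"
    "elementary_abelian p (G Mod N)" by (auto simp: class_C1_def finite_p_group_def)
  interpret G: group G by fact
  show "G \<in> class_C2 p"
  proof (cases "N = carrier G")
    case False
    from central_extension_in_extraspecial[OF assms G N False] obtain E :: "nat monoid" and i
      where E: "extraspecial p E" "i \<in> hom G E" "inj_on i (carrier G)" "i ` N = group_center E" by blast
    moreover have "N \<subseteq> carrier G" using N(1) by (simp add: normal_imp_subgroup subgroup.subset)
    ultimately show ?thesis using class_C2I[OF G(1) E(1-3)] by blast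
  next
    \<comment> \<open>Here \<open>Hom (G/N, N)\<close> is trivial and the semidirect product would
      be the abelian group \<open>G\<close>. The direct square of \<open>G\<close>, with the kernel
      of \<open>snd\<close> in the role of \<open>N\<close>, satisfies the hypotheses of the
      construction; \<open>G\<close> embeds as that kernel, which becomes the center.\<close>
    case True
    interpret GC: comm_group G
      using normal_prime_order_central[OF assms N] True by (intro G.group_comm_groupI) auto
    have cardG: "card (carrier G) = p" using N(2) True by (simp add: cyclic_of_order_def)
    have el: "elementary_abelian p G"
      using G.pow_order_eq_1 cardG by (simp add: elementary_abelian_def GC.comm_group_axioms Coset.order_def)
    interpret GG: group "G \<times>\<times> G" using G(1) by (simp add: DirProd_group)
    have snd: "snd \<in> hom (G \<times>\<times> G) G" by (auto simp: hom_def)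
    interpret s: group_hom "G \<times>\<times> G" G snd
      using snd by (simp add: group_hom_def group_hom_axioms_def GG.is_group G.is_group)
    have ker: "kernel (G \<times>\<times> G) G snd = carrier G \<times> {\<one>\<^bsub>G\<^esub>}" by (auto simp: kernel_def)
    have "finite (carrier (G \<times>\<times> G))" using G(2) by simp
    moreover have "cyclic_of_order p ((G \<times>\<times> G)\<lparr>carrier := kernel (G \<times>\<times> G) G snd\<rparr>)"
      using GG.subgroup_imp_group[OF s.subgroup_kernel] cardG
      by (auto simp: cyclic_of_order_def ker card_cartesian_product intro!: prime_card_imp_cyclic[OF _ _ assms])
    moreover have "kernel (G \<times>\<times> G) G snd \<noteq> carrier (G \<times>\<times> G)"
    proof
      assume "kernel (G \<times>\<times> G) G snd = carrier (G \<times>\<times> G)"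
      then have "carrier G \<subseteq> {\<one>\<^bsub>G\<^esub>}" using G.one_closed by (auto simp: ker)
      then have "card (carrier G) \<le> 1" using card_mono[of "{\<one>\<^bsub>G\<^esub>}" "carrier G"] by simp
      then show False using cardG prime_gt_1_nat[OF assms] by simp
    qed
    ultimately obtain E :: "nat monoid" and i
      where E: "extraspecial p E" "i \<in> hom (G \<times>\<times> G) E" "inj_on i (carrier (G \<times>\<times> G))"
        "i ` (carrier G \<times> {\<one>\<^bsub>G\<^esub>}) = group_center E"
      using central_extension_in_extraspecial[OF assms GG.is_group _ s.normal_kernel _
        elementary_abelian_Mod_kernel[OF el GG.is_group snd]] ker by metis
    have "(\<lambda>g. (g, \<one>\<^bsub>G\<^esub>)) \<in> hom G (G \<times>\<times> G)" by (auto simp: hom_def)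
    then have "i \<circ> (\<lambda>g. (g, \<one>\<^bsub>G\<^esub>)) \<in> hom G E" using E(2) hom_compose by blast
    moreover have "inj_on (i \<circ> (\<lambda>g. (g, \<one>\<^bsub>G\<^esub>))) (carrier G)"
      by (intro comp_inj_on inj_on_subset[OF E(3)]) (auto intro: inj_onI)
    moreover have "group_center E \<subseteq> (i \<circ> (\<lambda>g. (g, \<one>\<^bsub>G\<^esub>))) ` carrier G"
      unfolding E(4)[symmetric] by auto
    ultimately show ?thesis using class_C2I[OF G(1) E(1)] by blast
  qed
qed

text \<open>\<open>V\<close> contains the zero class, so the image of \<open>G\<close> contains the
  center, and the composite with the projection to the quotient has a kernel of order
  \<open>p\<close>.\<close>

lemma class_C2_subset_C1:
  assumes "prime p" shows "(class_C2 p :: 'g monoid set) \<subseteq> class_C1 p"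
proof
  fix G :: "'g monoid" assume "G \<in> class_C2 p"
  then obtain E :: "nat monoid" and V h where G: "group G" and E: "extraspecial p E"
    and V: "Fp_subspace p V (E Mod group_center E)" and h: "h \<in> iso G (E\<lparr>carrier := center_preimage E V\<rparr>)"
    by (auto simp: class_C2_def is_iso_def)
  interpret G: group G by fact
  interpret E: group E using E by (simp add: extraspecial_def finite_p_group_def)
  interpret Z: normal "group_center E" E by (rule group_center_subgroup[OF E.is_group])
  have hE: "h \<in> hom G E" using h by (auto simp: iso_def hom_def center_preimage_def)
  have inj: "inj_on h (carrier G)" and img: "h ` carrier G = center_preimage E V" using h by (auto simp: iso_iff)
  have finE: "finite (carrier E)" using E by (simp add: extraspecial_def finite_p_group_def)
  then have fin: "finite (carrier G)"
    using inj img finite_imageD[of h "carrier G"] by (auto simp: center_preimage_def)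
  have "\<one>\<^bsub>E Mod group_center E\<^esub> \<in> V" using V by (auto simp: Fp_subspace_def dest: subgroup.one_closed)
  then have sub: "group_center E \<subseteq> h ` carrier G"
    unfolding img using Z.rcos_const Z.subset by (auto simp: center_preimage_def)
  have ker: "kernel G (E Mod group_center E) ((\<lambda>a. group_center E #>\<^bsub>E\<^esub> a) \<circ> h) = {g \<in> carrier G. h g \<in> group_center E}"
    using kernel_r_coset_Mod[OF Z.normal_axioms] hE by (auto simp: kernel_def hom_def)
  have "h ` {g \<in> carrier G. h g \<in> group_center E} = group_center E" using sub by auto
  moreover have "inj_on h {g \<in> carrier G. h g \<in> group_center E}" using inj by (rule inj_on_subset) auto
  ultimately have "card {g \<in> carrier G. h g \<in> group_center E} = card (group_center E)"
    by (metis card_image)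
  also have "\<dots> = p" using E by (simp add: extraspecial_def cyclic_of_order_def)
  finally show "G \<in> class_C1 p"
    using class_C1I[OF assms G fin _ hom_compose[OF hE Z.r_coset_hom_Mod]] ker E
    by (simp add: extraspecial_def)
qed

section \<open>Translations of an Artin--Schreier equation\<close>

locale alg_closed_prime_char =
  fixes p :: nat and field_type :: "'k::alg_closed_field itself"
  assumes CHAR_eq: "CHAR('k) = p" and prime_p: "prime p"
begin

section \<open>Frobenius, the Artin-Schreier operator and finiteness of translations\<close>

lemma p_gt_1: "p > 1" and p_ge_2: "p \<ge> 2" and p_pos: "p > 0"
  using prime_p by (rule prime_gt_1_nat prime_ge_2_nat prime_gt_0_nat)+

lemma add_power_p: "((x::'k) + y) ^ p = x ^ p + y ^ p"
  using freshmans_dream[where ?'a='k] prime_p CHAR_eq by simp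

lemma poly_add_power_p: "((x::'k poly) + y) ^ p = x ^ p + y ^ p"
  using freshmans_dream[where ?'a="'k poly"] prime_p CHAR_eq by simp

lemma minus_power_p: "(- (x::'k)) ^ p = - (x ^ p)"
  using minus_power_prime_CHAR[where ?'a='k] prime_p CHAR_eq by simp

lemma poly_minus_power_p: "(- (x::'k poly)) ^ p = - (x ^ p)"
  using minus_power_prime_CHAR[where ?'a="'k poly"] prime_p CHAR_eq by simp

lemma of_nat_p_eq_0 [simp]: "of_nat p = (0::'k)"
  using of_nat_CHAR[where ?'a='k] CHAR_eq by simp

lemma of_nat_eq_0_iff: "of_nat n = (0::'k) \<longleftrightarrow> p dvd n"
  using of_nat_eq_0_iff_char_dvd[where ?'a='k] CHAR_eq by simp

text \<open>The Artin-Schreier operator. It is additive, commutes with substitutions and has the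
  prime field as kernel; replacing \<open>w\<close> by \<open>w + Q x\<close> adds
  \<open>frob_diff Q\<close> to \<open>f\<close>.\<close>

abbreviation frob_diff :: "'k poly \<Rightarrow> 'k poly" where
  "frob_diff h \<equiv> h ^ p - h"

lemma frob_diff_add: "frob_diff (g + h) = frob_diff g + frob_diff h"
  by (simp add: poly_add_power_p)

lemma frob_diff_minus: "frob_diff (- g) = - frob_diff g"
  by (simp add: poly_minus_power_p)

lemma frob_diff_diff: "frob_diff (g - h) = frob_diff g - frob_diff h"
  using frob_diff_add[of g "- h"] frob_diff_minus[of h] by simp

lemma pcompose_power: "pcompose (g ^ n) (q :: 'k poly) = pcompose g q ^ n"
  by (induction n) (simp_all add: pcompose_mult pcompose_1)

lemma frob_diff_pcompose: "pcompose (frob_diff g) q = frob_diff (pcompose g q)"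
  by (simp add: pcompose_diff pcompose_power)

lemma degree_frob_diff: "degree g > 0 \<Longrightarrow> degree (frob_diff g) = p * degree g"
proof -
  assume g: "degree g > 0"
  then have "degree (g ^ p) = p * degree g" by (intro degree_power_eq) auto
  moreover have "p * degree g > degree g" using g p_gt_1 by simp
  ultimately have "degree (g ^ p + - g) = degree (g ^ p)" by (intro degree_add_eq_left) simp
  then show ?thesis using \<open>degree (g ^ p) = p * degree g\<close> by simp
qed

lemma frob_diff_eq_0_iff: "frob_diff g = 0 \<longleftrightarrow> (\<exists>c. g = [:c:] \<and> c ^ p = c)"
proof
  assume g: "frob_diff g = 0"
  then have "degree g = 0" using degree_frob_diff[of g] p_pos by (cases "degree g > 0") auto
  then obtain c where "g = [:c:]" by (meson degree_eq_zeroE)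
  moreover from this g have "[:c ^ p:] = [:c:]" by (simp add: poly_const_pow)
  ultimately show "\<exists>c. g = [:c:] \<and> c ^ p = c" by auto
qed (auto simp: poly_const_pow)

lemma frob_diff_const: "frob_diff [:c:] = [:c ^ p - c:]"
  by (simp add: poly_const_pow)

lemma ex_frob_diff_root: "\<exists>c::'k. c ^ p - c = d"
proof -
  have "degree (frob_diff [:0, 1:] - [:d:]) = p"
  proof -
    have "degree (frob_diff [:0, 1:] - [:d:]) = degree (frob_diff ([:0, 1:]) + - [:d:])" by (simp only: diff_conv_add_uminus)
    also have "\<dots> = degree (frob_diff [:0, 1:])"
      using degree_frob_diff[of "[:0,1:]"] p_pos by (intro degree_add_eq_left) simp
    finally show ?thesis using degree_frob_diff[of "[:0,1:]"] by simp
  qed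
  then obtain c where "poly (frob_diff [:0, 1:] - [:d:]) c = 0"
    using alg_closed_imp_poly_has_root p_pos by metis
  then show ?thesis by (intro exI[of _ c]) simp
qed

lemma ex_pth_root: "\<exists>c::'k. c ^ p = d"
  using nth_root_exists[of p d] p_pos by auto

lemma infinite_UNIV_k: "infinite (UNIV :: 'k set)"
proof
  assume fin: "finite (UNIV :: 'k set)"
  define g :: "'k poly" where "g = (\<Prod>a\<in>UNIV. [:- a, 1:]) + 1"
  have "degree (\<Prod>a\<in>(UNIV::'k set). [:- a, 1:]) = card (UNIV :: 'k set)"
    by (simp add: degree_prod_eq_sum_degree)
  moreover have "card (UNIV :: 'k set) > 0" using fin by (simp add: card_gt_0_iff)
  ultimately have "degree g > 0" unfolding g_def by (subst degree_add_eq_left) auto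
  then obtain x where "poly g x = 0" using alg_closed_imp_poly_has_root by blast
  moreover have "(\<Prod>a\<in>UNIV. x - a) = 0" using fin by (intro prod_zero) auto
  ultimately show False by (simp add: g_def poly_prod)
qed

lemma coeff_power_p: "coeff ((g::'k poly) ^ p) n = (if p dvd n then coeff g (n div p) ^ p else 0)"
proof -
  have "g ^ p = (\<Sum>i\<le>degree g. monom (coeff g i) i) ^ p" by (simp add: poly_as_sum_of_monoms)
  also have "\<dots> = (\<Sum>i\<le>degree g. monom (coeff g i) i ^ p)"
    using freshmans_dream_sum[where ?'a="'k poly"] prime_p CHAR_eq by simp
  also have "\<dots> = (\<Sum>i\<le>degree g. monom (coeff g i ^ p) (p * i))"
    by (simp add: monom_power mult.commute)
  finally have "coeff (g ^ p) n = (\<Sum>i\<le>degree g. if p * i = n then coeff g i ^ p else 0)"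
    by (simp add: coeff_sum)
  also have "\<dots> = (if p dvd n then coeff g (n div p) ^ p else 0)"
  proof (cases "p dvd n")
    case True
    then obtain j where j: "n = p * j" by auto
    then have "(\<Sum>i\<le>degree g. if p * i = n then coeff g i ^ p else 0) = (\<Sum>i\<le>degree g. if i = j then coeff g i ^ p else 0)"
      using p_pos by (intro sum.cong) auto
    also have "\<dots> = coeff g j ^ p"
      using p_pos by (auto simp: coeff_eq_0)
    finally show ?thesis using j p_pos by simp
  next
    case False
    then have "\<And>i. p * i \<noteq> n" by auto
    then show ?thesis using False by simp
  qed
  finally show ?thesis .
qed

lemma coeff_translate:
  "coeff (pcompose (f::'k poly) [:b, 1:]) j = (\<Sum>i\<le>degree f. coeff f i * of_nat (i choose j) * b ^ (i - j))"
proof -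
  have "pcompose f [:b, 1:] = (\<Sum>i\<le>degree f. smult (coeff f i) ([:b, 1:] ^ i))"
    by (simp add: pcompose_altdef poly_altdef degree_map_poly coeff_map_poly)
  moreover have "coeff ([:b, 1:] ^ i) j = of_nat (i choose j) * b ^ (i - j)" for i
    by (cases "j \<le> i") (simp_all add: coeff_linear_poly_power binomial_eq_0 coeff_eq_0 degree_linear_power)
  ultimately show ?thesis by (simp add: coeff_sum mult.assoc)
qed

lemma pderiv_power_p: "pderiv ((g::'k poly) ^ p) = 0"
proof -
  obtain n where n: "p = Suc n" using p_pos by (cases p) auto
  have "of_nat p = (0::'k)" by simp
  then show ?thesis unfolding n pderiv_power_Suc by (metis mult_zero_left n smult_0_left)
qed

text \<open>A polynomial of the form \<open>P ^ p - P\<close> satisfies, along \<open>i, i p, i p\<^sup>2, ...\<close> with \<open>i\<close> prime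
  to \<open>p\<close>, an additive relation between its coefficients. Applied to \<open>f (x + b) - f x\<close> and to the
  exponents leading to \<open>degree f - 1\<close>, it becomes a nonzero polynomial equation for \<open>b\<close>.\<close>

primrec frob_trace :: "nat \<Rightarrow> (nat \<Rightarrow> 'a::comm_ring_1) \<Rightarrow> nat \<Rightarrow> 'a" where
  "frob_trace i c 0 = c i"
| "frob_trace i c (Suc s) = frob_trace i c s ^ p + c (i * p ^ Suc s)"

text \<open>The coefficient of \<open>g ^ p - g\<close> at \<open>i * p ^ Suc s\<close> is the p-th
  power of the preceding coefficient of \<open>g\<close> along the chain minus the current one, so
  the sum telescopes; at \<open>i\<close> itself the p-th power contributes nothing.\<close>

lemma frob_trace_frob_diff:
  assumes "\<not> p dvd i"
  shows "frob_trace i (coeff (frob_diff g)) s = - coeff g (i * p ^ s)"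
proof (induction s)
  case 0
  show ?case using assms by (simp add: coeff_power_p)
next
  case (Suc s)
  have "i * p ^ Suc s div p = i * p ^ s" using p_pos by (simp add: mult.left_commute)
  then show ?case using Suc by (simp add: minus_power_p coeff_power_p)
qed

text \<open>With \<open>m = degree f\<close>, the right side has degree below \<open>m\<close>, so
  \<open>degree P < m - 1\<close>. For \<open>m - 1 = i * p ^ S\<close> with \<open>i\<close> prime
  to \<open>p\<close>, the telescoped relation makes \<open>frob_trace\<close> at \<open>S\<close>
  vanish. As a polynomial in \<open>b\<close> it is nonzero: p-th powers have derivative 0, and the
  remaining term is linear with slope \<open>m\<close> times the leading coefficient.\<close>

lemma finite_translations:
  fixes f :: "'k poly"
  assumes "degree f > 1" "\<not> p dvd degree f"
  shows "finite {b. \<exists>P. frob_diff P = pcompose f [:b, 1:] - f}"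
proof -
  define m where "m = degree f"
  have "m - 1 \<noteq> 0" using assms(1) by (simp add: m_def)
  moreover have "\<not> is_unit p" using p_gt_1 by simp
  ultimately obtain i where i: "m - 1 = p ^ multiplicity p (m - 1) * i" "\<not> p dvd i"
    using multiplicity_decompose'[of "m - 1" p] by blast
  define S where "S = multiplicity p (m - 1)"
  have mi: "i * p ^ S = m - 1" using i by (simp add: S_def mult.commute)
  \<comment> \<open>The coefficient of \<open>X ^ j\<close> in \<open>f (X + b) - f X\<close>,
    viewed as a polynomial in \<open>b\<close>.\<close>
  define c where "c = (\<lambda>j. (\<Sum>l\<le>m. monom (coeff f l * of_nat (l choose j)) (l - j)) - [:coeff f j:])"
  have cb: "coeff (pcompose f [:b, 1:] - f) j = poly (c j) b" for b j
    by (simp add: coeff_translate c_def poly_sum poly_monom m_def)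
  have tr: "frob_trace i (coeff (pcompose f [:b, 1:] - f)) s = poly (frob_trace i c s) b" for b s
    by (induction s) (simp_all only: frob_trace.simps cb poly_add poly_power)
  have "pderiv (frob_trace i c s) = pderiv (c (i * p ^ s))" for s
    by (cases s) (simp_all add: pderiv_add pderiv_power_p)
  moreover have "pderiv (c (m - 1)) = [:of_nat m * coeff f m:]"
  proof -
    have m: "m = Suc (m - 1)" using assms(1) by (simp add: m_def)
    have "(\<Sum>l\<le>m. monom (coeff f l * of_nat (l choose (m - 1))) (l - (m - 1)))
        = (\<Sum>l\<in>{m - 1, m}. monom (coeff f l * of_nat (l choose (m - 1))) (l - (m - 1)))"
      by (rule sum.mono_neutral_right) (auto simp: binomial_eq_0)
    also have "\<dots> = [:coeff f (m - 1):] + monom (coeff f m * of_nat m) 1"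
      using m binomial_symmetric[of "m - 1" m] by (simp add: monom_0)
    finally have "c (m - 1) = monom (coeff f m * of_nat m) 1"
      by (simp add: c_def)
    then show ?thesis by (simp add: pderiv_monom monom_0 mult.commute)
  qed
  ultimately have "pderiv (frob_trace i c S) = [:of_nat m * coeff f m:]" using mi by simp
  moreover have "of_nat m * coeff f m \<noteq> 0"
    using assms of_nat_eq_0_iff[of m] by (auto simp: m_def)
  ultimately have "frob_trace i c S \<noteq> 0" by (metis pCons_eq_0_iff pderiv_0)
  then have "finite {b. poly (frob_trace i c S) b = 0}" by (rule poly_roots_finite)
  moreover have "{b. \<exists>P. frob_diff P = pcompose f [:b, 1:] - f} \<subseteq> {b. poly (frob_trace i c S) b = 0}"
  proof safe
    fix b P assume P: "frob_diff P = pcompose f [:b, 1:] - f"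
    have "degree (pcompose f [:b, 1:] - f) < m"
    proof (rule degree_lessI)
      show "\<forall>l\<ge>m. coeff (pcompose f [:b, 1:] - f) l = 0"
      proof safe
        fix l assume "l \<ge> m"
        moreover have "degree (pcompose f [:b, 1:]) = m" by (simp add: m_def degree_pcompose)
        moreover have "lead_coeff (pcompose f [:b, 1:]) = lead_coeff f" by (subst lead_coeff_comp) auto
        ultimately show "coeff (pcompose f [:b, 1:] - f) l = 0"
          by (cases "l = m") (auto simp: m_def coeff_eq_0)
      qed
    qed (use assms(1) in \<open>auto simp: m_def\<close>)
    then have "degree (frob_diff P) < m" using P by simp
    then have "degree P < m - 1"
    proof (cases "degree P = 0")
      case False
      then have "p * degree P < m" using \<open>degree (frob_diff P) < m\<close> degree_frob_diff[of P] by simp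
      moreover have "2 * degree P \<le> p * degree P" using p_ge_2 by (rule mult_le_mono1)
      ultimately show ?thesis using False by linarith
    qed (use assms(1) in \<open>simp add: m_def\<close>)
    then have "coeff P (i * p ^ S) = 0" using mi by (simp add: coeff_eq_0)
    then show "poly (frob_trace i c S) b = 0"
      using tr[of b S] frob_trace_frob_diff[OF i(2), of P S] P by simp
  qed
  ultimately show ?thesis using finite_subset by blast
qed

end

text \<open>A pair \<open>(b, P)\<close> stands for the automorphism
  \<open>x \<mapsto> x + b, w \<mapsto> w + P x\<close>. Field automorphisms act contravariantly on
  points, so the product substitutes the right factor into the left one.\<close>

definition translation_group :: "'k::alg_closed_field poly \<Rightarrow> ('k \<times> 'k poly) monoid" where
  "translation_group f = \<lparr>carrier = {(b, P). P ^ CHAR('k) - P = pcompose f [:b, 1:] - f},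
     monoid.mult = (\<lambda>(b, P) (b', P'). (b + b', P' + pcompose P [:b', 1:])), one = (0, 0)\<rparr>"

definition additive_group :: "'a::ab_group_add monoid" where
  "additive_group = \<lparr>carrier = UNIV, monoid.mult = (+), one = 0\<rparr>"

lemma comm_group_additive_group: "comm_group (additive_group :: 'a::ab_group_add monoid)"
  by (rule comm_groupI) (auto simp: additive_group_def add.assoc add.commute intro: exI[of _ "- _"])

section \<open>Group structure and finiteness of the translation group\<close>

context alg_closed_prime_char
begin

lemma elementary_abelian_additive_group: "elementary_abelian p (additive_group :: 'k monoid)"
proof -
  have "a [^]\<^bsub>additive_group\<^esub> n = of_nat n * a" for a :: 'k and n :: nat
    by (induction n) (simp_all add: additive_group_def algebra_simps)
  then show ?thesis
    by (simp add: elementary_abelian_def comm_group_additive_group) (simp add: additive_group_def)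
qed

lemma pcompose_translate_translate: "pcompose (pcompose h [:b, 1:]) [:b', 1:] = pcompose h [:b + b', 1:]" for h :: "'k poly"
  by (simp add: pcompose_assoc[symmetric] pcompose_pCons add.commute)

lemma translation_group_carrier:
  "(b, P) \<in> carrier (translation_group (f :: 'k poly)) \<longleftrightarrow> frob_diff P = pcompose f [:b, 1:] - f"
  by (simp add: translation_group_def CHAR_eq)

lemma translation_group_mult:
  "(b, P) \<otimes>\<^bsub>translation_group f\<^esub> (b', P') = (b + b', P' + pcompose P [:b', 1:])" for f :: "'k poly"
  by (simp add: translation_group_def)

lemma translation_group_one: "\<one>\<^bsub>translation_group f\<^esub> = (0, 0)" for f :: "'k poly"
  by (simp add: translation_group_def)

lemma translation_group_closed:
  assumes "frob_diff P = pcompose f [:b, 1:] - f" "frob_diff P' = pcompose f [:b', 1:] - f"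
  shows "frob_diff (P' + pcompose P [:b', 1:]) = pcompose f [:b + b', 1:] - f"
proof -
  have "frob_diff (P' + pcompose P [:b', 1:]) = frob_diff P' + pcompose (frob_diff P) [:b', 1:]"
    by (simp only: frob_diff_add frob_diff_pcompose)
  also have "\<dots> = pcompose f [:b + b', 1:] - f"
    unfolding assms by (simp add: pcompose_diff pcompose_translate_translate)
  finally show ?thesis .
qed

lemma group_translation_group: "group (translation_group (f :: 'k poly))"
proof (rule groupI)
  fix x y assume "x \<in> carrier (translation_group f)" "y \<in> carrier (translation_group f)"
  then show "x \<otimes>\<^bsub>translation_group f\<^esub> y \<in> carrier (translation_group f)"
    by (cases x, cases y) (simp add: translation_group_carrier translation_group_mult translation_group_closed)
next
  show "\<one>\<^bsub>translation_group f\<^esub> \<in> carrier (translation_group f)"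
    using p_pos by (simp add: translation_group_one translation_group_carrier)
next
  fix x y z
  show "x \<otimes>\<^bsub>translation_group f\<^esub> y \<otimes>\<^bsub>translation_group f\<^esub> z = x \<otimes>\<^bsub>translation_group f\<^esub> (y \<otimes>\<^bsub>translation_group f\<^esub> z)"
    by (cases x, cases y, cases z)
      (simp add: translation_group_mult pcompose_add pcompose_translate_translate add.assoc)
next
  fix x show "\<one>\<^bsub>translation_group f\<^esub> \<otimes>\<^bsub>translation_group f\<^esub> x = x"
    by (cases x) (simp add: translation_group_mult translation_group_one)
next
  fix x assume "x \<in> carrier (translation_group f)"
  then obtain b P where x: "x = (b, P)" "frob_diff P = pcompose f [:b, 1:] - f"
    by (cases x) (auto simp: translation_group_carrier)
  have "frob_diff (- pcompose P [:- b, 1:]) = pcompose f [:- b, 1:] - f"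
    unfolding frob_diff_minus frob_diff_pcompose[symmetric] x(2)
    by (simp add: pcompose_diff pcompose_translate_translate)
  then show "\<exists>y\<in>carrier (translation_group f). y \<otimes>\<^bsub>translation_group f\<^esub> x = \<one>\<^bsub>translation_group f\<^esub>"
    by (intro bexI[of _ "(- b, - pcompose P [:- b, 1:])"])
      (simp_all add: x(1) translation_group_carrier translation_group_mult translation_group_one
        pcompose_uminus pcompose_translate_translate)
qed

lemma card_frobenius_fixed: "card {c::'k. c ^ p = c} = p" and finite_frobenius_fixed: "finite {c::'k. c ^ p = c}"
proof -
  have nz: "frob_diff [:0, 1:] \<noteq> 0"
    using degree_frob_diff[of "[:0,1:]"] p_pos by auto
  have eq: "{c::'k. c ^ p = c} = {c. poly (frob_diff [:0, 1:]) c = 0}" by auto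
  show fin: "finite {c::'k. c ^ p = c}" unfolding eq using nz by (rule poly_roots_finite)
  have "card {c::'k. c ^ p = c} \<le> p"
    unfolding eq using card_poly_roots_bound[OF nz] degree_frob_diff[of "[:0,1:]"] by simp
  moreover have "(of_nat i :: 'k) ^ p = of_nat i" for i
    by (induction i) (use p_pos in \<open>simp_all add: add_power_p\<close>)
  then have "of_nat ` {..<p} \<subseteq> {c::'k. c ^ p = c}" by auto
  moreover have "inj_on (of_nat :: nat \<Rightarrow> 'k) {..<p}"
  proof (rule linorder_inj_onI)
    fix i j assume ij: "i < j" "i \<in> {..<p}" "j \<in> {..<p}"
    show "(of_nat i :: 'k) \<noteq> of_nat j"
    proof
      assume "(of_nat i :: 'k) = of_nat j"
      then have "of_nat (j - i) = (0::'k)" using ij by (simp add: of_nat_diff)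
      then have "p dvd j - i" by (simp only: of_nat_eq_0_iff)
      then show False using ij by (auto dest: dvd_imp_le)
    qed
  qed auto
  ultimately show "card {c::'k. c ^ p = c} = p"
    using card_mono[OF fin, of "of_nat ` {..<p}"] by (simp add: card_image)
qed

lemma fst_hom_translation_group: "fst \<in> hom (translation_group (f :: 'k poly)) additive_group"
  by (auto simp: hom_def additive_group_def translation_group_def)

lemma kernel_fst_translation_group:
  "kernel (translation_group (f :: 'k poly)) additive_group fst = (\<lambda>c. (0, [:c:])) ` {c. c ^ p = c}"
proof (rule Set.set_eqI)
  fix x :: "'k \<times> 'k poly"
  obtain b P where x: "x = (b, P)" by (cases x)
  have "frob_diff P = 0 \<longleftrightarrow> (\<exists>c. P = [:c:] \<and> c ^ p = c)" by (rule frob_diff_eq_0_iff)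
  then show "x \<in> kernel (translation_group f) additive_group fst \<longleftrightarrow> x \<in> (\<lambda>c. (0, [:c:])) ` {c. c ^ p = c}"
    unfolding x kernel_def by (auto simp: translation_group_carrier additive_group_def)
qed

lemma card_kernel_fst_translation_group:
  "card (kernel (translation_group (f :: 'k poly)) additive_group fst) = p"
  unfolding kernel_fst_translation_group using card_frobenius_fixed by (simp add: card_image inj_on_def)

text \<open>Two solutions \<open>P\<close> over the same \<open>b\<close> differ by an element of
  the prime field.\<close>

lemma finite_translation_group:
  fixes f :: "'k poly"
  assumes "degree f > 1" "\<not> p dvd degree f"
  shows "finite (carrier (translation_group f))"
proof -
  define B where "B = {b. \<exists>P. frob_diff P = pcompose f [:b, 1:] - f}"
  define R where "R = (\<lambda>b. SOME P. frob_diff P = pcompose f [:b, 1:] - f)"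
  have "carrier (translation_group f) \<subseteq> (\<lambda>(b, c). (b, R b + [:c:])) ` (B \<times> {c. c ^ p = c})"
  proof
    fix x assume "x \<in> carrier (translation_group f)"
    then obtain b P where x: "x = (b, P)" "frob_diff P = pcompose f [:b, 1:] - f"
      by (cases x) (auto simp: translation_group_carrier)
    have "b \<in> B" using x(2) by (auto simp only: B_def)
    have R: "frob_diff (R b) = pcompose f [:b, 1:] - f" unfolding R_def by (rule someI) (rule x(2))
    have "frob_diff (P - R b) = 0" by (simp only: frob_diff_diff x(2) R) simp
    then obtain c where "P - R b = [:c:]" "c ^ p = c" by (auto simp only: frob_diff_eq_0_iff)
    then show "x \<in> (\<lambda>(b, c). (b, R b + [:c:])) ` (B \<times> {c. c ^ p = c})"
      using x(1) \<open>b \<in> B\<close> by (auto simp: algebra_simps intro!: image_eqI[of _ _ "(b, c)"])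
  qed
  moreover have "finite (B \<times> {c::'k. c ^ p = c})"
    using finite_translations[OF assms] finite_frobenius_fixed by (simp add: B_def)
  ultimately show ?thesis by (meson finite_imageI finite_subset)
qed

lemma class_C1_translation_group:
  fixes f :: "'k poly"
  assumes "degree f > 1" "\<not> p dvd degree f" "group (G :: 'g monoid)" "G \<cong> translation_group f"
  shows "G \<in> class_C1 p"
proof -
  obtain h where h: "h \<in> iso G (translation_group f)" using assms(4) by (auto simp: is_iso_def)
  have hG: "h \<in> hom G (translation_group f)" and inj: "inj_on h (carrier G)"
    and img: "h ` carrier G = carrier (translation_group f)" using h by (auto simp: iso_iff)
  have fin: "finite (carrier G)"
    using finite_translation_group[OF assms(1,2)] iso_finite[OF assms(4)] by simp
  have "h ` kernel G additive_group (fst \<circ> h) = kernel (translation_group f) additive_group fst"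
  proof
    show "h ` kernel G additive_group (fst \<circ> h) \<subseteq> kernel (translation_group f) additive_group fst"
      using hG by (auto simp: kernel_def hom_def)
    show "kernel (translation_group f) additive_group fst \<subseteq> h ` kernel G additive_group (fst \<circ> h)"
      unfolding kernel_def img[symmetric] by auto
  qed
  moreover have "inj_on h (kernel G additive_group (fst \<circ> h))"
    using inj by (rule inj_on_subset) (auto simp: kernel_def)
  ultimately have "card (kernel G additive_group (fst \<circ> h)) = p"
    using card_kernel_fst_translation_group by (metis card_image)
  then show ?thesis
    using class_C1I[OF prime_p assms(3) fin elementary_abelian_additive_group
        hom_compose[OF hG fst_hom_translation_group]] by blast
qed

end

section \<open>Realizing a given extension by translations\<close>

context alg_closed_prime_char
begin

text \<open>When \<open>p\<close> divides the degree, the leading term is a p-th power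
  \<open>(e X ^ j) ^ p\<close>; adding \<open>frob_diff (- e X ^ j)\<close> replaces it by
  \<open>e X ^ j\<close>, and the degree drops. The constant term is an Artin-Schreier value of a
  constant, hence removable.\<close>

lemma ex_frob_diff_reduced:
  fixes f :: "'k poly"
  shows "\<exists>Q. coeff (f + frob_diff Q) 0 = 0 \<and> (degree (f + frob_diff Q) = 0 \<or> \<not> p dvd degree (f + frob_diff Q))"
proof (induction "degree f" arbitrary: f rule: less_induct)
  case less
  consider "degree f = 0" | "degree f > 0" "\<not> p dvd degree f" | "degree f > 0" "p dvd degree f" by blast
  then show ?case
  proof cases
    case 1
    then obtain c where f: "f = [:c:]" by (meson degree_eq_zeroE)
    obtain e where "e ^ p - e = - c" using ex_frob_diff_root by blast
    then have "f + frob_diff [:e:] = 0" unfolding frob_diff_const f by simp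
    then show ?thesis by (intro exI[of _ "[:e:]"]) simp
  next
    case 2
    obtain e where e: "e ^ p - e = - coeff f 0" using ex_frob_diff_root by blast
    then have "frob_diff [:e:] = [:- coeff f 0:]" by (simp only: frob_diff_const)
    moreover have "degree (f + [:- coeff f 0:]) = degree f"
      using 2 by (intro degree_add_eq_left) simp
    ultimately show ?thesis using 2 by (intro exI[of _ "[:e:]"]) (simp only:, simp)
  next
    case 3
    then obtain j where j: "degree f = p * j" "j > 0" by auto
    obtain e where e: "e ^ p = lead_coeff f" using ex_pth_root by blast
    define g where "g = f + frob_diff (- monom e j)"
    have g: "g = f - monom (lead_coeff f) (p * j) + monom e j"
      by (simp add: g_def poly_minus_power_p monom_power e mult.commute)
    have jp: "j < p * j" using j p_gt_1 by simp
    have "degree g < degree f"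
    proof (rule degree_lessI)
      show "\<forall>k\<ge>degree f. coeff g k = 0"
        unfolding g using j jp by (auto simp: coeff_eq_0)
    qed (use 3 in auto)
    from less[OF this] obtain Q where Q: "coeff (g + frob_diff Q) 0 = 0"
      "degree (g + frob_diff Q) = 0 \<or> \<not> p dvd degree (g + frob_diff Q)" by blast
    have "g + frob_diff Q = f + frob_diff (- monom e j + Q)"
      unfolding g_def frob_diff_add by (simp add: add.assoc)
    then show ?thesis using Q by metis
  qed
qed

end

section \<open>Finite additive subgroups of the field and their vanishing polynomials\<close>

locale finite_additive_subgroup = alg_closed_prime_char p field_type
  for p and field_type :: "'k::alg_closed_field itself" +
  fixes V :: "'k set"
  assumes V_finite: "finite V" and V_zero: "0 \<in> V"
    and V_add: "u \<in> V \<Longrightarrow> v \<in> V \<Longrightarrow> u + v \<in> V" and V_minus: "v \<in> V \<Longrightarrow> - v \<in> V"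
begin

text \<open>The invariant coordinate for \<open>V\<close> acting by translations; by
  \<open>vanishing_translate\<close> it is an additive polynomial.\<close>

definition vanishing :: "'k poly" where
  "vanishing = (\<Prod>v\<in>V. [:- v, 1:])"

lemma card_V_pos: "card V > 0"
  using V_finite V_zero by (auto simp: card_gt_0_iff)

lemma degree_vanishing: "degree vanishing = card V"
  unfolding vanishing_def by (subst degree_prod_eq_sum_degree) auto

lemma lead_coeff_vanishing: "lead_coeff vanishing = 1"
  unfolding vanishing_def by (simp add: lead_coeff_prod)

lemma V_translate: "v \<in> V \<Longrightarrow> (\<lambda>u. u + v) ` V = V"
proof -
  assume v: "v \<in> V"
  have "u \<in> (\<lambda>u. u + v) ` V" if "u \<in> V" for u
    using V_add[OF that V_minus[OF v]] by (intro image_eqI[of _ _ "u - v"]) auto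
  then show ?thesis using v V_add by auto
qed

lemma vanishing_translate_V: "v \<in> V \<Longrightarrow> pcompose vanishing [:v, 1:] = vanishing"
proof -
  assume v: "v \<in> V"
  have "pcompose vanishing [:v, 1:] = (\<Prod>u\<in>V. [:- (u + - v), 1:])"
    unfolding vanishing_def pcompose_prod by (simp add: pcompose_pCons)
  also have "\<dots> = (\<Prod>w\<in>(\<lambda>u. u + - v) ` V. [:- w, 1:])"
    by (subst prod.reindex) (auto simp: inj_on_def)
  finally show ?thesis unfolding V_translate[OF V_minus[OF v]] vanishing_def .
qed

lemma poly_vanishing_eq_0_iff: "poly vanishing x = 0 \<longleftrightarrow> x \<in> V"
  using V_finite by (auto simp: vanishing_def poly_prod)

text \<open>Both sides are monic of degree \<open>card V\<close> and agree on \<open>V\<close>: at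
  \<open>z\<close> in \<open>V\<close> the left side equals the translate by \<open>z\<close>
  evaluated at \<open>b\<close>, and \<open>vanishing\<close> is invariant under
  \<open>z\<close>.\<close>

lemma vanishing_translate: "pcompose vanishing [:b, 1:] = vanishing + [:poly vanishing b:]"
proof (rule poly_eqI_degree_lead_coeff[where n = "card V" and A = V])
  have deg: "degree (vanishing + [:poly vanishing b:]) = card V"
    using card_V_pos by (subst degree_add_eq_left) (auto simp: degree_vanishing)
  have deg': "degree (pcompose vanishing [:b, 1:]) = card V"
    by (simp add: degree_pcompose degree_vanishing)
  show "degree (vanishing + [:poly vanishing b:]) \<le> card V" "degree (pcompose vanishing [:b, 1:]) \<le> card V"
    using deg deg' by auto
  have "lead_coeff (pcompose vanishing [:b, 1:]) = 1"
    by (subst lead_coeff_comp) (auto simp: lead_coeff_vanishing)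
  moreover have "coeff vanishing (card V) = 1" using lead_coeff_vanishing degree_vanishing by simp
  ultimately show "coeff (pcompose vanishing [:b, 1:]) (card V) = coeff (vanishing + [:poly vanishing b:]) (card V)"
    using deg' card_V_pos by (cases "card V") auto
next
  fix z assume z: "z \<in> V"
  have "poly (pcompose vanishing [:b, 1:]) z = poly (pcompose vanishing [:z, 1:]) b"
    by (simp add: poly_pcompose add.commute)
  then show "poly (pcompose vanishing [:b, 1:]) z = poly (vanishing + [:poly vanishing b:]) z"
    using z by (simp add: vanishing_translate_V poly_vanishing_eq_0_iff[THEN iffD2])
qed simp

definition vanishing_slope :: 'k where
  "vanishing_slope = poly (pderiv vanishing) 0"

text \<open>The derivative is invariant under all translations of the infinite field
  \<open>k\<close>, hence constant.\<close>

lemma pderiv_vanishing: "pderiv vanishing = [:vanishing_slope:]"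
proof -
  have "poly (pderiv vanishing) b = vanishing_slope" for b
  proof -
    have "pderiv (pcompose vanishing [:b, 1:]) = pderiv vanishing"
      by (simp add: vanishing_translate pderiv_add pderiv_pCons)
    then have "pcompose (pderiv vanishing) [:b, 1:] = pderiv vanishing"
      by (simp add: pderiv_pcompose pderiv_pCons)
    then have "poly (pcompose (pderiv vanishing) [:b, 1:]) 0 = vanishing_slope"
      by (simp add: vanishing_slope_def)
    then show ?thesis by (simp add: poly_pcompose)
  qed
  then have "{x. poly (pderiv vanishing - [:vanishing_slope:]) x = 0} = UNIV" by auto
  then show ?thesis using poly_roots_finite[of "pderiv vanishing - [:vanishing_slope:]"] infinite_UNIV_k by auto
qed

lemma vanishing_slope_nonzero: "vanishing_slope \<noteq> 0"
proof -
  define Z where "Z = (\<Prod>v\<in>V - {0}. [:- v, 1:])"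
  have "vanishing = [:0, 1:] * Z"
    unfolding vanishing_def Z_def using V_zero V_finite by (subst prod.remove[of V 0]) auto
  then have "vanishing_slope = poly Z 0"
    by (simp add: vanishing_slope_def pderiv_mult pderiv_pCons)
  also have "\<dots> \<noteq> 0" using V_finite by (auto simp: Z_def poly_prod)
  finally show ?thesis .
qed

text \<open>An element of trace 1 for \<open>V\<close> acting by translations, as needed for
  additive Hilbert 90. Its translates are, up to the scalar, the products over
  \<open>V - {v}\<close>, which are the summands of \<open>pderiv vanishing\<close>; this derivative
  is the constant \<open>vanishing_slope\<close>, hence the normalization.\<close>

definition trace_one :: "'k poly" where
  "trace_one = smult (inverse vanishing_slope) (\<Prod>v\<in>V - {0}. [:- v, 1:])"

lemma sum_smult: "(\<Sum>v\<in>A. smult c (g v)) = smult c (\<Sum>v\<in>A. g v :: 'k poly)"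
  by (induction A rule: infinite_finite_induct) (simp_all add: smult_add_right)

lemma sum_trace_one_minus: "(\<Sum>v\<in>V. pcompose trace_one [:- v, 1:]) = 1"
proof -
  have "pcompose (\<Prod>u\<in>V - {0}. [:- u, 1:]) [:- v, 1:] = (\<Prod>w\<in>V - {v}. [:- w, 1:])" if v: "v \<in> V" for v
  proof -
    have "pcompose (\<Prod>u\<in>V - {0}. [:- u, 1:]) [:- v, 1:] = (\<Prod>u\<in>V - {0}. [:- (u + v), 1:])"
      unfolding pcompose_prod by (simp add: pcompose_pCons)
    also have "\<dots> = (\<Prod>w\<in>(\<lambda>u. u + v) ` (V - {0}). [:- w, 1:])"
      by (subst prod.reindex) (auto simp: inj_on_def)
    also have "(\<lambda>u. u + v) ` (V - {0}) = V - {v}"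
      using V_translate[OF v] by (auto simp: image_set_diff[of "\<lambda>u. u + v"] inj_on_def)
    finally show ?thesis .
  qed
  then have "(\<Sum>v\<in>V. pcompose trace_one [:- v, 1:])
      = smult (inverse vanishing_slope) (\<Sum>v\<in>V. \<Prod>w\<in>V - {v}. [:- w, 1:])"
    using V_finite by (simp add: trace_one_def pcompose_smult sum_smult)
  also have "(\<Sum>v\<in>V. \<Prod>w\<in>V - {v}. [:- w, 1:]) = pderiv vanishing"
    unfolding vanishing_def by (simp add: pderiv_prod pderiv_pCons)
  finally show ?thesis
    using vanishing_slope_nonzero by (simp add: pderiv_vanishing one_pCons)
qed

lemma sum_V_minus: "(\<Sum>v\<in>V. g (- v)) = (\<Sum>v\<in>V. g v)"
proof -
  have "uminus ` V = V" using V_minus by force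
  then show ?thesis using sum.reindex[of uminus V g] by (simp add: inj_on_def comp_def)
qed

lemma sum_trace_one: "(\<Sum>v\<in>V. pcompose trace_one [:v, 1:]) = 1"
  using sum_trace_one_minus sum_V_minus[of "\<lambda>v. pcompose trace_one [:v, 1:]"] by simp

lemma sum_V_translate: "w \<in> V \<Longrightarrow> (\<Sum>v\<in>V. g (v + w)) = (\<Sum>v\<in>V. g v)"
  using sum.reindex[of "\<lambda>v. v + w" V g] V_translate[of w] by (simp add: inj_on_def comp_def)

lemma degree_pderiv_le: "degree (pderiv (h :: 'k poly)) \<le> degree h"
  by (rule degree_le) (auto simp: coeff_pderiv coeff_eq_0)

text \<open>Adding \<open>y ^ (p e + 1)\<close>, with \<open>y\<close> the \<open>V\<close>-invariant coordinate, destroys all translations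
  outside \<open>V\<close>: after differentiation the difference \<open>(y + \<beta>) ^ (p e + 1) - y ^ (p e + 1)\<close> has
  too large a degree to be the derivative of \<open>P ^ p - P\<close>.\<close>

lemma translation_in_V:
  fixes f P :: "'k poly"
  assumes e: "e \<ge> 3" "\<not> p dvd e" and f: "degree f < p * card V * (e - 1)"
    and P: "frob_diff P = pcompose (f + vanishing ^ (p * e + 1)) [:b, 1:] - (f + vanishing ^ (p * e + 1))"
  shows "b \<in> V"
proof (rule ccontr)
  assume "b \<notin> V"
  define \<beta> where "\<beta> = poly vanishing b"
  have \<beta>: "\<beta> \<noteq> 0" using \<open>b \<notin> V\<close> by (simp add: \<beta>_def poly_vanishing_eq_0_iff)
  define d where "d = p * e + 1"
  \<comment> \<open>Substituting \<open>vanishing ^ p\<close> for the variable gives the difference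
    of the powers with exponent \<open>p * e\<close>. The degree is exactly \<open>e - 1\<close>
    since \<open>p\<close> does not divide \<open>e\<close>.\<close>
  define g where "g = [:\<beta> ^ p, 1:] ^ e - [:0, 1:] ^ e"
  have eS: "e = Suc (e - 1)" using e by simp
  have deg_g: "degree g = e - 1"
  proof (rule antisym)
    show "degree g \<le> e - 1"
    proof (rule degree_le, intro allI impI)
      fix i assume "i > e - 1"
      then consider "i = e" | "i > e" by linarith
      then show "coeff g i = 0"
        by cases (simp_all add: g_def coeff_linear_poly_power coeff_eq_0 degree_linear_power)
    qed
    have "coeff g (e - 1) = of_nat e * \<beta> ^ p"
      using e binomial_symmetric[of "e - 1" e] by (simp add: g_def coeff_linear_poly_power)
    then have "coeff g (e - 1) \<noteq> 0" using e \<beta> of_nat_eq_0_iff[of e] by simp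
    then show "degree g \<ge> e - 1" by (rule le_degree)
  qed
  have comp: "pcompose g (vanishing ^ p) = (vanishing + [:\<beta>:]) ^ (p * e) - vanishing ^ (p * e)"
    by (simp add: g_def pcompose_diff pcompose_power pcompose_pCons poly_add_power_p power_mult
        poly_const_pow add.commute)
  have vnz: "vanishing \<noteq> 0" using lead_coeff_vanishing by auto
  have "degree (pcompose g (vanishing ^ p)) = (e - 1) * (p * card V)"
    by (simp add: degree_pcompose deg_g degree_power_eq[OF vnz] degree_vanishing)
  then have deg1: "degree (smult vanishing_slope (pcompose g (vanishing ^ p))) = p * card V * (e - 1)"
    using vanishing_slope_nonzero by (simp add: mult.commute)
  \<comment> \<open>The exponent is 1 modulo \<open>p\<close>, so differentiating
    \<open>h ^ d\<close> leaves the factor \<open>h ^ (p * e)\<close> with coefficient 1.\<close>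
  have "of_nat d = (1::'k)" by (simp add: d_def)
  then have pd: "pderiv (h ^ d) = h ^ (p * e) * pderiv h" for h :: "'k poly"
    using pderiv_power_Suc[of h "p * e"] by (simp add: d_def)
  have vb: "pcompose vanishing [:b, 1:] = vanishing + [:\<beta>:]" by (simp add: vanishing_translate \<beta>_def)
  have RHS: "frob_diff P = (pcompose f [:b, 1:] - f) + ((vanishing + [:\<beta>:]) ^ d - vanishing ^ d)"
    unfolding P d_def[symmetric] by (simp add: pcompose_add pcompose_power vb)
  \<comment> \<open>Only \<open>- pderiv P\<close> survives on the left, so the large degree of the
    differentiated right side bounds \<open>degree P\<close> from below.\<close>
  have "pderiv (frob_diff P) = - pderiv P" by (simp add: pderiv_diff pderiv_power_p)
  moreover have "pderiv (frob_diff P) = pderiv (pcompose f [:b, 1:] - f) + smult vanishing_slope (pcompose g (vanishing ^ p))"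
    unfolding RHS by (simp add: pderiv_add pderiv_diff pd pderiv_vanishing pderiv_pCons comp smult_diff_right)
  moreover have "degree (pderiv (pcompose f [:b, 1:] - f)) < p * card V * (e - 1)"
  proof -
    have "degree (pcompose f [:b, 1:] - f) \<le> degree f"
      by (rule degree_diff_le) (simp_all add: degree_pcompose)
    then show ?thesis using f degree_pderiv_le[of "pcompose f [:b, 1:] - f"] by linarith
  qed
  ultimately have "degree (- pderiv P) = p * card V * (e - 1)"
    using degree_add_eq_right[of "pderiv (pcompose f [:b, 1:] - f)" "smult vanishing_slope (pcompose g (vanishing ^ p))"]
    by (simp only: deg1)
  then have degP': "p * card V * (e - 1) \<le> degree P"
    using degree_pderiv_le[of P] by simp
  moreover have "p * card V * (e - 1) > 0" using p_pos card_V_pos e by simp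
  ultimately have "degree (frob_diff P) = p * degree P" by (intro degree_frob_diff) linarith
  moreover have "degree (frob_diff P) \<le> max (degree f) (card V * d)"
    unfolding RHS
  proof (rule degree_add_le)
    show "degree (pcompose f [:b, 1:] - f) \<le> max (degree f) (card V * d)"
      by (rule degree_diff_le) (simp_all add: degree_pcompose)
    have "degree (vanishing + [:\<beta>:]) = card V"
      using card_V_pos by (subst degree_add_eq_left) (auto simp: degree_vanishing)
    then show "degree ((vanishing + [:\<beta>:]) ^ d - vanishing ^ d) \<le> max (degree f) (card V * d)"
      using degree_power_le[of "vanishing + [:\<beta>:]" d] degree_power_le[of vanishing d]
      by (intro degree_diff_le) (simp_all add: degree_vanishing le_max_iff_disj)
  qed
  ultimately have le: "p * degree P \<le> max (degree f) (card V * d)" by simp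
  \<comment> \<open>Here \<open>e \<ge> 3\<close> enters: it yields
    \<open>p * p * (e - 1) > p * e + 1\<close>, so \<open>p * degree P\<close> exceeds the degree of
    the right side.\<close>
  have "p * (e - 1) \<ge> e + 1"
  proof -
    have "2 * (e - 1) \<le> p * (e - 1)" using p_ge_2 by (rule mult_le_mono1)
    then show ?thesis using e by linarith
  qed
  then have "p * (p * (e - 1)) \<ge> p * (e + 1)" by (rule mult_le_mono2)
  then have "p * (p * (e - 1)) > d" using p_gt_1 by (simp add: d_def algebra_simps)
  then have "card V * d < card V * (p * (p * (e - 1)))" using card_V_pos by simp
  also have "\<dots> = p * (p * card V * (e - 1))" by (simp add: mult_ac)
  also have "\<dots> \<le> p * degree P" using degP' by simp
  finally have "card V * d < p * degree P" .
  moreover have "degree f < p * degree P"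
    using f degP' p_pos by (metis le_trans less_le_trans mult_le_mono1 nat_mult_1 One_nat_def Suc_leI)
  ultimately show False using le by simp
qed

end

section \<open>From a group of the first class to a polynomial\<close>

context alg_closed_prime_char
begin

text \<open>A separating homomorphism sends some element to 1; its kernel is a proper subgroup of a
  group of prime order, hence trivial, and equal cardinalities give surjectivity onto the prime
  field.\<close>

lemma ex_frobenius_fixed_character:
  fixes N :: "'g monoid"
  assumes "group N" "card (carrier N) = p"
  shows "\<exists>\<iota>. \<iota> \<in> hom N additive_group \<and> inj_on \<iota> (carrier N) \<and> \<iota> ` carrier N = {c::'k. c ^ p = c}"
proof -
  interpret N: group N by fact
  have finN: "finite (carrier N)" using assms(2) p_pos card_ge_0_finite by auto
  obtain x where x: "x \<in> carrier N" "carrier N = range (\<lambda>i::int. x [^]\<^bsub>N\<^esub> i)"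
    using prime_card_imp_cyclic[OF assms prime_p] N.cyclic_group by blast
  interpret N: comm_group N
  proof (rule N.group_comm_groupI)
    fix a b assume "a \<in> carrier N" "b \<in> carrier N"
    then obtain i j :: int where "a = x [^]\<^bsub>N\<^esub> i" "b = x [^]\<^bsub>N\<^esub> j" unfolding x(2) by blast
    then show "a \<otimes>\<^bsub>N\<^esub> b = b \<otimes>\<^bsub>N\<^esub> a" using x(1) by (simp add: N.int_pow_mult[symmetric] add.commute)
  qed
  have elN: "elementary_abelian p N"
    using N.pow_order_eq_1 assms(2) by (simp add: elementary_abelian_def N.comm_group_axioms Coset.order_def)
  let ?F = "additive_group\<lparr>carrier := {c::'k. c ^ p = c}\<rparr>"
  interpret A: comm_group "additive_group :: 'k monoid" by (rule comm_group_additive_group)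
  have sub: "subgroup {c::'k. c ^ p = c} additive_group"
  proof (rule A.subgroupI)
    fix a :: 'k assume a: "a \<in> {c. c ^ p = c}"
    have "inv\<^bsub>additive_group\<^esub> a = - a"
      by (rule A.inv_equality) (simp_all add: additive_group_def)
    then show "inv\<^bsub>additive_group\<^esub> a \<in> {c. c ^ p = c}" using a by (simp add: minus_power_p)
  qed (use p_pos in \<open>auto simp: additive_group_def add_power_p intro: exI[of _ 0]\<close>)
  have elF: "elementary_abelian p ?F"
    using elementary_abelian_inj_hom[OF elementary_abelian_additive_group A.subgroup_imp_group[OF sub], of id]
    by (auto simp: hom_def additive_group_def)
  have "\<exists>a\<in>carrier N. a \<noteq> \<one>\<^bsub>N\<^esub>"
  proof (rule ccontr)
    assume "\<not> ?thesis"
    then have "carrier N \<subseteq> {\<one>\<^bsub>N\<^esub>}" by auto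
    then have "card (carrier N) \<le> 1" using card_mono[of "{\<one>\<^bsub>N\<^esub>}" "carrier N"] by simp
    then show False using assms(2) p_gt_1 by simp
  qed
  then obtain a where a: "a \<in> carrier N" "a \<noteq> \<one>\<^bsub>N\<^esub>" by blast
  obtain \<iota> where \<iota>: "\<iota> \<in> hom N ?F" "\<iota> a = 1"
    using elementary_abelian_separating_hom[OF prime_p elN finN elF a, of 1] by auto
  have FG: "group ?F" by (rule A.subgroup_imp_group[OF sub])
  interpret i: group_hom N ?F \<iota>
    using \<iota>(1) by (simp add: group_hom_def group_hom_axioms_def N.is_group FG)
  have "subgroup (kernel N ?F \<iota>) N" by (rule i.subgroup_kernel)
  then have "card (kernel N ?F \<iota>) dvd p"
    using N.lagrange_finite[OF finN, of "kernel N ?F \<iota>"]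
    by (intro dvdI[of _ _ "card (rcosets\<^bsub>N\<^esub> kernel N ?F \<iota>)"]) (simp add: Coset.order_def assms(2) mult.commute)
  moreover have "card (kernel N ?F \<iota>) \<noteq> p"
  proof
    assume "card (kernel N ?F \<iota>) = p"
    then have "kernel N ?F \<iota> = carrier N"
      using card_subset_eq[OF finN, of "kernel N ?F \<iota>"] assms(2) by (auto simp: kernel_def)
    then have "\<iota> a = 0" using a(1) by (auto simp: kernel_def additive_group_def)
    then show False using \<iota>(2) by simp
  qed
  ultimately have "card (kernel N ?F \<iota>) = 1" using prime_p by (meson prime_nat_iff)
  moreover have "\<one>\<^bsub>N\<^esub> \<in> kernel N ?F \<iota>" using i.hom_one by (simp add: kernel_def)
  ultimately have "kernel N ?F \<iota> = {\<one>\<^bsub>N\<^esub>}" by (metis card_1_singletonE singletonD)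
  then have inj: "inj_on \<iota> (carrier N)" by (simp add: i.inj_iff_trivial_ker)
  moreover have "\<iota> ` carrier N = {c::'k. c ^ p = c}"
    using card_subset_eq[OF finite_frobenius_fixed, of "\<iota> ` carrier N"] \<iota>(1) card_image[OF inj] assms(2)
      card_frobenius_fixed by (auto simp: hom_def)
  moreover have "\<iota> \<in> hom N additive_group" using \<iota>(1) by (auto simp: hom_def additive_group_def)
  ultimately show ?thesis by blast
qed

lemma class_C1_imp_translation_group:
  fixes G :: "'g monoid"
  assumes "G \<in> class_C1 p"
  shows "\<exists>f::'k poly. [:0, 1:] dvd f \<and> degree f > 1 \<and> \<not> p dvd degree f \<and> G \<cong> translation_group f"
proof -
  obtain N where G: "group G" "finite (carrier G)" and N: "N \<lhd> G" "cyclic_of_order p (G\<lparr>carrier := N\<rparr>)"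
    "elementary_abelian p (G Mod N)" using assms by (auto simp: class_C1_def finite_p_group_def)
  interpret N: normal N G by fact
  have cen: "n \<otimes>\<^bsub>G\<^esub> g = g \<otimes>\<^bsub>G\<^esub> n" if "n \<in> N" "g \<in> carrier G" for n g
    using normal_prime_order_central[OF prime_p N that(2,1)] by simp
  have NG: "n \<in> carrier G" if "n \<in> N" for n using that by (rule N.mem_carrier)
  have "finite (carrier (G Mod N))" using G(2) by (simp add: carrier_FactGroup)
  then obtain \<beta>0 :: "_ \<Rightarrow> 'k" where b0: "\<beta>0 \<in> hom (G Mod N) additive_group" "inj_on \<beta>0 (carrier (G Mod N))"
    using elementary_abelian_embedding[OF prime_p N(3) _ elementary_abelian_additive_group] infinite_UNIV_k
    by (auto simp: additive_group_def)
  define \<beta> where "\<beta> = (\<lambda>g. \<beta>0 (N #>\<^bsub>G\<^esub> g))"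
  have \<beta>_mult: "\<beta> (g \<otimes>\<^bsub>G\<^esub> h) = \<beta> g + \<beta> h" if "g \<in> carrier G" "h \<in> carrier G" for g h
    using b0(1) that by (auto simp: \<beta>_def hom_def additive_group_def N.rcos_sum carrier_FactGroup)
  have \<beta>_eq: "\<beta> g = \<beta> h \<longleftrightarrow> g \<otimes>\<^bsub>G\<^esub> inv\<^bsub>G\<^esub> h \<in> N" if "g \<in> carrier G" "h \<in> carrier G" for g h
  proof -
    have "\<beta> g = \<beta> h \<longleftrightarrow> N #>\<^bsub>G\<^esub> g = N #>\<^bsub>G\<^esub> h"
      using inj_onD[OF b0(2)] that by (auto simp: \<beta>_def carrier_FactGroup)
    also have "\<dots> \<longleftrightarrow> g \<in> N #>\<^bsub>G\<^esub> h"
      using that N.repr_independence[OF _ _ N.subgroup_axioms] N.rcos_self[OF _ N.subgroup_axioms] by metis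
    also have "\<dots> \<longleftrightarrow> g \<otimes>\<^bsub>G\<^esub> inv\<^bsub>G\<^esub> h \<in> N"
      using that NG N.rcos_module by blast
    finally show ?thesis .
  qed
  have \<beta>_one: "\<beta> \<one>\<^bsub>G\<^esub> = 0" using \<beta>_mult[of "\<one>\<^bsub>G\<^esub>" "\<one>\<^bsub>G\<^esub>"]
    by (metis N.l_one N.one_closed add_cancel_right_right)
  have \<beta>_N: "\<beta> n = 0 \<longleftrightarrow> n \<in> N" if "n \<in> carrier G" for n
    using \<beta>_eq[OF that N.subgroup_axioms[THEN subgroup.one_closed, THEN NG]] \<beta>_one that by simp
  obtain \<iota> where \<iota>: "\<iota> \<in> hom (G\<lparr>carrier := N\<rparr>) additive_group" "inj_on \<iota> N" "\<iota> ` N = {c::'k. c ^ p = c}"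
    using ex_frobenius_fixed_character[of "G\<lparr>carrier := N\<rparr>"] N(2) by (auto simp: cyclic_of_order_def)
  have \<iota>_mult: "\<iota> (m \<otimes>\<^bsub>G\<^esub> n) = \<iota> m + \<iota> n" if "m \<in> N" "n \<in> N" for m n
    using \<iota>(1) that by (auto simp: hom_def additive_group_def)
  define V where "V = \<beta> ` carrier G"
  interpret V: finite_additive_subgroup p field_type V
  proof unfold_locales
    show "finite V" using G(2) by (simp add: V_def)
    show "0 \<in> V" using \<beta>_one by (force simp: V_def)
    show "u + v \<in> V" if "u \<in> V" "v \<in> V" for u v
    proof -
      from that obtain g h where "g \<in> carrier G" "h \<in> carrier G" "u = \<beta> g" "v = \<beta> h" by (auto simp: V_def)
      then show ?thesis using \<beta>_mult[of g h] by (auto simp: V_def intro!: image_eqI[of _ _ "g \<otimes>\<^bsub>G\<^esub> h"])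
    qed
    show "- v \<in> V" if v: "v \<in> V" for v
    proof -
      from v obtain g where g: "g \<in> carrier G" "v = \<beta> g" by (auto simp: V_def)
      then have "\<beta> (inv\<^bsub>G\<^esub> g) + v = 0" using \<beta>_mult[of "inv\<^bsub>G\<^esub> g" g] \<beta>_one by simp
      then have "- v = \<beta> (inv\<^bsub>G\<^esub> g)" by (metis add.commute add.inverse_unique)
      then show ?thesis using g(1) by (auto simp: V_def)
    qed
  qed
  define s where "s = (\<lambda>v. SOME g. g \<in> carrier G \<and> \<beta> g = v)"
  have s: "s v \<in> carrier G" "\<beta> (s v) = v" if "v \<in> V" for v
  proof -
    have "\<exists>g. g \<in> carrier G \<and> \<beta> g = v" using that by (auto simp: V_def)
    from someI_ex[OF this] show "s v \<in> carrier G" "\<beta> (s v) = v" by (auto simp: s_def)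
  qed
  have \<beta>V: "\<beta> g \<in> V" if "g \<in> carrier G" for g using that by (simp add: V_def)
  \<comment> \<open>The component of \<open>g\<close> in \<open>N\<close> relative to the section
    \<open>s\<close>, read in \<open>k\<close> through \<open>\<iota>\<close>.\<close>
  define lam where "lam = (\<lambda>g. \<iota> (g \<otimes>\<^bsub>G\<^esub> inv\<^bsub>G\<^esub> s (\<beta> g)))"
  have lam_mult: "lam (n \<otimes>\<^bsub>G\<^esub> g) = \<iota> n + lam g" if "n \<in> N" "g \<in> carrier G" for n g
  proof -
    have "\<beta> (n \<otimes>\<^bsub>G\<^esub> g) = \<beta> g" using that \<beta>_mult[OF NG] \<beta>_N NG by simp
    moreover have "g \<otimes>\<^bsub>G\<^esub> inv\<^bsub>G\<^esub> s (\<beta> g) \<in> N" using that(2) \<beta>_eq[of g "s (\<beta> g)"] s \<beta>V by simp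
    ultimately show ?thesis using that s(1)[OF \<beta>V] NG by (simp add: lam_def N.m_assoc \<iota>_mult)
  qed
  \<comment> \<open>The change of \<open>lam\<close> under left multiplication by \<open>g\<close>.
    As \<open>N\<close> is central, it depends on the right argument only through its class modulo
    \<open>N\<close>, and it satisfies a cocycle rule.\<close>
  define \<delta> where "\<delta> = (\<lambda>g v. lam (g \<otimes>\<^bsub>G\<^esub> s v) - lam (s v))"
  have \<delta>_any: "\<delta> g (\<beta> h) = lam (g \<otimes>\<^bsub>G\<^esub> h) - lam h" if "g \<in> carrier G" "h \<in> carrier G" for g h
  proof -
    let ?t = "s (\<beta> h)"
    have t: "?t \<in> carrier G" "\<beta> ?t = \<beta> h" using s \<beta>V that by auto
    define n where "n = ?t \<otimes>\<^bsub>G\<^esub> inv\<^bsub>G\<^esub> h"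
    have n: "n \<in> N" using \<beta>_eq[of ?t h] t that by (simp add: n_def)
    have th: "?t = n \<otimes>\<^bsub>G\<^esub> h" using t that by (simp add: n_def N.m_assoc)
    have "g \<otimes>\<^bsub>G\<^esub> ?t = n \<otimes>\<^bsub>G\<^esub> (g \<otimes>\<^bsub>G\<^esub> h)"
      unfolding th using cen[OF n that(1)] NG[OF n] that by (simp add: N.m_assoc[symmetric])
    then have "lam (g \<otimes>\<^bsub>G\<^esub> ?t) = \<iota> n + lam (g \<otimes>\<^bsub>G\<^esub> h)" using lam_mult[OF n] that by simp
    moreover have "lam ?t = \<iota> n + lam h" using lam_mult[OF n that(2)] th by simp
    ultimately show ?thesis by (simp add: \<delta>_def)
  qed
  have \<delta>_mult: "\<delta> (g \<otimes>\<^bsub>G\<^esub> h) v = \<delta> g (v + \<beta> h) + \<delta> h v" if "g \<in> carrier G" "h \<in> carrier G" "v \<in> V" for g h v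
  proof -
    have "\<delta> g (v + \<beta> h) = lam (g \<otimes>\<^bsub>G\<^esub> (h \<otimes>\<^bsub>G\<^esub> s v)) - lam (h \<otimes>\<^bsub>G\<^esub> s v)"
      using \<delta>_any[of g "h \<otimes>\<^bsub>G\<^esub> s v"] that s[OF that(3)] by (simp add: \<beta>_mult add.commute)
    then show ?thesis using that s[OF that(3)] by (simp add: \<delta>_def N.m_assoc)
  qed
  \<comment> \<open>Averaging with \<open>trace_one\<close> turns the values
    \<open>\<delta> g v\<close> into one polynomial per \<open>g\<close>. On \<open>N\<close>, where
    \<open>\<delta>\<close> is constant in \<open>v\<close>, trace 1 gives back
    \<open>\<iota>\<close>.\<close>
  define P where "P = (\<lambda>g. \<Sum>v\<in>V. smult (\<delta> g v) (pcompose V.trace_one [:- v, 1:]))"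
  have P_mult: "P (g \<otimes>\<^bsub>G\<^esub> h) = P h + pcompose (P g) [:\<beta> h, 1:]" if "g \<in> carrier G" "h \<in> carrier G" for g h
  proof -
    have "pcompose (P g) [:\<beta> h, 1:] = (\<Sum>v\<in>V. smult (\<delta> g v) (pcompose V.trace_one [:- v + \<beta> h, 1:]))"
      by (simp add: P_def pcompose_sum pcompose_smult pcompose_translate_translate)
    also have "\<dots> = (\<Sum>v\<in>V. smult (\<delta> g (v + \<beta> h)) (pcompose V.trace_one [:- (v + \<beta> h) + \<beta> h, 1:]))"
      by (rule V.sum_V_translate[symmetric]) (rule \<beta>V[OF that(2)])
    finally have "P h + pcompose (P g) [:\<beta> h, 1:]
      = (\<Sum>v\<in>V. smult (\<delta> h v) (pcompose V.trace_one [:- v, 1:])) + (\<Sum>v\<in>V. smult (\<delta> g (v + \<beta> h)) (pcompose V.trace_one [:- v, 1:]))"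
      by (simp add: P_def)
    also have "\<dots> = P (g \<otimes>\<^bsub>G\<^esub> h)"
      unfolding P_def sum.distrib[symmetric] smult_add_left[symmetric]
      by (intro sum.cong) (auto simp: \<delta>_mult[OF that] add.commute)
    finally show ?thesis by simp
  qed
  have P_N: "P n = [:\<iota> n:]" if n: "n \<in> N" for n
  proof -
    have "\<delta> n v = \<iota> n" if "v \<in> V" for v using lam_mult[OF n s(1)[OF that]] by (simp add: \<delta>_def)
    then have "P n = (\<Sum>v\<in>V. smult (\<iota> n) (pcompose V.trace_one [:- v, 1:]))" by (simp add: P_def)
    also have "\<dots> = smult (\<iota> n) 1" unfolding V.sum_smult V.sum_trace_one_minus ..
    finally show ?thesis by (simp add: one_pCons)
  qed
  \<comment> \<open>Within a coset of \<open>N\<close>, \<open>P\<close> changes by an element of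
    the prime field, which \<open>frob_diff\<close> kills; so \<open>frob_diff (P g)\<close> is a
    cocycle on \<open>V\<close>.\<close>
  have A_cong: "frob_diff (P g) = frob_diff (P h)" if "g \<in> carrier G" "h \<in> carrier G" "\<beta> g = \<beta> h" for g h
  proof -
    define n where "n = g \<otimes>\<^bsub>G\<^esub> inv\<^bsub>G\<^esub> h"
    have n: "n \<in> N" using \<beta>_eq that by (simp add: n_def)
    have "g = n \<otimes>\<^bsub>G\<^esub> h" using that by (simp add: n_def N.m_assoc)
    then have "P g = P h + [:\<iota> n:]" using P_mult[OF NG[OF n] that(2)] P_N[OF n] by simp
    moreover have "frob_diff [:\<iota> n:] = 0" using \<iota>(3) n by (auto simp: frob_diff_const)
    ultimately show ?thesis by (simp only: frob_diff_add) simp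
  qed
  \<comment> \<open>Additive Hilbert 90 for this cocycle: its sum weighted with the translates of
    \<open>trace_one\<close> trivializes it.\<close>
  define f0 where "f0 = - (\<Sum>v\<in>V. frob_diff (P (s v)) * pcompose V.trace_one [:v, 1:])"
  have f0: "pcompose f0 [:\<beta> g, 1:] - f0 = frob_diff (P g)" if g: "g \<in> carrier G" for g
  proof -
    have A: "frob_diff (pcompose (P (s v)) [:\<beta> g, 1:]) = frob_diff (P (s (v + \<beta> g))) - frob_diff (P g)" if v: "v \<in> V" for v
    proof -
      have "frob_diff (P (s (v + \<beta> g))) = frob_diff (P (s v \<otimes>\<^bsub>G\<^esub> g))"
        using V.V_add[OF v \<beta>V[OF g]] s v g by (intro A_cong) (auto simp: \<beta>_mult)
      also have "\<dots> = frob_diff (P g) + frob_diff (pcompose (P (s v)) [:\<beta> g, 1:])"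
        unfolding P_mult[OF s(1)[OF v] g] by (rule frob_diff_add)
      finally show ?thesis by simp
    qed
    have "pcompose f0 [:\<beta> g, 1:]
        = - (\<Sum>v\<in>V. frob_diff (pcompose (P (s v)) [:\<beta> g, 1:]) * pcompose V.trace_one [:v + \<beta> g, 1:])"
      unfolding f0_def
      by (simp only: pcompose_uminus pcompose_sum pcompose_mult frob_diff_pcompose pcompose_translate_translate)
    also have "\<dots> = - (\<Sum>v\<in>V. frob_diff (P (s (v + \<beta> g))) * pcompose V.trace_one [:v + \<beta> g, 1:]
        - frob_diff (P g) * pcompose V.trace_one [:v + \<beta> g, 1:])"
      by (intro arg_cong[of _ _ uminus] sum.cong refl) (simp only: A left_diff_distrib)
    also have "\<dots> = - ((\<Sum>v\<in>V. frob_diff (P (s (v + \<beta> g))) * pcompose V.trace_one [:v + \<beta> g, 1:])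
        - frob_diff (P g) * (\<Sum>v\<in>V. pcompose V.trace_one [:v + \<beta> g, 1:]))"
      by (simp only: sum_subtractf sum_distrib_left)
    also have "(\<Sum>v\<in>V. frob_diff (P (s (v + \<beta> g))) * pcompose V.trace_one [:v + \<beta> g, 1:]) = - f0"
      unfolding f0_def
      using V.sum_V_translate[OF \<beta>V[OF g], of "\<lambda>v. frob_diff (P (s v)) * pcompose V.trace_one [:v, 1:]"] by simp
    also have "(\<Sum>v\<in>V. pcompose V.trace_one [:v + \<beta> g, 1:]) = 1"
      using V.sum_V_translate[OF \<beta>V[OF g], of "\<lambda>v. pcompose V.trace_one [:v, 1:]"] V.sum_trace_one by simp
    finally show ?thesis by simp
  qed
  \<comment> \<open>Prime to \<open>p\<close>, at least 3, and large enough compared with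
    \<open>degree f0\<close> for \<open>translation_in_V\<close>.\<close>
  define e where "e = p * (degree f0 + 2) + 1"
  have "p dvd e \<longleftrightarrow> p dvd 1" unfolding e_def by (rule dvd_add_right_iff) simp
  moreover have "p * (degree f0 + 2) \<ge> 1 * 2" using p_gt_1 by (intro mult_le_mono) auto
  ultimately have e: "e \<ge> 3" "\<not> p dvd e" using p_gt_1 by (auto simp: e_def)
  have "degree f0 < p * card V * (e - 1)"
  proof -
    have "1 \<le> p * card V * p" using p_pos V.card_V_pos by (simp add: Suc_le_eq)
    then have "1 * (degree f0 + 2) \<le> (p * card V * p) * (degree f0 + 2)" by (rule mult_le_mono1)
    then have "degree f0 < (p * card V * p) * (degree f0 + 2)"
      by (rule less_le_trans[rotated]) simp
    moreover have "e - 1 = p * (degree f0 + 2)" by (simp only: e_def add_diff_cancel_right')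
    ultimately show ?thesis by (simp only: mult.assoc)
  qed
  note inV = V.translation_in_V[OF e this]
  \<comment> \<open>\<open>vanishing\<close> is invariant under \<open>V\<close>, so the
    translations in \<open>V\<close> keep their polynomials \<open>P g\<close>, while those outside
    \<open>V\<close> disappear.\<close>
  define f1 where "f1 = f0 + V.vanishing ^ (p * e + 1)"
  have f1: "pcompose f1 [:\<beta> g, 1:] - f1 = frob_diff (P g)" if g: "g \<in> carrier G" for g
    using f0[OF g] V.vanishing_translate_V[OF \<beta>V[OF g]]
    by (simp add: f1_def pcompose_add pcompose_power pcompose_mult)
  obtain Q where Q: "coeff (f1 + frob_diff Q) 0 = 0"
    "degree (f1 + frob_diff Q) = 0 \<or> \<not> p dvd degree (f1 + frob_diff Q)"
    using ex_frob_diff_reduced by blast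
  define F where "F = f1 + frob_diff Q"
  have cF: "coeff F 0 = 0" using Q(1) by (simp only: F_def)
  \<comment> \<open>Replacing \<open>f1\<close> by \<open>f1 + frob_diff Q\<close> shifts every
    solution at \<open>b\<close> by \<open>R b\<close>.\<close>
  define R where "R = (\<lambda>b. pcompose Q [:b, 1:] - Q)"
  have FR: "pcompose F [:b, 1:] - F = (pcompose f1 [:b, 1:] - f1) + frob_diff (R b)" for b
    unfolding F_def R_def frob_diff_diff frob_diff_pcompose[symmetric] by (simp add: pcompose_add)
  have Fin: "b \<in> V" if "frob_diff S = pcompose F [:b, 1:] - F" for b S
  proof -
    have "frob_diff (S - R b) = pcompose f1 [:b, 1:] - f1" unfolding frob_diff_diff that FR by simp
    then show ?thesis unfolding f1_def by (rule inV)
  qed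
  \<comment> \<open>For \<open>F\<close> of degree at most 1, every \<open>b\<close> would admit a
    constant solution of its Artin-Schreier equation, and the finite \<open>V\<close> would be all
    of \<open>k\<close>.\<close>
  have degF: "degree F > 1"
  proof (rule ccontr)
    assume "\<not> degree F > 1"
    then have le: "degree F \<le> 1" by simp
    obtain c where F: "F = [:0, c:]"
    proof
      show "F = [:0, coeff F 1:]"
        using cF le by (auto simp: poly_eq_iff coeff_eq_0 coeff_pCons split: nat.split)
    qed
    have "b \<in> V" for b
    proof -
      obtain \<gamma> where "\<gamma> ^ p - \<gamma> = b * c" using ex_frob_diff_root by blast
      then have "frob_diff [:\<gamma>:] = pcompose F [:b, 1:] - F"
        by (simp add: frob_diff_const F pcompose_pCons)
      then show ?thesis by (rule Fin)
    qed
    then show False using V.V_finite infinite_UNIV_k by (metis UNIV_eq_I)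
  qed
  define \<Phi> where "\<Phi> = (\<lambda>g. (\<beta> g, P g + R (\<beta> g)))"
  have \<Phi>_carrier: "\<Phi> g \<in> carrier (translation_group F)" if "g \<in> carrier G" for g
    unfolding \<Phi>_def translation_group_carrier FR f1[OF that] frob_diff_add ..
  have "\<Phi> \<in> iso G (translation_group F)"
  proof (rule isoI)
    show "\<Phi> \<in> hom G (translation_group F)"
    proof (rule homI)
      fix g h assume gh: "g \<in> carrier G" "h \<in> carrier G"
      show "\<Phi> (g \<otimes>\<^bsub>G\<^esub> h) = \<Phi> g \<otimes>\<^bsub>translation_group F\<^esub> \<Phi> h"
        using gh by (simp add: \<Phi>_def translation_group_mult \<beta>_mult P_mult R_def pcompose_add pcompose_diff
          pcompose_translate_translate)
    qed (rule \<Phi>_carrier)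
    have inj: "inj_on \<Phi> (carrier G)"
    proof (rule inj_onI)
      fix g h assume gh: "g \<in> carrier G" "h \<in> carrier G" "\<Phi> g = \<Phi> h"
      then have b: "\<beta> g = \<beta> h" and Pe: "P g = P h" by (auto simp: \<Phi>_def)
      define n where "n = g \<otimes>\<^bsub>G\<^esub> inv\<^bsub>G\<^esub> h"
      have n: "n \<in> N" using \<beta>_eq gh b by (simp add: n_def)
      have g: "g = n \<otimes>\<^bsub>G\<^esub> h" using gh by (simp add: n_def N.m_assoc)
      then have "P g = P h + [:\<iota> n:]" using P_mult[OF NG[OF n] gh(2)] P_N[OF n] by simp
      then have "\<iota> n = 0" using Pe by simp
      moreover have "\<iota> \<one>\<^bsub>G\<^esub> = 0" using \<iota>_mult[of "\<one>\<^bsub>G\<^esub>" "\<one>\<^bsub>G\<^esub>"]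
        by (metis N.l_one N.group_l_invI N.one_closed N.subgroup_axioms add_cancel_right_right subgroup.one_closed)
      ultimately have "n = \<one>\<^bsub>G\<^esub>" using inj_onD[OF \<iota>(2)] n by simp
      then show "g = h" using g gh by simp
    qed
    have "carrier (translation_group F) \<subseteq> \<Phi> ` carrier G"
    proof
      fix x assume "x \<in> carrier (translation_group F)"
      then obtain b S where x: "x = (b, S)" "frob_diff S = pcompose F [:b, 1:] - F"
        by (cases x) (auto simp: translation_group_carrier)
      then obtain g where g: "g \<in> carrier G" "b = \<beta> g" using Fin by (auto simp: V_def)
      have "frob_diff (S - (P g + R (\<beta> g))) = 0"
        unfolding frob_diff_diff frob_diff_add x(2) FR g(2) f1[OF g(1)] by simp
      then obtain c where c: "S - (P g + R (\<beta> g)) = [:c:]" "c ^ p = c" by (auto simp only: frob_diff_eq_0_iff)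
      then obtain n where n: "n \<in> N" "c = \<iota> n" using \<iota>(3) by blast
      have "\<beta> (n \<otimes>\<^bsub>G\<^esub> g) = \<beta> g" using n g \<beta>_mult[OF NG] \<beta>_N NG by simp
      moreover have "P (n \<otimes>\<^bsub>G\<^esub> g) = P g + [:c:]" using P_mult[OF NG[OF n(1)] g(1)] P_N n by simp
      ultimately have "\<Phi> (n \<otimes>\<^bsub>G\<^esub> g) = x" using c(1) x(1) g(2) by (simp add: \<Phi>_def algebra_simps)
      then show "x \<in> \<Phi> ` carrier G" using g(1) NG[OF n(1)] by (intro image_eqI[of _ _ "n \<otimes>\<^bsub>G\<^esub> g"]) auto
    qed
    then show "bij_betw \<Phi> (carrier G) (carrier (translation_group F))"
      using inj \<Phi>_carrier by (auto simp: bij_betw_def)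
  qed
  then have "G \<cong> translation_group F" by (auto simp: is_iso_def)
  moreover have "[:0, 1:] dvd F" using cF by (simp add: dvd_iff_poly_eq_0 poly_0_coeff_0)
  moreover have "\<not> p dvd degree F" using Q(2)[folded F_def] degF by auto
  ultimately show ?thesis using degF by blast
qed

end

section \<open>The function field inside the Laurent series\<close>

lemma fps_poly_taylor:
  fixes G :: "'a::idom fps poly"
  shows "\<exists>r. poly G (x + h) = poly G x + h * poly (pderiv G) x + h ^ 2 * r"
proof (induction G)
  case (pCons a G)
  then obtain r where r: "poly G (x + h) = poly G x + h * poly (pderiv G) x + h ^ 2 * r" by blast
  have "poly (pCons a G) (x + h) = poly (pCons a G) x + h * poly (pderiv (pCons a G)) x
      + h ^ 2 * (poly (pderiv G) x + x * r + h * r)"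
    by (simp only: poly_pCons pderiv_pCons poly_add r) (simp add: algebra_simps power2_eq_square)
  then show ?case by blast
qed auto

lemma fps_poly_diff_dvd:
  fixes G :: "'a::comm_ring_1 fps poly"
  shows "x - y dvd poly G x - poly G y"
proof (induction G)
  case (pCons a G)
  have "poly (pCons a G) x - poly (pCons a G) y = x * (poly G x - poly G y) + (x - y) * poly G y"
    by (simp add: algebra_simps)
  also have "x - y dvd \<dots>" using pCons by (intro dvd_add) auto
  finally show ?case .
qed auto

lemma fps_X_power_dvd_iff: "fps_X ^ n dvd (g :: 'a::comm_ring_1 fps) \<longleftrightarrow> (\<forall>i<n. fps_nth g i = 0)"
proof
  assume "\<forall>i<n. fps_nth g i = 0"
  then have "g = fps_X ^ n * fps_shift n g"
    by (intro fps_ext) (simp add: fps_X_power_mult_nth)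
  then show "fps_X ^ n dvd g" by (rule dvdI)
qed (auto simp: fps_X_power_mult_nth elim!: dvdE)

text \<open>Newton iteration, one coefficient at a time: adding \<open>c X ^ (n + 1)\<close> to
  \<open>Z\<close> changes coefficient \<open>n + 1\<close> of the value by \<open>c\<close> times
  the constant term of the derivative. That constant term stays nonzero because the constant term of
  \<open>Z\<close> never changes.\<close>

lemma fps_hensel:
  fixes G :: "'a::field fps poly"
  assumes "fps_nth (poly G (fps_const z0)) 0 = 0" "fps_nth (poly (pderiv G) (fps_const z0)) 0 \<noteq> 0"
  shows "\<exists>Z. poly G Z = 0 \<and> fps_nth Z 0 = z0"
proof -
  define Q where "Q = (\<lambda>n Z. fps_nth Z 0 = z0 \<and> fps_X ^ Suc n dvd poly G Z)"
  have deriv: "fps_nth (poly (pderiv G) Z) 0 \<noteq> 0" if "fps_nth Z 0 = z0" for Z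
  proof -
    have "fps_X ^ 1 dvd Z - fps_const z0" using that unfolding fps_X_power_dvd_iff by simp
    then have "fps_X ^ 1 dvd poly (pderiv G) Z - poly (pderiv G) (fps_const z0)"
      using fps_poly_diff_dvd dvd_trans by blast
    then show ?thesis using assms(2) unfolding fps_X_power_dvd_iff by simp
  qed
  have step: "\<exists>Z'. Q (Suc n) Z' \<and> fps_X ^ Suc n dvd Z' - Z" if "Q n Z" for n Z
  proof -
    define d where "d = fps_nth (poly (pderiv G) Z) 0"
    have d: "d \<noteq> 0" using that deriv by (simp add: Q_def d_def)
    define c where "c = - fps_nth (poly G Z) (Suc n) / d"
    define h where "h = fps_const c * fps_X ^ Suc n"
    obtain r where r: "poly G (Z + h) = poly G Z + h * poly (pderiv G) Z + h ^ 2 * r"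
      using fps_poly_taylor by blast
    have "fps_nth (poly G (Z + h)) i = 0" if i: "i < Suc (Suc n)" for i
    proof -
      \<comment> \<open>\<open>h ^ 2\<close> is divisible by \<open>X ^ (2 n + 2)\<close>, so the
        quadratic term cannot disturb coefficient \<open>n + 1\<close>.\<close>
      have "fps_X ^ Suc (Suc n) dvd h ^ 2"
        unfolding h_def power2_eq_square power_mult_distrib
        by (rule dvdI[of _ _ "fps_const (c * c) * fps_X ^ n"]) (simp add: mult_ac flip: power_add power_Suc fps_const_mult)
      then have "fps_X ^ Suc (Suc n) dvd h ^ 2 * r" by (rule dvd_mult2)
      then have "fps_nth (h ^ 2 * r) i = 0" using i unfolding fps_X_power_dvd_iff by blast
      moreover have "fps_nth (h * poly (pderiv G) Z) i = (if i = Suc n then c * d else 0)"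
        using i by (auto simp: h_def d_def mult.assoc fps_X_power_mult_nth simp del: power_Suc)
      moreover have "fps_nth (poly G Z) i = 0" if "i < Suc n"
        using \<open>Q n Z\<close> that unfolding Q_def fps_X_power_dvd_iff by blast
      ultimately show ?thesis using d i unfolding r by (auto simp: c_def less_Suc_eq)
    qed
    then have "fps_X ^ Suc (Suc n) dvd poly G (Z + h)" unfolding fps_X_power_dvd_iff by blast
    moreover have "fps_nth (Z + h) 0 = z0"
      using that by (simp add: Q_def h_def fps_X_power_mult_nth del: power_Suc)
    moreover have "fps_X ^ Suc n dvd (Z + h) - Z" by (simp add: h_def del: power_Suc)
    ultimately show ?thesis unfolding Q_def by blast
  qed
  have "Q 0 (fps_const z0)"
    using assms(1) unfolding Q_def fps_X_power_dvd_iff by simp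
  then have "\<exists>F. \<forall>n. Q n (F n) \<and> fps_X ^ Suc n dvd F (Suc n) - F n"
    using step by (intro dependent_nat_choice) blast+
  then obtain F where F: "\<And>n. Q n (F n)" "\<And>n. fps_X ^ Suc n dvd F (Suc n) - F n" by blast
  have stable: "fps_nth (F (n + k)) i = fps_nth (F n) i" if "i \<le> n" for n k i
  proof (induction k)
    case (Suc k)
    have "fps_nth (F (Suc (n + k)) - F (n + k)) i = 0"
      using F(2)[of "n + k"] that unfolding fps_X_power_dvd_iff by simp
    then show ?case using Suc by simp
  qed simp
  \<comment> \<open>Coefficient \<open>n\<close> no longer changes after stage \<open>n\<close>, so
    the diagonal is the limit.\<close>
  define Z where "Z = Abs_fps (\<lambda>n. fps_nth (F n) n)"
  have ZF: "fps_X ^ Suc n dvd Z - F n" for n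
    unfolding fps_X_power_dvd_iff
  proof safe
    fix i assume "i < Suc n"
    then have "fps_nth (F (i + (n - i))) i = fps_nth (F i) i" by (intro stable) simp
    then show "fps_nth (Z - F n) i = 0" using \<open>i < Suc n\<close> by (simp add: Z_def)
  qed
  have "fps_X ^ Suc n dvd poly G Z" for n
  proof -
    have "fps_X ^ Suc n dvd poly G Z - poly G (F n)" using ZF[of n] fps_poly_diff_dvd dvd_trans by blast
    moreover have "fps_X ^ Suc n dvd poly G (F n)" using F(1)[of n] by (simp only: Q_def)
    ultimately show ?thesis by (metis diff_add_cancel dvd_add)
  qed
  then have "poly G Z = 0" unfolding fps_X_power_dvd_iff by (intro fps_ext) auto
  moreover have "fps_nth Z 0 = z0" using F(1)[of 0] by (simp add: Z_def Q_def)
  ultimately show ?thesis by blast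
qed

lemma pderiv_sum: "pderiv (sum g A) = (\<Sum>a\<in>A. pderiv (g a :: 'a::idom poly))"
  by (induction A rule: infinite_finite_induct) (simp_all add: pderiv_add)

section \<open>Evaluation along coefficient homomorphisms\<close>

locale coeff_hom =
  fixes h :: "'a::comm_ring_1 \<Rightarrow> 'b::comm_ring_1"
  assumes h_0: "h 0 = 0" and h_1: "h 1 = 1" and h_add: "h (a + b) = h a + h b" and h_mult: "h (a * b) = h a * h b"
begin

text \<open>One evaluation for several coefficient rings: \<open>k\<close>, \<open>k[X]\<close> and
  \<open>k(X)\<close> are all mapped to Laurent series, and \<open>k[X]\<close> once more through
  the image of \<open>x\<close> under an automorphism.\<close>

definition heval :: "'b \<Rightarrow> 'a poly \<Rightarrow> 'b" where
  "heval y q = poly (map_poly h q) y"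

lemma heval_0: "heval y 0 = 0" by (simp add: heval_def)

lemma heval_pCons: "heval y (pCons a q) = h a + y * heval y q"
  by (simp add: heval_def map_poly_pCons h_0)

lemma heval_add: "heval y (q + r) = heval y q + heval y r"
proof (induction q arbitrary: r)
  case (pCons a q)
  obtain b s where "r = pCons b s" by (cases r)
  then show ?case by (simp only: add_pCons heval_pCons h_add pCons.IH) (simp add: algebra_simps)
qed (simp add: heval_0)

lemma heval_smult: "heval y (smult c q) = h c * heval y q"
  by (induction q) (simp_all add: heval_0 heval_pCons h_mult algebra_simps)

lemma heval_mult: "heval y (q * r) = heval y q * heval y r"
  by (induction q) (simp_all add: heval_0 heval_pCons heval_add heval_smult h_0 algebra_simps)

lemma heval_const: "heval y [:c:] = h c" by (simp add: heval_pCons heval_0)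

lemma heval_1: "heval y 1 = 1" by (simp add: one_pCons heval_const h_1)

lemma heval_minus: "heval y (- q) = - heval y q"
  using heval_add[of y q "- q"] by (simp add: heval_0 eq_neg_iff_add_eq_0 add.commute)

lemma heval_diff: "heval y (q - r) = heval y q - heval y r"
  using heval_add[of y q "- r"] by (simp add: heval_minus)

lemma heval_power: "heval y (q ^ n) = heval y q ^ n"
  by (induction n) (simp_all add: heval_1 heval_mult)

lemma heval_sum: "heval y (sum g A) = (\<Sum>a\<in>A. heval y (g a))"
  by (induction A rule: infinite_finite_induct) (simp_all add: heval_0 heval_add)

lemma heval_monom: "heval y (monom c n) = h c * y ^ n"
  by (induction n) (simp_all add: monom_0 monom_Suc heval_pCons heval_0 h_0 mult_ac)

lemma heval_altdef: "heval y q = (\<Sum>i\<le>degree q. h (coeff q i) * y ^ i)"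
  by (subst (1) poly_as_sum_of_monoms[of q, symmetric]) (simp add: heval_sum heval_monom)

lemma heval_altdef':
  assumes "degree q < n" shows "heval y q = (\<Sum>i<n. h (coeff q i) * y ^ i)"
  unfolding heval_altdef using assms
  by (intro sum.mono_neutral_left) (auto simp: coeff_eq_0 h_0)

end

interpretation fls_const: coeff_hom "fls_const :: 'a::comm_ring_1 \<Rightarrow> 'a fls"
  by unfold_locales (simp_all add: fls_plus_const)

abbreviation fls_eval :: "'a::comm_ring_1 fls \<Rightarrow> 'a poly \<Rightarrow> 'a fls" where
  "fls_eval \<equiv> fls_const.heval"

lemma fps_to_fls_sum: "fps_to_fls (sum g A) = (\<Sum>a\<in>A. fps_to_fls (g a))"
  by (induction A rule: infinite_finite_induct) simp_all

lemma fls_eval_pcompose: "fls_eval y (pcompose q r) = fls_eval (fls_eval y r) q"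
  by (induction q)
    (simp_all add: fls_const.heval_0 fls_const.heval_pCons pcompose_pCons fls_const.heval_add fls_const.heval_mult)

text \<open>Since \<open>y\<close> has a pole, the top power dominates; in particular
  \<open>y\<close> is transcendental over the constants.\<close>

lemma fls_eval_subdegree:
  fixes y :: "'a::field fls"
  assumes "fls_subdegree y < 0" "q \<noteq> 0"
  shows "fls_eval y q \<noteq> 0 \<and> fls_subdegree (fls_eval y q) = int (degree q) * fls_subdegree y"
  using assms(2)
proof (induction q)
  case (pCons a q)
  show ?case
  proof (cases "q = 0")
    case True
    then show ?thesis using pCons by (simp add: fls_const.heval_const fls_const_nonzero)
  next
    case False
    have y0: "y \<noteq> 0" using assms(1) by auto
    have IH: "fls_eval y q \<noteq> 0" "fls_subdegree (fls_eval y q) = int (degree q) * fls_subdegree y"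
      using pCons False by auto
    have sd: "fls_subdegree (y * fls_eval y q) = int (Suc (degree q)) * fls_subdegree y"
      using IH y0 by (simp add: algebra_simps)
    have "int (Suc (degree q)) * fls_subdegree y < 0" using assms(1) by (simp add: mult_pos_neg)
    then have lt: "fls_subdegree (y * fls_eval y q) < fls_subdegree (fls_const a)" using sd by simp
    have nz: "y * fls_eval y q \<noteq> 0" using y0 IH by simp
    have "fls_subdegree (fls_const a + y * fls_eval y q) = fls_subdegree (y * fls_eval y q)"
      by (rule fls_subdegree_add_eq2[OF nz lt])
    moreover have "fls_const a + y * fls_eval y q \<noteq> 0"
      using lt calculation sd \<open>int (Suc (degree q)) * fls_subdegree y < 0\<close> by auto
    ultimately show ?thesis using False sd by (simp add: fls_const.heval_pCons)
  qed
qed simp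

lemma (in alg_closed_prime_char) ex_artin_schreier_laurent:
  fixes f :: "'k poly"
  assumes m: "degree f > 0" "\<not> p dvd degree f"
  shows "\<exists>x w :: 'k fls. fls_subdegree x = - int p \<and> fls_subdegree w = - int (degree f) \<and> w ^ p - w = fls_eval x f"
proof -
  define m where "m = degree f"
  obtain z0 where z0: "z0 ^ m = inverse (coeff f m)"
    using nth_root_exists[of m "inverse (coeff f m)"] assms by (auto simp: m_def)
  have fm: "coeff f m \<noteq> 0" using assms by (auto simp: m_def)
  have z0nz: "z0 \<noteq> 0" using z0 fm assms by (auto simp: m_def power_0_left)
  \<comment> \<open>The order of \<open>t ^ (p * m) * w\<close>. Multiplying the curve equation by
    \<open>t ^ (p * m)\<close> turns it into \<open>G = 0\<close> for the unknown unit
    \<open>t ^ p * x\<close>.\<close>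
  define D where "D = (p - 1) * m"
  have Dpos: "D > 0" using p_gt_1 assms by (simp add: D_def m_def)
  define G :: "'k fps poly" where
    "G = (\<Sum>l\<le>m. monom (fps_const (coeff f l) * fps_X ^ (p * (m - l))) l) - [:1 - fps_X ^ D:]"
  have G: "poly G Z = (\<Sum>l\<le>m. fps_const (coeff f l) * fps_X ^ (p * (m - l)) * Z ^ l) - (1 - fps_X ^ D)" for Z
    by (simp add: G_def poly_sum poly_monom)
  have G': "poly (pderiv G) Z = (\<Sum>l\<le>m. of_nat l * (fps_const (coeff f l) * fps_X ^ (p * (m - l))) * Z ^ (l - 1))" for Z
    by (simp add: G_def pderiv_diff pderiv_sum pderiv_monom poly_sum poly_monom pderiv_pCons)
  have nth0: "fps_nth (fps_X ^ (p * (m - l))) 0 = (if l = m then 1 else (0::'k))" if "l \<le> m" for l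
    using that p_pos by (auto simp: fps_X_power_nth)
  have "fps_nth (poly G (fps_const z0)) 0 = (\<Sum>l\<le>m. if l = m then coeff f l * z0 ^ l else 0) - 1"
  proof -
    have "fps_nth (\<Sum>l\<le>m. fps_const (coeff f l) * fps_X ^ (p * (m - l)) * fps_const z0 ^ l) 0
        = (\<Sum>l\<le>m. if l = m then coeff f l * z0 ^ l else 0)"
      unfolding fps_sum_nth using p_pos
      by (intro sum.cong refl) (auto simp: fps_power_zeroth power_0_left)
    then show ?thesis unfolding G using Dpos by (simp add: fps_power_zeroth power_0_left)
  qed
  also have "\<dots> = 0" using z0 fm by simp
  finally have "fps_nth (poly G (fps_const z0)) 0 = 0" .
  \<comment> \<open>At \<open>t = 0\<close> only the top term of \<open>f\<close> remains, so the
    derivative becomes \<open>m * coeff f m * z0 ^ (m - 1)\<close>, nonzero as \<open>p\<close> does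
    not divide \<open>m\<close>.\<close>
  moreover have "fps_nth (poly (pderiv G) (fps_const z0)) 0 = (\<Sum>l\<le>m. if l = m then of_nat l * coeff f l * z0 ^ (l - 1) else 0)"
    unfolding G' fps_sum_nth using p_pos
    by (intro sum.cong refl) (auto simp: fps_power_zeroth power_0_left)
  then have "fps_nth (poly (pderiv G) (fps_const z0)) 0 \<noteq> 0"
    using fm z0nz assms of_nat_eq_0_iff[of m] by (simp add: m_def)
  ultimately obtain Z where Z: "poly G Z = 0" "fps_nth Z 0 = z0" using fps_hensel by blast
  define t where "t = (fls_X :: 'k fls)"
  have t: "t \<noteq> 0" by (simp add: t_def)
  define Y where "Y = fps_to_fls Z"
  have Y: "fls_subdegree Y = 0" "Y \<noteq> 0"
  proof -
    have "subdegree Z = 0" using Z(2) z0nz by (auto intro: subdegreeI)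
    moreover have "Z \<noteq> 0" using Z(2) z0nz by auto
    ultimately show "fls_subdegree Y = 0" "Y \<noteq> 0" by (simp_all add: Y_def fls_subdegree_fls_to_fps)
  qed
  have "fps_to_fls (poly G Z) = (\<Sum>l\<le>m. fls_const (coeff f l) * t ^ (p * (m - l)) * Y ^ l) - (1 - t ^ D)"
    unfolding G by (simp add: t_def Y_def fls_times_fps_to_fls fps_to_fls_power fps_to_fls_sum mult.assoc)
  then have rel: "(\<Sum>l\<le>m. fls_const (coeff f l) * t ^ (p * (m - l)) * Y ^ l) = 1 - t ^ D" using Z(1) by simp
  define x where "x = Y / t ^ p"
  define w where "w = 1 / t ^ m"
  have "t ^ (p * m) * fls_eval x f = (\<Sum>l\<le>m. t ^ (p * m) * (fls_const (coeff f l) * x ^ l))"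
    by (simp add: fls_const.heval_altdef m_def sum_distrib_left)
  also have "\<dots> = (\<Sum>l\<le>m. fls_const (coeff f l) * t ^ (p * (m - l)) * Y ^ l)"
  proof (intro sum.cong refl)
    fix l assume "l \<in> {..m}"
    then have "p * m = p * (m - l) + p * l" by (simp add: algebra_simps flip: distrib_left)
    then have "t ^ (p * m) = t ^ (p * (m - l)) * (t ^ p) ^ l" by (simp add: power_add power_mult)
    then show "t ^ (p * m) * (fls_const (coeff f l) * x ^ l) = fls_const (coeff f l) * t ^ (p * (m - l)) * Y ^ l"
      using t by (simp add: x_def power_divide)
  qed
  also have "\<dots> = t ^ (p * m) * (w ^ p - w)"
  proof -
    have "p * m = D + m" using p_pos by (cases p) (auto simp: D_def)
    then have "t ^ (p * m) * w = t ^ D" using t by (simp add: w_def power_add)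
    moreover have "t ^ (p * m) * w ^ p = 1" using t by (simp add: w_def power_divide mult.commute flip: power_mult)
    ultimately show ?thesis unfolding rel by (simp add: right_diff_distrib)
  qed
  finally have "w ^ p - w = fls_eval x f" using t by simp
  moreover have "fls_subdegree x = - int p"
    using Y t by (simp add: x_def fls_divide_subdegree t_def)
  moreover have "fls_subdegree w = - int (degree f)"
    using t by (simp add: w_def fls_divide_subdegree t_def m_def)
  ultimately show ?thesis by blast
qed

text \<open>The term of least order cannot be cancelled. Distinctness is asked of the nonzero
  summands, since \<open>0\<close> has subdegree 0 by convention.\<close>

lemma fls_subdegree_sum_distinct:
  fixes g :: "'b \<Rightarrow> 'a::field fls"
  assumes "finite A" "\<And>a b. a \<in> A \<Longrightarrow> b \<in> A \<Longrightarrow> g a \<noteq> 0 \<Longrightarrow> g b \<noteq> 0 \<Longrightarrow>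
      fls_subdegree (g a) = fls_subdegree (g b) \<Longrightarrow> a = b"
    and "\<exists>a\<in>A. g a \<noteq> 0"
  shows "sum g A \<noteq> 0 \<and> (\<exists>b\<in>A. g b \<noteq> 0 \<and> fls_subdegree (sum g A) = fls_subdegree (g b)) \<and>
    (\<forall>a\<in>A. g a \<noteq> 0 \<longrightarrow> fls_subdegree (sum g A) \<le> fls_subdegree (g a))"
  using assms
proof (induction A rule: finite_induct)
  case (insert a A)
  show ?case
  proof (cases "\<exists>b\<in>A. g b \<noteq> 0")
    case False
    then have "sum g A = 0" by (intro sum.neutral) auto
    then show ?thesis using insert False by auto
  next
    case True
    have "sum g A \<noteq> 0 \<and> (\<exists>b\<in>A. g b \<noteq> 0 \<and> fls_subdegree (sum g A) = fls_subdegree (g b)) \<and>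
        (\<forall>a\<in>A. g a \<noteq> 0 \<longrightarrow> fls_subdegree (sum g A) \<le> fls_subdegree (g a))"
      by (rule insert.IH) (use insert.prems(1) True in blast)+
    then have IH: "sum g A \<noteq> 0" "\<exists>b\<in>A. g b \<noteq> 0 \<and> fls_subdegree (sum g A) = fls_subdegree (g b)"
      "\<forall>a\<in>A. g a \<noteq> 0 \<longrightarrow> fls_subdegree (sum g A) \<le> fls_subdegree (g a)"
      by blast+
    show ?thesis
    proof (cases "g a = 0")
      case True
      then show ?thesis using insert IH by auto
    next
      case False
      obtain b where b: "b \<in> A" "g b \<noteq> 0" "fls_subdegree (sum g A) = fls_subdegree (g b)" using IH(2) by blast
      have "fls_subdegree (g a) \<noteq> fls_subdegree (g b)"
        using insert.prems(1)[of a b] b False insert.hyps(2) by auto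
      then consider "fls_subdegree (g a) < fls_subdegree (sum g A)" | "fls_subdegree (sum g A) < fls_subdegree (g a)"
        using b(3) by linarith
      then show ?thesis
      proof cases
        case 1
        have e: "fls_subdegree (g a + sum g A) = fls_subdegree (g a)" using False 1 by (rule fls_subdegree_add_eq1)
        moreover have "g a + sum g A \<noteq> 0"
        proof
          assume "g a + sum g A = 0"
          then have "g a = - sum g A" by (simp add: eq_neg_iff_add_eq_0)
          then show False using 1 by simp
        qed
        ultimately show ?thesis using insert.hyps False 1 IH(3) by force
      next
        case 2
        have e: "fls_subdegree (g a + sum g A) = fls_subdegree (sum g A)" using IH(1) 2 by (rule fls_subdegree_add_eq2)
        moreover have "g a + sum g A \<noteq> 0"
        proof
          assume "g a + sum g A = 0"
          then have "g a = - sum g A" by (simp add: eq_neg_iff_add_eq_0)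
          then show False using 2 by simp
        qed
        ultimately show ?thesis using insert.hyps False 2 IH(3) b by force
      qed
    qed
  qed
qed simp

text \<open>Defined through a chosen representative of the fraction; independence of the choice
  rests on \<open>x\<close> being transcendental and is \<open>fract_eval_Fract\<close>.\<close>

definition fract_eval :: "'k::field fls \<Rightarrow> 'k poly fract \<Rightarrow> 'k fls" where
  "fract_eval x q = (SOME y. \<exists>a b. b \<noteq> 0 \<and> q = Fraction_Field.Fract a b \<and> y = fls_eval x a / fls_eval x b)"

section \<open>Rational functions of a series with a pole\<close>

locale transcendental_laurent =
  fixes x :: "'k::field fls"
  assumes x_neg: "fls_subdegree x < 0"
begin

sublocale poly: coeff_hom "fls_eval x"
  by unfold_locales
    (simp_all add: fls_const.heval_0 fls_const.heval_1 fls_const.heval_add fls_const.heval_mult)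

lemma fls_eval_eq_0_iff [simp]: "fls_eval x a = 0 \<longleftrightarrow> a = 0"
  using fls_eval_subdegree[OF x_neg, of a] by (auto simp: fls_const.heval_0)

lemma fls_eval_eq_iff [simp]: "fls_eval x a = fls_eval x b \<longleftrightarrow> a = b"
  using fls_eval_eq_0_iff[of "a - b"] by (simp add: fls_const.heval_diff)

lemma fract_eval_Fract: "b \<noteq> 0 \<Longrightarrow> fract_eval x (Fraction_Field.Fract a b) = fls_eval x a / fls_eval x b"
proof -
  assume b: "b \<noteq> 0"
  then have "\<exists>y a' b'. b' \<noteq> 0 \<and> Fraction_Field.Fract a b = Fraction_Field.Fract a' b' \<and> y = fls_eval x a' / fls_eval x b'"
    by blast
  from someI_ex[OF this, folded fract_eval_def] obtain a' b' where
    *: "b' \<noteq> 0" "Fraction_Field.Fract a b = Fraction_Field.Fract a' b'"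
    "fract_eval x (Fraction_Field.Fract a b) = fls_eval x a' / fls_eval x b'" by blast
  then have "a * b' = a' * b" using b by (simp add: eq_fract)
  then have "fls_eval x a * fls_eval x b' = fls_eval x a' * fls_eval x b"
    by (simp only: fls_const.heval_mult[symmetric])
  then have "fls_eval x a / fls_eval x b = fls_eval x a' / fls_eval x b'"
    using b *(1) by (simp add: frac_eq_eq)
  then show ?thesis using *(3) by simp
qed

lemma fract_eval_to_fract: "fract_eval x (to_fract a) = fls_eval x a"
  by (simp add: to_fract_def fract_eval_Fract fls_const.heval_1)

sublocale fract: coeff_hom "fract_eval x"
proof unfold_locales
  show "fract_eval x 0 = 0" using fract_eval_to_fract[of 0] by (simp add: fls_const.heval_0)
  show "fract_eval x 1 = 1" using fract_eval_to_fract[of 1] by (simp add: fls_const.heval_1)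
  fix q r :: "'k poly fract"
  obtain a b where q: "q = Fraction_Field.Fract a b" "b \<noteq> 0" by (rule Fract_cases)
  obtain c d where r: "r = Fraction_Field.Fract c d" "d \<noteq> 0" by (rule Fract_cases)
  show "fract_eval x (q + r) = fract_eval x q + fract_eval x r"
    using q(2) r(2) by (simp add: q r fract_eval_Fract fls_const.heval_add fls_const.heval_mult field_simps)
  show "fract_eval x (q * r) = fract_eval x q * fract_eval x r"
    using q(2) r(2) by (simp add: q r fract_eval_Fract fls_const.heval_mult)
qed

lemma fract_eval_subdegree:
  assumes "q \<noteq> 0" shows "fract_eval x q \<noteq> 0" "fls_subdegree x dvd fls_subdegree (fract_eval x q)"
proof -
  obtain a b where q: "q = Fraction_Field.Fract a b" "b \<noteq> 0" by (rule Fract_cases)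
  have a: "a \<noteq> 0" using assms q by (auto simp: fract_collapse)
  then show "fract_eval x q \<noteq> 0" using q by (simp add: fract_eval_Fract)
  have "fls_subdegree (fract_eval x q) = int (degree a) * fls_subdegree x - int (degree b) * fls_subdegree x"
    using a q(2) fls_eval_subdegree[OF x_neg] by (simp add: q(1) fract_eval_Fract fls_divide_subdegree)
  then show "fls_subdegree x dvd fls_subdegree (fract_eval x q)" by simp
qed

end

text \<open>The orders of \<open>x\<close> and \<open>w\<close> and the curve equation are fixed,
  not the concrete series, so that the same theory can be instantiated at the images of
  \<open>x\<close> and \<open>w\<close> under a prospective automorphism.\<close>

locale artin_schreier_laurent = alg_closed_prime_char p field_type
  for p and field_type :: "'k::alg_closed_field itself" +
  fixes f :: "'k poly" and x w :: "'k fls"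
  assumes degree_f: "degree f > 1" and degree_f_prime: "\<not> p dvd degree f"
    and x_subdegree: "fls_subdegree x = - int p"
    and w_subdegree: "fls_subdegree w = - int (degree f)"
    and w_equation: "w ^ p - w = fls_eval x f"
begin

sublocale transcendental_laurent x
  by unfold_locales (use p_pos x_subdegree in simp)

abbreviation "ev \<equiv> fract.heval w"
abbreviation "biv \<equiv> poly.heval w"
abbreviation "AS \<equiv> artin_schreier_poly f"

definition K :: "'k fls set" where "K = range ev"

text \<open>The curve equation over \<open>k[X]\<close> instead of \<open>k(X)\<close>. It is monic,
  so division by it introduces no denominators.\<close>

definition as_biv :: "'k poly poly" where
  "as_biv = monom 1 p - monom 1 1 - [:f:]"

lemma w_nonzero: "w \<noteq> 0" using w_subdegree degree_f by auto

lemma x_nonzero: "x \<noteq> 0" using x_subdegree p_pos by auto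

text \<open>The orders of the coefficients are multiples of \<open>p\<close>, and the numbers
  \<open>degree f * j\<close> for \<open>j < p\<close> are distinct modulo \<open>p\<close> as
  \<open>p\<close> does not divide \<open>degree f\<close>; hence no two nonzero summands have the
  same order.\<close>

lemma sum_powers_w:
  assumes c: "\<And>j. c j \<noteq> 0 \<Longrightarrow> int p dvd fls_subdegree (c j)" and j: "j < p" "c j \<noteq> 0"
  shows "(\<Sum>j<p. c j * w ^ j) \<noteq> 0"
    and "fls_subdegree (\<Sum>j<p. c j * w ^ j) \<le> fls_subdegree (c j) - int (degree f * j)"
proof -
  have sd: "fls_subdegree (c i * w ^ i) = fls_subdegree (c i) - int (degree f * i)" if "c i \<noteq> 0" for i
    using that w_nonzero by (simp add: fls_subdegree_pow w_subdegree)
  have *: "(\<Sum>j<p. c j * w ^ j) \<noteq> 0 \<and>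
    (\<exists>b\<in>{..<p}. c b * w ^ b \<noteq> 0 \<and> fls_subdegree (\<Sum>j<p. c j * w ^ j) = fls_subdegree (c b * w ^ b)) \<and>
    (\<forall>a\<in>{..<p}. c a * w ^ a \<noteq> 0 \<longrightarrow> fls_subdegree (\<Sum>j<p. c j * w ^ j) \<le> fls_subdegree (c a * w ^ a))"
  proof (rule fls_subdegree_sum_distinct)
    show "\<exists>a\<in>{..<p}. c a * w ^ a \<noteq> 0" using j w_nonzero by auto
    fix a b assume ab: "a \<in> {..<p}" "b \<in> {..<p}" "c a * w ^ a \<noteq> 0" "c b * w ^ b \<noteq> 0"
      "fls_subdegree (c a * w ^ a) = fls_subdegree (c b * w ^ b)"
    then have "fls_subdegree (c a) - int (degree f * a) = fls_subdegree (c b) - int (degree f * b)"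
      using sd[of a] sd[of b] by (metis mult_zero_left)
    then have "int (degree f) * (int a - int b) = fls_subdegree (c a) - fls_subdegree (c b)"
      by (simp add: algebra_simps)
    moreover have "int p dvd fls_subdegree (c a) - fls_subdegree (c b)"
      using ab c by (intro dvd_diff) auto
    ultimately have "int p dvd int (degree f) * (int a - int b)" by simp
    moreover have "\<not> int p dvd int (degree f)" using degree_f_prime by (simp add: int_dvd_int_iff)
    ultimately have "int p dvd int a - int b"
      using prime_p by (metis prime_dvd_mult_iff prime_nat_int_transfer)
    then have "int a mod int p = int b mod int p" by (metis mod_eq_dvd_iff)
    then show "a = b" using ab(1,2) by simp
  qed simp
  then show "(\<Sum>j<p. c j * w ^ j) \<noteq> 0" by blast
  from * j w_nonzero have "fls_subdegree (\<Sum>j<p. c j * w ^ j) \<le> fls_subdegree (c j * w ^ j)" by auto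
  then show "fls_subdegree (\<Sum>j<p. c j * w ^ j) \<le> fls_subdegree (c j) - int (degree f * j)"
    using sd[OF j(2)] by simp
qed

lemma ev_eq_0_degree: "degree q < p \<Longrightarrow> ev q = 0 \<Longrightarrow> q = 0"
proof (rule ccontr)
  assume q: "degree q < p" "ev q = 0" "q \<noteq> 0"
  have "ev q = (\<Sum>j<p. fract_eval x (coeff q j) * w ^ j)" by (rule fract.heval_altdef'[OF q(1)])
  moreover have "(\<Sum>j<p. fract_eval x (coeff q j) * w ^ j) \<noteq> 0"
  proof (rule sum_powers_w(1))
    show "int p dvd fls_subdegree (fract_eval x (coeff q j))" if "fract_eval x (coeff q j) \<noteq> 0" for j
    proof -
      have "coeff q j \<noteq> 0" using that fract.h_0 by metis
      then show ?thesis using fract_eval_subdegree(2)[of "coeff q j"] by (simp add: x_subdegree)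
    qed
    show "fract_eval x (coeff q (degree q)) \<noteq> 0" using q(3) fract_eval_subdegree(1) by simp
  qed (rule q(1))
  ultimately show False using q(2) by simp
qed

lemma AS_altdef: "AS = monom 1 p - monom 1 1 - [:to_fract f:]"
  by (simp add: artin_schreier_poly_def CHAR_eq)

lemma monic_degree: "degree (monom (1::'b::comm_ring_1) p - monom 1 1 - [:a:]) = p"
  "lead_coeff (monom (1::'b::comm_ring_1) p - monom 1 1 - [:a:]) = 1"
proof -
  have "degree (- monom (1::'b) 1 - [:a:]) \<le> 1" by (intro degree_diff_le) (simp_all add: degree_monom_le)
  moreover have "degree (monom (1::'b) p) = p" by (simp add: degree_monom_eq)
  ultimately have lt: "degree (- monom (1::'b) 1 - [:a:]) < degree (monom (1::'b) p)" using p_gt_1 by linarith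
  have e: "monom (1::'b) p - monom 1 1 - [:a:] = monom 1 p + (- monom 1 1 - [:a:])" by simp
  show d: "degree (monom (1::'b) p - monom 1 1 - [:a:]) = p"
    unfolding e using degree_add_eq_left[OF lt] by (simp add: degree_monom_eq)
  have "coeff [:a:] p = 0" using p_pos by (simp add: coeff_eq_0)
  then show "lead_coeff (monom (1::'b) p - monom 1 1 - [:a:]) = 1" unfolding d using p_gt_1 by simp
qed

lemma degree_AS: "degree AS = p" and AS_nonzero: "AS \<noteq> 0"
proof -
  show d: "degree AS = p" unfolding AS_altdef by (rule monic_degree)
  then show "AS \<noteq> 0" using p_pos by auto
qed

lemma ev_AS: "ev AS = 0"
  unfolding AS_altdef using w_equation
  by (simp add: fract.heval_diff fract.heval_monom fract.heval_const fract.h_1 fract_eval_to_fract)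

text \<open>A remainder modulo \<open>AS\<close> has degree below \<open>p\<close>, where
  \<open>ev\<close> vanishes only at 0. This identifies the function field with \<open>K\<close>
  without appealing to irreducibility of \<open>AS\<close>.\<close>

lemma ev_eq_0_iff: "ev q = 0 \<longleftrightarrow> AS dvd q"
proof
  assume "AS dvd q" then show "ev q = 0" by (auto simp: fract.heval_mult ev_AS elim!: dvdE)
next
  assume q: "ev q = 0"
  have "q = q div AS * AS + q mod AS" by simp
  then have "ev (q mod AS) = 0" using q by (metis add_0 ev_AS fract.heval_add fract.heval_mult mult_zero_right)
  moreover have "q mod AS = 0 \<or> degree (q mod AS) < p"
    using degree_mod_less[OF AS_nonzero] degree_AS by metis
  ultimately have "q mod AS = 0" using ev_eq_0_degree by blast
  then show "AS dvd q" by (simp add: dvd_eq_mod_eq_0)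
qed

lemma ev_eq_iff: "ev q = ev r \<longleftrightarrow> AS dvd q - r"
  using ev_eq_0_iff[of "q - r"] by (simp add: fract.heval_diff)

section \<open>The field generated by \<open>x\<close> and \<open>w\<close>\<close>

lemma K_add: "a \<in> K \<Longrightarrow> b \<in> K \<Longrightarrow> a + b \<in> K"
  by (auto simp: K_def simp flip: fract.heval_add)

lemma K_diff: "a \<in> K \<Longrightarrow> b \<in> K \<Longrightarrow> a - b \<in> K"
  by (auto simp: K_def simp flip: fract.heval_diff)

lemma K_mult: "a \<in> K \<Longrightarrow> b \<in> K \<Longrightarrow> a * b \<in> K"
  by (auto simp: K_def simp flip: fract.heval_mult)

lemma K_eval: "fls_eval x a \<in> K"
  using fract.heval_const[of w "to_fract a"] by (auto simp: K_def fract_eval_to_fract intro!: rangeI[of ev] dest: sym)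

lemma K_const: "fls_const c \<in> K"
  using K_eval[of "[:c:]"] by (simp add: fls_const.heval_const)

lemma K_0: "0 \<in> K" and K_1: "1 \<in> K"
  using K_const[of 0] K_const[of 1] by auto

lemma K_uminus: "a \<in> K \<Longrightarrow> - a \<in> K"
  using K_diff[OF K_0] by simp

lemma K_power: "a \<in> K \<Longrightarrow> a ^ n \<in> K"
  by (induction n) (auto intro: K_1 K_mult)

lemma K_x: "x \<in> K"
  using K_eval[of "[:0,1:]"] by (simp add: fls_const.heval_pCons fls_const.heval_0)

lemma K_w: "w \<in> K"
proof -
  have "ev [:0, 1:] = w" by (simp add: fract.heval_pCons fract.heval_0 fract.h_0 fract.h_1)
  then show ?thesis by (metis K_def rangeI)
qed

text \<open>The polynomials whose value is a multiple of \<open>z\<close> in \<open>K\<close> form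
  an ideal containing \<open>AS\<close>; let \<open>r\<close> be a nonzero element of least degree.
  In \<open>AS = r * s\<close> the value of \<open>r\<close> is nonzero, so that of \<open>s\<close>
  vanishes, \<open>degree s \<ge> p\<close> and \<open>r\<close> is constant. Thus a nonzero element
  of \<open>k(x)\<close> is a multiple of \<open>z\<close>.\<close>

lemma K_inverse:
  assumes z: "z \<in> K" shows "inverse z \<in> K"
proof (cases "z = 0")
  case True then show ?thesis by (simp add: K_0)
next
  case False
  obtain q where q: "z = ev q" using z by (auto simp: K_def)
  define I where "I = {r. \<exists>s. ev r = z * ev s}"
  have AS: "AS \<in> I" using ev_AS fract.heval_0 by (auto simp: I_def intro!: exI[of _ 0])
  define n where "n = (LEAST n. \<exists>r\<in>I. r \<noteq> 0 \<and> degree r = n)"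
  have "\<exists>r\<in>I. r \<noteq> 0 \<and> degree r = n"
    unfolding n_def by (rule LeastI[of _ "degree AS"]) (use AS AS_nonzero in blast)
  then obtain r where r: "r \<in> I" "r \<noteq> 0" "degree r = n" by blast
  have min: "s = 0" if "s \<in> I" "degree s < n" for s
    using not_less_Least[of "degree s" "\<lambda>n. \<exists>r\<in>I. r \<noteq> 0 \<and> degree r = n"] that unfolding n_def[symmetric] by blast
  have dvd: "r dvd s" if s: "s \<in> I" for s
  proof -
    obtain t u where t: "ev s = z * ev t" "ev r = z * ev u" using s r(1) by (auto simp: I_def)
    have "ev (s mod r) = ev s - ev (s div r) * ev r"
      by (simp add: fract.heval_diff fract.heval_mult flip: minus_div_mult_eq_mod)
    also have "\<dots> = z * ev (t - s div r * u)"
      by (simp add: t fract.heval_diff fract.heval_mult algebra_simps)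
    finally have "s mod r \<in> I" by (auto simp: I_def)
    then have "s mod r = 0" using min degree_mod_less[OF r(2), of s] r(3) by blast
    then show ?thesis by (simp add: dvd_eq_mod_eq_0)
  qed
  have "q \<in> I" using q by (auto simp: I_def fract.heval_1 intro!: exI[of _ 1])
  then have rq: "r dvd q" by (rule dvd)
  obtain s where s: "AS = r * s" using dvd[OF AS] by (auto elim: dvdE)
  have "ev r \<noteq> 0"
    using rq False q by (auto simp: fract.heval_mult elim!: dvdE)
  then have "ev s = 0" using ev_AS by (simp add: s fract.heval_mult)
  then have "AS dvd s" by (simp add: ev_eq_0_iff)
  moreover have "s \<noteq> 0" using s AS_nonzero by auto
  ultimately have "degree s \<ge> p" using dvd_imp_degree_le degree_AS by metis
  moreover have "p = degree r + degree s" using s degree_AS degree_mult_eq[OF r(2) \<open>s \<noteq> 0\<close>] by metis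
  ultimately have "degree r = 0" by simp
  then obtain c where c: "r = [:c:]" "c \<noteq> 0" using r(2) by (metis degree_eq_zeroE pCons_eq_0_iff)
  obtain t where "ev r = z * ev t" using r(1) by (auto simp: I_def)
  then have "fract_eval x c = z * ev t" by (simp add: c fract.heval_const)
  moreover have "fract_eval x (inverse c) * fract_eval x c = 1"
    using c(2) fract.h_mult[of "inverse c" c] fract.h_1 by simp
  ultimately have "z * (fract_eval x (inverse c) * ev t) = 1" by (simp add: mult_ac)
  then have "inverse z = ev (smult (inverse c) t)"
    by (simp add: fract.heval_smult inverse_unique)
  then show ?thesis by (simp add: K_def)
qed

lemma K_divide: "a \<in> K \<Longrightarrow> b \<in> K \<Longrightarrow> a / b \<in> K"
  by (simp add: divide_inverse K_mult K_inverse)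

lemma biv_in_K: "biv B \<in> K"
  unfolding poly.heval_altdef
proof -
  have "finite A \<Longrightarrow> (\<Sum>i\<in>A. fls_eval x (coeff B i) * w ^ i) \<in> K" for A
    by (induction A rule: finite_induct) (auto intro: K_0 K_add K_mult K_eval K_power K_w)
  then show "(\<Sum>i\<le>degree B. fls_eval x (coeff B i) * w ^ i) \<in> K" by simp
qed

lemma K_obtain:
  assumes "z \<in> K" obtains B h where "h \<noteq> 0" "z = biv B / fls_eval x h"
proof -
  have "\<exists>B h. h \<noteq> 0 \<and> ev q = biv B / fls_eval x h" for q
  proof (induction q)
    case 0
    show ?case by (intro exI[of _ 0] exI[of _ 1]) (simp add: fract.heval_0 poly.heval_0)
  next
    case (pCons a q)
    obtain B h where B: "h \<noteq> 0" "ev q = biv B / fls_eval x h" using pCons by blast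
    obtain c d where a: "a = Fraction_Field.Fract c d" "d \<noteq> 0" by (rule Fract_cases)
    have "ev (pCons a q) = biv (smult h [:c:] + smult d (pCons 0 B)) / fls_eval x (d * h)"
      using B a(2) by (simp add: fract.heval_pCons a(1) fract_eval_Fract poly.heval_add poly.heval_smult
          poly.heval_pCons poly.h_0 poly.heval_0 fls_const.heval_mult field_simps)
    then show ?case using B(1) a(2) by (metis mult_eq_0_iff)
  qed
  then show ?thesis using assms that by (auto simp: K_def)
qed

section \<open>Reduced polynomials in \<open>x\<close> and \<open>w\<close>\<close>

lemma degree_as_biv: "degree as_biv = p" and lead_coeff_as_biv: "lead_coeff as_biv = 1"
  unfolding as_biv_def by (rule monic_degree)+

lemma biv_as_biv: "biv as_biv = 0"
  unfolding as_biv_def using w_equation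
  by (simp add: poly.heval_diff poly.heval_monom poly.heval_const poly.h_1)

lemma biv_reduce: "\<exists>S R. B = as_biv * S + R \<and> degree R < p"
proof -
  obtain S R where SR: "pseudo_divmod B as_biv = (S, R)" by (meson surj_pair)
  have nz: "as_biv \<noteq> 0" using degree_as_biv p_pos by auto
  from pseudo_divmod[OF nz SR] have "B = as_biv * S + R" "R = 0 \<or> degree R < p"
    using lead_coeff_as_biv by (simp_all add: degree_as_biv)
  then show ?thesis using p_pos by (metis degree_0)
qed

lemma ex_biv_reduced: "\<exists>R. biv B = biv R \<and> degree R < p"
  using biv_reduce[of B] by (metis add_0 biv_as_biv mult_zero_left poly.heval_add poly.heval_mult)

text \<open>No cancellation occurs among the terms, so each coefficient forces its own pole order at
  infinity. Bounded poles there become degree conditions on the coefficients.\<close>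

lemma biv_reduced_coeff:
  assumes "degree R < p" "coeff R j \<noteq> 0"
  shows "biv R \<noteq> 0" "fls_subdegree (biv R) \<le> - int (p * degree (coeff R j) + degree f * j)"
proof -
  have e: "biv R = (\<Sum>j<p. fls_eval x (coeff R j) * w ^ j)" by (rule poly.heval_altdef'[OF assms(1)])
  have sd: "fls_subdegree (fls_eval x a) = - int (p * degree a)" if "a \<noteq> 0" for a
    using fls_eval_subdegree[OF x_neg that] by (simp add: x_subdegree)
  have c: "int p dvd fls_subdegree (fls_eval x (coeff R i))" if "fls_eval x (coeff R i) \<noteq> 0" for i
  proof -
    have "coeff R i \<noteq> 0" using that by simp
    then show ?thesis by (simp add: sd)
  qed
  have j: "j < p" "fls_eval x (coeff R j) \<noteq> 0" using assms le_degree[of R j] by auto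
  show "biv R \<noteq> 0" unfolding e using c j by (rule sum_powers_w(1))
  have "fls_subdegree (biv R) \<le> fls_subdegree (fls_eval x (coeff R j)) - int (degree f * j)"
    unfolding e using c j by (rule sum_powers_w(2))
  then show "fls_subdegree (biv R) \<le> - int (p * degree (coeff R j) + degree f * j)"
    using assms(2) by (simp add: sd)
qed

lemma biv_eq_0_imp_dvd: "biv B = 0 \<Longrightarrow> as_biv dvd B"
proof -
  assume B: "biv B = 0"
  obtain S R where SR: "B = as_biv * S + R" "degree R < p" using biv_reduce by blast
  then have "biv R = 0" using B by (simp add: poly.heval_add poly.heval_mult biv_as_biv)
  then have "R = 0" using biv_reduced_coeff(1)[OF SR(2)] by (metis poly_eqI coeff_0)
  then show ?thesis using SR(1) by simp
qed

lemma biv_reduced_unique: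
  assumes "biv R = biv R'" "degree R < p" "degree R' < p" shows "R = R'"
proof -
  have "degree (R - R') < p" using assms degree_diff_le_max[of R R'] by linarith
  moreover have "biv (R - R') = 0" using assms by (simp add: poly.heval_diff)
  ultimately have "R - R' = 0" using biv_reduced_coeff(1) by (metis poly_eqI coeff_0)
  then show ?thesis by simp
qed

end

section \<open>The points of the curve\<close>

context artin_schreier_laurent
begin

text \<open>The counterpart of \<open>curve_points\<close> for subrings of \<open>K\<close>; the two
  are matched in \<open>curve_points_iff\<close>.\<close>

definition is_place :: "'k fls set \<Rightarrow> bool" where
  "is_place P \<longleftrightarrow> P \<subseteq> K \<and> range fls_const \<subseteq> P \<and> (\<forall>a\<in>P. \<forall>b\<in>P. a + b \<in> P \<and> a * b \<in> P) \<and>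
     (\<forall>a\<in>P. - a \<in> P) \<and> P \<noteq> K \<and> (\<forall>z\<in>K. z \<noteq> 0 \<longrightarrow> z \<in> P \<or> inverse z \<in> P)"

definition max_ideal :: "'k fls set \<Rightarrow> 'k fls set" where
  "max_ideal P = {z \<in> P. z = 0 \<or> inverse z \<notin> P}"

text \<open>A relation rather than a function, because the existence of residues in \<open>k\<close>
  is a later result (\<open>finite_places_value\<close>).\<close>

definition has_value :: "'k fls set \<Rightarrow> 'k fls \<Rightarrow> 'k \<Rightarrow> bool" where
  "has_value P z c \<longleftrightarrow> z - fls_const c \<in> max_ideal P"

lemma max_ideal_subset: "z \<in> max_ideal P \<Longrightarrow> z \<in> P"
  by (simp add: max_ideal_def)

section \<open>Arithmetic of a valuation ring and of residues in \<open>k\<close>\<close>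

context
  fixes P assumes P: "is_place P"
begin

lemma place_K: "z \<in> P \<Longrightarrow> z \<in> K" and place_const: "fls_const c \<in> P"
  and place_add: "a \<in> P \<Longrightarrow> b \<in> P \<Longrightarrow> a + b \<in> P" and place_mult: "a \<in> P \<Longrightarrow> b \<in> P \<Longrightarrow> a * b \<in> P"
  and place_uminus: "a \<in> P \<Longrightarrow> - a \<in> P" and place_not_K: "P \<noteq> K"
  and place_inverse: "z \<in> K \<Longrightarrow> z \<noteq> 0 \<Longrightarrow> z \<notin> P \<Longrightarrow> inverse z \<in> P"
  using P by (auto simp: is_place_def)

lemma place_0: "0 \<in> P" and place_1: "1 \<in> P"
  using place_const[of 0] place_const[of 1] by auto

lemma place_diff: "a \<in> P \<Longrightarrow> b \<in> P \<Longrightarrow> a - b \<in> P"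
  using place_add[of a "- b"] place_uminus[of b] by simp

lemma place_power: "a \<in> P \<Longrightarrow> a ^ n \<in> P"
  by (induction n) (auto intro: place_1 place_mult)

lemma place_sum: "(\<And>i. i \<in> A \<Longrightarrow> g i \<in> P) \<Longrightarrow> sum g A \<in> P"
  by (induction A rule: infinite_finite_induct) (auto intro: place_0 place_add)

lemma max_ideal_mult: "a \<in> P \<Longrightarrow> z \<in> max_ideal P \<Longrightarrow> a * z \<in> max_ideal P"
proof -
  assume a: "a \<in> P" and z: "z \<in> max_ideal P"
  have "inverse (a * z) \<notin> P" if nz: "a * z \<noteq> 0"
  proof
    assume "inverse (a * z) \<in> P"
    then have "a * inverse (a * z) \<in> P" using a by (rule place_mult[rotated])
    moreover have "a * inverse (a * z) = inverse z" using nz by (simp add: field_simps)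
    ultimately have "inverse z \<in> P" by (simp only:)
    then show False using z nz by (auto simp: max_ideal_def)
  qed
  then show ?thesis using a z place_mult by (auto simp: max_ideal_def)
qed

lemma max_ideal_uminus: "z \<in> max_ideal P \<Longrightarrow> - z \<in> max_ideal P"
  using max_ideal_mult[OF place_uminus[OF place_1]] by fastforce

lemma max_ideal_add: "y \<in> max_ideal P \<Longrightarrow> z \<in> max_ideal P \<Longrightarrow> y + z \<in> max_ideal P"
proof -
  have *: "y + z \<in> max_ideal P"
    if "y \<in> max_ideal P" "z \<in> max_ideal P" "z \<noteq> 0" "y / z \<in> P" for y z
  proof -
    have "(1 + y / z) * z \<in> max_ideal P"
      using that by (intro max_ideal_mult place_add place_1) auto
    then show ?thesis using that(3) by (simp add: distrib_right add.commute)
  qed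
  assume y: "y \<in> max_ideal P" and z: "z \<in> max_ideal P"
  show ?thesis
  proof (cases "y = 0 \<or> z = 0")
    case False
    have "y / z \<in> K" using y z by (intro K_divide) (auto intro: place_K max_ideal_subset)
    then have "y / z \<in> P \<or> z / y \<in> P" using place_inverse[of "y / z"] False by auto
    then show ?thesis using *[of y z] *[of z y] y z False by (auto simp: add.commute)
  qed (use y z in auto)
qed

lemma max_ideal_0: "0 \<in> max_ideal P"
  by (simp add: max_ideal_def place_0)

lemma one_notin_max_ideal: "1 \<notin> max_ideal P"
  by (simp add: max_ideal_def place_1)

lemma max_ideal_prime: "a \<in> P \<Longrightarrow> b \<in> P \<Longrightarrow> a * b \<in> max_ideal P \<Longrightarrow> a \<in> max_ideal P \<or> b \<in> max_ideal P"
proof (rule ccontr)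
  assume ab: "a \<in> P" "b \<in> P" "a * b \<in> max_ideal P" and "\<not> (a \<in> max_ideal P \<or> b \<in> max_ideal P)"
  then have "a \<noteq> 0" "b \<noteq> 0" "inverse a \<in> P" "inverse b \<in> P" by (auto simp: max_ideal_def)
  then have "inverse a * inverse b * (a * b) \<in> max_ideal P"
    using ab by (intro max_ideal_mult[OF place_mult])
  moreover have "inverse a * inverse b * (a * b) = 1" using \<open>a \<noteq> 0\<close> \<open>b \<noteq> 0\<close> by (simp add: field_simps)
  ultimately show False using one_notin_max_ideal by (simp only:)
qed

lemma place_prod: "(\<And>i. i \<in> A \<Longrightarrow> g i \<in> P) \<Longrightarrow> prod g A \<in> P"
  by (induction A rule: infinite_finite_induct) (auto intro: place_1 place_mult)

lemma max_ideal_prime_prod: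
  "finite A \<Longrightarrow> (\<And>i. i \<in> A \<Longrightarrow> g i \<in> P) \<Longrightarrow> prod g A \<in> max_ideal P \<Longrightarrow> \<exists>i\<in>A. g i \<in> max_ideal P"
proof (induction A rule: finite_induct)
  case (insert a A)
  have "prod g A \<in> P" using insert by (intro place_prod) auto
  then show ?case using insert max_ideal_prime[of "g a" "prod g A"] by auto
qed (use one_notin_max_ideal in simp)

lemma inverse_in_max_ideal: "z \<in> K \<Longrightarrow> z \<notin> P \<Longrightarrow> inverse z \<in> max_ideal P"
  using place_0 place_inverse[of z] by (auto simp: max_ideal_def)

lemma has_value_place: "has_value P z c \<Longrightarrow> z \<in> P"
  using place_add[OF max_ideal_subset place_const[of c], of "z - fls_const c"] by (simp add: has_value_def)

lemma const_max_ideal: "fls_const c \<in> max_ideal P \<longleftrightarrow> c = 0"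
proof
  assume "fls_const c \<in> max_ideal P"
  then have "fls_const (inverse c) * fls_const c \<in> max_ideal P" by (intro max_ideal_mult place_const)
  then show "c = 0" using one_notin_max_ideal by (cases "c = 0") auto
qed (simp add: max_ideal_0)

lemma has_value_unique: "has_value P z c \<Longrightarrow> has_value P z d \<Longrightarrow> c = d"
proof -
  assume "has_value P z c" "has_value P z d"
  then have "(z - fls_const c) + - (z - fls_const d) \<in> max_ideal P"
    unfolding has_value_def by (intro max_ideal_add max_ideal_uminus)
  moreover have "(z - fls_const c) + - (z - fls_const d) = fls_const (d - c)"
  proof -
    have "fls_const (d - c) = fls_const d - fls_const c" by (rule fls_eqI) simp
    then show ?thesis by simp
  qed
  ultimately show "c = d" using const_max_ideal[of "d - c"] by simp
qed

lemma has_value_const: "has_value P (fls_const c) c"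
  by (simp add: has_value_def max_ideal_0)

lemma has_value_add: "has_value P y c \<Longrightarrow> has_value P z d \<Longrightarrow> has_value P (y + z) (c + d)"
  using max_ideal_add[of "y - fls_const c" "z - fls_const d"]
  by (simp add: has_value_def fls_const.h_add algebra_simps)

lemma has_value_mult: "has_value P y c \<Longrightarrow> has_value P z d \<Longrightarrow> has_value P (y * z) (c * d)"
proof -
  assume y: "has_value P y c" and z: "has_value P z d"
  have "z * (y - fls_const c) + fls_const c * (z - fls_const d) \<in> max_ideal P"
    using y z by (intro max_ideal_add max_ideal_mult place_const has_value_place[OF z]) (simp_all add: has_value_def)
  moreover have "z * (y - fls_const c) + fls_const c * (z - fls_const d) = y * z - fls_const (c * d)"
    by (simp add: algebra_simps)
  ultimately show ?thesis by (simp add: has_value_def)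
qed

lemma has_value_diff: "has_value P y c \<Longrightarrow> has_value P z d \<Longrightarrow> has_value P (y - z) (c - d)"
  using has_value_add[OF _ has_value_mult[OF has_value_const[of "-1"]], of y c z d] by simp

lemma has_value_0_iff: "has_value P z 0 \<longleftrightarrow> z \<in> max_ideal P"
  by (simp add: has_value_def)

lemma has_value_unit: "has_value P z c \<Longrightarrow> c \<noteq> 0 \<Longrightarrow> z \<noteq> 0 \<and> inverse z \<in> P"
proof -
  assume z: "has_value P z c" "c \<noteq> 0"
  have "z \<notin> max_ideal P"
  proof
    assume "z \<in> max_ideal P"
    then have "has_value P z 0" by (simp add: has_value_0_iff)
    then show False using has_value_unique z by blast
  qed
  then show ?thesis using has_value_place[OF z(1)] by (auto simp: max_ideal_def)
qed

lemma has_value_divide: "has_value P y c \<Longrightarrow> has_value P z d \<Longrightarrow> d \<noteq> 0 \<Longrightarrow> has_value P (y / z) (c / d)"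
proof -
  assume y: "has_value P y c" and z: "has_value P z d" and d: "d \<noteq> 0"
  have z0: "z \<noteq> 0" "inverse z \<in> P" using has_value_unit[OF z d] by auto
  have "inverse z * (y - z * fls_const (c / d)) \<in> max_ideal P"
    using has_value_diff[OF y has_value_mult[OF z has_value_const[of "c / d"]]] d z0(2)
    by (intro max_ideal_mult) (simp_all add: has_value_0_iff)
  then show ?thesis using z0 by (simp add: has_value_def field_simps)
qed

text \<open>Valuation rings are integrally closed: if \<open>v\<close> is not in \<open>P\<close>,
  dividing the equation by \<open>v ^ (p - 1)\<close> writes \<open>v\<close> in terms of
  \<open>inverse v\<close>, which is in \<open>P\<close>.\<close>

lemma place_integral:
  assumes v: "v \<in> K" and a: "a \<in> P" and b: "b \<in> P" and eq: "v ^ p = a * v + b"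
  shows "v \<in> P"
proof (rule ccontr)
  assume nv: "v \<notin> P"
  then have v0: "v \<noteq> 0" using place_0 by auto
  have iv: "inverse v \<in> P" using place_inverse v nv v0 by blast
  define n where "n = p - 2"
  have n: "p = Suc (Suc n)" using p_ge_2 by (simp add: n_def)
  have "v = (a * v + b) * inverse v ^ Suc n"
  proof -
    have "v ^ p * inverse v ^ Suc n = v * (v * inverse v) ^ Suc n"
      unfolding n by (simp only: power_mult_distrib power_Suc mult_ac)
    then show ?thesis unfolding eq[symmetric] using v0 by simp
  qed
  also have "\<dots> = a * inverse v ^ n + b * inverse v ^ Suc n" using v0 by (simp add: distrib_right)
  also have "\<dots> \<in> P" using a b iv by (intro place_add place_mult place_power)
  finally show False using nv by simp
qed

lemma place_power_p: "v \<in> K \<Longrightarrow> v ^ p \<in> P \<Longrightarrow> v \<in> P"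
  using place_integral[of v 0 "v ^ p"] place_0 by simp

lemma fls_eval_place: "x \<in> P \<Longrightarrow> fls_eval x a \<in> P"
  unfolding fls_const.heval_altdef by (intro place_sum place_mult place_const place_power)

lemma w_place: "x \<in> P \<Longrightarrow> w \<in> P"
  using place_integral[OF K_w place_1 fls_eval_place[of f]] w_equation by (simp add: algebra_simps)

lemma has_value_fls_eval: "has_value P x a \<Longrightarrow> has_value P (fls_eval x h) (poly h a)"
proof (induction h)
  case 0 then show ?case using has_value_const[of 0] by (simp add: fls_const.heval_0)
next
  case (pCons b h)
  then show ?case
    unfolding fls_const.heval_pCons poly_pCons by (intro has_value_add has_value_mult has_value_const) auto
qed

lemma has_value_biv:
  "has_value P x a \<Longrightarrow> has_value P w c \<Longrightarrow> has_value P (biv B) (poly (poly B [:c:]) a)"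
proof (induction B)
  case 0 then show ?case using has_value_const[of 0] by (simp add: poly.heval_0)
next
  case (pCons b B)
  have "has_value P (fls_eval x b + w * biv B) (poly b a + c * poly (poly B [:c:]) a)"
    using pCons by (intro has_value_add has_value_mult has_value_fls_eval) auto
  then show ?case by (simp add: poly.heval_pCons)
qed

text \<open>At a place where \<open>x\<close> is regular, some nonconstant polynomial in \<open>x\<close> vanishes; otherwise
  the place would contain \<open>k(x)\<close>, hence the field \<open>K\<close>, which is integral over it.\<close>

lemma finite_place_point:
  assumes x: "x \<in> P"
  shows "\<exists>a c. c ^ p - c = poly f a \<and> has_value P x a \<and> has_value P w c"
proof -
  have wP: "w \<in> P" using w_place[OF x] .
  have bP: "biv B \<in> P" for B
    unfolding poly.heval_altdef by (intro place_sum place_mult fls_eval_place x place_power wP)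
  have "\<exists>h. h \<noteq> 0 \<and> fls_eval x h \<in> max_ideal P"
  proof (rule ccontr)
    assume no: "\<not> ?thesis"
    have "K \<subseteq> P"
    proof
      fix z assume "z \<in> K"
      then obtain B h where z: "h \<noteq> 0" "z = biv B / fls_eval x h" by (rule K_obtain)
      then have "inverse (fls_eval x h) \<in> P"
        using no fls_eval_place[OF x, of h] by (auto simp: max_ideal_def)
      then show "z \<in> P" using z(2) bP[of B] by (simp add: divide_inverse place_mult)
    qed
    then show False using place_not_K place_K by blast
  qed
  then obtain h where h: "h \<noteq> 0" "fls_eval x h \<in> max_ideal P" by blast
  obtain A where A: "size A = degree h" "h = smult (lead_coeff h) (\<Prod>a\<in>#A. [:- a, 1:])"
    using alg_closed_imp_factorization[OF h(1)] by metis
  \<comment> \<open>The maximal ideal is prime, so one of the linear factors of \<open>h\<close>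
    vanishes at the place.\<close>
  have "fls_eval x (\<Prod>a\<in>#B. [:- a, 1:]) \<in> max_ideal P \<Longrightarrow> \<exists>a. has_value P x a" for B
  proof (induction B)
    case empty
    then show ?case using one_notin_max_ideal by (simp add: fls_const.heval_1)
  next
    case (add b B)
    have e: "fls_eval x [:- b, 1:] = x - fls_const b"
      by (simp add: fls_const.heval_pCons fls_const.heval_0)
    then have "(x - fls_const b) * fls_eval x (\<Prod>a\<in>#B. [:- a, 1:]) \<in> max_ideal P"
      using add.prems by (simp only: image_mset_add_mset prod_mset.add_mset fls_const.heval_mult)
    then have "x - fls_const b \<in> max_ideal P \<or> fls_eval x (\<Prod>a\<in>#B. [:- a, 1:]) \<in> max_ideal P"
      by (intro max_ideal_prime fls_eval_place place_diff x place_const)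
    then show ?case using add.IH by (auto simp: has_value_def)
  qed
  moreover have "fls_eval x (\<Prod>a\<in>#A. [:- a, 1:]) \<in> max_ideal P"
  proof -
    have "fls_const (inverse (lead_coeff h)) * fls_eval x h \<in> max_ideal P"
      using h(2) by (intro max_ideal_mult place_const)
    moreover have "fls_eval x h = fls_const (lead_coeff h) * fls_eval x (\<Prod>a\<in>#A. [:- a, 1:])"
      by (subst A(2)) (rule fls_const.heval_smult)
    ultimately show ?thesis using h(1) by (simp add: mult.assoc[symmetric])
  qed
  ultimately obtain a where a: "has_value P x a" by blast
  obtain c0 where c0: "c0 ^ p - c0 = poly f a" using ex_frob_diff_root by blast
  have "fls_eval w (frob_diff [:0,1:] - [:poly f a:]) = w ^ p - w - fls_const (poly f a)"
    by (simp add: fls_const.heval_diff fls_const.heval_power fls_const.heval_pCons fls_const.heval_0)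
  also have "\<dots> = fls_eval x f - fls_const (poly f a)" using w_equation by simp
  also have "\<dots> \<in> max_ideal P" using has_value_fls_eval[OF a, of f] by (simp add: has_value_def)
  finally have m: "fls_eval w (frob_diff [:0,1:] - [:poly f a:]) \<in> max_ideal P" .
  define F where "F = {c::'k. c ^ p = c}"
  have F: "finite F" "card F = p" using finite_frobenius_fixed card_frobenius_fixed by (simp_all add: F_def)
  \<comment> \<open>The roots of \<open>X ^ p - X = f a\<close> form the coset of one root modulo
    the prime field; primality again picks a factor \<open>w - (c0 + c)\<close>.\<close>
  have "frob_diff [:0,1:] - [:poly f a:] = (\<Prod>c\<in>F. [:- (c0 + c), 1:])"
  proof (rule poly_eqI_degree_lead_coeff[where n = p and A = "(+) c0 ` F"])
    have d: "degree (frob_diff [:0,1:] - [:poly f a:]) = p" "coeff (frob_diff [:0,1:] - [:poly f a:]) p = 1"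
    proof -
      have e: "frob_diff [:0,1:] - [:poly f a:] = monom 1 p - monom 1 1 - [:poly f a:]"
        by (simp add: monom_altdef)
      show "degree (frob_diff [:0,1:] - [:poly f a:]) = p" unfolding e by (rule monic_degree)
      then show "coeff (frob_diff [:0,1:] - [:poly f a:]) p = 1"
        using monic_degree(2)[of "poly f a"] unfolding e by simp
    qed
    have d': "degree (\<Prod>c\<in>F. [:- (c0 + c), 1:]) = p"
      using F by (subst degree_prod_eq_sum_degree) auto
    show "degree (frob_diff [:0,1:] - [:poly f a:]) \<le> p" "degree (\<Prod>c\<in>F. [:- (c0 + c), 1:]) \<le> p"
      using d d' by auto
    have "lead_coeff (\<Prod>c\<in>F. [:- (c0 + c), 1:]) = 1" by (simp add: lead_coeff_prod)
    then show "coeff (frob_diff [:0,1:] - [:poly f a:]) p = coeff (\<Prod>c\<in>F. [:- (c0 + c), 1:]) p"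
      using d d' by simp
    show "card ((+) c0 ` F) \<ge> p" using F by (simp add: card_image)
    fix z assume "z \<in> (+) c0 ` F"
    then obtain c where c: "z = c0 + c" "c \<in> F" by auto
    have "z ^ p - z = (c0 ^ p - c0) + (c ^ p - c)" by (simp add: c(1) add_power_p)
    then have "poly (frob_diff [:0,1:] - [:poly f a:]) z = 0" using c(2) c0 by (simp add: F_def)
    moreover have "poly (\<Prod>c\<in>F. [:- (c0 + c), 1:]) z = 0"
      using c F by (auto simp: poly_prod intro!: prod_zero)
    ultimately show "poly (frob_diff [:0,1:] - [:poly f a:]) z = poly (\<Prod>c\<in>F. [:- (c0 + c), 1:]) z" by simp
  qed
  moreover have "fls_eval w (\<Prod>c\<in>A. [:- (c0 + c), 1:]) = (\<Prod>c\<in>A. w - fls_const (c0 + c))" for A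
  proof -
    have lin: "fls_eval w [:- b, 1:] = w - fls_const b" for b
      by (simp add: fls_const.heval_pCons fls_const.heval_0)
    show ?thesis
      by (induction A rule: infinite_finite_induct)
        (simp_all only: prod.insert prod.empty prod.infinite fls_const.heval_1 fls_const.heval_mult lin not_False_eq_True)
  qed
  ultimately have "(\<Prod>c\<in>F. w - fls_const (c0 + c)) \<in> max_ideal P" using m by simp
  then obtain c where c: "c \<in> F" "w - fls_const (c0 + c) \<in> max_ideal P"
    using max_ideal_prime_prod[OF F(1), of "\<lambda>c. w - fls_const (c0 + c)"] place_diff[OF wP place_const] by blast
  have "(c0 + c) ^ p - (c0 + c) = (c0 ^ p - c0) + (c ^ p - c)" by (simp add: add_power_p)
  also have "\<dots> = poly f a" using c(1) c0 by (simp add: F_def)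
  finally have "(c0 + c) ^ p - (c0 + c) = poly f a" .
  then show ?thesis using a c(2) by (auto simp: has_value_def)
qed

end

section \<open>The point at infinity and the affine points\<close>

abbreviation beval :: "'k \<Rightarrow> 'k \<Rightarrow> 'k poly poly \<Rightarrow> 'k" where
  "beval a c B \<equiv> poly (poly B [:c:]) a"

definition local_ring :: "'k \<Rightarrow> 'k \<Rightarrow> 'k fls set" where
  "local_ring a c = {biv B / biv D | B D. beval a c D \<noteq> 0}"

definition place_infinity :: "'k fls set" where
  "place_infinity = {z \<in> K. z = 0 \<or> fls_subdegree z \<ge> 0}"

lemma place_infinityI: "z \<in> K \<Longrightarrow> fls_subdegree z \<ge> 0 \<Longrightarrow> z \<in> place_infinity"
  by (simp add: place_infinity_def)

lemma is_place_infinity: "is_place place_infinity"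
  unfolding is_place_def
proof (intro conjI ballI impI)
  show "range fls_const \<subseteq> place_infinity" by (auto simp: place_infinity_def K_const)
  show "a + b \<in> place_infinity" if "a \<in> place_infinity" "b \<in> place_infinity" for a b
  proof (cases "a = 0 \<or> b = 0 \<or> a + b = 0")
    case True
    then show ?thesis using that by (auto simp: place_infinity_def K_0)
  next
    case False
    then have "fls_subdegree (a + b) \<ge> min (fls_subdegree a) (fls_subdegree b)" by (intro fls_plus_subdegree) auto
    then show ?thesis using that False by (auto simp: place_infinity_def K_add)
  qed
  show "a * b \<in> place_infinity" if "a \<in> place_infinity" "b \<in> place_infinity" for a b
    using that by (cases "a = 0 \<or> b = 0") (auto simp: place_infinity_def K_mult K_0)
  have "x \<notin> place_infinity" using x_subdegree p_pos x_nonzero by (simp add: place_infinity_def)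
  then show "place_infinity \<noteq> K" using K_x by blast
qed (auto simp: place_infinity_def K_uminus K_inverse)

lemma x_notin_place_infinity: "x \<notin> place_infinity"
  using x_subdegree p_pos x_nonzero by (simp add: place_infinity_def)

text \<open>\<open>y = inverse x\<close> lies in the maximal ideal of \<open>P\<close>. An element
  regular at infinity is a sum of terms \<open>u(x) * w ^ j / h(x)\<close> that are regular there
  separately. The pole order of \<open>w\<close> is not a multiple of \<open>p\<close>, so powers of
  \<open>y\<close> cannot balance it exactly; but they balance \<open>w ^ p = w + f x\<close>, so
  the p-th power of each term lies in \<open>P\<close>, and then the term itself by
  \<open>place_power_p\<close>.\<close>

lemma place_infinity_subset:
  assumes P: "is_place P" and x: "x \<notin> P"
  shows "place_infinity \<subseteq> P"
proof
  define m where "m = degree f"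
  define y where "y = inverse x"
  have y: "y \<in> max_ideal P" unfolding y_def using inverse_in_max_ideal[OF P K_x x] .
  have yP: "y \<in> P" using y by (rule max_ideal_subset)
  have xy: "x * y = 1" using x_nonzero by (simp add: y_def)
  have xyn: "x ^ i * y ^ i = 1" for i using xy by (simp flip: power_mult_distrib)
  have poly_bound: "fls_eval x a * y ^ n \<in> P" if "degree a \<le> n" for a n
  proof -
    have "x ^ i * y ^ n = y ^ (n - i)" if "i \<le> degree a" for i
    proof -
      have "n = i + (n - i)" using that \<open>degree a \<le> n\<close> by simp
      then have "y ^ n = y ^ i * y ^ (n - i)" by (metis power_add)
      then show ?thesis using xyn[of i] by (simp flip: mult.assoc)
    qed
    then have "fls_eval x a * y ^ n = (\<Sum>i\<le>degree a. fls_const (coeff a i) * y ^ (n - i))"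
      unfolding fls_const.heval_altdef sum_distrib_right by (intro sum.cong) (auto simp: mult.assoc)
    also have "\<dots> \<in> P" by (intro place_sum[OF P] place_mult[OF P] place_const[OF P] place_power[OF P] yP)
    finally show ?thesis .
  qed
  \<comment> \<open>After multiplication by \<open>y ^ degree a\<close> only the leading coefficient
    survives modulo the maximal ideal.\<close>
  have poly_unit: "inverse (fls_eval x a * y ^ degree a) \<in> P" if "a \<noteq> 0" for a
  proof -
    have "has_value P (fls_eval x a * y ^ degree a) (lead_coeff a)"
    proof -
      obtain b where b: "a = b + monom (lead_coeff a) (degree a)" "b = 0 \<or> degree b < degree a"
      proof
        show "a = (a - monom (lead_coeff a) (degree a)) + monom (lead_coeff a) (degree a)" by simp
        show "a - monom (lead_coeff a) (degree a) = 0 \<or> degree (a - monom (lead_coeff a) (degree a)) < degree a"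
        proof (cases "degree a = 0")
          case True
          then show ?thesis by (metis degree_0_id cancel_comm_monoid_add_class.diff_cancel monom_0)
        next
          case False
          then have "degree (a - monom (lead_coeff a) (degree a)) < degree a"
            by (intro degree_lessI) (auto simp: coeff_eq_0)
          then show ?thesis by simp
        qed
      qed
      have "fls_eval x b * y ^ degree a \<in> max_ideal P"
      proof (cases "b = 0")
        case False
        then have lt: "degree b < degree a" using b(2) by simp
        then have "degree b \<le> degree a - 1" by simp
        then have "y * (fls_eval x b * y ^ (degree a - 1)) \<in> P" "fls_eval x b * y ^ (degree a - 1) \<in> P"
          using poly_bound yP by (auto intro: place_mult[OF P])
        then have "(fls_eval x b * y ^ (degree a - 1)) * y \<in> max_ideal P"
          by (intro max_ideal_mult[OF P] y)
        moreover have "(fls_eval x b * y ^ (degree a - 1)) * y = fls_eval x b * y ^ degree a"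
          using lt by (cases "degree a") (auto simp: mult_ac)
        ultimately show ?thesis by (simp only:)
      qed (simp add: fls_const.heval_0 max_ideal_0[OF P])
      moreover have "fls_eval x a * y ^ degree a - fls_const (lead_coeff a) = fls_eval x b * y ^ degree a"
        by (subst b(1)) (simp add: fls_const.heval_add fls_const.heval_monom distrib_right mult.assoc xyn)
      ultimately show ?thesis unfolding has_value_def by simp
    qed
    from has_value_unit[OF P this] that show ?thesis by (simp del: inverse_mult_distrib)
  qed
  have f_bound: "fls_eval x f * y ^ m \<in> P" by (rule poly_bound) (simp add: m_def)
  define v where "v = w * y ^ m"
  have yK: "y \<in> K" by (simp add: y_def K_inverse K_x)
  define q where "q = p - 1"
  have q: "p = Suc q" using p_pos by (simp add: q_def)
  \<comment> \<open>\<open>w * y ^ m\<close> overcompensates the pole of \<open>w\<close>, but it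
    satisfies a monic equation over \<open>P\<close>; consequently \<open>w ^ p * y ^ m\<close> is
    in \<open>P\<close> as well.\<close>
  have vP: "v \<in> P"
  proof (rule place_integral[OF P])
    show "v \<in> K" by (simp add: v_def K_mult K_w K_power yK)
    have "v ^ p = w ^ p * y ^ (m * p)" by (simp add: v_def power_mult_distrib power_mult)
    also have "w ^ p = w + fls_eval x f" using w_equation by (simp add: algebra_simps)
    also have "(w + fls_eval x f) * y ^ (m * p) = y ^ (m * q) * v + (fls_eval x f * y ^ m) * y ^ (m * q)"
      by (simp add: v_def q power_add algebra_simps)
    finally show "v ^ p = y ^ (m * q) * v + (fls_eval x f * y ^ m) * y ^ (m * q)" .
  qed (intro place_mult[OF P] place_power[OF P] yP f_bound)+
  have sP: "(w + fls_eval x f) * y ^ m \<in> P"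
    unfolding distrib_right using vP f_bound by (intro place_add[OF P]) (simp_all add: v_def)
  fix z assume z: "z \<in> place_infinity"
  show "z \<in> P"
  proof (cases "z = 0")
    case True then show ?thesis using place_0[OF P] by simp
  next
    case False
    obtain B h where B: "h \<noteq> 0" "z = biv B / fls_eval x h"
      using z K_obtain by (metis (no_types, lifting) mem_Collect_eq place_infinity_def)
    obtain R where R: "biv B = biv R" "degree R < p" using ex_biv_reduced by blast
    have bnz: "biv R \<noteq> 0" using False B R by auto
    have "fls_subdegree z = fls_subdegree (biv R) + int (p * degree h)"
      using B bnz R fls_eval_subdegree[OF x_neg B(1)] by (simp add: fls_divide_subdegree x_subdegree)
    then have sd: "fls_subdegree (biv R) \<ge> - int (p * degree h)" using z False by (simp add: place_infinity_def)
    have trm: "fls_eval x (coeff R j) * w ^ j / fls_eval x h \<in> P" for j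
    proof (cases "coeff R j = 0")
      case True then show ?thesis using place_0[OF P] by (simp add: fls_const.heval_0)
    next
      case False
      define d where "d = degree (coeff R j)"
      have "fls_subdegree (biv R) \<le> - int (p * d + m * j)"
        unfolding d_def m_def by (rule biv_reduced_coeff(2)[OF R(2) False])
      then have "p * d + m * j \<le> p * degree h" using sd by linarith
      \<comment> \<open>The slack between the pole order allowed by \<open>h\<close> and that of the
        term becomes a spare power of \<open>y\<close>.\<close>
      then obtain e where e: "p * degree h = p * d + m * j + e" using le_Suc_ex by blast
      let ?u = "fls_eval x (coeff R j)" and ?h = "fls_eval x h" and ?s = "w + fls_eval x f"
      have hnz: "?h \<noteq> 0" using B(1) by simp
      have ynz: "y \<noteq> 0" using xy by auto
      show ?thesis
      proof (rule place_power_p[OF P])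
        show "?u * w ^ j / ?h \<in> K" by (intro K_divide K_mult K_eval K_power K_w)
        have "(?u * w ^ j / ?h) ^ p = ?u ^ p * (w ^ p) ^ j / ?h ^ p"
          by (simp add: power_mult_distrib power_divide mult.commute flip: power_mult)
        also have "w ^ p = ?s" using w_equation by (simp add: algebra_simps)
        also have "?u ^ p * ?s ^ j / ?h ^ p = (?u ^ p * ?s ^ j * y ^ (p * d + m * j + e)) / (?h ^ p * y ^ (p * degree h))"
          unfolding e using ynz by simp
        also have "\<dots> = (?u * y ^ d) ^ p * (?s * y ^ m) ^ j * y ^ e * inverse (?h * y ^ degree h) ^ p"
        proof -
          have "(?u * y ^ d) ^ p = ?u ^ p * y ^ (p * d)" "(?s * y ^ m) ^ j = ?s ^ j * y ^ (m * j)"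
            and hp: "(?h * y ^ degree h) ^ p = ?h ^ p * y ^ (p * degree h)"
            by (simp_all add: power_mult_distrib mult.commute flip: power_mult)
          moreover have "inverse (?h * y ^ degree h) ^ p = inverse (?h ^ p * y ^ (p * degree h))"
            by (simp only: power_inverse hp)
          ultimately show ?thesis by (simp only: power_add divide_inverse mult_ac)
        qed
        finally have eq: "(?u * w ^ j / ?h) ^ p = (?u * y ^ d) ^ p * (?s * y ^ m) ^ j * y ^ e * inverse (?h * y ^ degree h) ^ p" .
        have "?u * y ^ d \<in> P" by (rule poly_bound) (simp add: d_def)
        then have "(?u * y ^ d) ^ p \<in> P" by (rule place_power[OF P])
        moreover have "(?s * y ^ m) ^ j \<in> P" by (rule place_power[OF P sP])
        moreover have "y ^ e \<in> P" by (rule place_power[OF P yP])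
        moreover have "inverse (?h * y ^ degree h) ^ p \<in> P" by (rule place_power[OF P poly_unit[OF B(1)]])
        ultimately show "(?u * w ^ j / ?h) ^ p \<in> P"
          unfolding eq by (rule place_mult[OF P place_mult[OF P place_mult[OF P]]])
      qed
    qed
    have "biv R = (\<Sum>j<p. fls_eval x (coeff R j) * w ^ j)" by (rule poly.heval_altdef'[OF R(2)])
    then have "z = (\<Sum>j<p. fls_eval x (coeff R j) * w ^ j / fls_eval x h)"
      using B(2) R(1) by (simp add: sum_divide_distrib)
    then show ?thesis using place_sum[OF P, of "{..<p}"] trm by simp
  qed
qed

text \<open>The valuation ring at infinity is maximal: an element \<open>z\<close> of
  \<open>P\<close> with a pole there would put every \<open>u = (u / z ^ N) * z ^ N\<close> into
  \<open>P\<close>, for \<open>N\<close> large.\<close>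

lemma place_infinity_unique:
  assumes P: "is_place P" and x: "x \<notin> P"
  shows "P = place_infinity"
proof
  note sub = place_infinity_subset[OF assms]
  show "place_infinity \<subseteq> P" by (rule sub)
  show "P \<subseteq> place_infinity"
  proof (rule ccontr)
    assume "\<not> P \<subseteq> place_infinity"
    then obtain z where "z \<in> P" "z \<notin> place_infinity" by blast
    then have z: "z \<in> P" "z \<noteq> 0" "fls_subdegree z < 0"
      using place_K[OF P] by (auto simp: place_infinity_def)
    have "K \<subseteq> P"
    proof
      fix u assume u: "u \<in> K"
      define N where "N = nat \<bar>fls_subdegree u\<bar>"
      have "u / z ^ N \<in> place_infinity"
      proof (cases "u = 0")
        case False
        have "int N * 1 \<le> int N * (- fls_subdegree z)" using z(3) by (intro mult_left_mono) auto
        then have "fls_subdegree u - int N * fls_subdegree z \<ge> 0" by (simp add: N_def)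
        then have "fls_subdegree (u / z ^ N) \<ge> 0" using False z(2) by (simp add: fls_divide_subdegree fls_subdegree_pow)
        then show ?thesis using u z place_K[OF P] by (intro place_infinityI K_divide K_power)
      qed (simp add: place_infinity_def K_0)
      then have "u / z ^ N * z ^ N \<in> P" using sub z by (intro place_mult[OF P] place_power[OF P]) auto
      then show "u \<in> P" using z by simp
    qed
    then show False using place_not_K[OF P] place_K[OF P] by blast
  qed
qed

definition on_curve :: "'k \<Rightarrow> 'k \<Rightarrow> bool" where
  "on_curve a c \<longleftrightarrow> c ^ p - c = poly f a"

text \<open>\<open>biv\<close> determines a polynomial modulo \<open>as_biv\<close>, and
  \<open>as_biv\<close> vanishes at the points of the curve; so the value at a point is well defined
  on functions.\<close>

lemma beval_unique: "on_curve a c \<Longrightarrow> biv B = biv D \<Longrightarrow> beval a c B = beval a c D"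
proof -
  assume c: "on_curve a c" and e: "biv B = biv D"
  then have "biv (B - D) = 0" by (simp add: poly.heval_diff)
  then obtain S where "B - D = as_biv * S" using biv_eq_0_imp_dvd by (auto elim: dvdE)
  moreover have "beval a c as_biv = 0"
    using c by (simp add: as_biv_def on_curve_def poly_monom flip: poly_const_pow)
  ultimately have "beval a c (B - D) = 0" by simp
  then show ?thesis by simp
qed

lemma biv_X: "biv [:[:0, 1:]:] = x" and biv_W: "biv [:0, 1:] = w" and biv_eval: "biv [:h:] = fls_eval x h"
  by (simp_all add: poly.heval_pCons poly.heval_0 poly.h_0 poly.h_1 fls_const.heval_pCons fls_const.heval_0)

text \<open>\<open>x - a\<close> is a uniformizer at \<open>(a, c)\<close>, as \<open>(w - c) ((w - c) ^ (p - 1) - 1) = f x - f a\<close>.\<close>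

lemma biv_divide_uniformizer:
  assumes c: "on_curve a c" and B: "beval a c B = 0"
  shows "\<exists>C D. beval a c D \<noteq> 0 \<and> biv B = (x - fls_const a) * biv C / biv D"
proof -
  have "[:- [:c:], 1:] dvd B - [:poly B [:c:]:]" unfolding poly_eq_0_iff_dvd[symmetric] by simp
  then obtain B2 where B2: "B - [:poly B [:c:]:] = [:- [:c:], 1:] * B2" by (rule dvdE)
  have "[:- a, 1:] dvd poly B [:c:]" using B unfolding poly_eq_0_iff_dvd .
  then obtain h1 where h1: "poly B [:c:] = [:- a, 1:] * h1" by (rule dvdE)
  have "[:- a, 1:] dvd f - [:poly f a:]" unfolding poly_eq_0_iff_dvd[symmetric] by simp
  then obtain g where g: "f - [:poly f a:] = [:- a, 1:] * g" by (rule dvdE)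
  define q where "q = p - 2"
  have q: "p = Suc (Suc q)" using p_ge_2 by (simp add: q_def)
  define U :: "'k poly poly" where "U = [:- [:c:], 1:] ^ Suc q - 1"
  have bc: "biv [:- [:c:], 1:] = w - fls_const c"
    by (simp add: poly.heval_pCons poly.heval_0 poly.h_1 poly.heval_1 fls_const.heval_minus fls_const.heval_const fls_const.heval_1)
  have U: "beval a c U = - 1" by (simp add: U_def)
  have xa: "fls_eval x [:- a, 1:] = x - fls_const a" by (simp add: fls_const.heval_pCons fls_const.heval_0)
  have fp: "(w - fls_const c) ^ p = w ^ p - fls_const (c ^ p)"
  proof -
    have fd: "(u + v) ^ p = u ^ p + v ^ p" for u v :: "'k fls"
      using freshmans_dream[where ?'a="'k fls"] prime_p CHAR_eq by simp
    have "(w + fls_const (- c)) ^ p = w ^ p + fls_const (- c) ^ p" by (rule fd)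
    moreover have "fls_const (- c) ^ p = fls_const (- (c ^ p))" by (simp only: minus_power_p fls_const_power[symmetric])
    ultimately show ?thesis by simp
  qed
  have "(w - fls_const c) * biv U = (w - fls_const c) ^ p - (w - fls_const c)"
  proof -
    have bU: "biv U = (w - fls_const c) ^ Suc q - 1"
      by (simp only: U_def poly.heval_diff poly.heval_power poly.heval_1 bc)
    show ?thesis unfolding bU q by (simp only: right_diff_distrib power_Suc mult_1_right)
  qed
  also have "\<dots> = fls_eval x f - fls_const (poly f a)"
  proof -
    have "fls_const (poly f a) = fls_const (c ^ p) - fls_const c"
      using c unfolding on_curve_def by (intro fls_eqI) auto
    then show ?thesis using w_equation by (simp add: fp algebra_simps)
  qed
  also have "\<dots> = fls_eval x (f - [:poly f a:])" by (simp add: fls_const.heval_diff fls_const.heval_const)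
  also have "\<dots> = (x - fls_const a) * fls_eval x g" unfolding g fls_const.heval_mult xa ..
  finally have wc: "(w - fls_const c) * biv U = (x - fls_const a) * fls_eval x g" .
  have Unz: "biv U \<noteq> 0"
  proof
    assume "biv U = 0"
    then have "beval a c U = beval a c 0" by (intro beval_unique[OF c]) (simp add: poly.heval_0)
    then show False using U by simp
  qed
  have "B = [:- [:c:], 1:] * B2 + [:[:- a, 1:] * h1:]" using B2 h1 by (metis diff_add_cancel)
  then have "biv B = (w - fls_const c) * biv B2 + (x - fls_const a) * fls_eval x h1"
    by (simp only: poly.heval_add poly.heval_mult bc biv_eval fls_const.heval_mult xa)
  then have "biv B * biv U = (x - fls_const a) * (fls_eval x g * biv B2 + fls_eval x h1 * biv U)"
  proof -
    assume e: "biv B = (w - fls_const c) * biv B2 + (x - fls_const a) * fls_eval x h1"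
    have "biv B * biv U = ((w - fls_const c) * biv U) * biv B2 + (x - fls_const a) * fls_eval x h1 * biv U"
      unfolding e by (simp only: distrib_right) (simp only: mult_ac)
    then show ?thesis unfolding wc by (simp only: distrib_left) (simp only: mult_ac)
  qed
  also have "fls_eval x g * biv B2 + fls_eval x h1 * biv U = biv (smult g B2 + smult h1 U)"
    by (simp add: poly.heval_add poly.heval_smult)
  finally have "biv B = (x - fls_const a) * biv (smult g B2 + smult h1 U) / biv U"
    using Unz by (simp add: eq_divide_eq)
  then show ?thesis using U by (metis neg_equal_0_iff_equal zero_neq_one)
qed

lemma beval_nonzero_imp: "on_curve a c \<Longrightarrow> beval a c D \<noteq> 0 \<Longrightarrow> biv D \<noteq> 0"
  using beval_unique[of a c D 0] by (auto simp: poly.heval_0)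

lemma x_minus_const_nonzero: "x - fls_const a \<noteq> 0"
proof
  assume "x - fls_const a = 0"
  then have "x = fls_const a" by simp
  then show False using x_subdegree p_pos by simp
qed

lemma biv_x_minus: "biv [:[:- a, 1:]:] = x - fls_const a"
  unfolding biv_eval by (simp add: fls_const.heval_pCons fls_const.heval_0)

text \<open>The uniformizer \<open>x - a\<close> is extracted as long as possible. This stops
  because some multiple of \<open>biv B\<close> by a polynomial in \<open>x\<close> and
  \<open>w\<close> is a polynomial \<open>h(x)\<close>, and the multiplicity of \<open>a\<close> as
  a root of \<open>h\<close> bounds the exponent.\<close>

lemma biv_unit_form:
  assumes c: "on_curve a c" and B: "biv B \<noteq> 0"
  shows "\<exists>n C D. beval a c C \<noteq> 0 \<and> beval a c D \<noteq> 0 \<and> biv B = (x - fls_const a) ^ n * biv C / biv D"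
proof -
  let ?t = "x - fls_const a"
  define Q where "Q = (\<lambda>n. \<exists>C D. beval a c D \<noteq> 0 \<and> biv B = ?t ^ n * biv C / biv D)"
  obtain G h where G: "h \<noteq> 0" "inverse (biv B) = biv G / fls_eval x h"
    using K_obtain[OF K_inverse[OF biv_in_K]] by metis
  obtain l h1 where h1: "h = [:- a, 1:] ^ l * h1" "\<not> [:- a, 1:] dvd h1"
    using order_decomp[OF G(1), of a] by blast
  then have h1a: "poly h1 a \<noteq> 0" by (simp add: poly_eq_0_iff_dvd)
  have bound: "n \<le> l" if n: "Q n" for n
  proof (rule ccontr)
    assume "\<not> n \<le> l"
    then obtain k where k: "n = l + Suc k" by (metis add_Suc_right less_imp_Suc_add not_le)
    obtain C D where D: "beval a c D \<noteq> 0" "biv B = ?t ^ n * biv C / biv D" using n by (auto simp: Q_def)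
    have Dnz: "biv D \<noteq> 0" using beval_nonzero_imp[OF c D(1)] .
    have "biv B * biv G = fls_eval x h" using G B by (simp add: field_simps)
    then have "?t ^ n * biv C * biv G = fls_eval x h * biv D" using D(2) Dnz by (simp add: field_simps)
    moreover have "fls_eval x h = ?t ^ l * fls_eval x h1"
      unfolding h1(1) by (simp add: fls_const.heval_mult fls_const.heval_power fls_const.heval_pCons fls_const.heval_0 del: mult_pCons_left)
    ultimately have "?t ^ l * (?t ^ Suc k * biv C * biv G) = ?t ^ l * (fls_eval x h1 * biv D)"
      by (simp only: k power_add mult.assoc)
    then have "?t ^ Suc k * biv C * biv G = fls_eval x h1 * biv D"
      using x_minus_const_nonzero[of a] by simp
    moreover have "biv ([:[:- a, 1:]:] ^ Suc k * C * G) = ?t ^ Suc k * biv C * biv G"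
      by (simp only: poly.heval_mult poly.heval_power biv_x_minus)
    moreover have "biv ([:h1:] * D) = fls_eval x h1 * biv D" by (simp only: poly.heval_mult biv_eval)
    ultimately have "biv ([:[:- a, 1:]:] ^ Suc k * C * G) = biv ([:h1:] * D)" by (simp only:)
    then have "beval a c ([:[:- a, 1:]:] ^ Suc k * C * G) = beval a c ([:h1:] * D)"
      by (rule beval_unique[OF c])
    then show False using h1a D(1) by simp
  qed
  have "Q 0" unfolding Q_def by (intro exI[of _ B] exI[of _ 1]) (simp add: poly.heval_1)
  then have "\<exists>n. Q n \<and> (\<forall>n'. Q n' \<longrightarrow> n' \<le> n)" using bound by (intro Nat.ex_has_greatest_nat[of Q 0 l]) auto
  then obtain n where n: "Q n" "\<And>n'. Q n' \<Longrightarrow> n' \<le> n" by blast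
  obtain C D where D: "beval a c D \<noteq> 0" "biv B = ?t ^ n * biv C / biv D" using n(1) by (auto simp: Q_def)
  have "beval a c C \<noteq> 0"
  proof
    assume "beval a c C = 0"
    then obtain C' D' where C': "beval a c D' \<noteq> 0" "biv C = ?t * biv C' / biv D'"
      using biv_divide_uniformizer[OF c] by blast
    have "biv B = ?t ^ Suc n * biv C' / biv (D' * D)"
      using D(2) C'(2) by (simp add: poly.heval_mult mult_ac)
    moreover have "beval a c (D' * D) \<noteq> 0" using D(1) C'(1) by simp
    ultimately have "Q (Suc n)" unfolding Q_def by blast
    then show False using n(2) by fastforce
  qed
  then show ?thesis using D by blast
qed

lemma K_unit_form:
  assumes c: "on_curve a c" and z: "z \<in> K" "z \<noteq> 0"
  shows "\<exists>C D. beval a c C \<noteq> 0 \<and> beval a c D \<noteq> 0 \<and>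
    ((\<exists>n. z = (x - fls_const a) ^ n * biv C / biv D) \<or> (\<exists>n. z = biv C / ((x - fls_const a) ^ Suc n * biv D)))"
proof -
  let ?t = "x - fls_const a"
  have t: "?t \<noteq> 0" by (rule x_minus_const_nonzero)
  obtain B h where B: "h \<noteq> 0" "z = biv B / fls_eval x h" using K_obtain[OF z(1)] .
  have "biv B \<noteq> 0" using z(2) B by auto
  then obtain n C D where C: "beval a c C \<noteq> 0" "beval a c D \<noteq> 0" "biv B = ?t ^ n * biv C / biv D"
    using biv_unit_form[OF c] by blast
  have "biv [:h:] \<noteq> 0" using B(1) by (simp only: biv_eval) simp
  then obtain n' C' D' where C': "beval a c C' \<noteq> 0" "beval a c D' \<noteq> 0" "biv [:h:] = ?t ^ n' * biv C' / biv D'"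
    using biv_unit_form[OF c] by blast
  have nz: "biv C \<noteq> 0" "biv D \<noteq> 0" "biv C' \<noteq> 0" "biv D' \<noteq> 0" using C C' beval_nonzero_imp[OF c] by auto
  have "z = (?t ^ n * biv C / biv D) / (?t ^ n' * biv C' / biv D')" using B C C' by (simp only: biv_eval)
  then have ze: "z = (?t ^ n * biv (C * D')) / (?t ^ n' * biv (D * C'))"
    by (simp add: poly.heval_mult mult_ac)
  have b: "beval a c (C * D') \<noteq> 0" "beval a c (D * C') \<noteq> 0" using C C' by auto
  show ?thesis
  proof (cases "n' \<le> n")
    case True
    then obtain k where "n = n' + k" using le_Suc_ex by blast
    then have "z = ?t ^ k * biv (C * D') / biv (D * C')" using ze t by (simp add: power_add mult.assoc)
    then show ?thesis using b by blast
  next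
    case False
    then obtain k where "n' = n + Suc k" by (metis add_Suc_right less_imp_Suc_add not_le)
    then have "z = biv (C * D') / (?t ^ Suc k * biv (D * C'))" using ze t by (simp add: power_add mult.assoc)
    then show ?thesis using b by blast
  qed
qed

lemma local_ringI: "beval a c D \<noteq> 0 \<Longrightarrow> biv B / biv D \<in> local_ring a c"
  by (auto simp: local_ring_def)

lemma local_ring_biv: "biv B \<in> local_ring a c"
  using local_ringI[where D = 1 and B = B] by (simp add: poly.heval_1)

lemma inverse_x_minus_notin:
  assumes c: "on_curve a c" and B: "beval a c B = 0" "biv B \<noteq> 0"
  shows "inverse (biv B) \<notin> local_ring a c"
proof
  assume "inverse (biv B) \<in> local_ring a c"
  then obtain C D where D: "beval a c D \<noteq> 0" "inverse (biv B) = biv C / biv D" by (auto simp: local_ring_def)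
  then have "biv D = biv (B * C)"
    using B(2) beval_nonzero_imp[OF c D(1)] by (simp add: poly.heval_mult field_simps)
  then have "beval a c D = beval a c (B * C)" by (rule beval_unique[OF c])
  then show False using B(1) D(1) by simp
qed

lemma is_place_local_ring:
  assumes c: "on_curve a c" shows "is_place (local_ring a c)"
  unfolding is_place_def
proof (intro conjI ballI impI)
  show "local_ring a c \<subseteq> K" by (auto simp: local_ring_def intro: K_divide biv_in_K)
  show "range fls_const \<subseteq> local_ring a c"
    using local_ring_biv[of "[:[:_:]:]"] by (auto simp: biv_eval fls_const.heval_const)
  fix u assume "u \<in> local_ring a c"
  then obtain B D where u: "u = biv B / biv D" "beval a c D \<noteq> 0" by (auto simp: local_ring_def)
  have "- u = biv (- B) / biv D" using u by (simp add: poly.heval_minus)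
  then show "- u \<in> local_ring a c" using local_ringI[OF u(2)] by simp
  fix v assume "v \<in> local_ring a c"
  then obtain B' D' where v: "v = biv B' / biv D'" "beval a c D' \<noteq> 0" by (auto simp: local_ring_def)
  have nz: "biv D \<noteq> 0" "biv D' \<noteq> 0" using u v beval_nonzero_imp[OF c] by auto
  have d: "beval a c (D * D') \<noteq> 0" using u v by simp
  have "u + v = biv (B * D' + B' * D) / biv (D * D')"
    using nz by (simp add: u v poly.heval_add poly.heval_mult field_simps)
  then show "u + v \<in> local_ring a c" using local_ringI[OF d] by simp
  have "u * v = biv (B * B') / biv (D * D')" using nz by (simp add: u v poly.heval_mult)
  then show "u * v \<in> local_ring a c" using local_ringI[OF d] by simp
next
  have "inverse (biv [:[:- a, 1:]:]) \<notin> local_ring a c"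
    by (rule inverse_x_minus_notin[OF c]) (use x_minus_const_nonzero biv_x_minus in auto)
  moreover have "inverse (biv [:[:- a, 1:]:]) \<in> K" by (intro K_inverse biv_in_K)
  ultimately show "local_ring a c \<noteq> K" by blast
next
  fix z assume z: "z \<in> K" "z \<noteq> 0"
  let ?t = "x - fls_const a"
  obtain C D where C: "beval a c C \<noteq> 0" "beval a c D \<noteq> 0"
    "(\<exists>n. z = ?t ^ n * biv C / biv D) \<or> (\<exists>n. z = biv C / (?t ^ Suc n * biv D))"
    using K_unit_form[OF c z] by blast
  from C(3) show "z \<in> local_ring a c \<or> inverse z \<in> local_ring a c"
  proof (elim disjE exE)
    fix n assume "z = ?t ^ n * biv C / biv D"
    then have "z = biv ([:[:- a, 1:]:] ^ n * C) / biv D"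
      by (simp only: poly.heval_mult poly.heval_power biv_x_minus)
    then show ?thesis using local_ringI[OF C(2)] by simp
  next
    fix n assume "z = biv C / (?t ^ Suc n * biv D)"
    then have "inverse z = biv ([:[:- a, 1:]:] ^ Suc n * D) / biv C"
      by (simp only: poly.heval_mult poly.heval_power biv_x_minus inverse_divide)
    then show ?thesis using local_ringI[OF C(1)] by simp
  qed
qed

lemma has_value_local_ring:
  assumes c: "on_curve a c" and D: "beval a c D \<noteq> 0"
  shows "has_value (local_ring a c) (biv B / biv D) (beval a c B / beval a c D)"
proof -
  note P = is_place_local_ring[OF c]
  have *: "has_value (local_ring a c) (biv B) (beval a c B)" for B
  proof -
    have "biv (B - [:[:beval a c B:]:]) = biv B - fls_const (beval a c B)"
      by (simp only: poly.heval_diff biv_eval fls_const.heval_const)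
    moreover have "beval a c (B - [:[:beval a c B:]:]) = 0" by simp
    moreover have "biv (B - [:[:beval a c B:]:]) \<in> local_ring a c" by (rule local_ring_biv)
    ultimately show ?thesis
      using inverse_x_minus_notin[OF c, of "B - [:[:beval a c B:]:]"] unfolding has_value_def max_ideal_def by auto
  qed
  show ?thesis using has_value_divide[OF P * * D] .
qed

lemma has_value_x_local_ring: "on_curve a c \<Longrightarrow> has_value (local_ring a c) x a"
  and has_value_w_local_ring: "on_curve a c \<Longrightarrow> has_value (local_ring a c) w c"
  using has_value_local_ring[of a c 1 "[:[:0, 1:]:]"] has_value_local_ring[of a c 1 "[:0, 1:]"]
  by (simp_all only: biv_X biv_W poly.heval_1) simp_all

text \<open>Polynomials in \<open>x\<close> and \<open>w\<close> that are nonzero at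
  \<open>(a, c)\<close> are units of \<open>P\<close>, which gives one inclusion. Conversely, a
  negative power of \<open>x - a\<close> in \<open>P\<close> would make an element of the maximal
  ideal invertible.\<close>

lemma finite_place_eq_local_ring:
  assumes P: "is_place P" and x: "has_value P x a" and w: "has_value P w c" and c: "on_curve a c"
  shows "P = local_ring a c"
proof
  let ?t = "x - fls_const a"
  have unit: "inverse (biv D) \<in> P" "biv D \<in> P" if "beval a c D \<noteq> 0" for D
    using has_value_unit[OF P has_value_biv[OF P x w] that] has_value_place[OF P has_value_biv[OF P x w]] by auto
  show "local_ring a c \<subseteq> P"
    using has_value_place[OF P has_value_biv[OF P x w]] unit
    by (auto simp: local_ring_def divide_inverse intro!: place_mult[OF P])
  show "P \<subseteq> local_ring a c"
  proof
    fix z assume z: "z \<in> P"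
    show "z \<in> local_ring a c"
    proof (cases "z = 0")
      case True then show ?thesis using local_ring_biv[of 0] by (simp add: poly.heval_0)
    next
      case False
      obtain C D where C: "beval a c C \<noteq> 0" "beval a c D \<noteq> 0"
        "(\<exists>n. z = ?t ^ n * biv C / biv D) \<or> (\<exists>n. z = biv C / (?t ^ Suc n * biv D))"
        using K_unit_form[OF c place_K[OF P z] False] by blast
      from C(3) show ?thesis
      proof (elim disjE exE)
        fix n assume "z = ?t ^ n * biv C / biv D"
        then have "z = biv ([:[:- a, 1:]:] ^ n * C) / biv D"
          by (simp only: poly.heval_mult poly.heval_power biv_x_minus)
        then show ?thesis using local_ringI[OF C(2)] by simp
      next
        fix n assume ze: "z = biv C / (?t ^ Suc n * biv D)"
        have nz: "biv C \<noteq> 0" "biv D \<noteq> 0" "?t \<noteq> 0"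
          using C beval_nonzero_imp[OF c] x_minus_const_nonzero by auto
        have "(z * biv D * inverse (biv C) * ?t ^ n) * ?t \<in> max_ideal P"
        proof (intro max_ideal_mult[OF P] place_mult[OF P] z unit C place_power[OF P])
          show "?t \<in> max_ideal P" using x by (simp add: has_value_def)
          then show "?t \<in> P" by (rule max_ideal_subset)
        qed
        moreover have "(z * biv D * inverse (biv C) * ?t ^ n) * ?t = 1" using nz ze by (simp add: field_simps)
        ultimately show ?thesis using one_notin_max_ideal[OF P] by (simp only:)
      qed
    qed
  qed
qed

section \<open>Classification of the places, poles and regular functions\<close>

lemma place_cases:
  assumes "is_place P"
  obtains "P = place_infinity" "x \<notin> P" | a c where "on_curve a c" "P = local_ring a c" "x \<in> P"
  using finite_place_point[OF assms] finite_place_eq_local_ring[OF assms] place_infinity_unique[OF assms]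
  unfolding on_curve_def by metis

lemma finite_places_value:
  assumes "is_place P" "x \<in> P" "z \<in> P" shows "\<exists>d. has_value P z d"
proof -
  obtain a c where "on_curve a c" "P = local_ring a c"
    using place_cases[OF assms(1)] assms(2) by metis
  then show ?thesis using has_value_local_ring[of a c] assms(3) by (auto simp: local_ring_def)
qed

text \<open>Poles lie at infinity or above the roots of a denominator \<open>h\<close>, and each
  fibre is finite.\<close>

lemma finite_poles:
  assumes z: "z \<in> K" shows "finite {P. is_place P \<and> z \<notin> P}"
proof -
  obtain B h where B: "h \<noteq> 0" "z = biv B / fls_eval x h" using K_obtain[OF z] .
  define S where "S = (SIGMA a:{a. poly h a = 0}. {c. on_curve a c})"
  have "finite {c. on_curve a c}" for a
  proof -
    have "frob_diff [:0, 1:] - [:poly f a:] \<noteq> 0"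
    proof -
      have e: "frob_diff [:0,1:] - [:poly f a:] = monom 1 p - monom 1 1 - [:poly f a:]" by (simp add: monom_altdef)
      show ?thesis using monic_degree(1)[of "poly f a"] p_pos unfolding e by auto
    qed
    then have "finite {c. poly (frob_diff [:0, 1:] - [:poly f a:]) c = 0}" by (rule poly_roots_finite)
    then show ?thesis by (simp add: on_curve_def)
  qed
  then have "finite S" using B(1) by (simp add: S_def poly_roots_finite)
  moreover have "{P. is_place P \<and> z \<notin> P} \<subseteq> insert place_infinity ((\<lambda>(a, c). local_ring a c) ` S)"
  proof
    fix P assume "P \<in> {P. is_place P \<and> z \<notin> P}"
    then have P: "is_place P" "z \<notin> P" by auto
    show "P \<in> insert place_infinity ((\<lambda>(a, c). local_ring a c) ` S)"
    proof (cases "x \<in> P")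
      case False
      then show ?thesis using place_infinity_unique[OF P(1)] by simp
    next
      case True
      then obtain a c where c: "on_curve a c" "P = local_ring a c" using place_cases[OF P(1)] by metis
      have "beval a c [:h:] = 0"
      proof (rule ccontr)
        assume "beval a c [:h:] \<noteq> 0"
        moreover have "z = biv B / biv [:h:]" using B(2) by (simp only: biv_eval)
        ultimately show False using local_ringI c(2) P(2) by metis
      qed
      then have "(a, c) \<in> S" using c(1) by (simp add: S_def)
      then show ?thesis using c(2) by force
    qed
  qed
  ultimately show ?thesis by (meson finite_imageI finite_insert finite_subset)
qed

lemma infinite_places: "infinite {P. is_place P}"
proof
  assume fin: "finite {P. is_place P}"
  have "\<exists>P. is_place P \<and> has_value P x a" for a
  proof -
    obtain c where "on_curve a c" using ex_frob_diff_root[of "poly f a"] by (auto simp: on_curve_def)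
    then show ?thesis using is_place_local_ring has_value_x_local_ring by blast
  qed
  then obtain F where F: "\<And>a. is_place (F a)" "\<And>a. has_value (F a) x a" by metis
  have "inj F" using F has_value_unique by (metis injI)
  moreover have "range F \<subseteq> {P. is_place P}" using F by auto
  ultimately show False using fin infinite_UNIV_k by (meson finite_imageD finite_subset)
qed

lemma zero_if_infinite_zeros:
  assumes z: "z \<in> K" and S: "infinite S" "\<And>P. P \<in> S \<Longrightarrow> is_place P \<and> z \<in> max_ideal P"
  shows "z = 0"
proof (rule ccontr)
  assume "z \<noteq> 0"
  then have "S \<subseteq> {P. is_place P \<and> inverse z \<notin> P}" using S(2) by (auto simp: max_ideal_def)
  then show False using finite_poles[OF K_inverse[OF z]] S(1) finite_subset by blast
qed

text \<open>This expresses that the affine curve is normal. In a representation with a denominator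
  \<open>h\<close> of least degree, a root \<open>a\<close> of \<open>h\<close> would force the
  numerator to vanish at all \<open>p\<close> points above \<open>a\<close>; having degree below
  \<open>p\<close> in \<open>w\<close>, it would then be divisible by \<open>x - a\<close>, against
  minimality.\<close>

lemma regular_finite_places:
  assumes z: "z \<in> K" and reg: "\<And>P. is_place P \<Longrightarrow> x \<in> P \<Longrightarrow> z \<in> P"
  shows "\<exists>R. z = biv R \<and> degree R < p"
proof -
  define Q where "Q = (\<lambda>h. h \<noteq> 0 \<and> (\<exists>R. degree R < p \<and> z = biv R / fls_eval x h))"
  obtain B h0 where "h0 \<noteq> 0" "z = biv B / fls_eval x h0" using K_obtain[OF z] .
  then have "Q h0" using ex_biv_reduced[of B] by (auto simp: Q_def)
  then obtain h where h: "Q h" "\<And>h'. Q h' \<Longrightarrow> degree h \<le> degree h'"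
    using ex_has_least_nat[of Q h0 degree] by blast
  then obtain R where R: "h \<noteq> 0" "degree R < p" "z = biv R / fls_eval x h" by (auto simp: Q_def)
  show ?thesis
  proof (cases "degree h = 0")
    case True
    then obtain b where b: "h = [:b:]" "b \<noteq> 0" using R(1) by (metis degree_eq_zeroE pCons_eq_0_iff)
    have "z = biv (smult [:inverse b:] R)"
      using b R(3) by (simp add: poly.heval_smult fls_const.heval_const divide_inverse mult.commute fls_inverse_const)
    moreover have "degree (smult [:inverse b:] R) < p" using R(2) degree_smult_le[of "[:inverse b:]" R] by linarith
    ultimately show ?thesis by blast
  next
    case False
    then obtain a where a: "poly h a = 0" using alg_closed_imp_poly_has_root by blast
    have van: "beval a c R = 0" if c: "on_curve a c" for c
    proof -
      note P = is_place_local_ring[OF c]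
      have xP: "x \<in> local_ring a c" using has_value_place[OF P has_value_x_local_ring[OF c]] .
      have "z \<in> local_ring a c" using reg[OF P xP] .
      then obtain d where "has_value (local_ring a c) z d" using finite_places_value[OF P xP] by blast
      then have "has_value (local_ring a c) (z * fls_eval x h) (d * poly h a)"
        by (intro has_value_mult[OF P] has_value_fls_eval[OF P] has_value_x_local_ring[OF c])
      moreover have "z * fls_eval x h = biv R" using R by simp
      moreover have "has_value (local_ring a c) (biv R) (beval a c R)"
        by (intro has_value_biv[OF P] has_value_x_local_ring[OF c] has_value_w_local_ring[OF c])
      ultimately show ?thesis using has_value_unique[OF P] a by fastforce
    qed
    define Ra where "Ra = map_poly (\<lambda>r. poly r a) R"
    have pRa: "poly Ra c = beval a c R" for c
    proof -
      have "poly (map_poly (\<lambda>r. poly r a) B) c = beval a c B" for B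
        by (induction B) (simp_all add: map_poly_pCons)
      then show ?thesis by (simp add: Ra_def)
    qed
    obtain c0 where c0: "on_curve a c0" using ex_frob_diff_root[of "poly f a"] by (auto simp: on_curve_def)
    have "Ra = 0"
    proof (rule poly_eqI_degree[where A = "(+) c0 ` {c. c ^ p = c}"])
      have "card ((+) c0 ` {c. c ^ p = c}) = p" using card_frobenius_fixed by (simp add: card_image)
      moreover have "degree Ra \<le> degree R" by (rule degree_le) (auto simp: Ra_def coeff_map_poly coeff_eq_0)
      then have "degree Ra < p" using R(2) by linarith
      ultimately show "degree Ra < card ((+) c0 ` {c. c ^ p = c})" "degree (0::'k poly) < card ((+) c0 ` {c. c ^ p = c})"
        using p_pos by auto
      fix c assume "c \<in> (+) c0 ` {c. c ^ p = c}"
      then obtain e where e: "c = c0 + e" "e ^ p = e" by auto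
      have "c ^ p - c = (c0 ^ p - c0) + (e ^ p - e)" by (simp add: e(1) add_power_p)
      then have "on_curve a c" using c0 e(2) by (simp add: on_curve_def)
      then show "poly Ra c = poly 0 c" using van pRa by simp
    qed
    have "\<forall>j. [:- a, 1:] dvd coeff R j"
    proof
      fix j
      have "poly (coeff R j) a = coeff Ra j" by (simp add: Ra_def coeff_map_poly)
      then show "[:- a, 1:] dvd coeff R j" using \<open>Ra = 0\<close> by (simp add: poly_eq_0_iff_dvd[symmetric])
    qed
    then have "\<exists>R1. R = smult [:- a, 1:] R1"
    proof (induction R)
      case 0 show ?case by (intro exI[of _ 0]) simp
    next
      case (pCons r R)
      have "\<forall>j. [:- a, 1:] dvd coeff R j" using pCons.prems by (metis coeff_pCons_Suc)
      then obtain R1 where "R = smult [:- a, 1:] R1" using pCons.IH by blast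
      moreover obtain r1 where "r = [:- a, 1:] * r1" using pCons.prems by (metis coeff_pCons_0 dvdE)
      ultimately show ?case by (intro exI[of _ "pCons r1 R1"]) (simp del: mult_pCons_left)
    qed
    then obtain R1 where R1: "R = smult [:- a, 1:] R1" by blast
    have "[:- a, 1:] dvd h" using a by (simp add: poly_eq_0_iff_dvd)
    then obtain h1 where h1: "h = [:- a, 1:] * h1" by (rule dvdE)
    have xa: "fls_eval x [:- a, 1:] \<noteq> 0" by simp
    have "z = biv R1 / fls_eval x h1"
      unfolding R(3) R1 h1 poly.heval_smult fls_const.heval_mult using xa by (simp del: fls_eval_eq_0_iff)
    moreover have "h1 \<noteq> 0" using R(1) h1 by auto
    moreover have "degree R1 < p"
    proof -
      have "degree R = degree R1" unfolding R1 by (rule degree_smult_eq[THEN trans]) simp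
      then show ?thesis using R(2) by simp
    qed
    ultimately have "Q h1" by (auto simp: Q_def)
    then have "degree h \<le> degree h1" by (rule h(2))
    moreover have "degree h = Suc (degree h1)"
      unfolding h1 using \<open>h1 \<noteq> 0\<close> by (subst degree_mult_eq) auto
    ultimately show ?thesis by simp
  qed
qed

section \<open>Transfer from the function field and its points to \<open>K\<close>\<close>

abbreviation "FF \<equiv> function_field f"
abbreviation "pts \<equiv> curve_points f"

text \<open>\<open>ev\<close> is constant on the cosets of its kernel; this is the induced
  isomorphism onto \<open>K\<close>, through which statements on the curve are moved into Laurent
  series.\<close>

definition emb :: "'k poly fract poly set \<Rightarrow> 'k fls" where
  "emb Z = the_elem (ev ` Z)"

lemma ring_hom_ring_ev: "ring_hom_ring ring_of_type_algebra ring_of_type_algebra ev"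
  by (rule ring_hom_ringI[OF ring_from_type_algebra ring_from_type_algebra])
    (simp_all add: ring_of_type_algebra_def fract.heval_mult fract.heval_add fract.heval_1)

lemma artin_schreier_ideal_eq_kernel:
  "artin_schreier_ideal f = a_kernel ring_of_type_algebra ring_of_type_algebra ev"
  unfolding artin_schreier_ideal_def cgenideal_def a_kernel_def'
  by (auto simp: ring_of_type_algebra_def ev_eq_0_iff mult.commute elim!: dvdE)

lemma emb_ring_iso: "emb \<in> ring_iso FF (ring_of_type_algebra\<lparr>carrier := K\<rparr>)"
proof -
  have "range ev = K" by (simp add: K_def)
  then show ?thesis
    using ring_hom_ring.FactRing_iso_set_aux[OF ring_hom_ring_ev]
    unfolding function_field_def artin_schreier_ideal_eq_kernel emb_def[abs_def]
    by (simp add: ring_of_type_algebra_def)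
qed

lemma emb_bij: "bij_betw emb (carrier FF) K"
  using emb_ring_iso by (simp add: ring_iso_def)

lemma emb_inj: "inj_on emb (carrier FF)" and emb_image: "emb ` carrier FF = K"
  using emb_bij by (auto simp: bij_betw_def)

lemma emb_K: "z \<in> carrier FF \<Longrightarrow> emb z \<in> K"
  using emb_image by blast

lemma emb_mult: "y \<in> carrier FF \<Longrightarrow> z \<in> carrier FF \<Longrightarrow> emb (y \<otimes>\<^bsub>FF\<^esub> z) = emb y * emb z"
  and emb_add: "y \<in> carrier FF \<Longrightarrow> z \<in> carrier FF \<Longrightarrow> emb (y \<oplus>\<^bsub>FF\<^esub> z) = emb y + emb z"
  and emb_one: "emb \<one>\<^bsub>FF\<^esub> = 1"
  using emb_ring_iso by (simp_all add: ring_iso_def ring_hom_def ring_of_type_algebra_def)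

lemma ring_FF: "cring FF"
proof -
  interpret R: cring "ring_of_type_algebra :: 'k poly fract poly ring" by (rule cring_from_type_algebra)
  have "ideal (artin_schreier_ideal f) ring_of_type_algebra"
    unfolding artin_schreier_ideal_def by (rule R.cgenideal_ideal) (simp add: ring_of_type_algebra_def)
  then show ?thesis unfolding function_field_def by (rule ideal.quotient_is_cring[OF _ R.is_cring])
qed

sublocale FF: cring FF by (rule ring_FF)

lemma emb_zero: "emb \<zero>\<^bsub>FF\<^esub> = 0"
  using emb_add[of "\<zero>\<^bsub>FF\<^esub>" "\<zero>\<^bsub>FF\<^esub>"]
  by (metis FF.l_zero FF.zero_closed add_cancel_right_right)

lemma emb_eq_0_iff: "z \<in> carrier FF \<Longrightarrow> emb z = 0 \<longleftrightarrow> z = \<zero>\<^bsub>FF\<^esub>"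
  using inj_onD[OF emb_inj, of z "\<zero>\<^bsub>FF\<^esub>"] emb_zero by auto

lemma emb_minus: "z \<in> carrier FF \<Longrightarrow> emb (\<ominus>\<^bsub>FF\<^esub> z) = - emb z"
  using emb_add[of z "\<ominus>\<^bsub>FF\<^esub> z"] by (simp add: FF.r_neg emb_zero eq_neg_iff_add_eq_0 add.commute)

lemma emb_diff: "y \<in> carrier FF \<Longrightarrow> z \<in> carrier FF \<Longrightarrow> emb (y \<ominus>\<^bsub>FF\<^esub> z) = emb y - emb z"
  by (simp add: a_minus_def emb_add emb_minus)

lemma emb_eq_iff: "y \<in> carrier FF \<Longrightarrow> z \<in> carrier FF \<Longrightarrow> emb y = emb z \<longleftrightarrow> y = z"
  using inj_onD[OF emb_inj, of y z] by auto

lemma emb_inv: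
  assumes z: "z \<in> carrier FF" "z \<noteq> \<zero>\<^bsub>FF\<^esub>"
  shows "inv\<^bsub>FF\<^esub> z \<in> carrier FF" "emb (inv\<^bsub>FF\<^esub> z) = inverse (emb z)"
proof -
  have "inverse (emb z) \<in> K" by (intro K_inverse emb_K z)
  then obtain y where y: "y \<in> carrier FF" "emb y = inverse (emb z)" using emb_image by (metis imageE)
  have "emb (z \<otimes>\<^bsub>FF\<^esub> y) = emb \<one>\<^bsub>FF\<^esub>" using z y by (simp add: emb_mult emb_one emb_eq_0_iff)
  then have "z \<otimes>\<^bsub>FF\<^esub> y = \<one>\<^bsub>FF\<^esub>" using z y by (simp add: emb_eq_iff)
  then have "inv\<^bsub>FF\<^esub> z = y" using z(1) y(1) by (intro FF.comm_inv_char)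
  then show "inv\<^bsub>FF\<^esub> z \<in> carrier FF" "emb (inv\<^bsub>FF\<^esub> z) = inverse (emb z)" using y by auto
qed

lemma rational_fun_carrier: "rational_fun f h \<in> carrier FF"
  and emb_rational_fun: "emb (rational_fun f h) = fls_eval x h"
proof -
  interpret R: ring_hom_ring "ring_of_type_algebra :: 'k poly fract poly ring" "ring_of_type_algebra :: 'k fls ring" ev
    by (rule ring_hom_ring_ev)
  have c: "[:to_fract h:] \<in> carrier (ring_of_type_algebra :: 'k poly fract poly ring)"
    by (simp add: ring_of_type_algebra_def)
  show "rational_fun f h \<in> carrier FF"
    using abelian_group.a_rcosetsI[OF ring.is_abelian_group[OF ring_from_type_algebra] _ c, of "artin_schreier_ideal f"]
    by (simp add: rational_fun_def function_field_def FactRing_def ring_of_type_algebra_def)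
  have "ev ` (artin_schreier_ideal f +>\<^bsub>ring_of_type_algebra\<^esub> [:to_fract h:]) = {ev [:to_fract h:]}"
  proof -
    let ?r = "[:to_fract h:]"
    have "artin_schreier_ideal f +>\<^bsub>ring_of_type_algebra\<^esub> ?r = (\<lambda>k. k + ?r) ` {k. ev k = 0}"
      unfolding artin_schreier_ideal_eq_kernel a_r_coset_def' a_kernel_def'
      by (auto simp: ring_of_type_algebra_def)
    also have "ev ` \<dots> = (\<lambda>k. ev ?r) ` {k. ev k = 0}"
      unfolding image_image by (intro image_cong refl) (simp add: fract.heval_add)
    also have "\<dots> = {ev ?r}" using fract.heval_0[of w] by auto
    finally show ?thesis .
  qed
  then show "emb (rational_fun f h) = fls_eval x h"
    by (simp add: emb_def rational_fun_def fract.heval_const fract_eval_to_fract)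
qed

lemma emb_fun_const: "fun_const f c \<in> carrier FF" "emb (fun_const f c) = fls_const c"
  by (simp_all add: fun_const_def rational_fun_carrier emb_rational_fun fls_const.heval_const)

lemma emb_fun_X: "fun_X f \<in> carrier FF" "emb (fun_X f) = x"
  by (simp_all add: fun_X_def rational_fun_carrier emb_rational_fun fls_const.heval_pCons fls_const.heval_0)

lemma emb_mem_iff: "P \<subseteq> carrier FF \<Longrightarrow> z \<in> carrier FF \<Longrightarrow> emb z \<in> emb ` P \<longleftrightarrow> z \<in> P"
  using inj_on_image_mem_iff[OF emb_inj] by blast

lemma curve_points_iff: "P \<in> pts \<longleftrightarrow> P \<subseteq> carrier FF \<and> is_place (emb ` P)"
proof (intro iffI conjI)
  assume P: "P \<in> pts"
  then have sub: "subring P FF" by (simp add: curve_points_def)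
  note E = subringE[OF sub]
  show "P \<subseteq> carrier FF" by (rule E(1))
  show "is_place (emb ` P)"
    unfolding is_place_def
  proof (intro conjI ballI impI)
    show "emb ` P \<subseteq> K" using E(1) emb_K by blast
    show "range fls_const \<subseteq> emb ` P"
    proof safe
      fix c
      have "fun_const f c \<in> P" using P by (auto simp: curve_points_def)
      then show "fls_const c \<in> emb ` P" by (metis emb_fun_const(2) imageI)
    qed
    fix a assume "a \<in> emb ` P"
    then obtain u where u: "u \<in> P" "a = emb u" by auto
    have "- a = emb (\<ominus>\<^bsub>FF\<^esub> u)" using u E(1) by (simp add: emb_minus subset_iff)
    then show "- a \<in> emb ` P" using E(5)[OF u(1)] by simp
    fix b assume "b \<in> emb ` P"
    then obtain v where v: "v \<in> P" "b = emb v" by auto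
    have "a + b = emb (u \<oplus>\<^bsub>FF\<^esub> v)" "a * b = emb (u \<otimes>\<^bsub>FF\<^esub> v)"
      using u v E(1) by (simp_all add: emb_add emb_mult subset_iff)
    then show "a + b \<in> emb ` P" "a * b \<in> emb ` P" using E(6,7) u(1) v(1) by simp_all
  next
    show "emb ` P \<noteq> K"
      using P E(1) emb_image inj_on_image_eq_iff[OF emb_inj, of P "carrier FF"] by (auto simp: curve_points_def)
    fix z assume z: "z \<in> K" "z \<noteq> 0"
    then obtain u where u: "u \<in> carrier FF" "z = emb u" using emb_image by blast
    then have "u \<noteq> \<zero>\<^bsub>FF\<^esub>" using z(2) emb_zero by auto
    then have "u \<in> P \<or> inv\<^bsub>FF\<^esub> u \<in> P" using P u by (simp add: curve_points_def)
    then show "z \<in> emb ` P \<or> inverse z \<in> emb ` P"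
      using emb_inv(2)[OF u(1) \<open>u \<noteq> _\<close>] u by (metis imageI)
  qed
next
  assume P: "P \<subseteq> carrier FF \<and> is_place (emb ` P)"
  then have C: "P \<subseteq> carrier FF" and pl: "is_place (emb ` P)" by auto
  have mem: "z \<in> P \<longleftrightarrow> emb z \<in> emb ` P" if "z \<in> carrier FF" for z using emb_mem_iff[OF C that] by simp
  have "subring P FF"
  proof (rule FF.subringI[OF C])
    show "\<one>\<^bsub>FF\<^esub> \<in> P" using place_1[OF pl] by (simp add: mem emb_one)
    show "\<ominus>\<^bsub>FF\<^esub> u \<in> P" if "u \<in> P" for u
      using that C place_uminus[OF pl, of "emb u"] by (subst mem) (auto simp: emb_minus)
    fix u v assume uv: "u \<in> P" "v \<in> P"
    then have c: "u \<in> carrier FF" "v \<in> carrier FF" using C by auto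
    have "emb (u \<otimes>\<^bsub>FF\<^esub> v) \<in> emb ` P" "emb (u \<oplus>\<^bsub>FF\<^esub> v) \<in> emb ` P"
      unfolding emb_mult[OF c] emb_add[OF c] using uv by (auto intro: place_mult[OF pl] place_add[OF pl])
    then show "u \<otimes>\<^bsub>FF\<^esub> v \<in> P" "u \<oplus>\<^bsub>FF\<^esub> v \<in> P" using c mem by auto
  qed
  moreover have "range (fun_const f) \<subseteq> P"
    using place_const[OF pl] by (auto simp: mem emb_fun_const)
  moreover have "P \<noteq> carrier FF" using place_not_K[OF pl] emb_image by blast
  moreover have "z \<in> P \<or> inv\<^bsub>FF\<^esub> z \<in> P" if z: "z \<in> carrier FF" "z \<noteq> \<zero>\<^bsub>FF\<^esub>" for z
    using place_inverse[OF pl, of "emb z"] emb_K[OF z(1)] emb_eq_0_iff[OF z(1)] emb_inv[OF z] z mem by metis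
  ultimately show "P \<in> pts" by (simp add: curve_points_def)
qed

lemma pts_subset: "P \<in> pts \<Longrightarrow> P \<subseteq> carrier FF" and pts_place: "P \<in> pts \<Longrightarrow> is_place (emb ` P)"
  by (simp_all add: curve_points_iff)

lemma ex_point_of_place: "is_place Q \<Longrightarrow> {z \<in> carrier FF. emb z \<in> Q} \<in> pts \<and> emb ` {z \<in> carrier FF. emb z \<in> Q} = Q"
proof -
  assume Q: "is_place Q"
  then have "emb ` {z \<in> carrier FF. emb z \<in> Q} = Q" using place_K[OF Q] emb_image by (auto simp: image_iff)
  then show ?thesis using Q by (simp add: curve_points_iff)
qed

lemma pts_eqI: "P \<in> pts \<Longrightarrow> Q \<in> pts \<Longrightarrow> emb ` P = emb ` Q \<Longrightarrow> P = Q"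
  using inj_on_image_eq_iff[OF emb_inj] pts_subset by blast

lemma pts_inj: "inj_on (\<lambda>P. emb ` P) pts"
  by (rule inj_onI) (rule pts_eqI)

lemma finite_poles_pts: "z \<in> K \<Longrightarrow> finite {P \<in> pts. z \<notin> emb ` P}"
proof -
  assume "z \<in> K"
  then have "finite {Q. is_place Q \<and> z \<notin> Q}" by (rule finite_poles)
  moreover have "(\<lambda>P. emb ` P) ` {P \<in> pts. z \<notin> emb ` P} \<subseteq> {Q. is_place Q \<and> z \<notin> Q}"
    using pts_place by auto
  moreover have "inj_on (\<lambda>P. emb ` P) {P \<in> pts. z \<notin> emb ` P}" using pts_inj by (rule inj_on_subset) auto
  ultimately show ?thesis by (meson finite_imageD finite_subset)
qed

lemma infinite_pts: "infinite pts"
proof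
  assume "finite pts"
  moreover have "{P. is_place P} \<subseteq> (\<lambda>P. emb ` P) ` pts" using ex_point_of_place by (auto simp: image_iff)
  ultimately show False using infinite_places by (meson finite_imageI finite_subset)
qed

lemma point_ideal_iff: "P \<in> pts \<Longrightarrow> z \<in> carrier FF \<Longrightarrow> z \<in> point_ideal f P \<longleftrightarrow> emb z \<in> max_ideal (emb ` P)"
proof -
  assume P: "P \<in> pts" and z: "z \<in> carrier FF"
  note C = pts_subset[OF P] and pl = pts_place[OF P]
  have "(\<exists>w\<in>P. z \<otimes>\<^bsub>FF\<^esub> w = \<one>\<^bsub>FF\<^esub>) \<longleftrightarrow> emb z \<noteq> 0 \<and> inverse (emb z) \<in> emb ` P"
  proof
    assume "\<exists>w\<in>P. z \<otimes>\<^bsub>FF\<^esub> w = \<one>\<^bsub>FF\<^esub>"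
    then obtain u where u: "u \<in> P" "z \<otimes>\<^bsub>FF\<^esub> u = \<one>\<^bsub>FF\<^esub>" by blast
    then have "emb z * emb u = 1" using emb_mult[OF z, of u] C emb_one by auto
    then have "emb z \<noteq> 0" "emb u = inverse (emb z)" by (auto simp: inverse_unique)
    then show "emb z \<noteq> 0 \<and> inverse (emb z) \<in> emb ` P" using u(1) by (metis imageI)
  next
    assume a: "emb z \<noteq> 0 \<and> inverse (emb z) \<in> emb ` P"
    then obtain u where u: "u \<in> P" "inverse (emb z) = emb u" by auto
    have "emb (z \<otimes>\<^bsub>FF\<^esub> u) = emb z * emb u" using C z u(1) by (intro emb_mult) auto
    also have "\<dots> = emb \<one>\<^bsub>FF\<^esub>" unfolding u(2)[symmetric] emb_one using a by simp
    finally have "emb (z \<otimes>\<^bsub>FF\<^esub> u) = emb \<one>\<^bsub>FF\<^esub>" .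
    then have "z \<otimes>\<^bsub>FF\<^esub> u = \<one>\<^bsub>FF\<^esub>"
      using C z u(1) emb_eq_iff[of "z \<otimes>\<^bsub>FF\<^esub> u" "\<one>\<^bsub>FF\<^esub>"] by auto
    then show "\<exists>w\<in>P. z \<otimes>\<^bsub>FF\<^esub> w = \<one>\<^bsub>FF\<^esub>" using u(1) by blast
  qed
  then show ?thesis using emb_mem_iff[OF C z] by (auto simp: point_ideal_def max_ideal_def)
qed

definition val :: "'k fls set \<Rightarrow> 'k fls \<Rightarrow> 'k" where
  "val Q z = (THE c. has_value Q z c)"

lemma val_eq: "is_place Q \<Longrightarrow> has_value Q z c \<Longrightarrow> val Q z = c"
  unfolding val_def using has_value_unique by blast

lemma value_at_eq_val: "P \<in> pts \<Longrightarrow> z \<in> carrier FF \<Longrightarrow> value_at f P z = val (emb ` P) (emb z)"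
  unfolding value_at_def val_def has_value_def
  by (simp add: point_ideal_iff emb_diff emb_fun_const)

lemma regular_on_iff:
  assumes "U \<subseteq> pts"
  shows "regular_on f U g \<longleftrightarrow> (\<exists>z\<in>K. \<forall>P\<in>U. z \<in> emb ` P \<and> g P = val (emb ` P) z)"
proof
  assume "regular_on f U g"
  then obtain z where "z \<in> carrier FF" "\<forall>P\<in>U. z \<in> P \<and> g P = value_at f P z" by (auto simp: regular_on_def)
  then show "\<exists>z\<in>K. \<forall>P\<in>U. z \<in> emb ` P \<and> g P = val (emb ` P) z"
    using assms value_at_eq_val by (intro bexI[of _ "emb z"]) (auto simp: emb_K)
next
  assume "\<exists>z\<in>K. \<forall>P\<in>U. z \<in> emb ` P \<and> g P = val (emb ` P) z"
  then obtain z where z: "z \<in> K" "\<forall>P\<in>U. z \<in> emb ` P \<and> g P = val (emb ` P) z" by blast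
  obtain u where u: "u \<in> carrier FF" "z = emb u" using z(1) emb_image by blast
  have "u \<in> P \<and> g P = value_at f P u" if "P \<in> U" for P
    using that z(2) u assms value_at_eq_val[of P u] emb_mem_iff[OF pts_subset u(1), of P] by auto
  then show "regular_on f U g" using u(1) by (auto simp: regular_on_def)
qed

lemma point_infinity_props:
  "point_infinity f \<in> pts" "emb ` point_infinity f = place_infinity"
proof -
  let ?Q = "{z \<in> carrier FF. emb z \<in> place_infinity}"
  note Q = ex_point_of_place[OF is_place_infinity]
  have iff: "P \<in> pts \<and> fun_X f \<notin> P \<longleftrightarrow> P = ?Q" for P
  proof
    assume P: "P \<in> pts \<and> fun_X f \<notin> P"
    then have "x \<notin> emb ` P" using emb_mem_iff[OF pts_subset emb_fun_X(1), of P] emb_fun_X(2) by simp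
    then have "emb ` P = place_infinity" using P pts_place place_infinity_unique by blast
    then show "P = ?Q" using P Q pts_eqI[of P ?Q] by simp
  next
    assume "P = ?Q"
    then show "P \<in> pts \<and> fun_X f \<notin> P" using Q x_notin_place_infinity emb_fun_X by auto
  qed
  then have "point_infinity f = ?Q" unfolding point_infinity_def iff by simp
  then show "point_infinity f \<in> pts" "emb ` point_infinity f = place_infinity" using Q by auto
qed

end

section \<open>Automorphisms of the curve\<close>

context artin_schreier_laurent
begin

section \<open>Automorphisms of \<open>K\<close> over \<open>k\<close>\<close>

definition K_aut :: "('k fls \<Rightarrow> 'k fls) \<Rightarrow> bool" where
  "K_aut \<sigma> \<longleftrightarrow> bij_betw \<sigma> K K \<and> (\<forall>a\<in>K. \<forall>b\<in>K. \<sigma> (a + b) = \<sigma> a + \<sigma> b \<and> \<sigma> (a * b) = \<sigma> a * \<sigma> b) \<and>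
     (\<forall>c. \<sigma> (fls_const c) = fls_const c)"

lemma K_autD:
  assumes "K_aut \<sigma>"
  shows "\<And>a. a \<in> K \<Longrightarrow> \<sigma> a \<in> K" "\<And>a b. a \<in> K \<Longrightarrow> b \<in> K \<Longrightarrow> \<sigma> (a + b) = \<sigma> a + \<sigma> b"
    "\<And>a b. a \<in> K \<Longrightarrow> b \<in> K \<Longrightarrow> \<sigma> (a * b) = \<sigma> a * \<sigma> b" "\<And>c. \<sigma> (fls_const c) = fls_const c"
    "\<sigma> 0 = 0" "\<sigma> 1 = 1" "inj_on \<sigma> K" "\<sigma> ` K = K"
  using assms fls_const_0 fls_const_1 unfolding K_aut_def bij_betw_def by (blast, blast, blast, blast, metis, metis, blast, blast)

lemma K_aut_uminus: "K_aut \<sigma> \<Longrightarrow> a \<in> K \<Longrightarrow> \<sigma> (- a) = - \<sigma> a"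
  using K_autD(2)[of \<sigma> a "- a"] K_autD(5)[of \<sigma>] K_uminus[of a] by (simp add: eq_neg_iff_add_eq_0 add.commute)

lemma K_aut_diff: "K_aut \<sigma> \<Longrightarrow> a \<in> K \<Longrightarrow> b \<in> K \<Longrightarrow> \<sigma> (a - b) = \<sigma> a - \<sigma> b"
  using K_autD(2)[of \<sigma> a "- b"] K_aut_uminus[of \<sigma> b] K_uminus[of b] by simp

lemma K_aut_eq_0_iff: "K_aut \<sigma> \<Longrightarrow> a \<in> K \<Longrightarrow> \<sigma> a = 0 \<longleftrightarrow> a = 0"
  using inj_onD[OF K_autD(7), of \<sigma> a 0] K_autD(5) K_0 by metis

lemma K_aut_inverse:
  assumes s: "K_aut \<sigma>" and a: "a \<in> K" shows "\<sigma> (inverse a) = inverse (\<sigma> a)"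
proof (cases "a = 0")
  case True then show ?thesis using K_autD(5)[OF s] by simp
next
  case False
  have "\<sigma> a * \<sigma> (inverse a) = \<sigma> (a * inverse a)" using K_autD(3)[OF s a K_inverse[OF a]] by simp
  then have "\<sigma> a * \<sigma> (inverse a) = 1" using False K_autD(6)[OF s] by simp
  then show ?thesis by (simp add: inverse_unique)
qed

lemma K_aut_power: "K_aut \<sigma> \<Longrightarrow> a \<in> K \<Longrightarrow> \<sigma> (a ^ n) = \<sigma> a ^ n"
  by (induction n) (simp_all add: K_autD K_power)

lemma K_aut_divide: "K_aut \<sigma> \<Longrightarrow> a \<in> K \<Longrightarrow> b \<in> K \<Longrightarrow> \<sigma> (a / b) = \<sigma> a / \<sigma> b"
  by (simp add: divide_inverse K_autD(3) K_inverse K_aut_inverse)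

lemma K_fls_eval: "y \<in> K \<Longrightarrow> fls_eval y h \<in> K"
  by (induction h) (auto simp: fls_const.heval_0 fls_const.heval_pCons K_0 intro: K_add K_mult K_const)

lemma K_aut_fls_eval: "K_aut \<sigma> \<Longrightarrow> y \<in> K \<Longrightarrow> \<sigma> (fls_eval y h) = fls_eval (\<sigma> y) h"
  by (induction h) (simp_all add: fls_const.heval_0 fls_const.heval_pCons K_autD K_const K_mult K_fls_eval)

lemma K_aut_biv: "K_aut \<sigma> \<Longrightarrow> \<sigma> (biv B) = coeff_hom.heval (fls_eval (\<sigma> x)) (\<sigma> w) B"
proof -
  assume s: "K_aut \<sigma>"
  have *: "\<sigma> (\<Sum>i\<in>A. fls_eval x (coeff B i) * w ^ i) = (\<Sum>i\<in>A. fls_eval (\<sigma> x) (coeff B i) * \<sigma> w ^ i) \<and>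
      (\<Sum>i\<in>A. fls_eval x (coeff B i) * w ^ i) \<in> K" if "finite A" for A
    using that
    by (induction A rule: finite_induct)
      (simp_all add: K_autD[OF s] K_0 K_add K_mult K_eval K_power K_w K_aut_fls_eval[OF s] K_x K_aut_power[OF s])
  interpret H: coeff_hom "fls_eval (\<sigma> x)"
    by unfold_locales
      (simp_all add: fls_const.heval_0 fls_const.heval_1 fls_const.heval_add fls_const.heval_mult)
  show ?thesis unfolding poly.heval_altdef H.heval_altdef using *[of "{..degree B}"] by simp
qed

lemma K_aut_determined:
  assumes "K_aut \<sigma>" "K_aut \<tau>" "\<sigma> x = \<tau> x" "\<sigma> w = \<tau> w" "z \<in> K" shows "\<sigma> z = \<tau> z"
proof -
  obtain B h where z: "h \<noteq> 0" "z = biv B / fls_eval x h" using K_obtain[OF assms(5)] .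
  show ?thesis unfolding z(2)
    using assms by (simp add: K_aut_divide biv_in_K K_eval K_aut_biv K_aut_fls_eval K_x)
qed

lemma K_aut_inv_into: "K_aut \<sigma> \<Longrightarrow> K_aut (inv_into K \<sigma>)"
proof -
  assume s: "K_aut \<sigma>"
  note D = K_autD[OF s]
  have i: "inv_into K \<sigma> u \<in> K" "\<sigma> (inv_into K \<sigma> u) = u" if "u \<in> K" for u
    using that D(8) by (simp_all add: inv_into_into f_inv_into_f)
  have eq: "inv_into K \<sigma> u = v" if "v \<in> K" "\<sigma> v = u" for u v
    using inv_into_f_f[OF D(7) that(1)] that(2) by simp
  show ?thesis
    unfolding K_aut_def
  proof (intro conjI ballI allI)
    show "bij_betw (inv_into K \<sigma>) K K" by (rule bij_betw_inv_into) (simp add: bij_betw_def D(7,8))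
    show "inv_into K \<sigma> (a + b) = inv_into K \<sigma> a + inv_into K \<sigma> b" if "a \<in> K" "b \<in> K" for a b
      using that by (intro eq) (auto simp: D i K_add)
    show "inv_into K \<sigma> (a * b) = inv_into K \<sigma> a * inv_into K \<sigma> b" if "a \<in> K" "b \<in> K" for a b
      using that by (intro eq) (auto simp: D i K_mult)
    show "inv_into K \<sigma> (fls_const c) = fls_const c" for c
      by (intro eq) (auto simp: D K_const)
  qed
qed

lemma K_aut_comp: "K_aut \<sigma> \<Longrightarrow> K_aut \<tau> \<Longrightarrow> K_aut (\<sigma> \<circ> \<tau>)"
  unfolding K_aut_def by (auto simp: bij_betw_trans bij_betwE)

section \<open>Induced maps on the points\<close>

lemma is_place_vimage:
  assumes s: "K_aut \<sigma>" and Q: "is_place Q"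
  shows "is_place {z \<in> K. \<sigma> z \<in> Q}"
  unfolding is_place_def
proof (intro conjI ballI impI)
  note D = K_autD[OF s]
  show "range fls_const \<subseteq> {z \<in> K. \<sigma> z \<in> Q}" by (auto simp: D K_const place_const[OF Q])
  obtain u where "u \<in> K" "u \<notin> Q" using place_not_K[OF Q] place_K[OF Q] by blast
  moreover then obtain v where "v \<in> K" "u = \<sigma> v" using D(8) by blast
  ultimately show "{z \<in> K. \<sigma> z \<in> Q} \<noteq> K" by blast
  show "z \<in> {z \<in> K. \<sigma> z \<in> Q} \<or> inverse z \<in> {z \<in> K. \<sigma> z \<in> Q}" if "z \<in> K" "z \<noteq> 0" for z
    using that place_inverse[OF Q, of "\<sigma> z"] by (auto simp: D K_inverse K_aut_inverse[OF s] K_aut_eq_0_iff[OF s])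
qed (use K_autD[OF s] in \<open>auto simp: K_add K_mult K_uminus K_aut_uminus[OF s] intro: place_add[OF Q] place_mult[OF Q] place_uminus[OF Q]\<close>)

lemma has_value_vimage:
  assumes s: "K_aut \<sigma>" and z: "z \<in> K"
  shows "has_value {z \<in> K. \<sigma> z \<in> Q} z c \<longleftrightarrow> has_value Q (\<sigma> z) c"
proof -
  have zc: "z - fls_const c \<in> K" by (intro K_diff z K_const)
  have "\<sigma> (z - fls_const c) = \<sigma> z - fls_const c" using K_aut_diff[OF s z K_const] by (simp add: K_autD[OF s])
  then show ?thesis
    using zc K_inverse[OF zc] K_aut_inverse[OF s zc] K_aut_eq_0_iff[OF s zc]
    by (auto simp: has_value_def max_ideal_def)
qed

lemma val_vimage: "K_aut \<sigma> \<Longrightarrow> z \<in> K \<Longrightarrow> val {z \<in> K. \<sigma> z \<in> Q} z = val Q (\<sigma> z)"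
proof -
  assume "K_aut \<sigma>" "z \<in> K"
  then have "has_value {z \<in> K. \<sigma> z \<in> Q} z = has_value Q (\<sigma> z)" by (intro ext has_value_vimage)
  then show ?thesis by (simp add: val_def)
qed

text \<open>A point is its local ring, so a field automorphism acts on points by inverse image,
  reversing composition (\<open>pull_comp\<close>). The restriction to \<open>pts\<close> matches
  the extensionality of \<open>BijGroup\<close>.\<close>

definition pull :: "('k fls \<Rightarrow> 'k fls) \<Rightarrow> 'k curve_point \<Rightarrow> 'k curve_point" where
  "pull \<sigma> = (\<lambda>P\<in>pts. {z \<in> carrier FF. \<sigma> (emb z) \<in> emb ` P})"

lemma pull:
  assumes "K_aut \<sigma>" "P \<in> pts"
  shows "pull \<sigma> P \<in> pts" "emb ` pull \<sigma> P = {z \<in> K. \<sigma> z \<in> emb ` P}"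
proof -
  have "{z \<in> carrier FF. \<sigma> (emb z) \<in> emb ` P} = {z \<in> carrier FF. emb z \<in> {z \<in> K. \<sigma> z \<in> emb ` P}}"
    using emb_K by auto
  then show "pull \<sigma> P \<in> pts" "emb ` pull \<sigma> P = {z \<in> K. \<sigma> z \<in> emb ` P}"
    using ex_point_of_place[OF is_place_vimage[OF assms(1) pts_place[OF assms(2)]]] assms(2)
    by (simp_all add: pull_def)
qed

lemma pull_comp:
  assumes s: "K_aut \<sigma>" and t: "K_aut \<tau>" and P: "P \<in> pts"
  shows "pull \<sigma> (pull \<tau> P) = pull (\<tau> \<circ> \<sigma>) P"
proof (rule pts_eqI)
  show "emb ` pull \<sigma> (pull \<tau> P) = emb ` pull (\<tau> \<circ> \<sigma>) P"
    using pull[OF t P] pull[OF s pull(1)[OF t P]] pull[OF K_aut_comp[OF t s] P] K_autD(1)[OF s] by auto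
qed (intro pull K_aut_comp s t P)+

lemma pull_cong: "(\<And>z. z \<in> K \<Longrightarrow> \<sigma> z = \<tau> z) \<Longrightarrow> pull \<sigma> = pull \<tau>"
  unfolding pull_def by (intro restrict_ext) (auto simp: emb_K)

lemma pull_id: "P \<in> pts \<Longrightarrow> pull (\<lambda>z. z) P = P"
  using emb_mem_iff[OF pts_subset] pts_subset by (auto simp: pull_def)

lemma pull_inv_into:
  assumes s: "K_aut \<sigma>" and P: "P \<in> pts"
  shows "pull \<sigma> (pull (inv_into K \<sigma>) P) = P" "pull (inv_into K \<sigma>) (pull \<sigma> P) = P"
proof -
  note t = K_aut_inv_into[OF s]
  have "pull (inv_into K \<sigma> \<circ> \<sigma>) = pull (\<lambda>z. z)" "pull (\<sigma> \<circ> inv_into K \<sigma>) = pull (\<lambda>z. z)"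
    by (rule pull_cong; simp add: inv_into_f_f[OF K_autD(7)[OF s]] f_inv_into_f K_autD(8)[OF s])+
  then show "pull \<sigma> (pull (inv_into K \<sigma>) P) = P" "pull (inv_into K \<sigma>) (pull \<sigma> P) = P"
    using pull_comp[OF s t P] pull_comp[OF t s P] pull_id[OF P] by auto
qed

lemma pull_bij: "K_aut \<sigma> \<Longrightarrow> bij_betw (pull \<sigma>) pts pts"
  using pull_inv_into pull(1) K_aut_inv_into by (intro bij_betw_byWitness[of _ "pull (inv_into K \<sigma>)"]) auto

text \<open>The regular function given by \<open>z\<close> pulls back to the one given by
  \<open>\<sigma> z\<close>, and injectivity keeps the complements of open sets finite.\<close>

lemma curve_morphism_pull:
  assumes s: "K_aut \<sigma>" and eq: "\<And>P. P \<in> pts \<Longrightarrow> \<phi> P = pull \<sigma> P"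
  shows "curve_morphism f \<phi>"
  unfolding curve_morphism_def
proof (intro conjI allI impI)
  show "\<phi> \<in> pts \<rightarrow> pts" using eq pull(1)[OF s] by auto
  have inj: "inj_on \<phi> pts" using pull_bij[OF s] eq inj_on_cong[of pts \<phi> "pull \<sigma>"] by (auto simp: bij_betw_def)
  fix U assume U: "zariski_open f U"
  then have Us: "U \<subseteq> pts" by (simp add: zariski_open_def)
  show "zariski_open f (\<phi> -` U \<inter> pts)"
  proof (cases "U = {}")
    case False
    then have "finite (pts - U)" using U by (simp add: zariski_open_def)
    then have "finite (\<phi> -` (pts - U) \<inter> pts)" using inj by (intro finite_vimage_IntI)
    moreover have "pts - (\<phi> -` U \<inter> pts) \<subseteq> \<phi> -` (pts - U) \<inter> pts" using eq pull(1)[OF s] by auto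
    ultimately have "finite (pts - (\<phi> -` U \<inter> pts))" using finite_subset by blast
    then show ?thesis by (simp add: zariski_open_def)
  qed (simp add: zariski_open_def)
  fix g assume "regular_on f U g"
  then obtain z where z: "z \<in> K" "\<forall>P\<in>U. z \<in> emb ` P \<and> g P = val (emb ` P) z"
    using regular_on_iff[OF Us] by blast
  have "\<sigma> z \<in> emb ` P \<and> (g \<circ> \<phi>) P = val (emb ` P) (\<sigma> z)" if P: "P \<in> \<phi> -` U \<inter> pts" for P
  proof -
    have e: "emb ` \<phi> P = {z \<in> K. \<sigma> z \<in> emb ` P}" using P eq pull(2)[OF s] by simp
    have "z \<in> emb ` \<phi> P" "g (\<phi> P) = val (emb ` \<phi> P) z" using z(2) P by auto
    then show ?thesis unfolding e using val_vimage[OF s z(1)] by simp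
  qed
  then show "regular_on f (\<phi> -` U \<inter> pts) (g \<circ> \<phi>)"
    by (subst regular_on_iff) (use K_autD(1)[OF s z(1)] in blast)+
qed

lemma pull_in_curve_Aut:
  assumes s: "K_aut \<sigma>" shows "pull \<sigma> \<in> carrier (curve_Aut f)"
proof -
  have "pull \<sigma> \<in> extensional pts" by (simp add: pull_def)
  then have B: "pull \<sigma> \<in> Bij pts" using pull_bij[OF s] by (simp add: Bij_def)
  have "inv_into pts (pull \<sigma>) P = pull (inv_into K \<sigma>) P" if P: "P \<in> pts" for P
    using pull_inv_into[OF s P] pull(1)[OF K_aut_inv_into[OF s] P] pull_bij[OF s]
    by (intro inv_into_f_eq) (auto simp: bij_betw_def)
  then have "curve_morphism f (inv_into pts (pull \<sigma>))"
    by (rule curve_morphism_pull[OF K_aut_inv_into[OF s]])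
  moreover have "curve_morphism f (pull \<sigma>)" by (rule curve_morphism_pull[OF s]) simp
  ultimately show ?thesis using B by (simp add: curve_Aut_def)
qed

lemma equal_values_imp_eq:
  assumes z: "y \<in> K" "z \<in> K" and S: "S \<subseteq> pts" "infinite S"
    and v: "\<And>P. P \<in> S \<Longrightarrow> \<exists>c. has_value (emb ` P) y c \<and> has_value (emb ` P) z c"
  shows "y = z"
proof -
  have "y - z = 0"
  proof (rule zero_if_infinite_zeros)
    show "y - z \<in> K" by (intro K_diff z)
    show "infinite ((\<lambda>P. emb ` P) ` S)" using S pts_inj by (metis finite_imageD inj_on_subset)
    fix Q assume "Q \<in> (\<lambda>P. emb ` P) ` S"
    then obtain P where P: "P \<in> S" "Q = emb ` P" by auto
    have pl: "is_place Q" using P S(1) pts_place by auto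
    obtain c where "has_value Q y c" "has_value Q z c" using v P by auto
    then have "has_value Q (y - z) (c - c)" by (rule has_value_diff[OF pl])
    then show "is_place Q \<and> y - z \<in> max_ideal Q" using pl has_value_0_iff[OF pl] by simp
  qed
  then show ?thesis by simp
qed

text \<open>Away from finitely many points, \<open>\<sigma> z\<close> has at \<open>P\<close> the
  value of \<open>z\<close> at \<open>pull \<sigma> P\<close>; so equal maps on points give equal
  values.\<close>

lemma pull_inj:
  assumes s: "K_aut \<sigma>" and t: "K_aut \<tau>" and eq: "pull \<sigma> = pull \<tau>" and z: "z \<in> K"
  shows "\<sigma> z = \<tau> z"
proof (rule equal_values_imp_eq)
  let ?S = "pts - ({P \<in> pts. \<sigma> z \<notin> emb ` P} \<union> {P \<in> pts. x \<notin> emb ` P})"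
  show "infinite ?S"
    by (intro Diff_infinite_finite infinite_pts finite_UnI finite_poles_pts K_autD(1)[OF s] z K_x)
  fix P assume "P \<in> ?S"
  then have P: "P \<in> pts" "\<sigma> z \<in> emb ` P" "x \<in> emb ` P" by auto
  then obtain c where c: "has_value (emb ` P) (\<sigma> z) c" using finite_places_value[OF pts_place] by blast
  then have "has_value (emb ` pull \<sigma> P) z c" unfolding pull(2)[OF s P(1)] has_value_vimage[OF s z] .
  then have "has_value (emb ` P) (\<tau> z) c"
    unfolding eq pull(2)[OF t P(1)] has_value_vimage[OF t z] .
  then show "\<exists>c. has_value (emb ` P) (\<sigma> z) c \<and> has_value (emb ` P) (\<tau> z) c" using c by blast
qed (use K_autD(1)[OF s z] K_autD(1)[OF t z] in auto)

text \<open>The function \<open>\<sigma> z\<close> is the regular function \<open>z \<circ> \<phi>\<close>; it is determined by its values because a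
  nonzero function has only finitely many zeros.\<close>

lemma curve_morphism_pullback:
  assumes \<phi>: "curve_morphism f \<phi>" and inj: "inj_on \<phi> pts"
  shows "\<exists>\<sigma>. \<forall>z\<in>K. \<sigma> z \<in> K \<and> (\<forall>P\<in>pts. z \<in> emb ` \<phi> P \<longrightarrow> \<sigma> z \<in> emb ` P \<and> val (emb ` \<phi> P) z = val (emb ` P) (\<sigma> z))"
proof -
  have "\<exists>z'. z' \<in> K \<and> (\<forall>P\<in>pts. z \<in> emb ` \<phi> P \<longrightarrow> z' \<in> emb ` P \<and> val (emb ` \<phi> P) z = val (emb ` P) z')" if z: "z \<in> K" for z
  proof -
    define U where "U = {P \<in> pts. z \<in> emb ` P}"
    have "pts - U = {P \<in> pts. z \<notin> emb ` P}" by (auto simp: U_def)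
    then have U: "zariski_open f U" using finite_poles_pts[OF z] by (auto simp: zariski_open_def U_def)
    have Us: "U \<subseteq> pts" by (auto simp: U_def)
    have "regular_on f U (\<lambda>P. val (emb ` P) z)"
      by (subst regular_on_iff[OF Us]) (use z in \<open>auto simp: U_def\<close>)
    then have "regular_on f (\<phi> -` U \<inter> pts) ((\<lambda>P. val (emb ` P) z) \<circ> \<phi>)"
      using \<phi> U by (simp add: curve_morphism_def)
    then obtain z' where "z' \<in> K" "\<forall>P\<in>\<phi> -` U \<inter> pts. z' \<in> emb ` P \<and> val (emb ` \<phi> P) z = val (emb ` P) z'"
      by (subst (asm) regular_on_iff) auto
    moreover have "\<phi> P \<in> pts" if "P \<in> pts" for P using \<phi> that by (auto simp: curve_morphism_def)
    ultimately show ?thesis by (intro exI[of _ z']) (auto simp: U_def)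
  qed
  then show ?thesis by metis
qed

text \<open>The comorphism of \<open>\<phi>\<close> is known only through values, so each algebraic
  identity for it is checked at infinitely many points; the comorphism of the inverse map supplies
  bijectivity.\<close>

lemma curve_Aut_eq_pull:
  assumes \<phi>: "\<phi> \<in> carrier (curve_Aut f)"
  shows "\<exists>\<sigma>. K_aut \<sigma> \<and> \<phi> = pull \<sigma>"
proof -
  define \<psi> where "\<psi> = inv_into pts \<phi>"
  have m: "curve_morphism f \<phi>" "curve_morphism f \<psi>" and bij: "bij_betw \<phi> pts pts" and ext: "\<phi> \<in> extensional pts"
    using \<phi> by (auto simp: curve_Aut_def \<psi>_def Bij_def)
  have inj: "inj_on \<phi> pts" "inj_on \<psi> pts"
    using bij bij_betw_inv_into[OF bij] by (auto simp: bij_betw_def \<psi>_def)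
  have \<psi>\<phi>: "\<psi> (\<phi> P) = P" "\<phi> P \<in> pts" and \<phi>\<psi>: "\<phi> (\<psi> P) = P" "\<psi> P \<in> pts" if "P \<in> pts" for P
    using that bij by (auto simp: \<psi>_def bij_betw_inv_into_left bij_betw_inv_into_right bij_betwE
        intro: bij_betwE[OF bij_betw_inv_into[OF bij], rule_format])
  obtain \<sigma> where \<sigma>: "\<And>z. z \<in> K \<Longrightarrow> \<sigma> z \<in> K"
    "\<And>z P. z \<in> K \<Longrightarrow> P \<in> pts \<Longrightarrow> z \<in> emb ` \<phi> P \<Longrightarrow> \<sigma> z \<in> emb ` P \<and> val (emb ` \<phi> P) z = val (emb ` P) (\<sigma> z)"
    using curve_morphism_pullback[OF m(1) inj(1)] by blast
  obtain \<tau> where \<tau>: "\<And>z. z \<in> K \<Longrightarrow> \<tau> z \<in> K"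
    "\<And>z P. z \<in> K \<Longrightarrow> P \<in> pts \<Longrightarrow> z \<in> emb ` \<psi> P \<Longrightarrow> \<tau> z \<in> emb ` P \<and> val (emb ` \<psi> P) z = val (emb ` P) (\<tau> z)"
    using curve_morphism_pullback[OF m(2) inj(2)] by blast
  \<comment> \<open>Points such that all functions in \<open>A\<close> are regular at
    \<open>P\<close>, \<open>\<phi> P\<close> and \<open>\<psi> P\<close>; only finitely many points
    are removed. Including \<open>x\<close> in \<open>A\<close> ensures that values in
    \<open>k\<close> exist.\<close>
  define S where "S = (\<lambda>A. pts - (\<Union>z\<in>A. {P \<in> pts. z \<notin> emb ` P} \<union> (\<phi> -` {P \<in> pts. z \<notin> emb ` P} \<inter> pts) \<union>
      (\<psi> -` {P \<in> pts. z \<notin> emb ` P} \<inter> pts)))"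
  have S: "infinite (S A)" if "finite A" "A \<subseteq> K" for A
    unfolding S_def
    by (intro Diff_infinite_finite infinite_pts finite_UN_I that(1) finite_UnI finite_vimage_IntI inj finite_poles_pts)
      (use that(2) in auto)
  have SD: "P \<in> pts" "z \<in> emb ` P" "z \<in> emb ` \<phi> P" "z \<in> emb ` \<psi> P" if "P \<in> S A" "z \<in> A" for P A z
    using that \<psi>\<phi>(2) \<phi>\<psi>(2) by (auto simp: S_def)
  have Spts: "S A \<subseteq> pts" for A by (auto simp: S_def)
  have hv: "\<exists>c. has_value (emb ` \<phi> P) z c \<and> has_value (emb ` P) (\<sigma> z) c" if P: "P \<in> S A" "x \<in> A" "z \<in> A" "z \<in> K" for P A z
  proof -
    have pl: "is_place (emb ` P)" "is_place (emb ` \<phi> P)" using SD(1)[OF P(1,2)] \<psi>\<phi>(2) pts_place by auto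
    have zs: "\<sigma> z \<in> emb ` P" "val (emb ` \<phi> P) z = val (emb ` P) (\<sigma> z)"
      using \<sigma>(2)[OF P(4) SD(1)[OF P(1,2)] SD(3)[OF P(1,3)]] by auto
    obtain c where c: "has_value (emb ` \<phi> P) z c"
      using finite_places_value[OF pl(2) SD(3)[OF P(1,2)] SD(3)[OF P(1,3)]] by blast
    obtain d where d: "has_value (emb ` P) (\<sigma> z) d"
      using finite_places_value[OF pl(1) SD(2)[OF P(1,2)] zs(1)] by blast
    have "c = d" using zs(2) val_eq[OF pl(2) c] val_eq[OF pl(1) d] by simp
    then show ?thesis using c d by blast
  qed
  have pl: "is_place (emb ` P)" "is_place (emb ` \<phi> P)" if "P \<in> S A" for P A
    using that \<psi>\<phi>(2) pts_place Spts by blast+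
  have add: "\<sigma> (a + b) = \<sigma> a + \<sigma> b" and mult: "\<sigma> (a * b) = \<sigma> a * \<sigma> b" if ab: "a \<in> K" "b \<in> K" for a b
  proof -
    let ?S = "S {x, a, b, a + b, a * b}"
    have inf: "infinite ?S" by (rule S) (use ab K_x K_add K_mult in auto)
    have *: "\<exists>c d. has_value (emb ` P) (\<sigma> a) c \<and> has_value (emb ` P) (\<sigma> b) d \<and>
        has_value (emb ` P) (\<sigma> (a + b)) (c + d) \<and> has_value (emb ` P) (\<sigma> (a * b)) (c * d)" if P: "P \<in> ?S" for P
    proof -
      obtain c where c: "has_value (emb ` \<phi> P) a c" "has_value (emb ` P) (\<sigma> a) c" using hv[OF P _ _ ab(1)] by auto
      obtain d where d: "has_value (emb ` \<phi> P) b d" "has_value (emb ` P) (\<sigma> b) d" using hv[OF P _ _ ab(2)] by auto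
      obtain e where e: "has_value (emb ` \<phi> P) (a + b) e" "has_value (emb ` P) (\<sigma> (a + b)) e"
        using hv[OF P _ _ K_add[OF ab]] by auto
      obtain g where g: "has_value (emb ` \<phi> P) (a * b) g" "has_value (emb ` P) (\<sigma> (a * b)) g"
        using hv[OF P _ _ K_mult[OF ab]] by auto
      have "e = c + d" using has_value_unique[OF pl(2)[OF P] e(1) has_value_add[OF pl(2)[OF P] c(1) d(1)]] .
      moreover have "g = c * d" using has_value_unique[OF pl(2)[OF P] g(1) has_value_mult[OF pl(2)[OF P] c(1) d(1)]] .
      ultimately show ?thesis using c d e g by blast
    qed
    show "\<sigma> (a + b) = \<sigma> a + \<sigma> b"
    proof (rule equal_values_imp_eq[OF _ _ Spts inf])
      fix P assume P: "P \<in> ?S"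
      show "\<exists>c. has_value (emb ` P) (\<sigma> (a + b)) c \<and> has_value (emb ` P) (\<sigma> a + \<sigma> b) c"
        using *[OF P] has_value_add[OF pl(1)[OF P]] by blast
    qed (auto simp: \<sigma> ab K_add)
    show "\<sigma> (a * b) = \<sigma> a * \<sigma> b"
    proof (rule equal_values_imp_eq[OF _ _ Spts inf])
      fix P assume P: "P \<in> ?S"
      show "\<exists>c. has_value (emb ` P) (\<sigma> (a * b)) c \<and> has_value (emb ` P) (\<sigma> a * \<sigma> b) c"
        using *[OF P] has_value_mult[OF pl(1)[OF P]] by blast
    qed (auto simp: \<sigma> ab K_mult)
  qed
  have const: "\<sigma> (fls_const c) = fls_const c" for c
  proof (rule equal_values_imp_eq[OF _ _ Spts S[of "{x, fls_const c}"]])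
    fix P assume P: "P \<in> S {x, fls_const c}"
    obtain d where d: "has_value (emb ` \<phi> P) (fls_const c) d" "has_value (emb ` P) (\<sigma> (fls_const c)) d"
      using hv[OF P _ _ K_const] by auto
    have "d = c" using has_value_unique[OF pl(2)[OF P] d(1) has_value_const[OF pl(2)[OF P]]] .
    then show "\<exists>d. has_value (emb ` P) (\<sigma> (fls_const c)) d \<and> has_value (emb ` P) (fls_const c) d"
      using d has_value_const[OF pl(1)[OF P]] by blast
  qed (auto simp: \<sigma> K_const K_x)
  have hv': "\<exists>c. has_value (emb ` \<psi> P) z c \<and> has_value (emb ` P) (\<tau> z) c" if P: "P \<in> S A" "x \<in> A" "z \<in> A" "z \<in> K" for P A z
  proof -
    have pl: "is_place (emb ` P)" "is_place (emb ` \<psi> P)" using SD(1)[OF P(1,2)] \<phi>\<psi>(2) pts_place by auto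
    have zs: "\<tau> z \<in> emb ` P" "val (emb ` \<psi> P) z = val (emb ` P) (\<tau> z)"
      using \<tau>(2)[OF P(4) SD(1)[OF P(1,2)] SD(4)[OF P(1,3)]] by auto
    obtain c where c: "has_value (emb ` \<psi> P) z c"
      using finite_places_value[OF pl(2) SD(4)[OF P(1,2)] SD(4)[OF P(1,3)]] by blast
    obtain d where d: "has_value (emb ` P) (\<tau> z) d"
      using finite_places_value[OF pl(1) SD(2)[OF P(1,2)] zs(1)] by blast
    have "c = d" using zs(2) val_eq[OF pl(2) c] val_eq[OF pl(1) d] by simp
    then show ?thesis using c d by blast
  qed
  have \<sigma>\<tau>: "\<sigma> (\<tau> z) = z" if z: "z \<in> K" for z
  proof (rule equal_values_imp_eq[OF _ z Spts S[of "{x, z, \<tau> z}"]])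
    fix P assume P: "P \<in> S {x, z, \<tau> z}"
    have p: "P \<in> pts" using P Spts by blast
    obtain c where c: "has_value (emb ` \<phi> P) (\<tau> z) c" "has_value (emb ` P) (\<sigma> (\<tau> z)) c"
      using hv[OF P _ _ \<tau>(1)[OF z]] by auto
    have z': "z \<in> emb ` \<psi> (\<phi> P)" using SD(2)[OF P, of z] \<psi>\<phi>(1)[OF p] by simp
    have v: "val (emb ` \<psi> (\<phi> P)) z = val (emb ` \<phi> P) (\<tau> z)" using \<tau>(2)[OF z \<psi>\<phi>(2)[OF p] z'] by simp
    obtain d where d: "has_value (emb ` P) z d"
      using finite_places_value[OF pl(1)[OF P] SD(2)[OF P, of x] SD(2)[OF P, of z]] by auto
    have "d = c" using v val_eq[OF pl(1)[OF P] d] val_eq[OF pl(2)[OF P] c(1)] \<psi>\<phi>(1)[OF p] by simp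
    then show "\<exists>c. has_value (emb ` P) (\<sigma> (\<tau> z)) c \<and> has_value (emb ` P) z c" using c d by blast
  qed (auto simp: \<sigma> \<tau> z K_x)
  have \<tau>\<sigma>: "\<tau> (\<sigma> z) = z" if z: "z \<in> K" for z
  proof (rule equal_values_imp_eq[OF _ z Spts S[of "{x, z, \<sigma> z}"]])
    fix P assume P: "P \<in> S {x, z, \<sigma> z}"
    have p: "P \<in> pts" using P Spts by blast
    obtain c where c: "has_value (emb ` \<psi> P) (\<sigma> z) c" "has_value (emb ` P) (\<tau> (\<sigma> z)) c"
      using hv'[OF P _ _ \<sigma>(1)[OF z]] by auto
    have z': "z \<in> emb ` \<phi> (\<psi> P)" using SD(2)[OF P, of z] \<phi>\<psi>(1)[OF p] by simp
    have v: "val (emb ` \<phi> (\<psi> P)) z = val (emb ` \<psi> P) (\<sigma> z)" using \<sigma>(2)[OF z \<phi>\<psi>(2)[OF p] z'] by simp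
    obtain d where d: "has_value (emb ` P) z d"
      using finite_places_value[OF pl(1)[OF P] SD(2)[OF P, of x] SD(2)[OF P, of z]] by auto
    have "d = c" using v val_eq[OF pl(1)[OF P] d] val_eq[OF pts_place[OF \<phi>\<psi>(2)[OF p]] c(1)] \<phi>\<psi>(1)[OF p] by simp
    then show "\<exists>c. has_value (emb ` P) (\<tau> (\<sigma> z)) c \<and> has_value (emb ` P) z c" using c d by blast
  qed (auto simp: \<sigma> \<tau> z K_x)
  have "bij_betw \<sigma> K K" by (rule bij_betw_byWitness[of _ \<tau>]) (auto simp: \<sigma> \<tau> \<sigma>\<tau> \<tau>\<sigma>)
  then have s: "K_aut \<sigma>" using add mult const by (simp add: K_aut_def)
  \<comment> \<open>Regularity is transported one way by \<open>\<sigma>\<close> and back by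
    \<open>\<tau>\<close>, so the local ring at \<open>\<phi> P\<close> is exactly the preimage
    under \<open>\<sigma>\<close>.\<close>
  have "\<phi> P = pull \<sigma> P" if P: "P \<in> pts" for P
  proof (rule pts_eqI)
    have "z \<in> emb ` \<phi> P \<longleftrightarrow> \<sigma> z \<in> emb ` P" if z: "z \<in> K" for z
    proof
      assume "z \<in> emb ` \<phi> P" then show "\<sigma> z \<in> emb ` P" using \<sigma>(2)[OF z P] by simp
    next
      assume "\<sigma> z \<in> emb ` P"
      then have "\<sigma> z \<in> emb ` \<psi> (\<phi> P)" using \<psi>\<phi>(1)[OF P] by simp
      then have "\<tau> (\<sigma> z) \<in> emb ` \<phi> P" using \<tau>(2)[OF \<sigma>(1)[OF z] \<psi>\<phi>(2)[OF P]] by simp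
      then show "z \<in> emb ` \<phi> P" using \<tau>\<sigma>[OF z] by simp
    qed
    moreover have "emb ` \<phi> P \<subseteq> K" using \<psi>\<phi>(2)[OF P] pts_place place_K by blast
    ultimately show "emb ` \<phi> P = emb ` pull \<sigma> P" unfolding pull(2)[OF s P] by blast
  qed (use \<psi>\<phi>(2) pull(1)[OF s] P in auto)
  then have "\<phi> = pull \<sigma>" using ext by (intro extensionalityI[of _ pts]) (auto simp: pull_def)
  then show ?thesis using s by blast
qed

end

section \<open>The inertia group at infinity\<close>

text \<open>The substitutions \<open>x \<mapsto> a x + b, w \<mapsto> c w + P x\<close> respecting
  the curve equation: for \<open>c\<close> in the prime field, \<open>w ^ p - w\<close> becomes
  \<open>c f + (P ^ p - P)\<close>.\<close>

definition affine_data :: "'k::alg_closed_field poly \<Rightarrow> ('k \<times> 'k \<times> 'k \<times> 'k poly) set" where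
  "affine_data f = {(a, b, c, P). a \<noteq> 0 \<and> c \<noteq> 0 \<and> c ^ CHAR('k) = c \<and>
     smult c f + (P ^ CHAR('k) - P) = pcompose f [:b, a:]}"

context artin_schreier_laurent
begin

definition represents :: "('k fls \<Rightarrow> 'k fls) \<Rightarrow> 'k \<times> 'k \<times> 'k \<times> 'k poly \<Rightarrow> bool" where
  "represents \<sigma> = (\<lambda>(a, b, c, P). \<sigma> x = fls_eval x [:b, a:] \<and> \<sigma> w = fls_const c * w + fls_eval x P)"

lemma fls_add_power_p: "(u + v) ^ p = u ^ p + v ^ p" for u v :: "'k fls"
  using freshmans_dream[where ?'a="'k fls"] prime_p CHAR_eq by simp

lemma biv_place: "is_place P \<Longrightarrow> x \<in> P \<Longrightarrow> biv B \<in> P"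
  unfolding poly.heval_altdef
  by (intro place_sum place_mult fls_eval_place place_power w_place) auto

lemma fixes_infinity_iff:
  assumes s: "K_aut \<sigma>"
  shows "pull \<sigma> (point_infinity f) = point_infinity f \<longleftrightarrow>
    (\<forall>z\<in>K. \<sigma> z \<in> place_infinity \<longleftrightarrow> z \<in> place_infinity)"
proof -
  note I = point_infinity_props
  have "pull \<sigma> (point_infinity f) = point_infinity f \<longleftrightarrow> emb ` pull \<sigma> (point_infinity f) = emb ` point_infinity f"
    using pts_eqI[OF pull(1)[OF s I(1)] I(1)] by auto
  also have "\<dots> \<longleftrightarrow> {z \<in> K. \<sigma> z \<in> place_infinity} = place_infinity"
    unfolding pull(2)[OF s I(1)] I(2) ..
  also have "\<dots> \<longleftrightarrow> (\<forall>z\<in>K. \<sigma> z \<in> place_infinity \<longleftrightarrow> z \<in> place_infinity)"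
    using place_K[OF is_place_infinity] by blast
  finally show ?thesis .
qed

text \<open>Preserving the valuation ring preserves orders up to a factor \<open>e\<close>, read off
  from an element \<open>t\<close> of order 1; as \<open>t\<close> is itself an image,
  \<open>e\<close> divides 1. Such a \<open>t\<close> is a quotient of powers of \<open>x\<close>
  and \<open>w\<close>, whose orders are coprime.\<close>

lemma subdegree_preserved:
  assumes s: "K_aut \<sigma>" and fixd: "\<And>z. z \<in> K \<Longrightarrow> \<sigma> z \<in> place_infinity \<longleftrightarrow> z \<in> place_infinity"
    and z: "z \<in> K" "z \<noteq> 0"
  shows "fls_subdegree (\<sigma> z) = fls_subdegree z"
proof -
  note D = K_autD[OF s]
  define S where "S = (\<lambda>z. fls_subdegree (\<sigma> z))"
  have nz: "\<sigma> u \<noteq> 0" if "u \<in> K" "u \<noteq> 0" for u using that K_aut_eq_0_iff[OF s] by simp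
  have iff: "S u \<ge> 0 \<longleftrightarrow> fls_subdegree u \<ge> 0" if "u \<in> K" "u \<noteq> 0" for u
    using fixd[OF that(1)] that nz[OF that] D(1)[OF that(1)] by (simp add: place_infinity_def S_def)
  have mult: "S (u * v) = S u + S v" if "u \<in> K" "u \<noteq> 0" "v \<in> K" "v \<noteq> 0" for u v
    using that nz by (simp add: S_def D)
  have inv: "S (inverse u) = - S u" if "u \<in> K" "u \<noteq> 0" for u
    using that nz by (simp add: S_def K_aut_inverse[OF s])
  have pow: "S (u ^ n) = int n * S u" if "u \<in> K" "u \<noteq> 0" for u n
    using that nz by (simp add: S_def K_aut_power[OF s] fls_subdegree_pow)
  have "coprime (degree f) p" using degree_f_prime prime_p by (metis coprime_commute prime_imp_coprime_nat)
  then obtain b where "[degree f * b = 1] (mod p)" using cong_solve_coprime_nat by auto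
  then have "degree f * b mod p = 1" using p_gt_1 by (simp add: cong_def)
  then obtain a where ab: "degree f * b = p * a + 1" by (metis mult_div_mod_eq)
  define t where "t = x ^ a / w ^ b"
  have tK: "t \<in> K" by (simp add: t_def K_divide K_power K_x K_w)
  have t0: "t \<noteq> 0" using x_nonzero w_nonzero by (simp add: t_def)
  have st: "fls_subdegree t = 1"
  proof -
    have "int (degree f * b) = int (p * a + 1)" using ab by simp
    then have "int (degree f) * int b = int p * int a + 1" by simp
    then show ?thesis using x_nonzero w_nonzero
      by (simp add: t_def fls_divide_subdegree fls_subdegree_pow x_subdegree w_subdegree mult.commute)
  qed
  define e where "e = S t"
  have e: "e > 0"
  proof -
    have "S (inverse t) < 0" using iff[OF K_inverse[OF tK]] t0 st by auto
    then show ?thesis using inv[OF tK t0] by (simp add: e_def)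
  qed
  have zero: "S u = 0" if u: "u \<in> K" "u \<noteq> 0" "fls_subdegree u = 0" for u
    using iff[OF u(1,2)] iff[OF K_inverse[OF u(1)]] inv[OF u(1,2)] u by auto
  have lin: "S u = fls_subdegree u * e" if u: "u \<in> K" "u \<noteq> 0" for u
  proof (cases "fls_subdegree u \<ge> 0")
    case True
    define n where "n = nat (fls_subdegree u)"
    have n: "fls_subdegree u = int n" using True by (simp add: n_def)
    let ?v = "u * inverse (t ^ n)"
    have "S ?v = 0"
      by (rule zero) (use u tK t0 n st in \<open>auto simp: K_mult K_inverse K_power fls_subdegree_pow\<close>)
    moreover have "S ?v = S u - int n * e"
      using u tK t0 by (simp add: mult inv pow K_inverse K_power e_def)
    ultimately show ?thesis using n by simp
  next
    case False
    define n where "n = nat (- fls_subdegree u)"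
    have n: "fls_subdegree u = - int n" using False by (simp add: n_def)
    let ?v = "u * t ^ n"
    have "S ?v = 0"
      by (rule zero) (use u tK t0 n st in \<open>auto simp: K_mult K_power fls_subdegree_pow\<close>)
    moreover have "S ?v = S u + int n * e"
      using u tK t0 by (simp add: mult pow K_power e_def)
    ultimately show ?thesis using n by simp
  qed
  obtain v where v: "v \<in> K" "\<sigma> v = t" using D(8) tK by (metis imageE)
  then have "v \<noteq> 0" using t0 D(5) by auto
  then have "1 = fls_subdegree v * e" using lin[OF v(1)] v(2) st by (simp add: S_def)
  then have "e dvd 1" by (metis dvd_triv_right)
  then have "e = 1" using e by simp
  then show ?thesis using lin[OF z] by (simp add: S_def)
qed

text \<open>Polynomials in \<open>x\<close> and \<open>w\<close> have no poles at finite points, and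
  \<open>pull \<sigma>\<close> permutes these; so the image is regular at all finite places and is
  again such a polynomial.\<close>

lemma regular_image:
  assumes s: "K_aut \<sigma>" and fixd: "pull \<sigma> (point_infinity f) = point_infinity f"
  shows "\<exists>R. \<sigma> (biv B) = biv R \<and> degree R < p"
proof (rule regular_finite_places)
  show "\<sigma> (biv B) \<in> K" by (intro K_autD(1)[OF s] biv_in_K)
  fix Q assume Q: "is_place Q" "x \<in> Q"
  obtain P where P: "P \<in> pts" "emb ` P = Q" using ex_point_of_place[OF Q(1)] by blast
  have P': "pull \<sigma> P \<in> pts" "is_place (emb ` pull \<sigma> P)" using pull(1)[OF s P(1)] pts_place by auto
  have "x \<in> emb ` pull \<sigma> P"
  proof (rule ccontr)
    assume "x \<notin> emb ` pull \<sigma> P"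
    then have "emb ` pull \<sigma> P = place_infinity" by (rule place_infinity_unique[OF P'(2)])
    then have "pull \<sigma> P = pull \<sigma> (point_infinity f)"
      unfolding fixd using pts_eqI[OF P'(1)] point_infinity_props by simp
    then have "P = point_infinity f"
      using pull_bij[OF s] P(1) point_infinity_props(1) by (auto simp: bij_betw_def dest: inj_onD)
    then show False using P(2) Q(2) point_infinity_props x_notin_place_infinity by simp
  qed
  then have "biv B \<in> emb ` pull \<sigma> P" by (rule biv_place[OF P'(2)])
  then show "\<sigma> (biv B) \<in> Q" using pull(2)[OF s P(1)] P(2) by auto
qed

lemma poly_split_const: "degree (h :: 'k poly) \<le> 1 \<Longrightarrow> h = [:coeff h 0, coeff h 1:]"
  by (auto simp: poly_eq_iff coeff_pCons coeff_eq_0 split: nat.split)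

text \<open>\<open>\<sigma> x\<close> and \<open>\<sigma> w\<close> are reduced polynomials in
  \<open>x\<close> and \<open>w\<close> with the pole orders \<open>p\<close> and \<open>m\<close>
  of \<open>x\<close> and \<open>w\<close>, so few monomials can occur. For \<open>m < p\<close> the
  bound still allows powers of \<open>w\<close> in \<open>\<sigma> x\<close>; the transformed
  equation excludes them.\<close>

lemma ex_affine_data:
  assumes s: "K_aut \<sigma>" and fixd: "pull \<sigma> (point_infinity f) = point_infinity f"
  shows "\<exists>t \<in> affine_data f. represents \<sigma> t"
proof -
  define m where "m = degree f"
  have m: "m > 1" "\<not> p dvd m" using degree_f degree_f_prime by (simp_all add: m_def)
  have pm: "\<not> m dvd p"
    using m prime_p by (metis dvd_refl less_irrefl prime_nat_iff)
  note D = K_autD[OF s]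
  have sub: "fls_subdegree (\<sigma> z) = fls_subdegree z" if "z \<in> K" "z \<noteq> 0" for z
    using subdegree_preserved[OF s _ that] fixd fixes_infinity_iff[OF s] by blast
  have sx: "fls_subdegree (\<sigma> x) = - int p" and sw: "fls_subdegree (\<sigma> w) = - int m"
    using sub[OF K_x x_nonzero] sub[OF K_w w_nonzero] x_subdegree w_subdegree by (simp_all add: m_def)
  obtain R where R: "\<sigma> x = biv R" "degree R < p" using regular_image[OF s fixd, of "[:[:0, 1:]:]"] biv_X by auto
  obtain R' where R': "\<sigma> w = biv R'" "degree R' < p" using regular_image[OF s fixd, of "[:0, 1:]"] biv_W by auto
  have bR: "p * degree (coeff R j) + m * j \<le> p" if "coeff R j \<noteq> 0" for j
    using biv_reduced_coeff(2)[OF R(2) that] sx R(1) by (simp add: m_def flip: of_nat_mult of_nat_add)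
  have bR': "p * degree (coeff R' j) + m * j \<le> m" if "coeff R' j \<noteq> 0" for j
    using biv_reduced_coeff(2)[OF R'(2) that] sw R'(1) by (simp add: m_def flip: of_nat_mult of_nat_add)

  define P where "P = coeff R' 0"
  define c where "c = coeff (coeff R' 1) 0"
  have R'eq: "R' = [:P, [:c:]:]"
  proof (rule poly_eqI)
    fix j :: nat
    consider "j = 0" | "j = 1" | "j \<ge> 2" by linarith
    then show "coeff R' j = coeff [:P, [:c:]:] j"
    proof cases
      case 2
      have "degree (coeff R' 1) = 0" using bR'[of 1] p_pos m(1) by (cases "coeff R' 1 = 0") auto
      then obtain u where "coeff R' 1 = [:u:]" by (meson degree_eq_zeroE)
      then show ?thesis using 2 by (simp add: c_def)
    next
      case 3
      have "coeff R' j = 0"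
      proof (rule ccontr)
        assume "coeff R' j \<noteq> 0"
        then have "m * j \<le> m" using bR'[of j] by linarith
        moreover have "m * 2 \<le> m * j" using 3 by (rule mult_le_mono2)
        ultimately show False using m(1) by linarith
      qed
      then show ?thesis using 3 by (auto simp: coeff_pCons split: nat.split)
    qed (simp add: P_def)
  qed
  have sw_eq: "\<sigma> w = fls_const c * w + fls_eval x P"
    unfolding R'(1) R'eq by (simp add: poly.heval_pCons poly.heval_0 fls_const.heval_const poly.h_0 mult.commute add.commute)
  have c0: "c \<noteq> 0"
  proof
    assume c0: "c = 0"
    have "\<sigma> w \<noteq> 0" using K_aut_eq_0_iff[OF s K_w] w_nonzero by simp
    then have "P \<noteq> 0" using sw_eq c0 by (auto simp: fls_const.heval_0)
    then have "fls_subdegree (\<sigma> w) = - int (p * degree P)"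
      using sw_eq c0 fls_eval_subdegree[OF x_neg, of P] by (simp add: x_subdegree)
    then have "m = p * degree P" using sw by (simp flip: of_nat_mult)
    then show False using m(2) by simp
  qed
  have degP: "p * degree P \<le> m"
    using bR'[of 0] by (cases "P = 0") (auto simp: P_def)

  define b where "b = coeff (coeff R 0) 0"
  define a where "a = coeff (coeff R 0) 1"
  \<comment> \<open>The part of \<open>\<sigma> x\<close> in positive powers of \<open>w\<close>;
    the coefficients are constants since \<open>x * w ^ j\<close> exceeds the pole order
    \<open>p\<close>.\<close>
  define Q :: "'k poly" where "Q = (\<Sum>j\<in>{1..<p}. monom (coeff (coeff R j) 0) j)"
  define T where "T = [:[:b, a:]:] + map_poly (\<lambda>u. [:u:]) Q"
  have Qj: "coeff Q j = (if j \<in> {1..<p} then coeff (coeff R j) 0 else 0)" for j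
    by (simp add: Q_def coeff_sum)
  have R0: "coeff R 0 = [:b, a:]"
  proof -
    have "degree (coeff R 0) \<le> 1" using bR[of 0] p_pos by (cases "coeff R 0 = 0") auto
    then show ?thesis unfolding a_def b_def by (rule poly_split_const)
  qed
  have RT: "R = T"
  proof (rule poly_eqI)
    fix j :: nat
    consider "j = 0" | "j \<in> {1..<p}" | "j \<ge> p" by (metis atLeastLessThan_iff less_one linorder_not_le)
    then show "coeff R j = coeff T j"
    proof cases
      case 1
      then show ?thesis by (simp add: T_def R0 coeff_map_poly Qj)
    next
      case 2
      have "degree (coeff R j) = 0"
      proof (rule ccontr)
        assume d: "degree (coeff R j) \<noteq> 0"
        then have "coeff R j \<noteq> 0" by auto
        then have "p * degree (coeff R j) + m * j \<le> p" by (rule bR)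
        moreover have "p * 1 \<le> p * degree (coeff R j)" using d by (intro mult_le_mono2) simp
        moreover have "m * 1 \<le> m * j" using 2 by (intro mult_le_mono2) simp
        ultimately show False using m(1) by linarith
      qed
      then obtain u where "coeff R j = [:u:]" by (meson degree_eq_zeroE)
      then show ?thesis using 2 by (cases j) (auto simp: T_def coeff_map_poly Qj)
    next
      case 3
      then have "coeff R j = 0" using R(2) by (intro coeff_eq_0) simp
      then show ?thesis using 3 p_pos by (cases j) (auto simp: T_def coeff_map_poly Qj)
    qed
  qed
  \<comment> \<open>Otherwise \<open>\<sigma> x\<close> would be a polynomial in \<open>w\<close>,
    and its pole order \<open>p\<close> a multiple of \<open>m\<close>.\<close>
  have a0: "a \<noteq> 0"
  proof
    assume a: "a = 0"
    have Rc: "degree (coeff R j) = 0" for j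
    proof (cases "j = 0")
      case True then show ?thesis using a by (simp add: R0)
    next
      case False
      then show ?thesis unfolding RT T_def by (cases j) (auto simp: coeff_map_poly)
    qed
    have "biv R \<noteq> 0" using R(1) K_aut_eq_0_iff[OF s K_x] x_nonzero by simp
    have ev: "biv R = (\<Sum>j<p. fls_eval x (coeff R j) * w ^ j)" by (rule poly.heval_altdef'[OF R(2)])
    have "\<exists>j\<in>{..<p}. fls_eval x (coeff R j) * w ^ j \<noteq> 0"
    proof (rule ccontr)
      assume "\<not> ?thesis"
      then have "biv R = 0" unfolding ev by (intro sum.neutral) auto
      then show False using \<open>biv R \<noteq> 0\<close> by simp
    qed
    moreover
    have sd: "fls_subdegree (fls_eval x (coeff R j) * w ^ j) = - int (m * j)"
      if "fls_eval x (coeff R j) * w ^ j \<noteq> 0" for j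
      using that fls_eval_subdegree[OF x_neg, of "coeff R j"] Rc[of j]
      by (auto simp: fls_subdegree_pow w_subdegree m_def mult.commute)
    ultimately have nz: "\<exists>j\<in>{..<p}. fls_eval x (coeff R j) * w ^ j \<noteq> 0" by blast
    have "(\<Sum>j<p. fls_eval x (coeff R j) * w ^ j) \<noteq> 0 \<and>
      (\<exists>k\<in>{..<p}. fls_eval x (coeff R k) * w ^ k \<noteq> 0 \<and>
        fls_subdegree (\<Sum>j<p. fls_eval x (coeff R j) * w ^ j) = fls_subdegree (fls_eval x (coeff R k) * w ^ k)) \<and>
      (\<forall>k\<in>{..<p}. fls_eval x (coeff R k) * w ^ k \<noteq> 0 \<longrightarrow>
        fls_subdegree (\<Sum>j<p. fls_eval x (coeff R j) * w ^ j) \<le> fls_subdegree (fls_eval x (coeff R k) * w ^ k))"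
    proof (rule fls_subdegree_sum_distinct[OF _ _ nz])
      fix j k assume "fls_eval x (coeff R j) * w ^ j \<noteq> 0" "fls_eval x (coeff R k) * w ^ k \<noteq> 0"
        "fls_subdegree (fls_eval x (coeff R j) * w ^ j) = fls_subdegree (fls_eval x (coeff R k) * w ^ k)"
      then have "int (m * j) = int (m * k)" using sd[of j] sd[of k] by linarith
      then show "j = k" using m(1) by simp
    qed simp
    then obtain j where j: "fls_eval x (coeff R j) * w ^ j \<noteq> 0"
      "fls_subdegree (biv R) = fls_subdegree (fls_eval x (coeff R j) * w ^ j)" unfolding ev by blast
    then have "int p = int (m * j)" using sd[OF j(1)] sx[unfolded R(1)] by linarith
    then have "p = m * j" by (simp only: of_nat_eq_iff)
    then show False using pm by simp
  qed

  \<comment> \<open>Both sides of the transformed equation are written as polynomials in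
    \<open>x\<close> and \<open>w\<close> of degree below \<open>p\<close> in \<open>w\<close>, here
    \<open>f (T)\<close> and later \<open>H\<close>, so they can be compared
    coefficientwise.\<close>
  define FT where "FT = (\<Sum>i\<le>m. smult [:coeff f i:] (T ^ i))"
  have bFT: "biv FT = fls_eval (\<sigma> x) f"
    unfolding FT_def R(1) RT by (simp add: poly.heval_sum poly.heval_smult poly.heval_power
        fls_const.heval_const fls_const.heval_altdef m_def)
  have rel: "(fls_const c * w + fls_eval x P) ^ p - (fls_const c * w + fls_eval x P) = fls_eval (\<sigma> x) f"
  proof -
    have "\<sigma> (w ^ p - w) = \<sigma> (fls_eval x f)" using w_equation by simp
    then show ?thesis
      by (simp add: K_aut_diff[OF s] K_power K_w K_aut_power[OF s] K_aut_fls_eval[OF s K_x] flip: sw_eq)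
  qed
  define H where "H = [:smult (c ^ p) f + frob_diff P, [:c ^ p - c:]:]"
  have bH: "biv H = fls_eval (\<sigma> x) f"
  proof -
    have "(fls_const c * w + fls_eval x P) ^ p = fls_const (c ^ p) * (w + fls_eval x f) + fls_eval x (P ^ p)"
      using w_equation by (simp add: fls_add_power_p power_mult_distrib fls_const.heval_power flip: fls_const_power)
        (simp add: algebra_simps)
    moreover have "fls_const (c ^ p - c) = fls_const (c ^ p) - fls_const c" by (rule fls_eqI) simp
    moreover have "biv H = fls_eval x (smult (c ^ p) f + frob_diff P) + w * fls_const (c ^ p - c)"
      by (simp only: H_def poly.heval_pCons poly.heval_0 fls_const.heval_const mult_zero_right add_0_right)
    ultimately have "biv H = fls_eval x (smult (c ^ p) f + frob_diff P) + w * (fls_const (c ^ p) - fls_const c)"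
      and "(fls_const c * w + fls_eval x P) ^ p = fls_const (c ^ p) * (w + fls_eval x f) + fls_eval x (P ^ p)"
      by simp_all
    then show ?thesis
      unfolding rel[symmetric] by (simp add: fls_const.heval_add fls_const.heval_diff fls_const.heval_smult algebra_simps)
  qed
  have degH: "degree H < p" using p_ge_2 by (simp add: H_def)
  have degT: "m * degree T < p"
  proof (cases "degree R = 0")
    case False
    then have "coeff R (degree R) \<noteq> 0" by auto
    then have "m * degree R \<le> p" using bR by fastforce
    moreover have "m * degree R \<noteq> p" using pm by (metis dvd_triv_left)
    ultimately show ?thesis using RT by simp
  qed (use RT p_pos in simp)
  have degFT: "degree FT < p"
  proof -
    have "degree (smult [:coeff f i:] (T ^ i)) \<le> m * degree T" if "i \<le> m" for i
    proof -
      have "degree (smult [:coeff f i:] (T ^ i)) \<le> degree (T ^ i)" by (rule degree_smult_le)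
      also have "\<dots> \<le> degree T * i" by (rule degree_power_le)
      also have "\<dots> \<le> m * degree T" using that by (simp add: mult.commute)
      finally show ?thesis .
    qed
    then have "degree FT \<le> m * degree T" unfolding FT_def by (intro degree_sum_le) auto
    then show ?thesis using degT by simp
  qed
  have FTH: "FT = H" using biv_reduced_unique[OF _ degFT degH] bFT bH by simp
  have num: "poly f (b + a * u + poly Q v) = c ^ p * poly f u + (poly P u ^ p - poly P u) + (c ^ p - c) * v" for u v
  proof -
    have mp: "poly (map_poly (\<lambda>u. [:u:]) q) [:v:] = [:poly q v:]" for q :: "'k poly"
      by (induction q) (simp_all add: map_poly_pCons mult.commute)
    have "beval u v T = b + a * u + poly Q v" by (simp add: T_def mp mult.commute)
    then have "beval u v FT = poly f (b + a * u + poly Q v)"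
      by (simp add: FT_def poly_sum poly_power poly_altdef[of f] m_def)
    moreover have "beval u v H = c ^ p * poly f u + (poly P u ^ p - poly P u) + (c ^ p - c) * v"
      by (simp add: H_def mult.commute)
    ultimately show ?thesis using FTH by simp
  qed
  \<comment> \<open>If powers of \<open>w\<close> occurred, then \<open>m < p\<close> and
    \<open>P\<close> would be constant. Subtracting the identities at \<open>u = 1 / a\<close> and
    \<open>u = 0\<close>, where \<open>a * u\<close> differs by 1, would make
    \<open>f (X + 1) - f X\<close> constant along the nonconstant \<open>Q + b\<close>, although its
    degree is at least \<open>m - 1 > 0\<close>.\<close>
  have Q0: "Q = 0"
  proof (rule ccontr)
    assume "Q \<noteq> 0"
    have dQ: "degree Q > 0"
    proof (rule ccontr)
      assume "\<not> degree Q > 0"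
      then obtain q where "Q = [:q:]" by (auto elim: degree_eq_zeroE)
      moreover have "coeff Q 0 = 0" by (simp add: Qj)
      ultimately show False using \<open>Q \<noteq> 0\<close> by simp
    qed
    have lc: "coeff Q (degree Q) \<noteq> 0" using \<open>Q \<noteq> 0\<close> by simp
    then have "coeff R (degree Q) \<noteq> 0" by (auto simp: Qj split: if_splits)
    then have "m * degree Q \<le> p" using bR by fastforce
    moreover have "m * 1 \<le> m * degree Q" using dQ by (intro mult_le_mono2) simp
    ultimately have "m \<le> p" by linarith
    then have "m < p" using m(2) by (metis dvd_refl le_neq_implies_less)
    have "degree P = 0"
    proof (rule ccontr)
      assume "degree P \<noteq> 0"
      then have "p * 1 \<le> p * degree P" by (intro mult_le_mono2) simp
      then show False using degP \<open>m < p\<close> by linarith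
    qed
    then obtain d where d: "P = [:d:]" by (meson degree_eq_zeroE)
    define g where "g = pcompose f [:1, 1:] - f"
    have dg: "degree g \<ge> m - 1"
    proof (rule le_degree)
      have mS: "m = Suc (m - 1)" using m(1) by simp
      have "coeff (pcompose f [:1, 1:]) (m - 1) = (\<Sum>i\<in>{m - 1, m}. coeff f i * of_nat (i choose (m - 1)))"
        unfolding coeff_translate by (simp, rule sum.mono_neutral_right) (auto simp: m_def binomial_eq_0)
      also have "\<dots> = coeff f (m - 1) + coeff f m * of_nat m"
        using mS binomial_symmetric[of "m - 1" m] by simp
      finally have "coeff g (m - 1) = coeff f m * of_nat m" by (simp add: g_def)
      then show "coeff g (m - 1) \<noteq> 0" using m of_nat_eq_0_iff[of m] by (auto simp: m_def)
    qed
    define C where "C = c ^ p * poly f (1 / a) - c ^ p * poly f 0"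
    have "poly (pcompose g (Q + [:b:])) v = poly [:C:] v" for v
      using num[of "1 / a" v] num[of 0 v] a0
      by (simp add: g_def poly_pcompose C_def d add_ac)
    then have "pcompose g (Q + [:b:]) = [:C:]"
      using poly_roots_finite[of "pcompose g (Q + [:b:]) - [:C:]"] infinite_UNIV_k by auto
    then have "degree (pcompose g (Q + [:b:])) = 0" by simp
    moreover have "degree (Q + [:b:]) = degree Q" using dQ by (intro degree_add_eq_left) simp
    ultimately have "degree g = 0" using dQ by (simp add: degree_pcompose)
    then show False using dg m(1) by simp
  qed
  have sx_eq: "\<sigma> x = fls_eval x [:b, a:]"
    unfolding R(1) RT T_def Q0 by (simp add: poly.heval_const)
  have "fls_eval (\<sigma> x) f = biv [:pcompose f [:b, a:]:]"
    unfolding sx_eq by (simp add: poly.heval_const fls_eval_pcompose)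
  then have "H = [:pcompose f [:b, a:]:]"
    using bH by (intro biv_reduced_unique degH) (auto simp: p_pos)
  \<comment> \<open>The coefficient of \<open>w\<close> in the identity puts \<open>c\<close> into
    the prime field.\<close>
  then have "smult (c ^ p) f + frob_diff P = pcompose f [:b, a:]" "c ^ p - c = 0" by (auto simp: H_def)
  then have "(a, b, c, P) \<in> affine_data f" using a0 c0 by (simp add: affine_data_def CHAR_eq)
  moreover have "represents \<sigma> (a, b, c, P)" using sx_eq sw_eq by (simp add: represents_def)
  ultimately show ?thesis by blast
qed

end

section \<open>Finiteness of the affine data and the Sylow subgroup\<close>

context alg_closed_prime_char
begin

lemma affine_data_iff:
  "(a, b, c, P) \<in> affine_data (f :: 'k poly) \<longleftrightarrow>
     a \<noteq> 0 \<and> c \<noteq> 0 \<and> c ^ p = c \<and> smult c f + frob_diff P = pcompose f [:b, a:]"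
  by (simp add: affine_data_def CHAR_eq)

text \<open>\<open>p * degree P\<close> differs from \<open>degree f\<close> and cannot exceed it,
  since \<open>f (a X + b)\<close> has the degree of \<open>f\<close>; then the leading coefficients
  determine \<open>c\<close>.\<close>

lemma affine_data_degree:
  fixes f :: "'k poly"
  assumes f: "degree f > 1" "\<not> p dvd degree f" and t: "(a, b, c, P) \<in> affine_data f"
  shows "p * degree P < degree f" "c = a ^ degree f"
proof -
  have a: "a \<noteq> 0" and eq: "smult c f + frob_diff P = pcompose f [:b, a:]" using t by (simp_all add: affine_data_iff)
  have dc: "degree (pcompose f [:b, a:]) = degree f" using a by (simp add: degree_pcompose)
  have dP: "p * degree P \<noteq> degree f" using f(2) by (metis dvd_triv_left)
  have "\<not> p * degree P > degree f"
  proof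
    assume gt: "p * degree P > degree f"
    then have "degree (frob_diff P) = p * degree P" by (intro degree_frob_diff) (use gt in \<open>cases "degree P = 0"; simp\<close>)
    then have "degree (smult c f) < degree (frob_diff P)" using gt degree_smult_le[of c f] by linarith
    then have "degree (smult c f + frob_diff P) = degree (frob_diff P)" by (rule degree_add_eq_right)
    then show False using \<open>degree (frob_diff P) = p * degree P\<close> gt dc unfolding eq by linarith
  qed
  then show lt: "p * degree P < degree f" using dP by linarith
  have "degree (frob_diff P) < degree f"
  proof (cases "degree P = 0")
    case True
    then have "degree (frob_diff P) = 0" by (metis degree_eq_zeroE degree_pCons_0 frob_diff_const)
    then show ?thesis using f(1) by simp
  qed (use degree_frob_diff[of P] lt in simp)
  then have "coeff (frob_diff P) (degree f) = 0" by (rule coeff_eq_0)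
  then have "c * lead_coeff f = coeff (smult c f + frob_diff P) (degree f)" by simp
  also have "\<dots> = lead_coeff (pcompose f [:b, a:])" unfolding eq dc ..
  also have "\<dots> = lead_coeff f * a ^ degree f" using a by (subst lead_coeff_comp) simp_all
  finally show "c = a ^ degree f" using f(1) by auto
qed

text \<open>\<open>a ^ degree f\<close> lies in the finite prime field. For fixed \<open>a\<close>
  and \<open>c\<close>, comparison with one chosen solution turns the others into
  translations.\<close>

lemma finite_affine_data:
  fixes f :: "'k poly"
  assumes f: "degree f > 1" "\<not> p dvd degree f"
  shows "finite (affine_data f)"
proof -
  define F where "F = {c::'k. c ^ p = c}"
  define A where "A = {a::'k. a ^ degree f \<in> F}"
  define S where "S = (\<lambda>a c. {(b, P). (a, b, c, P) \<in> affine_data f})"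
  have F: "finite F" unfolding F_def by (rule finite_frobenius_fixed)
  have "finite {a::'k. a ^ degree f = c}" for c
  proof -
    have "degree (monom (1::'k) (degree f) - [:c:]) = degree f"
      unfolding diff_conv_add_uminus using f(1) by (subst degree_add_eq_left) (simp_all add: degree_monom_eq)
    then have "monom (1::'k) (degree f) - [:c:] \<noteq> 0" using f(1) by auto
    then have "finite {a. poly (monom 1 (degree f) - [:c:]) a = 0}" by (rule poly_roots_finite)
    then show ?thesis by (simp add: poly_monom)
  qed
  moreover have "A = (\<Union>c\<in>F. {a. a ^ degree f = c})" by (auto simp: A_def)
  ultimately have A: "finite A" using F by simp
  have S: "finite (S a c)" if a: "a \<noteq> 0" for a c
  proof (cases "S a c = {}")
    case False
    then obtain b0 P0 where 0: "(a, b0, c, P0) \<in> affine_data f" by (auto simp: S_def)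
    \<comment> \<open>The inverse of \<open>X \<mapsto> a X + b0\<close>; composing with it turns
      \<open>X \<mapsto> a X + b\<close> into the translation by \<open>b - b0\<close>.\<close>
    define l where "l = [:- b0 / a, 1 / a:]"
    define g where "g = (\<lambda>(b, P). (b - b0, pcompose (P - P0) l))"
    have ll: "pcompose l [:b0, a:] = [:0, 1:]" using a by (simp add: l_def pcompose_pCons)
    have lb: "pcompose [:b, a:] l = [:b - b0, 1:]" for b using a by (simp add: l_def pcompose_pCons)
    have "inj_on g (S a c)"
    proof (rule inj_onI, clarify)
      fix b P b' P' assume e: "g (b, P) = g (b', P')"
      then have "b = b'" "pcompose (P - P0) l = pcompose (P' - P0) l" by (auto simp: g_def)
      then have "pcompose (P - P0) (pcompose l [:b0, a:]) = pcompose (P' - P0) (pcompose l [:b0, a:])"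
        by (simp only: pcompose_assoc)
      then show "b = b' \<and> P = P'" using \<open>b = b'\<close> by (simp add: ll)
    qed
    moreover have "g ` S a c \<subseteq> carrier (translation_group f)"
    proof clarify
      fix b' P' b P assume e: "(b', P') = g (b, P)" and m: "(b, P) \<in> S a c"
      have "frob_diff P - frob_diff P0 = pcompose f [:b, a:] - pcompose f [:b0, a:]"
      proof -
        have "smult c f + frob_diff P = pcompose f [:b, a:]" "smult c f + frob_diff P0 = pcompose f [:b0, a:]"
          using m 0 by (simp_all add: S_def affine_data_iff)
        then show ?thesis by (metis add_diff_cancel_left)
      qed
      then have "pcompose (frob_diff (P - P0)) l = pcompose (pcompose f [:b, a:] - pcompose f [:b0, a:]) l"
        by (simp only: frob_diff_diff)
      then have "frob_diff (pcompose (P - P0) l) = pcompose f [:b - b0, 1:] - f"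
        unfolding frob_diff_pcompose pcompose_diff[of "pcompose f [:b, a:]"] pcompose_assoc[symmetric] lb by simp
      then have "g (b, P) \<in> carrier (translation_group f)"
        unfolding g_def prod.case translation_group_carrier .
      then show "(b', P') \<in> carrier (translation_group f)" using e by simp
    qed
    ultimately show ?thesis using finite_translation_group[OF f] by (meson inj_on_finite)
  qed simp
  have "affine_data f \<subseteq> (\<Union>a\<in>A - {0}. \<Union>c\<in>F. (\<lambda>(b, P). (a, b, c, P)) ` S a c)"
  proof
    fix t assume t: "t \<in> affine_data f"
    obtain a b c P where tt: "t = (a, b, c, P)" by (cases t)
    have "a \<noteq> 0" "c \<in> F" "c = a ^ degree f"
      using t affine_data_degree[OF f] unfolding tt by (auto simp: affine_data_iff F_def)
    then have "a \<in> A - {0}" "c \<in> F" by (auto simp: A_def)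
    moreover have "t \<in> (\<lambda>(b, P). (a, b, c, P)) ` S a c"
      unfolding tt by (rule image_eqI[of _ _ "(b, P)"]) (use t tt in \<open>simp_all add: S_def\<close>)
    ultimately show "t \<in> (\<Union>a\<in>A - {0}. \<Union>c\<in>F. (\<lambda>(b, P). (a, b, c, P)) ` S a c)" by blast
  qed
  moreover have "finite (\<Union>a\<in>A - {0}. \<Union>c\<in>F. (\<lambda>(b, P). (a, b, c, P)) ` S a c)"
    using A F S by auto
  ultimately show ?thesis by (rule finite_subset)
qed

text \<open>The multiplicative group of a field of characteristic \<open>p\<close> has no \<open>p\<close>-torsion, so every
  \<open>p\<close>-subgroup lies in the kernel of a character.\<close>

lemma sylow_subgroup_kernel:
  fixes \<alpha> :: "'g \<Rightarrow> 'k"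
  assumes I: "group I" "finite (carrier I)"
    and \<alpha>: "\<And>g. g \<in> carrier I \<Longrightarrow> \<alpha> g \<noteq> 0" "\<And>g h. g \<in> carrier I \<Longrightarrow> h \<in> carrier I \<Longrightarrow> \<alpha> (g \<otimes>\<^bsub>I\<^esub> h) = \<alpha> g * \<alpha> h"
    and H: "subgroup H I" "\<And>g. g \<in> carrier I \<Longrightarrow> g \<in> H \<longleftrightarrow> \<alpha> g = 1" "card H = p ^ n"
  shows "(THE H. sylow_subgroup p H I) = H"
proof -
  interpret I: group I by fact
  define s where "s = multiplicity p (card (carrier I))"
  have one: "\<alpha> \<one>\<^bsub>I\<^esub> = 1" using \<alpha>(2)[of "\<one>\<^bsub>I\<^esub>" "\<one>\<^bsub>I\<^esub>"] \<alpha>(1)[of "\<one>\<^bsub>I\<^esub>"] by simp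
  have pow: "\<alpha> (g [^]\<^bsub>I\<^esub> i) = \<alpha> g ^ i" if "g \<in> carrier I" for g and i :: nat
    using that by (induction i) (simp_all add: one \<alpha>(2) mult.commute)
  have root: "u = 1" if "u ^ (p ^ i) = 1" for u :: 'k and i
    using that
  proof (induction i)
    case (Suc i)
    have "(u ^ (p ^ i) - 1) ^ p = (u ^ (p ^ i)) ^ p - 1"
      using add_power_p[of "u ^ (p ^ i)" "- 1"] by (simp add: minus_power_p)
    also have "\<dots> = 0" using Suc.prems by (simp add: mult.commute flip: power_mult)
    finally have "u ^ (p ^ i) = 1" by simp
    then show ?case by (rule Suc.IH)
  qed simp
  \<comment> \<open>Elements of a Sylow subgroup have p-power order, so \<open>\<alpha>\<close> is 1
    on them. As \<open>card H\<close> is itself a power of \<open>p\<close>, comparing orders then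
    forces equality.\<close>
  have sub: "H' \<subseteq> H" if H': "sylow_subgroup p H' I" for H'
  proof
    fix g assume g: "g \<in> H'"
    have sg: "subgroup H' I" and card: "card H' = p ^ s" using H' by (auto simp: sylow_subgroup_def s_def)
    interpret H': group "I\<lparr>carrier := H'\<rparr>" using sg by (rule I.subgroup_imp_group)
    have gI: "g \<in> carrier I" using g sg by (meson subgroup.mem_carrier)
    have "g [^]\<^bsub>I\<^esub> (p ^ s) = \<one>\<^bsub>I\<^esub>"
      using H'.pow_order_eq_1[of g] g card I.nat_pow_consistent[of g _ H'] by (simp add: Coset.order_def)
    then have "\<alpha> g ^ (p ^ s) = 1" using pow[OF gI] one by metis
    then show "g \<in> H" using H(2)[OF gI] root by blast
  qed
  have nz: "card (carrier I) \<noteq> 0" using I(2) I.one_closed by (auto simp: card_eq_0_iff)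
  have "p ^ s dvd card (carrier I)" by (simp add: s_def multiplicity_dvd)
  then obtain k where "Coset.order I = p ^ s * k" by (auto simp: Coset.order_def)
  from sylow_thm[OF prime_p I(1) this I(2)] obtain H0 where "subgroup H0 I" "card H0 = p ^ s" by auto
  then have H0: "sylow_subgroup p H0 I" using I by (simp add: sylow_subgroup_def s_def)
  have finH: "finite H" using H(1) I(2) by (meson finite_subset subgroup.subset)
  have "card H dvd card (carrier I)"
    using I.lagrange_finite[OF I(2) H(1)] by (metis Coset.order_def dvd_triv_right)
  then have "n \<le> s" using nz p_gt_1 unfolding H(3) s_def by (intro multiplicity_geI) auto
  then have "card H \<le> card H0" using H(3) \<open>card H0 = p ^ s\<close> p_gt_1 by simp
  then have "H0 = H" using sub[OF H0] finH by (simp add: card_seteq)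
  show ?thesis
  proof (rule the_equality)
    show "sylow_subgroup p H I" using H0 \<open>H0 = H\<close> by simp
    fix H' assume H': "sylow_subgroup p H' I"
    then have "card H' = card H" using H0 \<open>H0 = H\<close> by (simp add: sylow_subgroup_def)
    then show "H' = H" using sub[OF H'] finH by (simp add: card_subset_eq)
  qed
qed

end

section \<open>Realization of affine data and the wild inertia group\<close>

context artin_schreier_laurent
begin

lemma K_least:
  assumes "x \<in> S" "w \<in> S" "\<And>c. fls_const c \<in> S" "\<And>a b. a \<in> S \<Longrightarrow> b \<in> S \<Longrightarrow> a + b \<in> S"
    "\<And>a b. a \<in> S \<Longrightarrow> b \<in> S \<Longrightarrow> a * b \<in> S" "\<And>a b. a \<in> S \<Longrightarrow> b \<in> S \<Longrightarrow> a / b \<in> S"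
  shows "K \<subseteq> S"
proof
  fix z assume "z \<in> K"
  then obtain B h where z: "h \<noteq> 0" "z = biv B / fls_eval x h" by (rule K_obtain)
  have pw: "u ^ n \<in> S" if "u \<in> S" for u n
    by (induction n) (use that assms(3)[of 1] assms(5) in auto)
  have sm: "sum g A \<in> S" if "\<And>i. i \<in> A \<Longrightarrow> g i \<in> S" for g :: "nat \<Rightarrow> _" and A
    using that by (induction A rule: infinite_finite_induct) (use assms(3)[of 0] assms(4) in auto)
  have e: "fls_eval x h \<in> S" for h unfolding fls_const.heval_altdef by (intro sm assms(1,3,5) pw)
  have "biv B \<in> S" unfolding poly.heval_altdef by (intro sm assms(2,5) pw e)
  then show "z \<in> S" unfolding z(2) by (intro assms(6) e)
qed

text \<open>The images \<open>x'\<close> and \<open>w'\<close> satisfy the assumptions under which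
  \<open>K\<close> was studied, so evaluation at them has the same kernel, generated by
  \<open>AS\<close>; sending one evaluation to the other is the automorphism. The fields agree
  because \<open>x\<close> and \<open>w\<close> can be recovered from their images.\<close>

lemma ex_K_aut_represents:
  assumes t: "t \<in> affine_data f"
  shows "\<exists>\<sigma>. K_aut \<sigma> \<and> represents \<sigma> t \<and> pull \<sigma> (point_infinity f) = point_infinity f"
proof -
  obtain a b c P where tt: "t = (a, b, c, P)" by (cases t)
  have a: "a \<noteq> 0" and c: "c \<noteq> 0" "c ^ p = c" and eq: "smult c f + frob_diff P = pcompose f [:b, a:]"
    using t by (simp_all add: tt affine_data_iff)
  define x' where "x' = fls_eval x [:b, a:]"
  define w' where "w' = fls_const c * w + fls_eval x P"
  have x'_eq: "x' = fls_const b + x * fls_const a"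
    by (simp add: x'_def fls_const.heval_pCons fls_const.heval_0)
  have x'_sub: "fls_subdegree x' = - int p"
    using fls_eval_subdegree[OF x_neg, of "[:b, a:]"] a by (simp add: x'_def x_subdegree)
  \<comment> \<open>\<open>p * degree P < degree f\<close> keeps the summand \<open>P x\<close> from
    affecting the pole order.\<close>
  have "fls_subdegree w' = - int (degree f)"
  proof (cases "P = 0")
    case True
    then show ?thesis using c(1) w_nonzero by (simp add: w'_def fls_const.heval_0 w_subdegree)
  next
    case False
    have "fls_subdegree (fls_eval x P) = - int (p * degree P)"
      using fls_eval_subdegree[OF x_neg False] by (simp add: x_subdegree)
    moreover have "int (p * degree P) < int (degree f)"
      using affine_data_degree(1)[OF degree_f degree_f_prime t[unfolded tt]] by (simp only: of_nat_less_iff)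
    moreover have "fls_subdegree (fls_const c * w) = - int (degree f)" "fls_const c * w \<noteq> 0"
      using c(1) w_nonzero by (simp_all add: w_subdegree)
    ultimately have "fls_subdegree (fls_const c * w + fls_eval x P) = fls_subdegree (fls_const c * w)"
      by (intro fls_subdegree_add_eq1) linarith+
    then show ?thesis using \<open>fls_subdegree (fls_const c * w) = _\<close> by (simp add: w'_def)
  qed
  moreover have "w' ^ p - w' = fls_eval x' f"
  proof -
    have wp: "w ^ p = w + fls_eval x f" using w_equation by (simp add: algebra_simps)
    have cp: "fls_const c ^ p = fls_const c" using c(2) by (metis fls_const_power)
    have "w' ^ p = fls_const c ^ p * w ^ p + fls_eval x P ^ p"
      by (simp add: w'_def fls_add_power_p power_mult_distrib)
    then have "w' ^ p - w' = fls_eval x (smult c f + frob_diff P)"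
      unfolding w'_def wp cp
      by (simp add: fls_const.heval_add fls_const.heval_diff fls_const.heval_smult fls_const.heval_power algebra_simps)
    also have "\<dots> = fls_eval x' f" unfolding eq x'_def by (rule fls_eval_pcompose)
    finally show ?thesis .
  qed
  ultimately interpret E: artin_schreier_laurent p field_type f x' w'
    using degree_f degree_f_prime x'_sub by unfold_locales auto
  have EK: "E.K \<subseteq> K"
    by (rule E.K_least) (auto simp: x'_def w'_def intro: K_eval K_add K_mult K_const K_w K_divide)
  have xE: "x \<in> E.K"
  proof -
    have "x = (x' - fls_const b) / fls_const a" using a by (simp add: x'_eq)
    then show ?thesis using E.K_divide[OF E.K_diff[OF E.K_x E.K_const] E.K_const] by metis
  qed
  moreover have "w \<in> E.K"
  proof -
    have "w = (w' - fls_eval x P) / fls_const c" using c(1) by (simp add: w'_def)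
    then show ?thesis using E.K_divide[OF E.K_diff[OF E.K_w E.K_fls_eval[OF xE]] E.K_const] by metis
  qed
  ultimately have KE: "K \<subseteq> E.K"
    by (rule K_least) (auto intro: E.K_const E.K_add E.K_mult E.K_divide)
  have KK: "E.K = K" using EK KE by blast
  \<comment> \<open>Any polynomial with value \<open>z\<close> may be chosen, because
    \<open>ev\<close> and \<open>E.ev\<close> identify the same polynomials.\<close>
  define \<sigma> where "\<sigma> = (\<lambda>z. E.ev (SOME q. ev q = z))"
  have \<sigma>: "\<sigma> (ev q) = E.ev q" for q
  proof -
    have "ev (SOME r. ev r = ev q) = ev q" by (rule someI) (rule refl)
    then have "AS dvd (SOME r. ev r = ev q) - q" by (simp only: ev_eq_iff)
    then show ?thesis unfolding \<sigma>_def by (simp only: E.ev_eq_iff)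
  qed
  have rep: "\<sigma> x = x'" "\<sigma> w = w'" and const: "\<sigma> (fls_const d) = fls_const d" for d
  proof -
    have e: "ev [:to_fract h:] = fls_eval x h" "E.ev [:to_fract h:] = fls_eval x' h" for h
      by (simp_all add: fract.heval_const fract_eval_to_fract E.fract.heval_const E.fract_eval_to_fract)
    have id: "fls_eval y [:0, 1:] = y" for y :: "'k fls" by (simp add: fls_const.heval_pCons fls_const.heval_0)
    show "\<sigma> x = x'" using \<sigma>[of "[:to_fract [:0, 1:]:]"] unfolding e id .
    show "\<sigma> (fls_const d) = fls_const d" using \<sigma>[of "[:to_fract [:d:]:]"] unfolding e fls_const.heval_const .
    have "ev [:0, 1:] = w" "E.ev [:0, 1:] = w'"
      by (simp_all add: fract.heval_pCons fract.heval_0 fract.h_0 fract.h_1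
          E.fract.heval_pCons E.fract.heval_0 E.fract.h_0 E.fract.h_1)
    then show "\<sigma> w = w'" using \<sigma>[of "[:0, 1:]"] by simp
  qed
  have s: "K_aut \<sigma>"
    unfolding K_aut_def
  proof (intro conjI ballI allI const)
    have "inj_on \<sigma> K"
    proof (rule inj_onI)
      fix y z assume "y \<in> K" "z \<in> K" "\<sigma> y = \<sigma> z"
      moreover then obtain q r where "y = ev q" "z = ev r" by (auto simp: K_def)
      ultimately show "y = z" using ev_eq_iff E.ev_eq_iff \<sigma> by simp
    qed
    moreover have "\<sigma> ` K = K"
    proof -
      have "\<sigma> ` K = range E.ev" by (auto simp: K_def \<sigma> image_image)
      then show ?thesis using KK E.K_def by simp
    qed
    ultimately show "bij_betw \<sigma> K K" by (simp add: bij_betw_def)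
    fix y z assume "y \<in> K" "z \<in> K"
    then obtain q r where "y = ev q" "z = ev r" by (auto simp: K_def)
    then show "\<sigma> (y + z) = \<sigma> y + \<sigma> z" "\<sigma> (y * z) = \<sigma> y * \<sigma> z"
      by (simp_all only: \<sigma> fract.heval_add[symmetric] fract.heval_mult[symmetric] E.fract.heval_add E.fract.heval_mult)
  qed
  have "represents \<sigma> t" by (simp add: represents_def tt rep x'_def w'_def)
  moreover have "pull \<sigma> (point_infinity f) = point_infinity f"
  proof (rule pts_eqI)
    note I = point_infinity_props
    have P: "is_place (emb ` pull \<sigma> (point_infinity f))" using pull(1)[OF s I(1)] pts_place by blast
    have "x' \<notin> place_infinity" using x'_sub p_pos by (auto simp: place_infinity_def)
    then have "x \<notin> emb ` pull \<sigma> (point_infinity f)" unfolding pull(2)[OF s I(1)] I(2) by (simp add: rep)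
    then show "emb ` pull \<sigma> (point_infinity f) = emb ` point_infinity f"
      using place_infinity_unique[OF P] I(2) by simp
  qed (use pull(1)[OF s] point_infinity_props(1) in auto)
  ultimately show ?thesis using s by blast
qed

lemma represents_unique:
  assumes "represents \<sigma> (a, b, c, P)" "represents \<sigma> (a', b', c', P')"
  shows "(a, b, c, P) = (a', b', c', P')"
proof -
  have "fls_eval x [:b, a:] = fls_eval x [:b', a':]" using assms by (simp only: represents_def prod.case)
  then have ab: "a = a'" "b = b'" by auto
  have e: "biv [:P, [:c:]:] = fls_const c * w + fls_eval x P" for c P
    by (simp add: poly.heval_pCons poly.heval_0 poly.h_0 fls_const.heval_const mult.commute add.commute)
  have "biv [:P, [:c:]:] = biv [:P', [:c':]:]" using assms unfolding e by (simp add: represents_def)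
  then have "[:P, [:c:]:] = [:P', [:c':]:]" by (rule biv_reduced_unique) (use p_ge_2 in auto)
  then show ?thesis using ab by auto
qed

lemma represents_determines:
  assumes "K_aut \<sigma>" "K_aut \<tau>" "represents \<sigma> t" "represents \<tau> t" shows "pull \<sigma> = pull \<tau>"
  by (rule pull_cong, rule K_aut_determined) (use assms in \<open>auto simp: represents_def split: prod.splits\<close>)

lemma represents_comp:
  assumes s: "K_aut \<sigma>" "represents \<sigma> (a, b, c, P)" and t: "K_aut \<tau>" "represents \<tau> (a', b', c', P')"
  shows "represents (\<tau> \<circ> \<sigma>) (a * a', b + a * b', c * c', smult c P' + pcompose P [:b', a':])"
proof -
  have S: "\<sigma> x = fls_eval x [:b, a:]" "\<sigma> w = fls_const c * w + fls_eval x P"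
    and T: "\<tau> x = fls_eval x [:b', a':]" "\<tau> w = fls_const c' * w + fls_eval x P'"
    using assms by (auto simp: represents_def)
  have "\<tau> (\<sigma> x) = fls_eval x (pcompose [:b, a:] [:b', a':])"
    unfolding S K_aut_fls_eval[OF t(1) K_x] T fls_eval_pcompose ..
  also have "pcompose [:b, a:] [:b', a':] = [:b + a * b', a * a':]" by (simp add: pcompose_pCons mult.commute)
  finally have 1: "\<tau> (\<sigma> x) = fls_eval x [:b + a * b', a * a':]" .
  have "\<tau> (\<sigma> w) = fls_const c * \<tau> w + fls_eval (\<tau> x) P"
    unfolding S by (simp add: K_autD[OF t(1)] K_mult K_const K_w K_eval K_aut_fls_eval[OF t(1) K_x])
  also have "\<dots> = fls_const (c * c') * w + fls_eval x (smult c P' + pcompose P [:b', a':])"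
    unfolding T fls_eval_pcompose[symmetric] fls_const.heval_add fls_const.heval_smult fls_const.h_mult
    by (simp add: distrib_left mult.assoc)
  finally show ?thesis using 1 by (simp add: represents_def)
qed

lemma K_aut_id: "K_aut (\<lambda>z. z)"
  by (simp add: K_aut_def bij_betw_def)

lemma inertia_carrier:
  "carrier (inertia_infinity f) = {pull \<sigma> | \<sigma>. K_aut \<sigma> \<and> pull \<sigma> (point_infinity f) = point_infinity f}"
  unfolding inertia_infinity_def using curve_Aut_eq_pull pull_in_curve_Aut by auto

lemma inertia_altdef: "inertia_infinity f = (BijGroup pts)\<lparr>carrier := carrier (inertia_infinity f)\<rparr>"
  by (simp add: inertia_infinity_def curve_Aut_def)

lemma pull_Bij: "K_aut \<sigma> \<Longrightarrow> pull \<sigma> \<in> Bij pts"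
  using pull_bij by (simp add: Bij_def pull_def)

lemma inertia_mult:
  assumes "K_aut \<sigma>" "K_aut \<tau>"
  shows "pull \<sigma> \<otimes>\<^bsub>inertia_infinity f\<^esub> pull \<tau> = pull (\<tau> \<circ> \<sigma>)"
proof -
  have "pull \<sigma> \<otimes>\<^bsub>inertia_infinity f\<^esub> pull \<tau> = compose pts (pull \<sigma>) (pull \<tau>)"
    by (subst inertia_altdef) (simp add: BijGroup_def pull_Bij assms)
  also have "\<dots> = pull (\<tau> \<circ> \<sigma>)"
    by (rule extensionalityI[of _ pts]) (auto simp: compose_def pull_comp[OF assms], simp add: pull_def)
  finally show ?thesis .
qed

lemma subgroup_inertia: "subgroup (carrier (inertia_infinity f)) (BijGroup pts)"
proof -
  interpret B: group "BijGroup pts" by (rule group_BijGroup)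
  note I = point_infinity_props(1)
  show ?thesis
  proof (rule B.subgroupI)
    show "carrier (inertia_infinity f) \<subseteq> carrier (BijGroup pts)"
      using pull_Bij by (auto simp: inertia_carrier BijGroup_def)
    show "carrier (inertia_infinity f) \<noteq> {}"
      using K_aut_id pull_id[OF I] by (auto simp: inertia_carrier)
    fix \<phi> assume "\<phi> \<in> carrier (inertia_infinity f)"
    then obtain \<sigma> where s: "\<phi> = pull \<sigma>" "K_aut \<sigma>" "pull \<sigma> (point_infinity f) = point_infinity f"
      by (auto simp: inertia_carrier)
    note s' = K_aut_inv_into[OF s(2)]
    have fixd: "pull (inv_into K \<sigma>) (point_infinity f) = point_infinity f"
      using pull_inv_into(2)[OF s(2) I] s(3) by simp
    have "inv\<^bsub>BijGroup pts\<^esub> \<phi> = pull (inv_into K \<sigma>)"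
    proof (rule B.inv_equality)
      show "pull (inv_into K \<sigma>) \<otimes>\<^bsub>BijGroup pts\<^esub> \<phi> = \<one>\<^bsub>BijGroup pts\<^esub>"
        using pull_Bij[OF s'] pull_Bij[OF s(2)] pull_inv_into(2)[OF s(2)]
        by (auto simp: BijGroup_def s(1) compose_def intro!: restrict_ext)
    qed (use pull_Bij[OF s'] pull_Bij[OF s(2)] s(1) in \<open>auto simp: BijGroup_def\<close>)
    then show "inv\<^bsub>BijGroup pts\<^esub> \<phi> \<in> carrier (inertia_infinity f)" using s' fixd by (auto simp: inertia_carrier)
    fix \<psi> assume "\<psi> \<in> carrier (inertia_infinity f)"
    then obtain \<tau> where t: "\<psi> = pull \<tau>" "K_aut \<tau>" "pull \<tau> (point_infinity f) = point_infinity f"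
      by (auto simp: inertia_carrier)
    have "\<phi> \<otimes>\<^bsub>BijGroup pts\<^esub> \<psi> = pull (\<tau> \<circ> \<sigma>)"
      using inertia_mult[OF s(2) t(2)] unfolding s(1) t(1) by (subst (asm) inertia_altdef) simp
    then show "\<phi> \<otimes>\<^bsub>BijGroup pts\<^esub> \<psi> \<in> carrier (inertia_infinity f)"
      using K_aut_comp[OF t(2) s(2)] pull_comp[OF s(2) t(2) I] s(3) t(3) by (auto simp: inertia_carrier)
  qed
qed

lemma group_inertia: "group (inertia_infinity f)"
  using group.subgroup_imp_group[OF group_BijGroup subgroup_inertia] inertia_altdef by simp

definition inertia_data :: "('k curve_point \<Rightarrow> 'k curve_point) \<Rightarrow> 'k \<times> 'k \<times> 'k \<times> 'k poly" where
  "inertia_data \<phi> = (SOME t. t \<in> affine_data f \<and> (\<exists>\<sigma>. K_aut \<sigma> \<and> \<phi> = pull \<sigma> \<and> represents \<sigma> t))"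

lemma inertia_data:
  assumes "\<phi> \<in> carrier (inertia_infinity f)"
  shows "inertia_data \<phi> \<in> affine_data f" "\<exists>\<sigma>. K_aut \<sigma> \<and> \<phi> = pull \<sigma> \<and> represents \<sigma> (inertia_data \<phi>)"
proof -
  obtain \<sigma> where s: "\<phi> = pull \<sigma>" "K_aut \<sigma>" "pull \<sigma> (point_infinity f) = point_infinity f"
    using assms unfolding inertia_carrier by blast
  have "\<exists>t. t \<in> affine_data f \<and> (\<exists>\<sigma>. K_aut \<sigma> \<and> \<phi> = pull \<sigma> \<and> represents \<sigma> t)"
    using ex_affine_data[OF s(2,3)] s(1,2) by blast
  from someI_ex[OF this, folded inertia_data_def]
  show "inertia_data \<phi> \<in> affine_data f" "\<exists>\<sigma>. K_aut \<sigma> \<and> \<phi> = pull \<sigma> \<and> represents \<sigma> (inertia_data \<phi>)" by auto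
qed

lemma inertia_data_eqI:
  assumes s: "K_aut \<sigma>" "pull \<sigma> \<in> carrier (inertia_infinity f)" "represents \<sigma> t"
  shows "inertia_data (pull \<sigma>) = t"
proof -
  obtain \<tau> where t: "K_aut \<tau>" "pull \<sigma> = pull \<tau>" "represents \<tau> (inertia_data (pull \<sigma>))"
    using inertia_data(2)[OF s(2)] by blast
  have "\<sigma> x = \<tau> x" "\<sigma> w = \<tau> w" using pull_inj[OF s(1) t(1,2)] K_x K_w by auto
  then have "represents \<sigma> (inertia_data (pull \<sigma>))" using t(3) by (auto simp: represents_def)
  then show ?thesis using s(3) represents_unique by (metis prod_cases4)
qed

lemma finite_inertia: "finite (carrier (inertia_infinity f))"
proof (rule inj_on_finite)
  show "finite (affine_data f)" by (rule finite_affine_data[OF degree_f degree_f_prime])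
  show "inertia_data ` carrier (inertia_infinity f) \<subseteq> affine_data f" using inertia_data(1) by blast
  show "inj_on inertia_data (carrier (inertia_infinity f))"
  proof (rule inj_onI)
    fix \<phi> \<psi> assume p: "\<phi> \<in> carrier (inertia_infinity f)" "\<psi> \<in> carrier (inertia_infinity f)" "inertia_data \<phi> = inertia_data \<psi>"
    then show "\<phi> = \<psi>" using inertia_data(2)[OF p(1)] inertia_data(2)[OF p(2)] represents_determines by metis
  qed
qed

definition translation :: "'k \<times> 'k poly \<Rightarrow> 'k curve_point \<Rightarrow> 'k curve_point" where
  "translation = (\<lambda>(b, P). pull (SOME \<sigma>. K_aut \<sigma> \<and> represents \<sigma> (1, b, 1, P) \<and> pull \<sigma> (point_infinity f) = point_infinity f))"

lemma translation:
  assumes "(b, P) \<in> carrier (translation_group f)"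
  shows "\<exists>\<sigma>. K_aut \<sigma> \<and> represents \<sigma> (1, b, 1, P) \<and> translation (b, P) = pull \<sigma>"
    "translation (b, P) \<in> carrier (inertia_infinity f)"
proof -
  have "frob_diff P = pcompose f [:b, 1:] - f" using assms by (simp only: translation_group_carrier)
  then have "smult 1 f + frob_diff P = pcompose f [:b, 1:]" by simp
  then have "(1, b, 1, P) \<in> affine_data f" unfolding affine_data_iff by simp
  from someI_ex[OF ex_K_aut_represents[OF this]]
  show "\<exists>\<sigma>. K_aut \<sigma> \<and> represents \<sigma> (1, b, 1, P) \<and> translation (b, P) = pull \<sigma>"
    "translation (b, P) \<in> carrier (inertia_infinity f)"
    by (auto simp: translation_def inertia_carrier)
qed

text \<open>The coefficient \<open>a\<close> is a character of the inertia group. In its kernel also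
  \<open>c = a ^ degree f = 1\<close>, so the kernel is exactly the group of translations, a
  p-group, and \<open>sylow_subgroup_kernel\<close> applies.\<close>

lemma translation_group_iso_wild_inertia: "translation_group f \<cong> wild_inertia_infinity f"
proof -
  let ?I = "inertia_infinity f"
  define H where "H = translation ` carrier (translation_group f)"
  have data: "inertia_data (translation (b, P)) = (1, b, 1, P)" if "(b, P) \<in> carrier (translation_group f)" for b P
    using translation[OF that] inertia_data_eqI by metis
  have HI: "H \<subseteq> carrier ?I" using translation(2) by (auto simp: H_def)
  have mult: "translation (u \<otimes>\<^bsub>translation_group f\<^esub> v) = translation u \<otimes>\<^bsub>?I\<^esub> translation v"
    if uv: "u \<in> carrier (translation_group f)" "v \<in> carrier (translation_group f)" for u v
  proof -
    obtain b P where u: "u = (b, P)" by (cases u)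
    obtain b' P' where v: "v = (b', P')" by (cases v)
    have "u \<otimes>\<^bsub>translation_group f\<^esub> v \<in> carrier (translation_group f)"
      using group.is_monoid[OF group_translation_group] uv by (rule monoid.m_closed)
    then have c: "(b + b', P' + pcompose P [:b', 1:]) \<in> carrier (translation_group f)"
      unfolding u v translation_group_mult .
    obtain \<sigma> where s: "K_aut \<sigma>" "represents \<sigma> (1, b, 1, P)" "translation (b, P) = pull \<sigma>"
      using translation(1) uv(1) u by blast
    obtain \<tau> where t: "K_aut \<tau>" "represents \<tau> (1, b', 1, P')" "translation (b', P') = pull \<tau>"
      using translation(1) uv(2) v by blast
    obtain \<rho> where r: "K_aut \<rho>" "represents \<rho> (1, b + b', 1, P' + pcompose P [:b', 1:])"
      "translation (b + b', P' + pcompose P [:b', 1:]) = pull \<rho>" using translation(1)[OF c] by blast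
    have "represents (\<tau> \<circ> \<sigma>) (1, b + b', 1, P' + pcompose P [:b', 1:])"
      using represents_comp[OF s(1,2) t(1,2)] by simp
    then have "pull \<rho> = pull (\<tau> \<circ> \<sigma>)" by (rule represents_determines[OF r(1) K_aut_comp[OF t(1) s(1)] r(2)])
    then show ?thesis unfolding u v translation_group_mult r(3) s(3) t(3) inertia_mult[OF s(1) t(1)] .
  qed
  have inj: "inj_on translation (carrier (translation_group f))"
  proof (rule inj_onI)
    fix u v assume uv: "u \<in> carrier (translation_group f)" "v \<in> carrier (translation_group f)" "translation u = translation v"
    obtain b P b' P' where "u = (b, P)" "v = (b', P')" by (cases u, cases v)
    then show "u = v" using uv data by (metis prod.inject)
  qed
  define \<alpha> where "\<alpha> = (\<lambda>\<phi>. fst (inertia_data \<phi>))"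
  have a0: "\<alpha> \<phi> \<noteq> 0" if "\<phi> \<in> carrier ?I" for \<phi>
    using inertia_data(1)[OF that] by (cases "inertia_data \<phi>") (auto simp: \<alpha>_def affine_data_iff)
  have amult: "\<alpha> (\<phi> \<otimes>\<^bsub>?I\<^esub> \<psi>) = \<alpha> \<phi> * \<alpha> \<psi>" if p: "\<phi> \<in> carrier ?I" "\<psi> \<in> carrier ?I" for \<phi> \<psi>
  proof -
    obtain a b c P where d: "inertia_data \<phi> = (a, b, c, P)" by (cases "inertia_data \<phi>")
    obtain a' b' c' P' where d': "inertia_data \<psi> = (a', b', c', P')" by (cases "inertia_data \<psi>")
    obtain \<sigma> where s: "K_aut \<sigma>" "\<phi> = pull \<sigma>" "represents \<sigma> (a, b, c, P)" using inertia_data(2)[OF p(1)] d by auto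
    obtain \<tau> where t: "K_aut \<tau>" "\<psi> = pull \<tau>" "represents \<tau> (a', b', c', P')" using inertia_data(2)[OF p(2)] d' by auto
    have m: "\<phi> \<otimes>\<^bsub>?I\<^esub> \<psi> = pull (\<tau> \<circ> \<sigma>)" unfolding s(2) t(2) by (rule inertia_mult[OF s(1) t(1)])
    have "pull (\<tau> \<circ> \<sigma>) \<in> carrier ?I"
      using monoid.m_closed[OF group.is_monoid[OF group_inertia] p] unfolding m .
    then have "inertia_data (pull (\<tau> \<circ> \<sigma>)) = (a * a', b + a * b', c * c', smult c P' + pcompose P [:b', a':])"
      by (rule inertia_data_eqI[OF K_aut_comp[OF t(1) s(1)] _ represents_comp[OF s(1,3) t(1,3)]])
    then show ?thesis unfolding m \<alpha>_def d d' by simp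
  qed
  have Hiff: "\<phi> \<in> H \<longleftrightarrow> \<alpha> \<phi> = 1" if p: "\<phi> \<in> carrier ?I" for \<phi>
  proof
    assume "\<phi> \<in> H" then show "\<alpha> \<phi> = 1" using data by (auto simp: H_def \<alpha>_def)
  next
    assume a1: "\<alpha> \<phi> = 1"
    obtain a b c P where d: "inertia_data \<phi> = (a, b, c, P)" by (cases "inertia_data \<phi>")
    then have "a = 1" using a1 by (simp add: \<alpha>_def)
    have ad: "(a, b, c, P) \<in> affine_data f" using inertia_data(1)[OF p] d by simp
    have "c = 1" using affine_data_degree(2)[OF degree_f degree_f_prime ad] \<open>a = 1\<close> by simp
    have "smult 1 f + frob_diff P = pcompose f [:b, 1:]"
      using ad unfolding \<open>a = 1\<close> \<open>c = 1\<close> affine_data_iff by blast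
    then have "frob_diff P = pcompose f [:b, 1:] - f" by (metis add_diff_cancel_left' smult_1_left)
    then have tr: "(b, P) \<in> carrier (translation_group f)" unfolding translation_group_carrier .
    obtain \<sigma> where s: "K_aut \<sigma>" "\<phi> = pull \<sigma>" "represents \<sigma> (1, b, 1, P)"
      using inertia_data(2)[OF p] unfolding d \<open>a = 1\<close> \<open>c = 1\<close> by blast
    then have "\<phi> = translation (b, P)" using translation(1)[OF tr] represents_determines by metis
    then show "\<phi> \<in> H" using tr by (auto simp: H_def)
  qed
  have fin: "finite (carrier (translation_group f))" by (rule finite_translation_group[OF degree_f degree_f_prime])
  have "finite_p_group p (translation_group f)"
    by (rule elementary_abelian_kernel_finite_p_group[OF prime_p group_translation_group fin
        elementary_abelian_additive_group fst_hom_translation_group card_kernel_fst_translation_group])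
  then obtain n where n: "card H = p ^ n"
    using card_image[OF inj] by (auto simp: finite_p_group_def H_def)
  have hom: "translation \<in> hom (translation_group f) ?I"
    using mult translation(2) by (intro homI) auto
  interpret h: group_hom "translation_group f" ?I translation
    using hom by (simp add: group_hom_def group_hom_axioms_def group_translation_group group_inertia)
  have sub: "subgroup H ?I" unfolding H_def by (rule h.img_is_subgroup)
  have "(THE H. sylow_subgroup p H ?I) = H"
    by (rule sylow_subgroup_kernel[OF group_inertia finite_inertia a0 amult sub Hiff n])
  then have W: "wild_inertia_infinity f = ?I\<lparr>carrier := H\<rparr>"
    by (simp add: wild_inertia_infinity_def CHAR_eq)
  have "translation \<in> iso (translation_group f) (wild_inertia_infinity f)"
    unfolding W using mult inj by (auto intro!: isoI homI simp: H_def bij_betw_def)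
  then show ?thesis by (auto simp: is_iso_def)
qed

end

lemma (in alg_closed_prime_char) translation_group_iso_wild_inertia_infinity:
  fixes f :: "'k poly"
  assumes "degree f > 1" "\<not> p dvd degree f"
  shows "translation_group f \<cong> wild_inertia_infinity f"
proof -
  obtain x w :: "'k fls" where "fls_subdegree x = - int p" "fls_subdegree w = - int (degree f)" "w ^ p - w = fls_eval x f"
    using ex_artin_schreier_laurent[of f] assms by auto
  then interpret artin_schreier_laurent p field_type f x w
    using assms by unfold_locales auto
  show ?thesis by (rule translation_group_iso_wild_inertia)
qed

section \<open>Comparison of the three classes\<close>

lemma (in alg_closed_prime_char) class_C1_eq_C3:
  "(class_C1 p :: 'g monoid set) = class_C3 TYPE('k)"
proof (intro equalityI subsetI)
  have cop: "coprime (degree f) CHAR('k) \<longleftrightarrow> \<not> p dvd degree f" for f :: "'k poly"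
    using prime_p CHAR_eq by (metis coprime_commute prime_imp_coprime_nat coprime_absorb_left not_prime_unit)
  fix G :: "'g monoid"
  {
    assume G: "G \<in> class_C1 p"
    then obtain f :: "'k poly" where f: "[:0, 1:] dvd f" "degree f > 1" "\<not> p dvd degree f" "G \<cong> translation_group f"
      using class_C1_imp_translation_group by blast
    have "G \<cong> wild_inertia_infinity f"
      using iso_trans[OF f(4) translation_group_iso_wild_inertia_infinity[OF f(2,3)]] .
    moreover have "group G" using G by (simp add: class_C1_def finite_p_group_def)
    ultimately show "G \<in> class_C3 TYPE('k)" using f cop by (auto simp: class_C3_def)
  next
    assume "G \<in> class_C3 TYPE('k)"
    then obtain f :: "'k poly" where f: "group G" "degree f > 1" "\<not> p dvd degree f" "G \<cong> wild_inertia_infinity f"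
      using cop by (auto simp: class_C3_def)
    have "G \<cong> translation_group f"
      using iso_trans[OF f(4) group.iso_sym[OF group_translation_group translation_group_iso_wild_inertia_infinity[OF f(2,3)]]] .
    then show "G \<in> class_C1 p" using class_C1_translation_group[OF f(2,3,1)] by blast
  }
qed

theorem theorem1p2:
  fixes p :: nat
  assumes "CHAR('k::alg_closed_field) = p" and "p > 0"
  shows "(class_C1 p :: 'g monoid set) = class_C2 p \<and>
         (class_C2 p :: 'g monoid set) = class_C3 TYPE('k)"
proof -
  have prime: "prime p"
    using assms prime_CHAR_semidom[where ?'a = 'k] by simp
  interpret alg_closed_prime_char p "TYPE('k)"
    using assms(1) prime by unfold_locales
  have "(class_C1 p :: 'g monoid set) = class_C2 p"
    using class_C1_subset_C2[OF prime] class_C2_subset_C1[OF prime] by blast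
  then show ?thesis using class_C1_eq_C3 by metis
qed

end
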